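(* If $k$ is a field of characteristic $p>0$ and $r=ap^l$ for some integer $a$ with $1\le a<p$ and some $l\in\{0,1,2,\dots\}$, then $S_R(\mathcal T_r,k)$ is quasi-hereditary.
   Context: $r\ge1$ and $n\ge r$ are integers, $\bar r=\{1,\dots,r\}$, and $M=\mathcal T_r$ is the monoid of all maps $\bar r\to\bar r$ under composition; it contains the symmetric group $\mathfrak S_r$. $\Lambda(r,n)$ is the set of compositions of $r$ with $n$ (nonnegative) parts; for $\mu\in\Lambda(r,n)$, $\mathfrak S_\mu\subseteq\mathfrak S_r$ is the Young subgroup preserving each of the consecutive blocks of $\bar r$ of sizes $\mu_1,\dots,\mu_n$. For $\mu,\nu\in\Lambda(r,n)$, ${}^\mu A^\nu$ is the $\mathbb Z$-submodule of $\mathbb Z[M]$ of elements invariant under left multiplication by $\mathfrak S_\mu$ and right multiplication by $\mathfrak S_\nu$. ${}_\mu M_\nu$ is the set of double cosets $\mathbf D=\mathfrak S_\mu m\mathfrak S_\nu$, $m\in M$; the sums $X(\mathbf D)=\sum_{m\in\mathbf D}m$ form a $\mathbb Z$-basis of ${}^\mu A^\nu$. $\bar A=\bigoplus_{\mu,\nu\in\Lambda(r,n)}{}^\mu A^\nu$ (external direct sum) has $\mathbb Z$-basis the elements $b_{\mathbf D}=X(\mathbf D)$. For $\mathbf D_1\in{}_\mu M_\nu$, $\mathbf D_2\in{}_\nu M_\pi$ write, in $\mathbb Z[M]$, $X(\mathbf D_1)X(\mathbf D_2)=\sum_{\mathbf D\in{}_\mu M_\pi}a(\mathbf D_1,\mathbf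 D_2,\mathbf D)X(\mathbf D)$. For $\mathbf D\in{}_\mu M_\nu$ let $n_R(\mathbf D)=|m\mathfrak S_\nu|$ for any $m\in\mathbf D$. Define a bilinear product on $\bar A$ by $b_{\mathbf D_1}*_{R}b_{\mathbf D_2}=\sum_{\mathbf D}\frac{n_R(\mathbf D)}{n_R(\mathbf D_1)n_R(\mathbf D_2)}a(\mathbf D_1,\mathbf D_2,\mathbf D)b_{\mathbf D}$ for $\mathbf D_1\in{}_\mu M_\nu,\mathbf D_2\in{}_\nu M_\pi$, and $0$ for $\mathbf D_1\in{}_\mu M_\nu,\mathbf D_2\in{}_\rho M_\pi$ with $\nu\ne\rho$. It is known that the structure constants are integers and the product is associative with identity. $A_R^{\mathbb Z}$ denotes $\bar A$ with product $*_R$, and $S_R(\mathcal T_r,k)=k\otimes_{\mathbb Z}A_R^{\mathbb Z}$. "Quasi-hereditary" is in the usual sense of Cline–Parshall–Scott. *)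

theory Defs
  imports "HOL-Algebra.Algebra"
begin

section \<open>Finite-dimensional algebras over a field\<close>

text \<open>The locale \<^locale>\<open>algebra\<close> of HOL-Algebra is restricted to commutative algebras.  The ground
  field is a type of class \<^class>\<open>field\<close>; a unital associative algebra is a \<^typ>\<open>('k, 'a) module\<close>
  record, whose ring part carries the multiplication of the algebra.\<close>

locale fin_dim_algebra = ring A for A :: "('k::field, 'a) module" (structure) +
  assumes smult_closed: "x \<in> carrier A \<Longrightarrow> c \<odot> x \<in> carrier A"
    and smult_l_distr: "x \<in> carrier A \<Longrightarrow> (c + d) \<odot> x = c \<odot> x \<oplus> d \<odot> x"
    and smult_r_distr:
      "x \<in> carrier A \<Longrightarrow> y \<in> carrier A \<Longrightarrow> c \<odot> (x \<oplus> y) = c \<odot> x \<oplus> c \<odot> y"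
    and smult_assoc: "x \<in> carrier A \<Longrightarrow> (c * d) \<odot> x = c \<odot> (d \<odot> x)"
    and smult_one: "x \<in> carrier A \<Longrightarrow> 1 \<odot> x = x"
    and smult_mult_left:
      "x \<in> carrier A \<Longrightarrow> y \<in> carrier A \<Longrightarrow> (c \<odot> x) \<otimes> y = c \<odot> (x \<otimes> y)"
    and smult_mult_right:
      "x \<in> carrier A \<Longrightarrow> y \<in> carrier A \<Longrightarrow> x \<otimes> (c \<odot> y) = c \<odot> (x \<otimes> y)"
    and finite_dim:
      "\<exists>B. finite B \<and> B \<subseteq> carrier A \<and> (\<forall>x\<in>carrier A. \<exists>c. x = (\<Oplus>b\<in>B. c b \<odot> b))"


section \<open>Quasi-hereditary algebras\<close>

definition left_ideal :: "('a, 'm) ring_scheme \<Rightarrow> 'a set \<Rightarrow> bool" where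
  "left_ideal A L \<longleftrightarrow>
     additive_subgroup L A \<and> (\<forall>a\<in>carrier A. \<forall>x\<in>L. a \<otimes>\<^bsub>A\<^esub> x \<in> L)"

definition maximal_left_ideal :: "('a, 'm) ring_scheme \<Rightarrow> 'a set \<Rightarrow> bool" where
  "maximal_left_ideal A L \<longleftrightarrow>
     left_ideal A L \<and> L \<noteq> carrier A \<and>
     (\<forall>L'. left_ideal A L' \<and> L \<subseteq> L' \<longrightarrow> L' = L \<or> L' = carrier A)"

definition jacobson_radical :: "('a, 'm) ring_scheme \<Rightarrow> 'a set" where
  "jacobson_radical A = carrier A \<inter> \<Inter> {L. maximal_left_ideal A L}"

text \<open>Left modules over a (noncommutative) ring are again \<^typ>\<open>('a, 'b) module\<close> records; only
  carrier, addition, zero and scalar multiplication of such a record are meaningful.\<close>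

definition left_module_hom ::
  "('a, 'm) ring_scheme \<Rightarrow> ('a, 'b) module \<Rightarrow> ('a, 'c) module \<Rightarrow> ('b \<Rightarrow> 'c) set" where
  "left_module_hom A P Q = {f. f \<in> carrier P \<rightarrow> carrier Q \<and>
     (\<forall>x\<in>carrier P. \<forall>y\<in>carrier P. f (x \<oplus>\<^bsub>P\<^esub> y) = f x \<oplus>\<^bsub>Q\<^esub> f y) \<and>
     (\<forall>a\<in>carrier A. \<forall>x\<in>carrier P. f (a \<odot>\<^bsub>P\<^esub> x) = a \<odot>\<^bsub>Q\<^esub> f x)}"

definition free_left_module :: "('a, 'm) ring_scheme \<Rightarrow> 'i set \<Rightarrow> ('a, 'i \<Rightarrow> 'a) module" where
  "free_left_module A I =
     \<lparr>carrier = {f. (\<forall>i\<in>I. f i \<in> carrier A) \<and> (\<forall>i. i \<notin> I \<longrightarrow> f i = \<zero>\<^bsub>A\<^esub>) \<and>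
                    finite {i. f i \<noteq> \<zero>\<^bsub>A\<^esub>}},
      monoid.mult = undefined, one = undefined,
      ring.zero = (\<lambda>i. \<zero>\<^bsub>A\<^esub>), add = (\<lambda>f g i. f i \<oplus>\<^bsub>A\<^esub> g i),
      module.smult = (\<lambda>a f i. a \<otimes>\<^bsub>A\<^esub> f i)\<rparr>"

text \<open>A module is projective if it is (isomorphic to) a direct summand of a free module.  It is no
  restriction to take the index set of the free module inside the type of \<^term>\<open>P\<close>: if \<^term>\<open>P\<close> is
  projective, then it is a direct summand of the free module on its own underlying set.\<close>

definition projective_left_module :: "('a, 'm) ring_scheme \<Rightarrow> ('a, 'b) module \<Rightarrow> bool" where
  "projective_left_module A P \<longleftrightarrow>
     (\<exists>(I :: 'b set) f g. f \<in> left_module_hom A P (free_left_module A I) \<and>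
        g \<in> left_module_hom A (free_left_module A I) P \<and> (\<forall>x\<in>carrier P. g (f x) = x))"

definition left_ideal_module :: "('a, 'm) ring_scheme \<Rightarrow> 'a set \<Rightarrow> ('a, 'a) module" where
  "left_ideal_module A J =
     \<lparr>carrier = J, monoid.mult = undefined, one = undefined,
      ring.zero = \<zero>\<^bsub>A\<^esub>, add = add A, module.smult = monoid.mult A\<rparr>"

text \<open>For a finite-dimensional algebra and an ideal satisfying the first three conditions, being
  projective as a left module and being projective as a right module are equivalent.\<close>

definition heredity_ideal :: "('a, 'm) ring_scheme \<Rightarrow> 'a set \<Rightarrow> bool" where
  "heredity_ideal A J \<longleftrightarrow>
     ideal J A \<and>
     J \<cdot>\<^bsub>A\<^esub> J = J \<and>
     (J \<cdot>\<^bsub>A\<^esub> jacobson_radical A) \<cdot>\<^bsub>A\<^esub> J = {\<zero>\<^bsub>A\<^esub>} \<and>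
     projective_left_module A (left_ideal_module A J)"

text \<open>A heredity chain is a chain of ideals \<open>0 = J\<^sub>0 \<subset> J\<^sub>1 \<subset> \<dots> \<subset> J\<^sub>s = A\<close> such that
  \<open>J\<^sub>i\<^sub>+\<^sub>1 / J\<^sub>i\<close> is a heredity ideal of \<open>A / J\<^sub>i\<close>.\<close>

definition quasi_hereditary :: "('k::field, 'a) module \<Rightarrow> bool" where
  "quasi_hereditary A \<longleftrightarrow>
     fin_dim_algebra A \<and>
     (\<exists>(s::nat) J.
        J 0 = {\<zero>\<^bsub>A\<^esub>} \<and> J s = carrier A \<and> (\<forall>i\<le>s. ideal (J i) A) \<and>
        (\<forall>i<s. J i \<subset> J (Suc i) \<and>
           heredity_ideal (A Quot (J i)) ((\<lambda>x. J i +>\<^bsub>A\<^esub> x) ` J (Suc i))))"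


section \<open>The transformation monoid, Young subgroups and double cosets\<close>

text \<open>A self-map of \<open>{1..r}\<close> is represented by its extension to \<^typ>\<open>nat\<close> by the identity, so that
  the monoid operation is \<^term>\<open>(\<circ>)\<close> and the symmetric group is \<^term>\<open>{f. f permutes {1..r}}\<close>.\<close>

definition full_transf :: "nat \<Rightarrow> (nat \<Rightarrow> nat) set" where
  "full_transf r = {f. f ` {1..r} \<subseteq> {1..r} \<and> (\<forall>i. i \<notin> {1..r} \<longrightarrow> f i = i)}"

definition compositions :: "nat \<Rightarrow> nat \<Rightarrow> nat list set" where
  "compositions r n = {\<mu>. length \<mu> = n \<and> sum_list \<mu> = r}"

definition block :: "nat list \<Rightarrow> nat \<Rightarrow> nat set" where
  "block \<mu> i = {sum_list (take i \<mu>)<..sum_list (take (Suc i) \<mu>)}"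

definition young :: "nat \<Rightarrow> nat list \<Rightarrow> (nat \<Rightarrow> nat) set" where
  "young r \<mu> = {\<sigma>. \<sigma> permutes {1..r} \<and> (\<forall>i<length \<mu>. \<sigma> ` block \<mu> i = block \<mu> i)}"

definition double_coset :: "nat \<Rightarrow> nat list \<Rightarrow> (nat \<Rightarrow> nat) \<Rightarrow> nat list \<Rightarrow> (nat \<Rightarrow> nat) set" where
  "double_coset r \<mu> m \<nu> = {\<sigma> \<circ> m \<circ> \<tau> | \<sigma> \<tau>. \<sigma> \<in> young r \<mu> \<and> \<tau> \<in> young r \<nu>}"

definition double_cosets :: "nat \<Rightarrow> nat list \<Rightarrow> nat list \<Rightarrow> (nat \<Rightarrow> nat) set set" where
  "double_cosets r \<mu> \<nu> = (\<lambda>m. double_coset r \<mu> m \<nu>) ` full_transf r"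

definition n_R :: "nat \<Rightarrow> nat list \<Rightarrow> (nat \<Rightarrow> nat) set \<Rightarrow> nat" where
  "n_R r \<nu> D = card ((\<lambda>\<tau>. (SOME m. m \<in> D) \<circ> \<tau>) ` young r \<nu>)"


lemma finite_full_transf: "finite (full_transf r)"
proof (rule finite_subset)
  show "full_transf r \<subseteq> {f. \<forall>i. if i \<in> {1..r} then f i \<in> {1..r} else f i = i}"
    by (auto simp: full_transf_def image_subset_iff)
  have "{f. \<forall>i. if i \<in> {1..r} then f i \<in> {1..r} else f i = i} \<subseteq>
        (\<lambda>g i. if i \<in> {1..r} then g i else i) ` ({1..r} \<rightarrow>\<^sub>E {1..r})" (is "_ \<subseteq> ?h ` _")
  proof
    fix f :: "nat \<Rightarrow> nat" assume f: "f \<in> {f. \<forall>i. if i \<in> {1..r} then f i \<in> {1..r} else f i = i}"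
    have *: "(if i \<in> {1..r} then f i \<in> {1..r} else f i = i)" for i using f by blast
    have "f = ?h (restrict f {1..r})"
    proof
      fix i show "f i = ?h (restrict f {1..r}) i" using *[of i] by (auto split: if_splits)
    qed
    moreover have "restrict f {1..r} \<in> {1..r} \<rightarrow>\<^sub>E {1..r}"
    proof
      fix i assume "i \<in> {1..r}" thus "restrict f {1..r} i \<in> {1..r}" using *[of i] by simp
    qed auto
    ultimately show "f \<in> ?h ` ({1..r} \<rightarrow>\<^sub>E {1..r})" by blast
  qed
  thus "finite {f. \<forall>i. if i \<in> {1..r} then f i \<in> {1..r} else (f i :: nat) = i}"
    by (rule finite_subset) (intro finite_imageI finite_PiE, auto)
qed

lemma full_transf_comp: "f \<in> full_transf r \<Longrightarrow> g \<in> full_transf r \<Longrightarrow> f \<circ> g \<in> full_transf r"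
  unfolding full_transf_def by (auto simp: image_subset_iff)

lemma young_subset: "young r \<mu> \<subseteq> full_transf r"
proof
  fix f assume "f \<in> young r \<mu>"
  hence "f permutes {1..r}" by (simp add: young_def)
  thus "f \<in> full_transf r"
    using permutes_image[of f "{1..r}"] permutes_not_in[of f "{1..r}"]
    by (simp add: full_transf_def del: atLeastAtMost_iff)
qed

lemma young_id: "id \<in> young r \<mu>"
  by (simp add: young_def permutes_id)

lemma young_comp:
  assumes "f \<in> young r \<mu>" "g \<in> young r \<mu>"
  shows "f \<circ> g \<in> young r \<mu>"
proof -
  have "f \<circ> g permutes {1..r}" using assms by (intro permutes_compose) (simp_all add: young_def)
  moreover have "(f \<circ> g) ` block \<mu> i = block \<mu> i" if "i < length \<mu>" for i
    using assms that by (simp only: young_def mem_Collect_eq image_comp [symmetric])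
  ultimately show ?thesis by (simp only: young_def mem_Collect_eq) blast
qed

lemma young_inv:
  assumes "f \<in> young r \<mu>"
  shows "Hilbert_Choice.inv f \<in> young r \<mu>" "f \<circ> Hilbert_Choice.inv f = id" "Hilbert_Choice.inv f \<circ> f = id"
proof -
  have p: "f permutes {1..r}" using assms by (simp add: young_def)
  show "f \<circ> Hilbert_Choice.inv f = id" "Hilbert_Choice.inv f \<circ> f = id" using permutes_inv_o[OF p] by auto
  have "Hilbert_Choice.inv f ` B = B" if "f ` B = B" for B
    by (metis that image_inv_f_f permutes_inj[OF p])
  thus "Hilbert_Choice.inv f \<in> young r \<mu>" using assms permutes_inv[OF p] by (auto simp: young_def)
qed

lemma finite_young: "finite (young r \<mu>)"
  using finite_subset[OF young_subset finite_full_transf] .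

lemma double_coset_self: "m \<in> double_coset r \<mu> m \<nu>"
proof -
  have "m = id \<circ> m \<circ> id" by simp
  thus ?thesis unfolding double_coset_def using young_id by blast
qed

lemma double_coset_subset: "m \<in> full_transf r \<Longrightarrow> double_coset r \<mu> m \<nu> \<subseteq> full_transf r"
  unfolding double_coset_def using young_subset full_transf_comp by blast

lemma double_coset_eq:
  assumes "m' \<in> double_coset r \<mu> m \<nu>"
  shows "double_coset r \<mu> m' \<nu> = double_coset r \<mu> m \<nu>"
proof -
  obtain s t where st: "s \<in> young r \<mu>" "t \<in> young r \<nu>" "m' = s \<circ> m \<circ> t"
    using assms by (auto simp: double_coset_def)
  have m: "m = Hilbert_Choice.inv s \<circ> m' \<circ> Hilbert_Choice.inv t"
    using young_inv[OF st(1)] young_inv[OF st(2)] unfolding st(3)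
    by (metis comp_assoc comp_id id_comp)
  have *: "double_coset r \<mu> (s \<circ> m \<circ> t) \<nu> \<subseteq> double_coset r \<mu> m \<nu>"
    if "s \<in> young r \<mu>" "t \<in> young r \<nu>" for s m t
  proof
    fix x assume "x \<in> double_coset r \<mu> (s \<circ> m \<circ> t) \<nu>"
    then obtain u v where uv: "u \<in> young r \<mu>" "v \<in> young r \<nu>" "x = u \<circ> (s \<circ> m \<circ> t) \<circ> v"
      by (auto simp: double_coset_def)
    have "x = (u \<circ> s) \<circ> m \<circ> (t \<circ> v)" by (simp add: uv(3) comp_assoc)
    thus "x \<in> double_coset r \<mu> m \<nu>"
      unfolding double_coset_def using that uv young_comp by blast
  qed
  show ?thesis
  proof
    show "double_coset r \<mu> m' \<nu> \<subseteq> double_coset r \<mu> m \<nu>"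
      using *[OF st(1,2), of m] by (simp only: st(3))
    show "double_coset r \<mu> m \<nu> \<subseteq> double_coset r \<mu> m' \<nu>"
      using *[OF young_inv(1)[OF st(1)] young_inv(1)[OF st(2)], of m'] by (simp only: m[symmetric])
  qed
qed

lemma double_cosets_subset: "D \<in> double_cosets r \<mu> \<nu> \<Longrightarrow> D \<subseteq> full_transf r"
  unfolding double_cosets_def using double_coset_subset by blast

lemma double_cosets_eq:
  "D \<in> double_cosets r \<mu> \<nu> \<Longrightarrow> m \<in> D \<Longrightarrow> D = double_coset r \<mu> m \<nu>"
  unfolding double_cosets_def using double_coset_eq by blast

lemma double_cosets_nonempty: "D \<in> double_cosets r \<mu> \<nu> \<Longrightarrow> D \<noteq> {}"
  unfolding double_cosets_def using double_coset_self by blast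

lemma finite_double_cosets: "finite (double_cosets r \<mu> \<nu>)"
  unfolding double_cosets_def using finite_full_transf by blast

lemma double_cosets_closed:
  assumes "D \<in> double_cosets r \<mu> \<nu>" "m \<in> D" "s \<in> young r \<mu>" "t \<in> young r \<nu>"
  shows "s \<circ> m \<circ> t \<in> D"
  using double_cosets_eq[OF assms(1,2)] assms(3,4) by (auto simp: double_coset_def)

lemma double_cosets_closed_left:
  assumes "D \<in> double_cosets r \<mu> \<nu>" "m \<in> D" "s \<in> young r \<mu>"
  shows "s \<circ> m \<in> D"
  using double_cosets_closed[OF assms young_id] by simp

lemma double_cosets_closed_right:
  assumes "D \<in> double_cosets r \<mu> \<nu>" "m \<in> D" "t \<in> young r \<nu>"
  shows "m \<circ> t \<in> D"
  using double_cosets_closed[OF assms(1,2) young_id assms(3)] by simp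

lemma n_R_eq:
  assumes D: "D \<in> double_cosets r \<mu> \<nu>" and m: "m \<in> D"
  shows "n_R r \<nu> D = card ((\<lambda>\<tau>. m \<circ> \<tau>) ` young r \<nu>)"
proof -
  define m' where "m' = (SOME m. m \<in> D)"
  have "m' \<in> D" unfolding m'_def using someI[of "\<lambda>m. m \<in> D", OF m] .
  then obtain s t where st: "s \<in> young r \<mu>" "t \<in> young r \<nu>" "m' = s \<circ> m \<circ> t"
    using double_cosets_eq[OF D m] by (auto simp: double_coset_def)
  have "(\<lambda>\<tau>. t \<circ> \<tau>) ` young r \<nu> = young r \<nu>"
  proof
    show "(\<lambda>\<tau>. t \<circ> \<tau>) ` young r \<nu> \<subseteq> young r \<nu>" using st young_comp by blast
    show "young r \<nu> \<subseteq> (\<lambda>\<tau>. t \<circ> \<tau>) ` young r \<nu>"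
    proof
      fix x assume "x \<in> young r \<nu>"
      moreover have "x = t \<circ> (Hilbert_Choice.inv t \<circ> x)"
        using young_inv(2)[OF st(2)] by (metis comp_assoc id_comp)
      ultimately show "x \<in> (\<lambda>\<tau>. t \<circ> \<tau>) ` young r \<nu>"
        using young_inv(1)[OF st(2)] young_comp by blast
    qed
  qed
  hence "(\<lambda>\<tau>. m' \<circ> \<tau>) ` young r \<nu> = (\<lambda>x. s \<circ> (m \<circ> x)) ` ((\<lambda>\<tau>. t \<circ> \<tau>) ` young r \<nu>)
       \<longleftrightarrow> (\<lambda>\<tau>. m' \<circ> \<tau>) ` young r \<nu> = (\<lambda>x. s \<circ> (m \<circ> x)) ` young r \<nu>" by simp
  moreover have "(\<lambda>\<tau>. m' \<circ> \<tau>) ` young r \<nu> = (\<lambda>x. s \<circ> (m \<circ> x)) ` ((\<lambda>\<tau>. t \<circ> \<tau>) ` young r \<nu>)"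
    unfolding image_image st(3) by (simp add: comp_assoc)
  ultimately have "(\<lambda>\<tau>. m' \<circ> \<tau>) ` young r \<nu> = (\<lambda>x. s \<circ> x) ` ((\<lambda>\<tau>. m \<circ> \<tau>) ` young r \<nu>)"
    by (simp add: image_image)
  moreover have "inj_on (\<lambda>x. s \<circ> x) B" for B :: "(nat \<Rightarrow> nat) set"
    by (rule inj_onI) (metis young_inv(3)[OF st(1)] comp_assoc id_comp)
  ultimately show ?thesis unfolding n_R_def m'_def[symmetric] by (simp add: card_image)
qed


section \<open>Structure constants\<close>

text \<open>Elements of the monoid ring \<open>\<int>[M]\<close>, \<open>M = \<T>\<^sub>r\<close>, are integer-valued functions vanishing
  outside \<^term>\<open>full_transf r\<close>.\<close>

definition monoid_ring_mult ::
  "nat \<Rightarrow> ((nat \<Rightarrow> nat) \<Rightarrow> int) \<Rightarrow> ((nat \<Rightarrow> nat) \<Rightarrow> int) \<Rightarrow> (nat \<Rightarrow> nat) \<Rightarrow> int" where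
  "monoid_ring_mult r x y =
     (\<lambda>m. \<Sum>(m1, m2)\<in>{(m1, m2). m1 \<in> full_transf r \<and> m2 \<in> full_transf r \<and> m1 \<circ> m2 = m}.
            x m1 * y m2)"

definition coset_sum :: "(nat \<Rightarrow> nat) set \<Rightarrow> (nat \<Rightarrow> nat) \<Rightarrow> int" where
  "coset_sum D = (\<lambda>m. if m \<in> D then 1 else 0)"

text \<open>The coefficients \<open>a(D1, D2, D)\<close> of the expansion of \<open>X(D1) X(D2)\<close> in the basis \<open>X(D)\<close>,
  where \<open>D\<close> ranges over the double cosets of \<open>\<SS>\<^sub>\<mu>\<close> and \<open>\<SS>\<^sub>\<pi>\<close>;
  see \<open>expansion_coeff_unique\<close> below.\<close>

definition expansion_coeff ::
  "nat \<Rightarrow> nat list \<Rightarrow> nat list \<Rightarrow> (nat \<Rightarrow> nat) set \<Rightarrow> (nat \<Rightarrow> nat) set \<Rightarrow> (nat \<Rightarrow> nat) set \<Rightarrow> int"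
  where
  "expansion_coeff r \<mu> \<pi> D1 D2 = (THE a.
     (\<forall>D. D \<notin> double_cosets r \<mu> \<pi> \<longrightarrow> a D = 0) \<and>
     monoid_ring_mult r (coset_sum D1) (coset_sum D2) =
       (\<lambda>m. \<Sum>D\<in>double_cosets r \<mu> \<pi>. a D * coset_sum D m))"

lemma monoid_ring_mult_coset_sum:
  assumes "D1 \<subseteq> full_transf r" "D2 \<subseteq> full_transf r"
  shows "monoid_ring_mult r (coset_sum D1) (coset_sum D2) m =
         int (card {(m1, m2). m1 \<in> D1 \<and> m2 \<in> D2 \<and> m1 \<circ> m2 = m})"
proof -
  let ?T = "{(m1, m2). m1 \<in> full_transf r \<and> m2 \<in> full_transf r \<and> m1 \<circ> m2 = m}"
  let ?S = "{(m1, m2). m1 \<in> D1 \<and> m2 \<in> D2 \<and> m1 \<circ> m2 = m}"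
  have fin: "finite ?T"
    by (rule finite_subset[of _ "full_transf r \<times> full_transf r"])
       (auto intro: finite_cartesian_product finite_full_transf)
  have "monoid_ring_mult r (coset_sum D1) (coset_sum D2) m = (\<Sum>x\<in>?T. if x \<in> ?S then 1 else 0)"
    unfolding monoid_ring_mult_def coset_sum_def by (rule sum.cong) auto
  also have "\<dots> = (\<Sum>x\<in>?T \<inter> ?S. 1)" using fin by (simp add: sum.If_cases)
  also have "?T \<inter> ?S = ?S" using assms by auto
  finally show ?thesis by simp
qed

lemma monoid_ring_mult_invariant:
  assumes D1: "D1 \<in> double_cosets r \<mu> \<nu>" and D2: "D2 \<in> double_cosets r \<nu> \<pi>"
    and s: "s \<in> young r \<mu>" and t: "t \<in> young r \<pi>"
  shows "monoid_ring_mult r (coset_sum D1) (coset_sum D2) (s \<circ> m \<circ> t) =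
         monoid_ring_mult r (coset_sum D1) (coset_sum D2) m"
proof -
  note [simp] = monoid_ring_mult_coset_sum[OF double_cosets_subset[OF D1] double_cosets_subset[OF D2]]
  have "bij_betw (\<lambda>(m1, m2). (s \<circ> m1, m2 \<circ> t))
     {(m1, m2). m1 \<in> D1 \<and> m2 \<in> D2 \<and> m1 \<circ> m2 = m}
     {(m1, m2). m1 \<in> D1 \<and> m2 \<in> D2 \<and> m1 \<circ> m2 = s \<circ> m \<circ> t}"
  proof (rule bij_betw_byWitness[where f' = "\<lambda>(m1, m2). (Hilbert_Choice.inv s \<circ> m1, m2 \<circ> Hilbert_Choice.inv t)"], goal_cases)
    case 1
    show ?case using young_inv(3)[OF s] young_inv(2)[OF t]
      by (auto simp: comp_assoc) (simp add: comp_assoc[symmetric])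
  next
    case 2
    show ?case using young_inv(2)[OF s] young_inv(3)[OF t]
      by (auto simp: comp_assoc) (simp add: comp_assoc[symmetric])
  next
    case 3
    show ?case using double_cosets_closed_left[OF D1 _ s] double_cosets_closed_right[OF D2 _ t]
      by (auto simp: comp_assoc)
  next
    case 4
    have "Hilbert_Choice.inv s \<circ> m1 \<circ> (m2 \<circ> Hilbert_Choice.inv t) = m" if "m1 \<circ> m2 = s \<circ> m \<circ> t" for m1 m2
    proof -
      have "Hilbert_Choice.inv s \<circ> m1 \<circ> (m2 \<circ> Hilbert_Choice.inv t) = Hilbert_Choice.inv s \<circ> (m1 \<circ> m2) \<circ> Hilbert_Choice.inv t" by (simp add: comp_assoc)
      also have "\<dots> = (Hilbert_Choice.inv s \<circ> s) \<circ> m \<circ> (t \<circ> Hilbert_Choice.inv t)" by (simp add: that comp_assoc)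
      finally show ?thesis using young_inv(3)[OF s] young_inv(2)[OF t] by simp
    qed
    thus ?case
      using double_cosets_closed_left[OF D1 _ young_inv(1)[OF s]]
        double_cosets_closed_right[OF D2 _ young_inv(1)[OF t]] by auto
  qed
  thus ?thesis using bij_betw_same_card by fastforce
qed

lemma sum_coset_sum:
  assumes D: "D \<in> double_cosets r \<mu> \<pi>" and m: "m \<in> D"
  shows "(\<Sum>D'\<in>double_cosets r \<mu> \<pi>. a D' * coset_sum D' m) = a D"
proof -
  have "(\<Sum>D'\<in>double_cosets r \<mu> \<pi>. a D' * coset_sum D' m) =
        (\<Sum>D'\<in>double_cosets r \<mu> \<pi>. if D' = D then a D' else 0)"
  proof (rule sum.cong[OF refl])
    fix D' assume D': "D' \<in> double_cosets r \<mu> \<pi>"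
    have "m \<in> D' \<longleftrightarrow> D' = D"
      using double_cosets_eq[OF D m] double_cosets_eq[OF D', of m] m by metis
    thus "a D' * coset_sum D' m = (if D' = D then a D' else 0)" by (simp add: coset_sum_def)
  qed
  also have "\<dots> = a D" using D finite_double_cosets by simp
  finally show ?thesis .
qed

lemma expansion_coeff_unique:
  assumes D1: "D1 \<in> double_cosets r \<mu> \<nu>" and D2: "D2 \<in> double_cosets r \<nu> \<pi>"
  shows "\<exists>!a. (\<forall>D. D \<notin> double_cosets r \<mu> \<pi> \<longrightarrow> a D = 0) \<and>
     monoid_ring_mult r (coset_sum D1) (coset_sum D2) =
       (\<lambda>m. \<Sum>D\<in>double_cosets r \<mu> \<pi>. a D * coset_sum D m)"
proof -
  define v where "v = monoid_ring_mult r (coset_sum D1) (coset_sum D2)"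
  define a where "a D = (if D \<in> double_cosets r \<mu> \<pi> then v (SOME m. m \<in> D) else 0)" for D
  have va: "v m = a D" if D: "D \<in> double_cosets r \<mu> \<pi>" and m: "m \<in> D" for D m
  proof -
    have "(SOME m. m \<in> D) \<in> D" using someI[of "\<lambda>m. m \<in> D", OF m] .
    then obtain s t where st: "s \<in> young r \<mu>" "t \<in> young r \<pi>" "(SOME m. m \<in> D) = s \<circ> m \<circ> t"
      using double_cosets_eq[OF D m] by (auto simp: double_coset_def)
    show ?thesis
      using monoid_ring_mult_invariant[OF D1 D2 st(1,2)] D by (simp add: a_def v_def st(3))
  qed
  have exp: "v m = (\<Sum>D\<in>double_cosets r \<mu> \<pi>. a D * coset_sum D m)" for m
  proof (cases "m \<in> full_transf r")
    case True
    hence "double_coset r \<mu> m \<pi> \<in> double_cosets r \<mu> \<pi>" by (auto simp: double_cosets_def)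
    thus ?thesis using va sum_coset_sum double_coset_self by metis
  next
    case False
    have "m1 \<circ> m2 \<noteq> m" if "m1 \<in> D1" "m2 \<in> D2" for m1 m2
      using False that full_transf_comp double_cosets_subset[OF D1] double_cosets_subset[OF D2] by blast
    hence "{(m1, m2). m1 \<in> D1 \<and> m2 \<in> D2 \<and> m1 \<circ> m2 = m} = {}" by blast
    hence "v m = 0" unfolding v_def
      by (simp only: monoid_ring_mult_coset_sum[OF double_cosets_subset[OF D1] double_cosets_subset[OF D2]]
          card.empty of_nat_0)
    moreover have "(\<Sum>D\<in>double_cosets r \<mu> \<pi>. a D * coset_sum D m) = 0"
      using False double_cosets_subset[of _ r \<mu> \<pi>]
      by (intro sum.neutral) (auto simp: coset_sum_def)
    ultimately show ?thesis by simp
  qed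
  have "b = a" if b: "\<forall>D. D \<notin> double_cosets r \<mu> \<pi> \<longrightarrow> b D = 0"
    "v = (\<lambda>m. \<Sum>D\<in>double_cosets r \<mu> \<pi>. b D * coset_sum D m)" for b
  proof
    fix D show "b D = a D"
    proof (cases "D \<in> double_cosets r \<mu> \<pi>")
      case True
      then obtain m where m: "m \<in> D" using double_cosets_nonempty by blast
      have "v m = b D" using sum_coset_sum[OF True m, of b] b(2) by simp
      thus ?thesis using va[OF True m] by simp
    qed (use b(1) in \<open>simp add: a_def\<close>)
  qed
  note uniq = this
  have zero: "\<forall>D. D \<notin> double_cosets r \<mu> \<pi> \<longrightarrow> a D = 0" by (simp add: a_def)
  have expv: "v = (\<lambda>m. \<Sum>D\<in>double_cosets r \<mu> \<pi>. a D * coset_sum D m)" by (rule ext) (rule exp)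
  show ?thesis unfolding v_def[symmetric]
  proof (rule ex1I[of _ a])
    show "(\<forall>D. D \<notin> double_cosets r \<mu> \<pi> \<longrightarrow> a D = 0) \<and>
      v = (\<lambda>m. \<Sum>D\<in>double_cosets r \<mu> \<pi>. a D * coset_sum D m)"
      using zero expv by (rule conjI)
  qed (elim conjE, rule uniq)
qed

lemma expansion_coeff_eq:
  assumes D1: "D1 \<in> double_cosets r \<mu> \<nu>" and D2: "D2 \<in> double_cosets r \<nu> \<pi>"
    and D: "D \<in> double_cosets r \<mu> \<pi>" and m: "m \<in> D"
  shows "expansion_coeff r \<mu> \<pi> D1 D2 D =
         int (card {(m1, m2). m1 \<in> D1 \<and> m2 \<in> D2 \<and> m1 \<circ> m2 = m})"
proof -
  let ?a = "expansion_coeff r \<mu> \<pi> D1 D2"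
  have "monoid_ring_mult r (coset_sum D1) (coset_sum D2) =
       (\<lambda>m. \<Sum>D\<in>double_cosets r \<mu> \<pi>. ?a D * coset_sum D m)"
    using theI'[OF expansion_coeff_unique[OF D1 D2]] unfolding expansion_coeff_def by (rule conjunct2)
  hence "monoid_ring_mult r (coset_sum D1) (coset_sum D2) m = ?a D"
    using sum_coset_sum[OF D m, of ?a] by simp
  thus ?thesis
    using monoid_ring_mult_coset_sum[OF double_cosets_subset[OF D1] double_cosets_subset[OF D2]]
    by simp
qed

lemma dvd_card_right_invariant:
  fixes E :: "(nat \<Rightarrow> nat) set"
  assumes closed: "\<And>x t. x \<in> E \<Longrightarrow> t \<in> young r \<pi> \<Longrightarrow> x \<circ> t \<in> E"
    and sz: "\<And>x. x \<in> E \<Longrightarrow> card ((\<lambda>\<tau>. x \<circ> \<tau>) ` young r \<pi>) = k" and fin: "finite E"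
  shows "k dvd card E"
proof -
  define c where "c x = (\<lambda>\<tau>. x \<circ> \<tau>) ` young r \<pi>" for x :: "nat \<Rightarrow> nat"
  have c_iff: "y \<in> c x \<longleftrightarrow> (\<exists>t\<in>young r \<pi>. y = x \<circ> t)" for x y :: "nat \<Rightarrow> nat" by (auto simp: c_def)
  have self: "x \<in> c x" for x :: "nat \<Rightarrow> nat"
    unfolding c_def by (rule image_eqI[OF _ young_id]) simp
  have sub: "c y \<subseteq> c x" if y: "y \<in> c x" for x y :: "nat \<Rightarrow> nat"
  proof
    fix z assume "z \<in> c y"
    then obtain u where u: "u \<in> young r \<pi>" "z = y \<circ> u" unfolding c_iff by (elim bexE)
    obtain t where t: "t \<in> young r \<pi>" "y = x \<circ> t" using y unfolding c_iff by (elim bexE)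
    show "z \<in> c x"
      unfolding c_iff by (rule bexI[OF _ young_comp[OF t(1) u(1)]]) (simp add: t(2) u(2) comp_assoc)
  qed
  have sym: "x \<in> c y" if y: "y \<in> c x" for x y :: "nat \<Rightarrow> nat"
  proof -
    obtain t where t: "t \<in> young r \<pi>" "y = x \<circ> t" using y unfolding c_iff by (elim bexE)
    have "x = y \<circ> Hilbert_Choice.inv t" using young_inv(2)[OF t(1)] by (simp add: t(2) comp_assoc)
    thus ?thesis unfolding c_iff by (rule bexI[OF _ young_inv(1)[OF t(1)]])
  qed
  have eq: "c y = c x" if "y \<in> c x" for x y :: "nat \<Rightarrow> nat"
    using sub[OF that] sub[OF sym[OF that]] by (rule equalityI)
  have "c x \<subseteq> E" if "x \<in> E" for x :: "nat \<Rightarrow> nat"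
    using closed[OF that] unfolding c_def by (rule image_subsetI)
  hence un: "\<Union> (c ` E) = E" using self by blast
  have "k * card (c ` E) = card (\<Union> (c ` E))"
  proof (rule card_partition)
    show "finite (c ` E)" using fin by simp
    show "finite (\<Union> (c ` E))" using un fin by simp
    show "card d = k" if "d \<in> c ` E" for d using that sz unfolding c_def[symmetric] by blast
    show "d1 \<inter> d2 = {}" if d: "d1 \<in> c ` E" "d2 \<in> c ` E" "d1 \<noteq> d2" for d1 d2
    proof (rule ccontr)
      assume "d1 \<inter> d2 \<noteq> {}"
      then obtain y where "y \<in> d1" "y \<in> d2" by blast
      moreover obtain x1 x2 where "d1 = c x1" "d2 = c x2" using d by blast
      ultimately show False using eq[of y x1] eq[of y x2] \<open>d1 \<noteq> d2\<close> by simp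
    qed
  qed
  thus ?thesis unfolding un by (metis dvd_triv_left)
qed

lemma n_R_dvd:
  assumes D1: "D1 \<in> double_cosets r \<mu> \<nu>" and D2: "D2 \<in> double_cosets r \<nu> \<pi>"
    and D: "D \<in> double_cosets r \<mu> \<pi>"
  shows "int (n_R r \<nu> D1) * int (n_R r \<pi> D2) dvd
         int (n_R r \<pi> D) * expansion_coeff r \<mu> \<pi> D1 D2 D"
proof -
  obtain m where m: "m \<in> D" using double_cosets_nonempty[OF D] by blast
  define C where "C = (\<lambda>\<tau>. m \<circ> \<tau>) ` young r \<pi>"
  have C_iff: "x \<in> C \<longleftrightarrow> (\<exists>t\<in>young r \<pi>. x = m \<circ> t)" for x by (auto simp: C_def)
  define P where "P x = {(m1, m2). m1 \<in> D1 \<and> m2 \<in> D2 \<and> m1 \<circ> m2 = x}" for x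
  define F where "F m1 = {m2 \<in> D2. m1 \<circ> m2 \<in> C}" for m1
  have finD1: "finite D1" and finD2: "finite D2"
    using finite_subset[OF double_cosets_subset finite_full_transf] D1 D2 by blast+
  have finC: "finite C" using finite_young by (simp add: C_def)
  have C_inv: "x \<circ> t \<in> C" if x: "x \<in> C" and t: "t \<in> young r \<pi>" for x t
  proof -
    obtain u where u: "u \<in> young r \<pi>" "x = m \<circ> u" using x unfolding C_iff by (elim bexE)
    show ?thesis unfolding C_iff
      by (rule bexI[OF _ young_comp[OF u(1) t]]) (simp add: u(2) comp_assoc)
  qed
  have P: "int (card (P x)) = expansion_coeff r \<mu> \<pi> D1 D2 D" if x: "x \<in> C" for x
  proof -
    have "x \<in> D" using x double_cosets_closed_right[OF D m] unfolding C_iff by (elim bexE) simp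
    from expansion_coeff_eq[OF D1 D2 D this] show ?thesis by (simp add: P_def)
  qed
  have "int (card C) * expansion_coeff r \<mu> \<pi> D1 D2 D = (\<Sum>x\<in>C. int (card (P x)))"
    by (simp add: P)
  also have "\<dots> = int (card (\<Union>x\<in>C. P x))"
  proof -
    have "finite (P x)" for x
      by (rule finite_subset[of _ "D1 \<times> D2"]) (auto simp: P_def finD1 finD2)
    thus ?thesis using finC by (subst card_UN_disjoint) (auto simp: P_def)
  qed
  also have "(\<Union>x\<in>C. P x) = Sigma D1 F" by (auto simp: P_def F_def)
  also have "card (Sigma D1 F) = (\<Sum>m1\<in>D1. card (F m1))"
    using finD1 finD2 by (subst card_SigmaI) (auto simp: F_def)
  finally have eq: "int (n_R r \<pi> D) * expansion_coeff r \<mu> \<pi> D1 D2 D = int (\<Sum>m1\<in>D1. card (F m1))"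
    by (simp add: n_R_eq[OF D m] C_def)

  have dvd_F: "n_R r \<pi> D2 dvd card (F m1)" for m1
  proof (rule dvd_card_right_invariant)
    show "finite (F m1)" using finD2 by (simp add: F_def)
    show "card ((\<lambda>\<tau>. x \<circ> \<tau>) ` young r \<pi>) = n_R r \<pi> D2" if "x \<in> F m1" for x
      using n_R_eq[OF D2, of x] that by (simp add: F_def)
    show "x \<circ> t \<in> F m1" if "x \<in> F m1" "t \<in> young r \<pi>" for x t
    proof -
      have "m1 \<circ> (x \<circ> t) \<in> C" using C_inv[of "m1 \<circ> x" t] that by (simp add: F_def comp_assoc)
      thus ?thesis using double_cosets_closed_right[OF D2 _ that(2)] that(1) by (simp add: F_def)
    qed
  qed
  have F_le: "card (F m1) \<le> card (F (m1 \<circ> t))" if t: "t \<in> young r \<nu>" for m1 t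
  proof (rule card_inj_on_le[where f = "\<lambda>x. Hilbert_Choice.inv t \<circ> x"])
    show "inj_on (\<lambda>x. Hilbert_Choice.inv t \<circ> x) (F m1)"
      by (rule inj_onI) (metis young_inv(2)[OF t] comp_assoc id_comp)
    show "finite (F (m1 \<circ> t))" using finD2 by (simp add: F_def)
    have "m1 \<circ> t \<circ> (Hilbert_Choice.inv t \<circ> x) = m1 \<circ> x" for x :: "nat \<Rightarrow> nat"
      by (metis young_inv(2)[OF t] comp_assoc id_comp)
    thus "(\<lambda>x. Hilbert_Choice.inv t \<circ> x) ` F m1 \<subseteq> F (m1 \<circ> t)"
      using double_cosets_closed_left[OF D2 _ young_inv(1)[OF t]] by (auto simp: F_def)
  qed
  have F_inv: "card (F (m1 \<circ> t)) = card (F m1)" if t: "t \<in> young r \<nu>" for m1 t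
  proof (rule antisym)
    have "m1 \<circ> t \<circ> Hilbert_Choice.inv t = m1" using young_inv(2)[OF t] by (simp add: comp_assoc)
    thus "card (F (m1 \<circ> t)) \<le> card (F m1)"
      using F_le[OF young_inv(1)[OF t], of "m1 \<circ> t"] by simp
  qed (rule F_le[OF t])
  have "(\<Sum>m1\<in>D1. card (F m1)) =
        (\<Sum>q\<in>(\<lambda>m1. card (F m1)) ` D1. \<Sum>m1\<in>{m1 \<in> D1. card (F m1) = q}. card (F m1))"
    by (rule sum.image_gen[OF finD1])
  also have "n_R r \<nu> D1 * n_R r \<pi> D2 dvd \<dots>"
  proof (rule dvd_sum)
    fix q assume "q \<in> (\<lambda>m1. card (F m1)) ` D1"
    hence "n_R r \<pi> D2 dvd q" using dvd_F by blast
    moreover have "n_R r \<nu> D1 dvd card {m1 \<in> D1. card (F m1) = q}"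
    proof (rule dvd_card_right_invariant)
      show "finite {m1 \<in> D1. card (F m1) = q}" using finD1 by simp
      show "card ((\<lambda>\<tau>. x \<circ> \<tau>) ` young r \<nu>) = n_R r \<nu> D1" if "x \<in> {m1 \<in> D1. card (F m1) = q}" for x
        using n_R_eq[OF D1, of x] that by simp
      show "x \<circ> t \<in> {m1 \<in> D1. card (F m1) = q}"
        if "x \<in> {m1 \<in> D1. card (F m1) = q}" "t \<in> young r \<nu>" for x t
        using that F_inv double_cosets_closed_right[OF D1] by simp
    qed
    ultimately show "n_R r \<nu> D1 * n_R r \<pi> D2 dvd (\<Sum>m1\<in>{m1 \<in> D1. card (F m1) = q}. card (F m1))"
      by (simp add: mult_dvd_mono)
  qed
  finally show ?thesis unfolding eq by (metis of_nat_mult of_nat_dvd_iff)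
qed

text \<open>Since the direct sum over \<open>(\<mu>, \<nu>)\<close> is external, and one set of maps can be a double coset
  for several pairs \<open>(\<mu>, \<nu>)\<close>, basis elements are indexed by triples \<open>(\<mu>, D, \<nu>)\<close>.\<close>

type_synonym coset_index = "nat list \<times> (nat \<Rightarrow> nat) set \<times> nat list"

definition basis_index :: "nat \<Rightarrow> nat \<Rightarrow> coset_index set" where
  "basis_index r n = {(\<mu>, D, \<nu>). \<mu> \<in> compositions r n \<and> \<nu> \<in> compositions r n \<and>
     D \<in> double_cosets r \<mu> \<nu>}"

text \<open>The coefficient of \<open>b\<^sub>z\<close> in \<open>b\<^sub>x *\<^sub>R b\<^sub>y\<close>; the division is exact, see
  \<open>n_R_dvd\<close> below.\<close>

fun struct_const_R :: "nat \<Rightarrow> coset_index \<Rightarrow> coset_index \<Rightarrow> coset_index \<Rightarrow> int" where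
  "struct_const_R r (\<mu>, D1, \<nu>) (\<rho>, D2, \<pi>) (\<mu>', D, \<pi>') =
     (if \<nu> = \<rho> \<and> \<mu>' = \<mu> \<and> \<pi>' = \<pi>
      then int (n_R r \<pi> D) * expansion_coeff r \<mu> \<pi> D1 D2 D
             div (int (n_R r \<nu> D1) * int (n_R r \<pi> D2))
      else 0)"


section \<open>The algebra \<open>S\<^sub>R(\<T>\<^sub>r, k)\<close>\<close>

text \<open>The \<open>k\<close>-module with basis \<open>b\<^sub>x\<close>, \<open>x \<in>\<close> \<^term>\<open>basis_index r n\<close>, and with the images in \<open>k\<close> of
  the integral structure constants.  For \<open>'k = int\<close> this is the ring \<open>A\<^sub>R\<^sup>\<int>\<close>, and for general \<open>'k\<close>
  its base change.  The identity is the sum of the elements indexed by \<open>(\<mu>, \<SS>\<^sub>\<mu>, \<mu>)\<close>.\<close>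

definition S_R :: "nat \<Rightarrow> nat \<Rightarrow> ('k::comm_ring_1, coset_index \<Rightarrow> 'k) module" where
  "S_R r n =
     \<lparr>carrier = {f. \<forall>x. x \<notin> basis_index r n \<longrightarrow> f x = 0},
      monoid.mult = (\<lambda>f g z. if z \<in> basis_index r n
         then \<Sum>x\<in>basis_index r n. \<Sum>y\<in>basis_index r n.
                f x * g y * of_int (struct_const_R r x y z)
         else 0),
      one = (\<lambda>(\<mu>, D, \<nu>). if \<mu> \<in> compositions r n \<and> \<nu> = \<mu> \<and> D = young r \<mu> then 1 else 0),
      ring.zero = (\<lambda>x. 0),
      add = (\<lambda>f g x. f x + g x),
      module.smult = (\<lambda>c f x. c * f x)\<rparr>"

end

theory Submission
  imports Defs "HOL-Library.Function_Algebras" "HOL-Library.Multiset_Order"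
begin

text \<open>A coset \<open>m \<SS>\<^sub>\<nu>\<close> is determined by its configuration, the multiset of all pairs of \<open>m t\<close> and
  the block of \<open>\<nu>\<close> containing \<open>t\<close>; its rank is the size of the image of \<open>m\<close>.  The algebra is spanned
  by codeterminants \<open>C\<^sub>S\<^sub>T\<close>, which count the ways to distribute the image over rows such that the
  blocks of \<open>\<mu>\<close> met by row \<open>j\<close> form the multiset \<open>S j\<close> and the fibres over row \<open>j\<close> form \<open>T j\<close>.  Modulo
  smaller rank, left multiplication affects only \<open>S\<close> and right multiplication only \<open>T\<close>.  Garnir
  relations straighten \<open>S\<close> and \<open>T\<close> modulo dominating shapes of the same rank, and antisymmetrizing
  over the columns of a shape separates the codeterminants of standard \<open>S\<close> and \<open>T\<close>.  Hence these
  form a cellular basis, with one layer for each partition \<open>\<eta>\<close> of each \<open>i \<in> {1..r}\<close>, and the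
  corresponding ideals form a heredity chain once no layer has zero multiplication.

  For the latter, let \<open>p\<^sup>j\<close> be the largest power of \<open>p\<close> dividing all rows of \<open>\<eta>\<close>, and let row \<open>c\<close> have
  \<open>p\<close>-adic valuation \<open>j\<close>.  Since \<open>p\<^sup>j \<le> i \<le> r = a p\<^sup>l\<close> and \<open>a < p\<close>, \<open>p\<^sup>j\<close> divides \<open>r\<close> and hence \<open>r - i\<close>.
  So \<open>r - i\<close> points can be distributed evenly over \<open>p\<^sup>j\<close> cells of row \<open>c\<close>.  The square of the
  resulting codeterminant is, modulo smaller rank, its multiple by the binomial coefficient of
  \<open>\<eta> c\<close> over \<open>p\<^sup>j\<close>, which is prime to \<open>p\<close>.\<close>

section \<open>Idempotents and the Jacobson radical\<close>

text \<open>In characteristic \<open>p\<close> no counting factor may be divided out, so both halves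
  of the basis argument keep leading coefficient 1: a Garnir relation contains
  \<open>codet S T\<close> exactly once, and the column determinants of standard fillings form an
  integral unitriangular matrix. Codeterminants are functions on abstract labelled sets, each point
  carrying its block of \<mu> and its fibre. Both labels then play the same role, and one
  straightening argument serves both sides. The factors \<open>n_R\<close> turn \<open>*_R\<close>
  into composition of kernels between configurations, where a map that keeps the rank acts through
  its sections. The weight \<open>ent\<close> serves twice: a Garnir move creates a row longer than
  both old ones, and 3^x - 1 is twice the sum of the 3^c with c < x, so \<open>ent\<close> is also a
  sum over cells that detects how rows can meet columns injectively. In the pairing step, putting
  all surplus points over one cell of row \<open>c\<close> would give the factor \<eta> c, which is
  zero whenever \<open>p\<close> divides every row; equal loads on \<open>k\<close> cells give a
  binomial coefficient instead.\<close>

lemma (in ring) left_idealI: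
  assumes "L \<subseteq> carrier R" "\<zero> \<in> L" "\<And>x y. x \<in> L \<Longrightarrow> y \<in> L \<Longrightarrow> x \<oplus> y \<in> L"
    "\<And>a x. a \<in> carrier R \<Longrightarrow> x \<in> L \<Longrightarrow> a \<otimes> x \<in> L"
  shows "left_ideal R L"
proof -
  have "\<ominus> x \<in> L" if "x \<in> L" for x
    using assms(4)[of "\<ominus> \<one>" x] that assms(1) by (simp add: l_minus subset_iff)
  hence "additive_subgroup L R"
    using assms by unfold_locales (auto simp: a_inv_def)
  thus ?thesis using assms(4) by (simp add: left_ideal_def)
qed

lemma (in ring) left_idealD:
  assumes "left_ideal R L"
  shows "L \<subseteq> carrier R" "\<zero> \<in> L" "x \<in> L \<Longrightarrow> y \<in> L \<Longrightarrow> x \<oplus> y \<in> L"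
    "a \<in> carrier R \<Longrightarrow> x \<in> L \<Longrightarrow> a \<otimes> x \<in> L"
proof -
  interpret additive_subgroup L R using assms by (simp add: left_ideal_def)
  show "L \<subseteq> carrier R" "\<zero> \<in> L" "x \<in> L \<Longrightarrow> y \<in> L \<Longrightarrow> x \<oplus> y \<in> L"
    using a_subset by auto
  show "a \<in> carrier R \<Longrightarrow> x \<in> L \<Longrightarrow> a \<otimes> x \<in> L" using assms by (simp add: left_ideal_def)
qed

text \<open>Zorn's lemma for the left ideals above \<open>L\<close> that avoid \<one>; unions of
  chains inherit both properties, and avoiding \<one> means being proper.\<close>

lemma (in ring) ex_maximal_left_ideal:
  assumes L: "left_ideal R L" and one: "\<one> \<notin> L"
  shows "\<exists>M. maximal_left_ideal R M \<and> L \<subseteq> M"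
proof -
  define \<A> where "\<A> = {M. left_ideal R M \<and> L \<subseteq> M \<and> \<one> \<notin> M}"
  have "\<exists>M\<in>\<A>. \<forall>N\<in>\<A>. M \<subseteq> N \<longrightarrow> N = M"
  proof (rule subset_Zorn_nonempty)
    show "\<A> \<noteq> {}" using L one by (auto simp: \<A>_def)
    fix \<C> assume ne: "\<C> \<noteq> {}" and ch: "subset.chain \<A> \<C>"
    have sub: "\<C> \<subseteq> \<A>" using ch by (auto simp: subset.chain_def)
    have lin: "N \<subseteq> Y \<or> Y \<subseteq> N" if "N \<in> \<C>" "Y \<in> \<C>" for N Y
      using ch that by (auto simp: subset.chain_def)
    have li: "left_ideal R N" if "N \<in> \<C>" for N using sub that by (auto simp: \<A>_def)
    have "left_ideal R (\<Union>\<C>)"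
    proof (rule left_idealI)
      show "\<Union>\<C> \<subseteq> carrier R" using left_idealD(1)[OF li] by blast
      show "\<zero> \<in> \<Union>\<C>" using left_idealD(2)[OF li] ne by blast
      show "x \<oplus> y \<in> \<Union>\<C>" if xy: "x \<in> \<Union>\<C>" "y \<in> \<Union>\<C>" for x y
      proof -
        obtain N Y where XY: "N \<in> \<C>" "x \<in> N" "Y \<in> \<C>" "y \<in> Y" using xy by blast
        show ?thesis
        proof (cases "N \<subseteq> Y")
          case True thus ?thesis using left_idealD(3)[OF li[OF XY(3)], of x y] XY by blast
        next
          case False
          hence "y \<in> N" using lin[OF XY(1,3)] XY by blast
          thus ?thesis using left_idealD(3)[OF li[OF XY(1)], of x y] XY by blast
        qed
      qed
      show "a \<otimes> x \<in> \<Union>\<C>" if "a \<in> carrier R" "x \<in> \<Union>\<C>" for a x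
        using left_idealD(4)[OF li] that by blast
    qed
    moreover have "L \<subseteq> \<Union>\<C>" "\<one> \<notin> \<Union>\<C>" using sub ne by (auto simp: \<A>_def)
    ultimately show "\<Union>\<C> \<in> \<A>" by (simp add: \<A>_def)
  qed
  then obtain M where M: "M \<in> \<A>" "\<And>N. N \<in> \<A> \<Longrightarrow> M \<subseteq> N \<Longrightarrow> N = M" by blast
  have "maximal_left_ideal R M" unfolding maximal_left_ideal_def
  proof (intro conjI allI impI)
    show "left_ideal R M" using M(1) by (simp add: \<A>_def)
    show "M \<noteq> carrier R" using M(1) one_closed unfolding \<A>_def by blast
    fix L' assume L': "left_ideal R L' \<and> M \<subseteq> L'"
    show "L' = M \<or> L' = carrier R"
    proof (cases "\<one> \<in> L'")
      case True
      have "x \<in> L'" if "x \<in> carrier R" for x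
        using left_idealD(4)[of L' x \<one>] L' True that by simp
      thus ?thesis using left_idealD(1)[of L'] L' by blast
    next
      case False
      hence "L' \<in> \<A>" using L' M(1) by (auto simp: \<A>_def)
      thus ?thesis using M(2) L' by blast
    qed
  qed
  thus ?thesis using M(1) by (auto simp: \<A>_def)
qed

text \<open>If 1 - u had no left inverse, some maximal left ideal would contain both 1 - u and u,
  hence 1. So b(1 - u) = 1 for some b, and u = b(1 - u)u = 0.\<close>

lemma (in ring) idempotent_in_jacobson_radical:
  assumes u: "u \<in> jacobson_radical R" and idem: "u \<otimes> u = u"
  shows "u = \<zero>"
proof -
  have uc: "u \<in> carrier R" using u by (simp add: jacobson_radical_def)
  define L where "L = (\<lambda>b. b \<otimes> (\<one> \<ominus> u)) ` carrier R"
  have L: "left_ideal R L"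
  proof (rule left_idealI)
    show "L \<subseteq> carrier R" using uc by (auto simp: L_def)
    show "\<zero> \<in> L" unfolding L_def by (rule image_eqI[of _ _ \<zero>]) (use uc in auto)
    show "x \<oplus> y \<in> L" if xy: "x \<in> L" "y \<in> L" for x y
    proof -
      obtain b c where bc: "b \<in> carrier R" "c \<in> carrier R" "x = b \<otimes> (\<one> \<ominus> u)" "y = c \<otimes> (\<one> \<ominus> u)"
        using xy by (auto simp: L_def)
      show ?thesis unfolding L_def
        by (rule image_eqI[of _ _ "b \<oplus> c"]) (use uc bc in \<open>auto simp: l_distr\<close>)
    qed
    show "a \<otimes> x \<in> L" if ax: "a \<in> carrier R" "x \<in> L" for a x
    proof -
      obtain b where b: "b \<in> carrier R" "x = b \<otimes> (\<one> \<ominus> u)" using ax by (auto simp: L_def)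
      show ?thesis unfolding L_def
        by (rule image_eqI[of _ _ "a \<otimes> b"]) (use uc ax b in \<open>auto simp: m_assoc\<close>)
    qed
  qed
  have "\<one> \<in> L"
  proof (rule ccontr)
    assume "\<one> \<notin> L"
    then obtain M where M: "maximal_left_ideal R M" "L \<subseteq> M" using ex_maximal_left_ideal[OF L] by blast
    have li: "left_ideal R M" and ne: "M \<noteq> carrier R" using M(1) by (auto simp: maximal_left_ideal_def)
    have "u \<in> M" using u M(1) by (auto simp: jacobson_radical_def)
    moreover have "\<one> \<otimes> (\<one> \<ominus> u) \<in> M" using M(2) by (auto simp: L_def)
    ultimately have "(\<one> \<ominus> u) \<oplus> u \<in> M" using left_idealD(3)[OF li] uc by simp
    hence "\<one> \<in> M" using uc by (simp add: minus_eq a_assoc l_neg)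
    hence "x \<in> M" if "x \<in> carrier R" for x using left_idealD(4)[OF li that, of \<one>] that by simp
    thus False using left_idealD(1)[OF li] ne by blast
  qed
  then obtain b where b: "b \<in> carrier R" "\<one> = b \<otimes> (\<one> \<ominus> u)" by (auto simp: L_def)
  have z: "(\<one> \<ominus> u) \<otimes> u = \<zero>" using uc idem by (simp add: minus_eq l_distr l_minus r_neg)
  have "u = b \<otimes> (\<one> \<ominus> u) \<otimes> u" using b uc by simp
  also have "\<dots> = b \<otimes> ((\<one> \<ominus> u) \<otimes> u)" using b(1) uc by (simp add: m_assoc)
  also have "\<dots> = \<zero>" using z b(1) by simp
  finally show ?thesis .
qed

lemma (in ring) jacobson_radical_left:
  assumes "u \<in> jacobson_radical R" "a \<in> carrier R"
  shows "a \<otimes> u \<in> jacobson_radical R"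
  using assms left_idealD(4)[of _ a u] unfolding jacobson_radical_def maximal_left_ideal_def by auto

section \<open>Heredity ideals from cell bases\<close>

text \<open>The algebra is a subspace \<open>V\<close> of a type-based vector space, so that
  \<open>span\<close> and \<open>subspace\<close> can be used; \<open>alg\<close> repackages it as
  the record for which quasi-heredity is defined.\<close>

locale vs_algebra = vector_space scale
  for scale :: "'k::field \<Rightarrow> 'v::ab_group_add \<Rightarrow> 'v" (infixr \<open>*s\<close> 75) +
  fixes V :: "'v set" and mul :: "'v \<Rightarrow> 'v \<Rightarrow> 'v" (infixl \<open>\<bullet>\<close> 75) and e :: 'v
  assumes V: "subspace V"
    and mul_closed [simp, intro]: "x \<in> V \<Longrightarrow> y \<in> V \<Longrightarrow> x \<bullet> y \<in> V"
    and e_closed [simp, intro]: "e \<in> V"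
    and mul_add_left: "x \<in> V \<Longrightarrow> y \<in> V \<Longrightarrow> z \<in> V \<Longrightarrow> (x + y) \<bullet> z = x \<bullet> z + y \<bullet> z"
    and mul_add_right: "x \<in> V \<Longrightarrow> y \<in> V \<Longrightarrow> z \<in> V \<Longrightarrow> x \<bullet> (y + z) = x \<bullet> y + x \<bullet> z"
    and mul_scale_left: "x \<in> V \<Longrightarrow> y \<in> V \<Longrightarrow> (c *s x) \<bullet> y = c *s (x \<bullet> y)"
    and mul_scale_right: "x \<in> V \<Longrightarrow> y \<in> V \<Longrightarrow> x \<bullet> (c *s y) = c *s (x \<bullet> y)"
    and mul_assoc: "x \<in> V \<Longrightarrow> y \<in> V \<Longrightarrow> z \<in> V \<Longrightarrow> (x \<bullet> y) \<bullet> z = x \<bullet> (y \<bullet> z)"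
    and e_left [simp]: "x \<in> V \<Longrightarrow> e \<bullet> x = x"
    and e_right [simp]: "x \<in> V \<Longrightarrow> x \<bullet> e = x"
    and fin_spanning: "\<exists>B. finite B \<and> B \<subseteq> V \<and> V \<subseteq> span B"
begin

definition alg :: "('k, 'v) module" where
  "alg = \<lparr>carrier = V, monoid.mult = mul, one = e, ring.zero = 0, add = (+), module.smult = scale\<rparr>"

lemma alg_simps [simp]:
  "carrier alg = V" "monoid.mult alg = mul" "one alg = e" "ring.zero alg = 0"
  "add alg = (+)" "module.smult alg = scale"
  by (simp_all add: alg_def)

lemma V_closed [simp, intro]:
  "0 \<in> V" "x \<in> V \<Longrightarrow> y \<in> V \<Longrightarrow> x + y \<in> V" "x \<in> V \<Longrightarrow> c *s x \<in> V"
  "x \<in> V \<Longrightarrow> y \<in> V \<Longrightarrow> x - y \<in> V" "x \<in> V \<Longrightarrow> - x \<in> V"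
  using V by (auto intro: subspace_0 subspace_add subspace_scale subspace_diff subspace_neg)

lemma V_sum [intro]: "(\<And>i. i \<in> A \<Longrightarrow> f i \<in> V) \<Longrightarrow> sum f A \<in> V"
  using V by (rule subspace_sum)

lemma ring_alg: "ring alg"
proof (rule ringI)
  show "abelian_group alg"
  proof (rule abelian_groupI)
    fix x assume "x \<in> carrier alg"
    thus "\<exists>y\<in>carrier alg. y \<oplus>\<^bsub>alg\<^esub> x = \<zero>\<^bsub>alg\<^esub>" by (intro bexI[of _ "- x"]) auto
  qed (auto simp: ac_simps)
  show "Group.monoid alg" by (rule monoidI) (auto simp: mul_assoc)
qed (auto simp: mul_add_left mul_add_right)

sublocale alg: ring alg by (rule ring_alg)

lemma a_inv_alg: "x \<in> V \<Longrightarrow> \<ominus>\<^bsub>alg\<^esub> x = - x"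
  using alg.minus_equality[of "- x" x] by simp

lemma finsum_alg: "finite A \<Longrightarrow> (\<And>i. i \<in> A \<Longrightarrow> f i \<in> V) \<Longrightarrow> (\<Oplus>\<^bsub>alg\<^esub>i\<in>A. f i) = sum f A"
  by (induction A rule: finite_induct) (auto simp: alg.finsum_insert Pi_def)

lemma fin_dim_alg: "fin_dim_algebra alg"
proof (intro fin_dim_algebra.intro fin_dim_algebra_axioms.intro ring_alg)
  obtain B where B: "finite B" "B \<subseteq> V" "V \<subseteq> span B" using fin_spanning by blast
  show "\<exists>B. finite B \<and> B \<subseteq> carrier alg \<and>
      (\<forall>x\<in>carrier alg. \<exists>c. x = (\<Oplus>\<^bsub>alg\<^esub>b\<in>B. c b \<odot>\<^bsub>alg\<^esub> b))"
  proof (intro exI[of _ B] conjI ballI)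
    fix x assume "x \<in> carrier alg"
    hence "x \<in> span B" using B by auto
    then obtain c where "x = (\<Sum>b\<in>B. c b *s b)" using span_finite[OF B(1)] by auto
    moreover have "(\<Oplus>\<^bsub>alg\<^esub>b\<in>B. c b \<odot>\<^bsub>alg\<^esub> b) = (\<Sum>b\<in>B. c b *s b)"
      using B by (subst finsum_alg) auto
    ultimately show "\<exists>c. x = (\<Oplus>\<^bsub>alg\<^esub>b\<in>B. c b \<odot>\<^bsub>alg\<^esub> b)" by metis
  qed (use B in auto)
qed (auto simp: scale_left_distrib scale_right_distrib mul_scale_left mul_scale_right)

lemma mul_diff_left: "x \<in> V \<Longrightarrow> y \<in> V \<Longrightarrow> z \<in> V \<Longrightarrow> (x - y) \<bullet> z = x \<bullet> z - y \<bullet> z"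
  using mul_add_left[of "x - y" y z] by (simp add: algebra_simps)

lemma mul_diff_right: "x \<in> V \<Longrightarrow> y \<in> V \<Longrightarrow> z \<in> V \<Longrightarrow> x \<bullet> (y - z) = x \<bullet> y - x \<bullet> z"
  using mul_add_right[of x "y - z" z] by (simp add: algebra_simps)

lemma mul_zero [simp]: "x \<in> V \<Longrightarrow> x \<bullet> 0 = 0" "x \<in> V \<Longrightarrow> 0 \<bullet> x = 0"
  using mul_diff_right[of x 0 0] mul_diff_left[of 0 0 x] by auto

lemma mul_sum_left:
  "(\<And>i. i \<in> A \<Longrightarrow> f i \<in> V) \<Longrightarrow> y \<in> V \<Longrightarrow> sum f A \<bullet> y = (\<Sum>i\<in>A. f i \<bullet> y)"
  by (induction A rule: infinite_finite_induct) (auto simp: mul_add_left V_sum)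

lemma mul_sum_right:
  "(\<And>i. i \<in> A \<Longrightarrow> f i \<in> V) \<Longrightarrow> y \<in> V \<Longrightarrow> y \<bullet> sum f A = (\<Sum>i\<in>A. y \<bullet> f i)"
  by (induction A rule: infinite_finite_induct) (auto simp: mul_add_right V_sum)

definition alg_ideal :: "'v set \<Rightarrow> bool" where
  "alg_ideal K \<longleftrightarrow> subspace K \<and> K \<subseteq> V \<and> (\<forall>a\<in>V. \<forall>x\<in>K. a \<bullet> x \<in> K \<and> x \<bullet> a \<in> K)"

lemma alg_idealD:
  assumes "alg_ideal K"
  shows "subspace K" "x \<in> K \<Longrightarrow> x \<in> V" "a \<in> V \<Longrightarrow> x \<in> K \<Longrightarrow> a \<bullet> x \<in> K" "a \<in> V \<Longrightarrow> x \<in> K \<Longrightarrow> x \<bullet> a \<in> K"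
    "x \<in> K \<Longrightarrow> y \<in> K \<Longrightarrow> x + y \<in> K" "x \<in> K \<Longrightarrow> y \<in> K \<Longrightarrow> x - y \<in> K" "x \<in> K \<Longrightarrow> c *s x \<in> K" "0 \<in> K"
    "(\<And>i. i \<in> A \<Longrightarrow> f i \<in> K) \<Longrightarrow> sum f A \<in> K"
  using assms unfolding alg_ideal_def
  by (auto intro: subspace_0 subspace_add subspace_scale subspace_diff subspace_sum)

lemma ideal_alg:
  assumes K: "alg_ideal K" shows "ideal K alg"
proof (rule idealI[OF ring_alg])
  show "subgroup K (add_monoid alg)"
  proof (rule alg.add.subgroupI)
    show "K \<subseteq> carrier alg" "K \<noteq> {}" using alg_idealD(2,8)[OF K] by auto
    show "\<ominus>\<^bsub>alg\<^esub> a \<in> K" if "a \<in> K" for a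
      using that alg_idealD(2)[OF K that] subspace_neg[OF alg_idealD(1)[OF K] that] by (simp add: a_inv_alg)
  qed (use alg_idealD(5)[OF K] in simp)
qed (use alg_idealD(3,4)[OF K] in auto)

abbreviation coset :: "'v set \<Rightarrow> 'v \<Rightarrow> 'v set" where "coset K x \<equiv> K +>\<^bsub>alg\<^esub> x"

lemma coset_def': "coset K x = {k + x | k. k \<in> K}"
  by (auto simp: a_r_coset_def' )

lemma coset_eq_iff:
  assumes K: "alg_ideal K" shows "coset K x = coset K y \<longleftrightarrow> x - y \<in> K"
proof
  assume eq: "coset K x = coset K y"
  have "x \<in> coset K x" using alg_idealD(8)[OF K] unfolding coset_def' by force
  then obtain k where "k \<in> K" "x = k + y" unfolding eq unfolding coset_def' by auto
  thus "x - y \<in> K" by simp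
next
  assume d: "x - y \<in> K"
  show "coset K x = coset K y"
  proof
    show "coset K x \<subseteq> coset K y"
    proof
      fix z assume "z \<in> coset K x"
      then obtain k where "k \<in> K" "z = k + x" unfolding coset_def' by auto
      hence "z = (k + (x - y)) + y" "k + (x - y) \<in> K" using alg_idealD(5)[OF K _ d] by auto
      thus "z \<in> coset K y" unfolding coset_def' by blast
    qed
    show "coset K y \<subseteq> coset K x"
    proof
      fix z assume "z \<in> coset K y"
      then obtain k where "k \<in> K" "z = k + y" unfolding coset_def' by auto
      hence "z = (k - (x - y)) + x" "k - (x - y) \<in> K" using alg_idealD(6)[OF K _ d] by auto
      thus "z \<in> coset K x" unfolding coset_def' by blast
    qed
  qed
qed

lemma Quot_simps:
  assumes K: "alg_ideal K"
  shows "carrier (alg Quot K) = coset K ` V" "\<zero>\<^bsub>alg Quot K\<^esub> = coset K 0" "\<one>\<^bsub>alg Quot K\<^esub> = coset K e"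
    "x \<in> V \<Longrightarrow> y \<in> V \<Longrightarrow> coset K x \<oplus>\<^bsub>alg Quot K\<^esub> coset K y = coset K (x + y)"
    "x \<in> V \<Longrightarrow> y \<in> V \<Longrightarrow> coset K x \<otimes>\<^bsub>alg Quot K\<^esub> coset K y = coset K (x \<bullet> y)"
proof -
  interpret ideal K alg by (rule ideal_alg[OF K])
  show "carrier (alg Quot K) = coset K ` V" by (auto simp: FactRing_def A_RCOSETS_def' a_r_coset_def')
  show "\<zero>\<^bsub>alg Quot K\<^esub> = coset K 0" by (simp add: FactRing_def coset_def')
  show "\<one>\<^bsub>alg Quot K\<^esub> = coset K e" by (simp add: FactRing_def)
  show "x \<in> V \<Longrightarrow> y \<in> V \<Longrightarrow> coset K x \<oplus>\<^bsub>alg Quot K\<^esub> coset K y = coset K (x + y)"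
    using a_rcos_sum[of x y] by (simp add: FactRing_def)
  show "x \<in> V \<Longrightarrow> y \<in> V \<Longrightarrow> coset K x \<otimes>\<^bsub>alg Quot K\<^esub> coset K y = coset K (x \<bullet> y)"
    using rcoset_mult_add[of x y] by (simp add: FactRing_def)
qed

lemma ring_Quot: "alg_ideal K \<Longrightarrow> ring (alg Quot K)"
  using ideal.quotient_is_ring[OF ideal_alg] .

end

text \<open>One layer \<open>K \<subseteq> K'\<close> of a standard basis in the sense of Du and Rui.\<close>

locale cell_layer = vs_algebra +
  fixes K K' :: "'b set" and I :: "'s set" and T :: "'t set" and C :: "'s \<Rightarrow> 't \<Rightarrow> 'b"
  assumes K: "alg_ideal K" and K': "alg_ideal K'" and K_sub: "K \<subseteq> K'"
    and fin: "finite I" "finite T"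
    and C_mem: "s \<in> I \<Longrightarrow> t \<in> T \<Longrightarrow> C s t \<in> K'"
    and spans: "x \<in> K' \<Longrightarrow> \<exists>c. x - (\<Sum>t\<in>T. \<Sum>s\<in>I. c s t *s C s t) \<in> K"
    and left: "a \<in> V \<Longrightarrow> s \<in> I \<Longrightarrow> \<exists>\<rho>. \<forall>t\<in>T. a \<bullet> C s t - (\<Sum>s'\<in>I. \<rho> s' *s C s' t) \<in> K"
    and right: "a \<in> V \<Longrightarrow> t \<in> T \<Longrightarrow> \<exists>\<rho>. \<forall>s\<in>I. C s t \<bullet> a - (\<Sum>t'\<in>T. \<rho> t' *s C s t') \<in> K"
    and indep: "(\<Sum>t\<in>T. \<Sum>s\<in>I. c s t *s C s t) \<in> K \<Longrightarrow> s \<in> I \<Longrightarrow> t \<in> T \<Longrightarrow> c s t = 0"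
    and pairing: "\<exists>s\<in>I. \<exists>t\<in>T. \<exists>s'\<in>I. \<exists>t'\<in>T. C s t \<bullet> C s' t' \<notin> K"
begin

lemma C_V: "s \<in> I \<Longrightarrow> t \<in> T \<Longrightarrow> C s t \<in> V"
  using C_mem alg_idealD(2)[OF K'] by blast

definition col :: "('s \<Rightarrow> 'a) \<Rightarrow> 't \<Rightarrow> 'b" where "col d t = (\<Sum>s\<in>I. d s *s C s t)"

definition lin :: "('s \<Rightarrow> 't \<Rightarrow> 'a) \<Rightarrow> 'b" where "lin c = (\<Sum>t\<in>T. col (\<lambda>s. c s t) t)"

lemma col_V: "t \<in> T \<Longrightarrow> col d t \<in> V"
  unfolding col_def using C_V by auto

lemma lin_V: "lin c \<in> V" unfolding lin_def using col_V by auto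

lemma col_add: "col d t + col d' t = col (\<lambda>s. d s + d' s) t"
  by (simp add: col_def scale_left_distrib sum.distrib)

lemma col_diff: "col d t - col d' t = col (\<lambda>s. d s - d' s) t"
  by (simp add: col_def scale_left_diff_distrib sum_subtractf)

lemma lin_add: "lin c + lin c' = lin (\<lambda>s t. c s t + c' s t)"
  by (simp add: lin_def col_add sum.distrib[symmetric])

lemma lin_diff: "lin c - lin c' = lin (\<lambda>s t. c s t - c' s t)"
  by (simp add: lin_def col_diff sum_subtractf[symmetric])

lemma lin_unique: "lin c - lin c' \<in> K \<Longrightarrow> s \<in> I \<Longrightarrow> t \<in> T \<Longrightarrow> c s t = c' s t"
  using indep[of "\<lambda>s t. c s t - c' s t" s t] by (simp add: lin_diff) (simp add: lin_def col_def)

lemma C_eq_lin: "s \<in> I \<Longrightarrow> t \<in> T \<Longrightarrow> C s t = lin (\<lambda>s' t'. if s' = s \<and> t' = t then 1 else 0)"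
proof -
  assume st: "s \<in> I" "t \<in> T"
  have "col (\<lambda>s'. if s' = s \<and> t' = t then 1 else 0) t' = (if t' = t then C s t else 0)" for t'
  proof (cases "t' = t")
    case True
    have "col (\<lambda>s'. if s' = s \<and> t' = t then 1 else 0) t' = (\<Sum>s'\<in>I. if s' = s then C s t else 0)"
      unfolding col_def True by (rule sum.cong) auto
    thus ?thesis using st fin True by simp
  qed (simp add: col_def)
  thus ?thesis using st fin by (simp add: lin_def)
qed

lemma C_notin: "s \<in> I \<Longrightarrow> t \<in> T \<Longrightarrow> C s t \<notin> K"
proof
  assume st: "s \<in> I" "t \<in> T" and "C s t \<in> K"
  hence "lin (\<lambda>s' t'. if s' = s \<and> t' = t then 1 else 0) - lin (\<lambda>s t. 0) \<in> K"
    using C_eq_lin[OF st] by (simp add: lin_def col_def)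
  from lin_unique[OF this st] show False by simp
qed

lemma K_trans: "x - y \<in> K \<Longrightarrow> y - z \<in> K \<Longrightarrow> x - z \<in> K"
  using alg_idealD(5)[OF K, of "x - y" "y - z"] by simp

lemma K_sym: "x - y \<in> K \<Longrightarrow> y - x \<in> K"
  using subspace_neg[OF alg_idealD(1)[OF K], of "x - y"] by simp

lemma K_scale: "x - y \<in> K \<Longrightarrow> c *s x - c *s y \<in> K"
  using alg_idealD(7)[OF K, of "x - y" c] by (simp add: scale_right_diff_distrib)

lemma K_sum: "(\<And>i. i \<in> A \<Longrightarrow> f i - g i \<in> K) \<Longrightarrow> sum f A - sum g A \<in> K"
  using alg_idealD(9)[OF K, of A "\<lambda>i. f i - g i"] by (simp add: sum_subtractf)

lemma K_add: "x - y \<in> K \<Longrightarrow> x' - y' \<in> K \<Longrightarrow> (x + x') - (y + y') \<in> K"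
  using alg_idealD(5)[OF K, of "x - y" "x' - y'"] by (simp add: algebra_simps)

lemma K_mul_left: "a \<in> V \<Longrightarrow> x \<in> V \<Longrightarrow> y \<in> V \<Longrightarrow> x - y \<in> K \<Longrightarrow> a \<bullet> x - a \<bullet> y \<in> K"
  using alg_idealD(3)[OF K, of a "x - y"] by (simp add: mul_diff_right)

lemma K_mul_right: "a \<in> V \<Longrightarrow> x \<in> V \<Longrightarrow> y \<in> V \<Longrightarrow> x - y \<in> K \<Longrightarrow> x \<bullet> a - y \<bullet> a \<in> K"
  using alg_idealD(4)[OF K, of a "x - y"] by (simp add: mul_diff_left)

text \<open>One matrix \<open>R\<close> serves all columns: modulo \<open>K\<close> the columns are
  copies of one left module. This is what lets \<open>projective_J\<close> move coordinates from
  column \<open>t\<close> to column \<open>t0\<close>.\<close>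

lemma left_matrix:
  assumes a: "a \<in> V"
  shows "\<exists>R. \<forall>d. \<forall>t\<in>T. a \<bullet> col d t - col (\<lambda>s'. \<Sum>s\<in>I. d s * R s s') t \<in> K"
proof -
  obtain R where R: "\<And>s t. s \<in> I \<Longrightarrow> t \<in> T \<Longrightarrow> a \<bullet> C s t - (\<Sum>s'\<in>I. R s s' *s C s' t) \<in> K"
    using left[OF a] by metis
  have "a \<bullet> col d t - col (\<lambda>s'. \<Sum>s\<in>I. d s * R s s') t \<in> K" if t: "t \<in> T" for d t
  proof -
    have "a \<bullet> col d t = (\<Sum>s\<in>I. d s *s (a \<bullet> C s t))"
      unfolding col_def using C_V a t by (subst mul_sum_right) (auto simp: mul_scale_right)
    moreover have "col (\<lambda>s'. \<Sum>s\<in>I. d s * R s s') t = (\<Sum>s\<in>I. d s *s (\<Sum>s'\<in>I. R s s' *s C s' t))"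
      unfolding col_def scale_sum_left scale_sum_right scale_scale by (rule sum.swap)
    ultimately show ?thesis using R t by (auto intro!: K_sum K_scale)
  qed
  thus ?thesis by blast
qed

text \<open>By \<open>left\<close> the product is a combination of elements of column t', by
  \<open>right\<close> one of elements of row s. Independence leaves only C s t', with a coefficient
  that depends neither on s nor on t'.\<close>

lemma product_form:
  assumes x: "x \<in> V" and t: "t \<in> T" and s': "s' \<in> I"
  shows "\<exists>\<phi>. \<forall>s\<in>I. \<forall>t'\<in>T. C s t \<bullet> x \<bullet> C s' t' - \<phi> *s C s t' \<in> K"
proof -
  have "\<exists>\<rho>. \<forall>t'\<in>T. C s t \<bullet> x \<bullet> C s' t' - (\<Sum>s''\<in>I. \<rho> s'' *s C s'' t') \<in> K" if "s \<in> I" for s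
    using left[OF _ s', of "C s t \<bullet> x"] that C_V x t by auto
  then obtain L where L: "\<And>s t'. s \<in> I \<Longrightarrow> t' \<in> T \<Longrightarrow>
      C s t \<bullet> x \<bullet> C s' t' - col (L s) t' \<in> K" unfolding col_def by metis
  have "\<exists>\<rho>. \<forall>s\<in>I. C s t \<bullet> (x \<bullet> C s' t') - (\<Sum>t''\<in>T. \<rho> t'' *s C s t'') \<in> K" if "t' \<in> T" for t'
    using right[OF _ t, of "x \<bullet> C s' t'"] that C_V x s' by auto
  then obtain R where R: "\<And>s t'. s \<in> I \<Longrightarrow> t' \<in> T \<Longrightarrow>
      C s t \<bullet> (x \<bullet> C s' t') - (\<Sum>t''\<in>T. R t' t'' *s C s t'') \<in> K" by metis
  \<comment> \<open>The two expansions of the same product, written as coefficient matrices: one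
    lives in column t', the other in row s.\<close>
  have LR: "(if t2 = t' then L s s1 else 0) = (if s1 = s then R t' t2 else 0)"
    if st: "s \<in> I" "t' \<in> T" "s1 \<in> I" "t2 \<in> T" for s t' s1 t2
  proof -
    have "col (L s) t' - (\<Sum>t''\<in>T. R t' t'' *s C s t'') \<in> K"
      using K_trans[OF K_sym[OF L[OF st(1,2)]]] R[OF st(1,2)] mul_assoc[of "C s t" x "C s' t'"]
        C_V st x t s' by simp
    moreover have "col (L s) t' = lin (\<lambda>s1 t2. if t2 = t' then L s s1 else 0)"
    proof -
      have "col (\<lambda>s1. if t2 = t' then L s s1 else 0) t2 = (if t2 = t' then col (L s) t' else 0)" for t2
        by (simp add: col_def)
      thus ?thesis using st fin by (simp add: lin_def)
    qed
    moreover have "(\<Sum>t''\<in>T. R t' t'' *s C s t'') = lin (\<lambda>s1 t2. if s1 = s then R t' t2 else 0)"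
      unfolding lin_def
    proof (rule sum.cong[OF refl])
      fix t2
      have "col (\<lambda>s1. if s1 = s then R t' t2 else 0) t2 = (\<Sum>s1\<in>I. if s1 = s then R t' t2 *s C s t2 else 0)"
        unfolding col_def by (rule sum.cong) auto
      thus "R t' t2 *s C s t2 = col (\<lambda>s1. if s1 = s then R t' t2 else 0) t2" using st fin by simp
    qed
    ultimately have "lin (\<lambda>s1 t2. if t2 = t' then L s s1 else 0) - lin (\<lambda>s1 t2. if s1 = s then R t' t2 else 0) \<in> K"
      by simp
    from lin_unique[OF this st(3,4)] show ?thesis .
  qed
  obtain s0 t0 where st0: "s0 \<in> I" "t0 \<in> T" using pairing by blast
  have "C s t \<bullet> x \<bullet> C s' t' - L s0 s0 *s C s t' \<in> K" if st: "s \<in> I" "t' \<in> T" for s t'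
  proof -
    have 1: "L s s1 = 0" if "s1 \<in> I" "s1 \<noteq> s" for s1 using LR[OF st that(1) st(2)] that by simp
    \<comment> \<open>The left side does not involve t' and the right side does not involve s, so
      this is one constant \<phi>.\<close>
    have "L s s = R t' t'" using LR[OF st st] by simp
    also have "\<dots> = L s0 s0" using LR[OF st0(1) st(2) st0(1) st(2)] by simp
    finally have "L s s = L s0 s0" .
    moreover have "col (L s) t' = L s s *s C s t'"
    proof -
      have "col (L s) t' = (\<Sum>s1\<in>I. if s1 = s then L s s *s C s t' else 0)"
        unfolding col_def by (rule sum.cong) (auto simp: 1)
      thus ?thesis using st fin by simp
    qed
    ultimately show ?thesis using L[OF st] by simp
  qed
  thus ?thesis by blast
qed

text \<open>\<open>product_form\<close> with the middle factor \<open>e\<close>, at a pair of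
  indices where some product is nonzero: that one product forces \<phi> to be nonzero for all s and
  t.\<close>

lemma nondegenerate:
  "\<exists>s0\<in>I. \<exists>t0\<in>T. \<exists>\<phi>. \<phi> \<noteq> 0 \<and> (\<forall>s\<in>I. \<forall>t\<in>T. C s t0 \<bullet> C s0 t - \<phi> *s C s t \<in> K)"
proof -
  obtain s1 t0 s0 t1 where st: "s1 \<in> I" "t0 \<in> T" "s0 \<in> I" "t1 \<in> T" "C s1 t0 \<bullet> C s0 t1 \<notin> K"
    using pairing by blast
  obtain \<phi> where "\<forall>s\<in>I. \<forall>t\<in>T. C s t0 \<bullet> e \<bullet> C s0 t - \<phi> *s C s t \<in> K"
    using product_form[OF e_closed st(2,3)] by blast
  hence \<phi>: "\<forall>s\<in>I. \<forall>t\<in>T. C s t0 \<bullet> C s0 t - \<phi> *s C s t \<in> K" using C_V st by simp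
  moreover have "\<phi> \<noteq> 0" using bspec[OF bspec[OF \<phi> st(1)] st(4)] st(5) by auto
  ultimately show ?thesis using st by blast
qed

lemma K_neq: "K \<noteq> K'"
  using nondegenerate C_notin C_mem by blast

abbreviation "Q \<equiv> alg Quot K"
abbreviation "J \<equiv> coset K ` K'"

sublocale Q: ring Q by (rule ring_Quot[OF K])

lemma ideal_J: "ideal J Q"
proof -
  interpret ideal K' alg by (rule ideal_alg[OF K'])
  show ?thesis
    using alg.ring_ideal_imp_quot_ideal[OF ideal_alg[OF K] ideal_alg[OF K']] .
qed

lemma mem_J: "x \<in> K' \<Longrightarrow> coset K x \<in> J" by blast

lemma Q_closed: "x \<in> V \<Longrightarrow> coset K x \<in> carrier Q"
  by (simp add: Quot_simps[OF K])

text \<open>Modulo \<open>K\<close>, each C s t is the product of C s t0 / \<phi> and C s0 t, both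
  in the layer.\<close>

lemma J_idempotent: "J \<cdot>\<^bsub>Q\<^esub> J = J"
proof
  show "J \<cdot>\<^bsub>Q\<^esub> J \<subseteq> J" using Q.ideal_prod_inter[OF ideal_J ideal_J] by blast
  interpret JJ: ideal "J \<cdot>\<^bsub>Q\<^esub> J" Q by (rule Q.ideal_prod_is_ideal[OF ideal_J ideal_J])
  obtain s0 t0 \<phi> where 0: "s0 \<in> I" "t0 \<in> T" "\<phi> \<noteq> 0"
    "\<And>s t. s \<in> I \<Longrightarrow> t \<in> T \<Longrightarrow> C s t0 \<bullet> C s0 t - \<phi> *s C s t \<in> K" using nondegenerate by blast
  have gen: "coset K (c *s C s t) \<in> J \<cdot>\<^bsub>Q\<^esub> J" if st: "s \<in> I" "t \<in> T" for c s t
  proof -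
    have "coset K ((c / \<phi>) *s C s t0) \<otimes>\<^bsub>Q\<^esub> coset K (C s0 t) \<in> J \<cdot>\<^bsub>Q\<^esub> J"
      using st 0 C_mem alg_idealD(7)[OF K'] by (intro ideal_prod.prod mem_J) auto
    also have "coset K ((c / \<phi>) *s C s t0) \<otimes>\<^bsub>Q\<^esub> coset K (C s0 t) = coset K ((c / \<phi>) *s (C s t0 \<bullet> C s0 t))"
      using st 0 C_V by (simp add: Quot_simps[OF K] mul_scale_left)
    also have "\<dots> = coset K (c *s C s t)"
      using K_scale[OF 0(4)[OF st], of "c / \<phi>"] 0(3) by (simp add: coset_eq_iff[OF K])
    finally show ?thesis .
  qed
  have sums: "coset K (sum f A) \<in> J \<cdot>\<^bsub>Q\<^esub> J"
    if "\<And>i. i \<in> A \<Longrightarrow> f i \<in> V \<and> coset K (f i) \<in> J \<cdot>\<^bsub>Q\<^esub> J" "finite A" for f and A :: "'c set"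
    using that(2,1)
  proof (induction A rule: finite_induct)
    case empty
    thus ?case using JJ.zero_closed by (simp add: Quot_simps[OF K])
  next
    case (insert i A)
    have "coset K (f i) \<oplus>\<^bsub>Q\<^esub> coset K (sum f A) \<in> J \<cdot>\<^bsub>Q\<^esub> J" using insert by (intro JJ.a_closed) auto
    moreover have "f i \<in> V" "sum f A \<in> V" using insert by auto
    ultimately show ?case using insert(1,2) by (simp add: Quot_simps[OF K])
  qed
  show "J \<subseteq> J \<cdot>\<^bsub>Q\<^esub> J"
  proof
    fix z assume "z \<in> J"
    then obtain x where x: "x \<in> K'" "z = coset K x" by blast
    obtain c where c: "x - (\<Sum>t\<in>T. \<Sum>s\<in>I. c s t *s C s t) \<in> K" using spans[OF x(1)] by blast
    have "coset K (\<Sum>s\<in>I. c s t *s C s t) \<in> J \<cdot>\<^bsub>Q\<^esub> J" if "t \<in> T" for t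
      using gen fin C_V that by (intro sums) auto
    hence "coset K (\<Sum>t\<in>T. \<Sum>s\<in>I. c s t *s C s t) \<in> J \<cdot>\<^bsub>Q\<^esub> J"
      using fin C_V by (intro sums) auto
    moreover have "z = coset K (\<Sum>t\<in>T. \<Sum>s\<in>I. c s t *s C s t)"
      using c by (simp add: x(2) coset_eq_iff[OF K])
    ultimately show "z \<in> J \<cdot>\<^bsub>Q\<^esub> J" by simp
  qed
qed

text \<open>If the scalar \<psi> of C s t x C s' t' were nonzero, u = \<psi>^-1 C s' t x would be an
  idempotent modulo \<open>K\<close> in the radical, hence zero there. Then \<psi> C s' t, which is
  C s' t x C s' t modulo \<open>K\<close>, would lie in \<open>K\<close>.\<close>

lemma C_rad_C:
  assumes x: "x \<in> V" and rad: "coset K x \<in> jacobson_radical Q"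
    and st: "s \<in> I" "t \<in> T" "s' \<in> I" "t' \<in> T"
  shows "C s t \<bullet> x \<bullet> C s' t' \<in> K"
proof -
  obtain \<psi> where \<psi>: "\<And>s t'. s \<in> I \<Longrightarrow> t' \<in> T \<Longrightarrow> C s t \<bullet> x \<bullet> C s' t' - \<psi> *s C s t' \<in> K"
    using product_form[OF x st(2,3)] by blast
  have "\<psi> = 0"
  proof (rule ccontr)
    assume ne: "\<psi> \<noteq> 0"
    define a where "a = inverse \<psi> *s C s' t"
    define u where "u = a \<bullet> x"
    have V: "a \<in> V" "u \<in> V" "C s' t \<in> V" using x st C_V by (auto simp: a_def u_def)
    have "C s' t \<bullet> x \<bullet> C s' t - \<psi> *s C s' t \<in> K" using \<psi>[OF st(3,2)] .
    hence "inverse \<psi> *s inverse \<psi> *s (C s' t \<bullet> x \<bullet> C s' t) - inverse \<psi> *s inverse \<psi> *s \<psi> *s C s' t \<in> K"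
      by (intro K_scale)
    hence "a \<bullet> x \<bullet> a - a \<in> K" using V x ne
      by (simp add: a_def mul_scale_left mul_scale_right)
    hence "a \<bullet> x \<bullet> a \<bullet> x - a \<bullet> x \<in> K" using V x by (intro K_mul_right) auto
    hence "u \<bullet> u - u \<in> K" using V x by (simp add: u_def mul_assoc)
    hence "coset K u \<otimes>\<^bsub>Q\<^esub> coset K u = coset K u" using V by (simp add: Quot_simps[OF K] coset_eq_iff[OF K])
    moreover have "coset K u \<in> jacobson_radical Q"
      using Q.jacobson_radical_left[OF rad, of "coset K a"] V x by (simp add: Quot_simps[OF K] u_def)
    ultimately have "coset K u = \<zero>\<^bsub>Q\<^esub>" by (intro Q.idempotent_in_jacobson_radical)
    hence "u \<in> K" by (simp add: Quot_simps[OF K] coset_eq_iff[OF K])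
    hence "\<psi> *s (u \<bullet> C s' t) \<in> K" using V alg_idealD(4,7)[OF K] by blast
    hence "C s' t \<bullet> x \<bullet> C s' t \<in> K" using V x ne by (simp add: u_def a_def mul_scale_left)
    hence "C s' t \<bullet> x \<bullet> C s' t - (C s' t \<bullet> x \<bullet> C s' t - \<psi> *s C s' t) \<in> K"
      using \<psi>[OF st(3,2)] alg_idealD(6)[OF K] by blast
    hence "\<psi> *s C s' t \<in> K" by simp
    hence "inverse \<psi> *s \<psi> *s C s' t \<in> K" by (rule alg_idealD(7)[OF K])
    hence "C s' t \<in> K" using ne by simp
    thus False using C_notin st by blast
  qed
  thus ?thesis using \<psi>[OF st(1,4)] by simp
qed

lemma J_rad_J: "(J \<cdot>\<^bsub>Q\<^esub> jacobson_radical Q) \<cdot>\<^bsub>Q\<^esub> J = {\<zero>\<^bsub>Q\<^esub>}"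
proof -
  have key: "a \<bullet> x \<bullet> b \<in> K"
    if a: "a \<in> K'" and b: "b \<in> K'" and x: "x \<in> V" "coset K x \<in> jacobson_radical Q" for a b x
  proof -
    obtain c where c: "a - lin c \<in> K" using spans[OF a] by (auto simp: lin_def col_def)
    obtain d where d: "b - lin d \<in> K" using spans[OF b] by (auto simp: lin_def col_def)
    have V: "a \<in> V" "b \<in> V" using a b alg_idealD(2)[OF K'] by auto
    have right_lin: "y \<bullet> lin d = (\<Sum>t'\<in>T. \<Sum>s'\<in>I. d s' t' *s (y \<bullet> C s' t'))" if "y \<in> V" for y
    proof -
      have "y \<bullet> col (\<lambda>s. d s t') t' = (\<Sum>s'\<in>I. d s' t' *s (y \<bullet> C s' t'))" if "t' \<in> T" for t'
        unfolding col_def using \<open>y \<in> V\<close> that C_V by (subst mul_sum_right) (auto simp: mul_scale_right)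
      thus ?thesis unfolding lin_def using that col_V by (simp add: mul_sum_right)
    qed
    have left_lin: "lin c \<bullet> y = (\<Sum>t\<in>T. \<Sum>s\<in>I. c s t *s (C s t \<bullet> y))" if "y \<in> V" for y
    proof -
      have "col (\<lambda>s. c s t) t \<bullet> y = (\<Sum>s\<in>I. c s t *s (C s t \<bullet> y))" if "t \<in> T" for t
        unfolding col_def using \<open>y \<in> V\<close> that C_V by (subst mul_sum_left) (auto simp: mul_scale_left)
      thus ?thesis unfolding lin_def using that col_V by (simp add: mul_sum_left)
    qed
    have "C s t \<bullet> x \<bullet> lin d \<in> K" if "s \<in> I" "t \<in> T" for s t
      unfolding right_lin[OF mul_closed[OF C_V[OF that] x(1)]]
      using C_rad_C[OF x that] by (intro alg_idealD(7,9)[OF K])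
    hence "C s t \<bullet> (x \<bullet> lin d) \<in> K" if "s \<in> I" "t \<in> T" for s t
      using mul_assoc C_V x lin_V that by simp
    hence "lin c \<bullet> (x \<bullet> lin d) \<in> K"
      unfolding left_lin[OF mul_closed[OF x(1) lin_V]] by (intro alg_idealD(7,9)[OF K])
    hence "lin c \<bullet> x \<bullet> lin d \<in> K" using mul_assoc[OF lin_V x(1) lin_V] by simp
    moreover have "a \<bullet> x \<bullet> b - lin c \<bullet> x \<bullet> b \<in> K"
      using c V x lin_V by (intro K_mul_right) auto
    moreover have "lin c \<bullet> x \<bullet> b - lin c \<bullet> x \<bullet> lin d \<in> K"
      using d V x lin_V by (intro K_mul_left) auto
    ultimately show ?thesis using alg_idealD(5)[OF K] by (metis K_trans diff_add_cancel)
  qed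
  have JR: "\<forall>b\<in>J. z \<otimes>\<^bsub>Q\<^esub> b = \<zero>\<^bsub>Q\<^esub> \<and> z \<in> carrier Q" if "z \<in> J \<cdot>\<^bsub>Q\<^esub> jacobson_radical Q" for z
    using that
  proof induction
    case (prod i j)
    obtain a where a: "a \<in> K'" "i = coset K a" using prod by blast
    obtain x where x: "x \<in> V" "j = coset K x"
      using prod by (auto simp: jacobson_radical_def Quot_simps[OF K])
    show ?case
    proof
      fix b' assume "b' \<in> J"
      then obtain b where b: "b \<in> K'" "b' = coset K b" by blast
      have V: "a \<in> V" "b \<in> V" using a b alg_idealD(2)[OF K'] by auto
      show "i \<otimes>\<^bsub>Q\<^esub> j \<otimes>\<^bsub>Q\<^esub> b' = \<zero>\<^bsub>Q\<^esub> \<and> i \<otimes>\<^bsub>Q\<^esub> j \<in> carrier Q"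
        using key[OF a(1) b(1) x(1)] prod(2) V x a(2) b(2) Q_closed[of "a \<bullet> x"]
        by (simp add: Quot_simps[OF K] coset_eq_iff[OF K])
    qed
  next
    case (sum s1 s2)
    have "b \<in> carrier Q" if "b \<in> J" for b using that alg_idealD(2)[OF K'] by (auto simp: Quot_simps[OF K])
    thus ?case using sum.IH by (simp add: Q.l_distr)
  qed
  have "z = \<zero>\<^bsub>Q\<^esub>" if "z \<in> (J \<cdot>\<^bsub>Q\<^esub> jacobson_radical Q) \<cdot>\<^bsub>Q\<^esub> J" for z
    using that by induction (use JR in auto)
  moreover have "\<zero>\<^bsub>Q\<^esub> \<in> (J \<cdot>\<^bsub>Q\<^esub> jacobson_radical Q) \<cdot>\<^bsub>Q\<^esub> J"
  proof -
    have z: "\<zero>\<^bsub>Q\<^esub> \<in> J" using alg_idealD(8)[OF K'] by (simp add: Quot_simps[OF K])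
    have "\<zero>\<^bsub>Q\<^esub> \<in> jacobson_radical Q"
      using Q.left_idealD(2) by (auto simp: jacobson_radical_def maximal_left_ideal_def)
    hence "\<zero>\<^bsub>Q\<^esub> \<otimes>\<^bsub>Q\<^esub> \<zero>\<^bsub>Q\<^esub> \<otimes>\<^bsub>Q\<^esub> \<zero>\<^bsub>Q\<^esub> \<in> (J \<cdot>\<^bsub>Q\<^esub> jacobson_radical Q) \<cdot>\<^bsub>Q\<^esub> J"
      using z by (intro ideal_prod.prod) auto
    thus ?thesis by simp
  qed
  ultimately show ?thesis by blast
qed

text \<open>The layer is a direct sum of columns, and each column is a summand of the regular
  module: send C s t to C s t0 / \<phi>, and return by right multiplication with C s0 t. So
  \<open>J\<close> is a summand of a free module with one generator per element of
  \<open>T\<close>.\<close>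

lemma projective_J: "projective_left_module Q (left_ideal_module Q J)"
proof -
  obtain s0 t0 \<phi> where 0: "s0 \<in> I" "t0 \<in> T" "\<phi> \<noteq> 0"
    "\<And>s t. s \<in> I \<Longrightarrow> t \<in> T \<Longrightarrow> C s t0 \<bullet> C s0 t - \<phi> *s C s t \<in> K" using nondegenerate by blast
  define crd where "crd x = (SOME c. x - lin c \<in> K)" for x
  define rep where "rep Z = (SOME z. z \<in> V \<and> coset K z = Z)" for Z
  \<comment> \<open>The definition of projectivity takes the index set from the type of the module,
    here the type of cosets, so t is encoded by the coset of C s0 t; independence makes this
    injective.\<close>
  define ix where "ix t = coset K (C s0 t)" for t
  define f where "f Z i = (if i \<in> ix ` T then coset K (col (\<lambda>s. crd (rep Z) s (inv_into T ix i) / \<phi>) t0) else \<zero>\<^bsub>Q\<^esub>)"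
    for Z i
  define g where "g h = coset K (\<Sum>t\<in>T. rep (h (ix t)) \<bullet> C s0 t)" for h :: "'b set \<Rightarrow> 'b set"
  let ?P = "left_ideal_module Q J" and ?F = "free_left_module Q (ix ` T)"
  note Qs = Quot_simps[OF K] coset_eq_iff[OF K]
  have crd: "x - lin (crd x) \<in> K" if "x \<in> K'" for x
    using spans[OF that] someI_ex[of "\<lambda>c. x - lin c \<in> K"] by (simp add: crd_def lin_def col_def)
  have crd_eq: "crd x s t = c s t" if "x - lin c \<in> K" "x \<in> K'" "s \<in> I" "t \<in> T" for x c s t
    using lin_unique[OF K_trans[OF K_sym[OF crd[OF that(2)]] that(1)]] that by simp
  have rep: "rep Z \<in> V" "coset K (rep Z) = Z" if "Z \<in> carrier Q" for Z
    using someI_ex[of "\<lambda>z. z \<in> V \<and> coset K z = Z"] that by (auto simp: rep_def Qs)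
  have rep_coset: "rep (coset K z) - z \<in> K" if "z \<in> V" for z
    using rep[of "coset K z"] that Q_closed[OF that] by (simp add: Quot_simps(2-)[OF K] coset_eq_iff[OF K])
  have inj: "inj_on ix T"
  proof (rule inj_onI)
    fix t t' assume t: "t \<in> T" "t' \<in> T" "ix t = ix t'"
    hence "C s0 t - C s0 t' \<in> K" using C_V 0 by (simp add: ix_def Qs)
    hence "lin (\<lambda>s'' t''. if s'' = s0 \<and> t'' = t then 1 else 0) - lin (\<lambda>s'' t''. if s'' = s0 \<and> t'' = t' then 1 else 0) \<in> K"
      using C_eq_lin 0 t by simp
    from lin_unique[OF this 0(1) t(1)] show "t = t'" by (auto split: if_splits)
  qed
  have inv: "inv_into T ix (ix t) = t" if "t \<in> T" for t using inj that by simp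
  have rep_J: "rep Z \<in> K'" if Z: "Z \<in> J" for Z
  proof -
    obtain x where x: "x \<in> K'" "Z = coset K x" using Z by blast
    have "rep Z - x \<in> K" using rep_coset x alg_idealD(2)[OF K'] by simp
    hence "(rep Z - x) + x \<in> K'" using x K_sub alg_idealD(5)[OF K'] by blast
    thus ?thesis by simp
  qed
  have JQ: "J \<subseteq> carrier Q" using alg_idealD(2)[OF K'] by (auto simp: Qs)
  have f_lin: "f (coset K z) (ix t) = coset K (col (\<lambda>s. c s t / \<phi>) t0)"
    if z: "z \<in> K'" "z - lin c \<in> K" and t: "t \<in> T" for z c t
  proof -
    have zV: "z \<in> V" using z alg_idealD(2)[OF K'] by blast
    have "rep (coset K z) - lin c \<in> K" using K_trans[OF rep_coset[OF zV] z(2)] .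
    hence "crd (rep (coset K z)) s t = c s t" if "s \<in> I" for s
      using crd_eq rep_J mem_J z(1) t that by blast
    hence "col (\<lambda>s. crd (rep (coset K z)) s t / \<phi>) t0 = col (\<lambda>s. c s t / \<phi>) t0" by (simp add: col_def)
    thus ?thesis using t inv by (simp add: f_def)
  qed
  have fF: "f \<in> left_module_hom Q ?P ?F"
    unfolding left_module_hom_def
  proof (intro CollectI conjI ballI)
    show "f \<in> carrier ?P \<rightarrow> carrier ?F"
    proof
      fix Z assume "Z \<in> carrier ?P"
      have "{i. f Z i \<noteq> \<zero>\<^bsub>Q\<^esub>} \<subseteq> ix ` T" by (auto simp: f_def)
      hence "finite {i. f Z i \<noteq> \<zero>\<^bsub>Q\<^esub>}" using fin finite_subset by blast
      thus "f Z \<in> carrier ?F" using col_V[OF 0(2)] by (auto simp: free_left_module_def f_def Qs)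
    qed
    fix Z Y assume ZY: "Z \<in> carrier ?P" "Y \<in> carrier ?P"
    obtain z y where z: "z \<in> K'" "Z = coset K z" and y: "y \<in> K'" "Y = coset K y"
      using ZY by (auto simp: left_ideal_module_def)
    have V: "z \<in> V" "y \<in> V" "z + y \<in> K'" using z y alg_idealD(2,5)[OF K'] by auto
    have "f (coset K (z + y)) i = f (coset K z) i \<oplus>\<^bsub>Q\<^esub> f (coset K y) i" for i
    proof (cases "i \<in> ix ` T")
      case True
      then obtain t where t: "t \<in> T" "i = ix t" by blast
      have "z + y - lin (\<lambda>s t. crd z s t + crd y s t) \<in> K"
        using K_add[OF crd[OF z(1)] crd[OF y(1)]] by (simp add: lin_add)
      thus ?thesis unfolding t(2) using f_lin[OF V(3) _ t(1)] f_lin[OF z(1) crd t(1)] f_lin[OF y(1) crd t(1)]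
          z y col_V[OF 0(2)] by (simp add: Qs col_add add_divide_distrib)
    next
      case False
      thus ?thesis by (simp add: f_def)
    qed
    thus "f (Z \<oplus>\<^bsub>?P\<^esub> Y) = f Z \<oplus>\<^bsub>?F\<^esub> f Y"
      using z y V by (simp add: left_ideal_module_def free_left_module_def Qs fun_eq_iff)
  next
    fix A Z assume AZ: "A \<in> carrier Q" "Z \<in> carrier ?P"
    obtain a z where a: "a \<in> V" "A = coset K a" and z: "z \<in> K'" "Z = coset K z"
      using AZ by (auto simp: left_ideal_module_def Qs)
    have V: "z \<in> V" "a \<bullet> z \<in> K'" using z a alg_idealD(2,3)[OF K'] by auto
    obtain R where R: "\<And>d t. t \<in> T \<Longrightarrow> a \<bullet> col d t - col (\<lambda>s'. \<Sum>s\<in>I. d s * R s s') t \<in> K"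
      using left_matrix[OF a(1)] by blast
    have az: "a \<bullet> z - lin (\<lambda>s' t. \<Sum>s\<in>I. crd z s t * R s s') \<in> K"
    proof (rule K_trans)
      show "a \<bullet> z - a \<bullet> lin (crd z) \<in> K" using a V lin_V crd[OF z(1)] by (intro K_mul_left) auto
      have "a \<bullet> lin (crd z) = (\<Sum>t\<in>T. a \<bullet> col (\<lambda>s. crd z s t) t)"
        unfolding lin_def using a col_V by (intro mul_sum_right)
      thus "a \<bullet> lin (crd z) - lin (\<lambda>s' t. \<Sum>s\<in>I. crd z s t * R s s') \<in> K"
        using R by (simp add: K_sum lin_def)
    qed
    have "f (coset K (a \<bullet> z)) i = coset K a \<otimes>\<^bsub>Q\<^esub> f (coset K z) i" for i
    proof (cases "i \<in> ix ` T")
      case True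
      then obtain t where t: "t \<in> T" "i = ix t" by blast
      have "a \<bullet> col (\<lambda>s. crd z s t / \<phi>) t0 - col (\<lambda>s'. (\<Sum>s\<in>I. crd z s t * R s s') / \<phi>) t0 \<in> K"
        using R[OF 0(2), of "\<lambda>s. crd z s t / \<phi>"] by (simp add: sum_divide_distrib)
      thus ?thesis unfolding t(2) using f_lin[OF V(2) az t(1)] f_lin[OF z(1) crd t(1)]
          z a col_V[OF 0(2)] K_sym by (simp add: Qs)
    next
      case False
      thus ?thesis using a by (simp add: f_def Qs)
    qed
    thus "f (A \<odot>\<^bsub>?P\<^esub> Z) = A \<odot>\<^bsub>?F\<^esub> f Z"
      using z a V by (simp add: left_ideal_module_def free_left_module_def Qs fun_eq_iff)
  qed
  have repF: "rep (h (ix t)) \<in> V" "coset K (rep (h (ix t))) = h (ix t)" "h (ix t) \<in> carrier Q"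
    if "h \<in> carrier ?F" "t \<in> T" for h t
    using rep[of "h (ix t)"] that by (auto simp: free_left_module_def)
  have sumV: "(\<Sum>t\<in>T. w t \<bullet> C s0 t) \<in> V" "(\<Sum>t\<in>T. w t \<bullet> C s0 t) \<in> K'"
    if "\<And>t. t \<in> T \<Longrightarrow> w t \<in> V" for w
    using that C_V C_mem 0 by (auto intro!: alg_idealD(3,9)[OF K'])
  have gF: "g \<in> left_module_hom Q ?F ?P"
    unfolding left_module_hom_def
  proof (intro CollectI conjI ballI)
    show "g \<in> carrier ?F \<rightarrow> carrier ?P"
      using sumV(2) repF(1) by (auto simp: left_ideal_module_def g_def)
    fix h h' assume h: "h \<in> carrier ?F" "h' \<in> carrier ?F"
    have "(\<Sum>t\<in>T. rep (h (ix t) \<oplus>\<^bsub>Q\<^esub> h' (ix t)) \<bullet> C s0 t) -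
          (\<Sum>t\<in>T. (rep (h (ix t)) + rep (h' (ix t))) \<bullet> C s0 t) \<in> K"
    proof (rule K_sum)
      fix t assume t: "t \<in> T"
      have "rep (h (ix t) \<oplus>\<^bsub>Q\<^esub> h' (ix t)) - (rep (h (ix t)) + rep (h' (ix t))) \<in> K"
        using rep_coset[of "rep (h (ix t)) + rep (h' (ix t))"] repF[OF h(1) t] repF[OF h(2) t]
        by (simp add: Qs(4)[symmetric])
      thus "rep (h (ix t) \<oplus>\<^bsub>Q\<^esub> h' (ix t)) \<bullet> C s0 t - (rep (h (ix t)) + rep (h' (ix t))) \<bullet> C s0 t \<in> K"
        using repF[OF h(1) t] repF[OF h(2) t] C_V 0 t rep(1)
        by (intro K_mul_right) auto
    qed
    hence "coset K (\<Sum>t\<in>T. rep (h (ix t) \<oplus>\<^bsub>Q\<^esub> h' (ix t)) \<bullet> C s0 t) =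
          coset K ((\<Sum>t\<in>T. rep (h (ix t)) \<bullet> C s0 t) + (\<Sum>t\<in>T. rep (h' (ix t)) \<bullet> C s0 t))"
      using repF(1)[OF h(1)] repF(1)[OF h(2)] C_V[OF 0(1)]
      by (simp add: Qs mul_add_left sum.distrib)
    thus "g (h \<oplus>\<^bsub>?F\<^esub> h') = g h \<oplus>\<^bsub>?P\<^esub> g h'"
      using sumV(1)[OF repF(1)[OF h(1)]] sumV(1)[OF repF(1)[OF h(2)]]
      by (simp add: g_def free_left_module_def left_ideal_module_def Qs)
  next
    fix A h assume A: "A \<in> carrier Q" and h: "h \<in> carrier ?F"
    obtain a where a: "a \<in> V" "A = coset K a" using A by (auto simp: Qs)
    have "(\<Sum>t\<in>T. rep (coset K a \<otimes>\<^bsub>Q\<^esub> h (ix t)) \<bullet> C s0 t) -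
          (\<Sum>t\<in>T. (a \<bullet> rep (h (ix t))) \<bullet> C s0 t) \<in> K"
    proof (rule K_sum)
      fix t assume t: "t \<in> T"
      have "rep (coset K a \<otimes>\<^bsub>Q\<^esub> h (ix t)) - (a \<bullet> rep (h (ix t))) \<in> K"
        using rep_coset[of "a \<bullet> rep (h (ix t))"] repF[OF h t] a by (simp add: Qs(5)[symmetric])
      thus "rep (coset K a \<otimes>\<^bsub>Q\<^esub> h (ix t)) \<bullet> C s0 t - (a \<bullet> rep (h (ix t))) \<bullet> C s0 t \<in> K"
        using repF[OF h t] C_V 0 t rep(1) a A by (intro K_mul_right) auto
    qed
    hence "coset K (\<Sum>t\<in>T. rep (coset K a \<otimes>\<^bsub>Q\<^esub> h (ix t)) \<bullet> C s0 t) =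
          coset K (a \<bullet> (\<Sum>t\<in>T. rep (h (ix t)) \<bullet> C s0 t))"
      using repF(1)[OF h] C_V[OF 0(1)] a by (simp add: Qs mul_sum_right mul_assoc)
    thus "g (A \<odot>\<^bsub>?F\<^esub> h) = A \<odot>\<^bsub>?P\<^esub> g h"
      using sumV(1)[OF repF(1)[OF h]] a
      by (simp add: g_def free_left_module_def left_ideal_module_def Qs)
  qed
  have "g (f Z) = Z" if Z: "Z \<in> carrier ?P" for Z
  proof -
    obtain z where z: "z \<in> K'" "Z = coset K z" using Z by (auto simp: left_ideal_module_def)
    have fZ: "f Z (ix t) = coset K (col (\<lambda>s. crd z s t / \<phi>) t0)" if "t \<in> T" for t
      using f_lin[OF z(1) crd[OF z(1)] that] z by simp
    have "(\<Sum>t\<in>T. rep (f Z (ix t)) \<bullet> C s0 t) - lin (crd z) \<in> K"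
      unfolding lin_def
    proof (rule K_sum)
      fix t assume t: "t \<in> T"
      let ?c = "col (\<lambda>s. crd z s t / \<phi>) t0"
      have cV: "?c \<in> V" using col_V 0 by blast
      have "rep (f Z (ix t)) \<bullet> C s0 t - ?c \<bullet> C s0 t \<in> K"
        using rep_coset[OF cV] rep(1)[of "coset K ?c"] cV C_V 0 t unfolding fZ[OF t]
        by (intro K_mul_right) (auto simp: Qs)
      moreover have "?c \<bullet> C s0 t - col (\<lambda>s. crd z s t) t \<in> K"
      proof -
        have "?c \<bullet> C s0 t = (\<Sum>s\<in>I. (crd z s t / \<phi>) *s (C s t0 \<bullet> C s0 t))"
          unfolding col_def using C_V 0 t by (subst mul_sum_left) (auto simp: mul_scale_left)
        moreover have "col (\<lambda>s. crd z s t) t = (\<Sum>s\<in>I. (crd z s t / \<phi>) *s \<phi> *s C s t)"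
          unfolding col_def using 0(3) by simp
        ultimately show ?thesis using 0(4)[OF _ t] by (simp only:) (intro K_sum K_scale)
      qed
      ultimately show "rep (f Z (ix t)) \<bullet> C s0 t - col (\<lambda>s. crd z s t) t \<in> K" by (rule K_trans)
    qed
    hence "(\<Sum>t\<in>T. rep (f Z (ix t)) \<bullet> C s0 t) - z \<in> K" using K_trans[OF _ K_sym[OF crd[OF z(1)]]] by blast
    thus ?thesis using z by (simp add: g_def Qs)
  qed
  thus ?thesis unfolding projective_left_module_def using fF gF by blast
qed

lemma heredity_J: "heredity_ideal Q J"
  unfolding heredity_ideal_def using ideal_J J_idempotent J_rad_J projective_J by blast

end

text \<open>The pairing condition is kept apart, in \<open>cell_basis\<close>: its verification uses
  that the \<open>J q\<close> are ideals, and this follows from the present assumptions.\<close>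

locale pre_cell_basis = vs_algebra +
  fixes m :: nat and I :: "nat \<Rightarrow> 's set" and T :: "nat \<Rightarrow> 't set" and C :: "nat \<Rightarrow> 's \<Rightarrow> 't \<Rightarrow> 'b"
    and J :: "nat \<Rightarrow> 'b set"
  defines "J \<equiv> \<lambda>q. span {C q' s t | q' s t. q' < q \<and> s \<in> I q' \<and> t \<in> T q'}"
  assumes fin: "q < m \<Longrightarrow> finite (I q)" "q < m \<Longrightarrow> finite (T q)"
    and C_V: "q < m \<Longrightarrow> s \<in> I q \<Longrightarrow> t \<in> T q \<Longrightarrow> C q s t \<in> V"
    and V_J: "V \<subseteq> J m"
    and left: "q < m \<Longrightarrow> a \<in> V \<Longrightarrow> s \<in> I q \<Longrightarrow>
      \<exists>\<rho>. \<forall>t\<in>T q. a \<bullet> C q s t - (\<Sum>s'\<in>I q. \<rho> s' *s C q s' t) \<in> J q"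
    and right: "q < m \<Longrightarrow> a \<in> V \<Longrightarrow> t \<in> T q \<Longrightarrow>
      \<exists>\<rho>. \<forall>s\<in>I q. C q s t \<bullet> a - (\<Sum>t'\<in>T q. \<rho> t' *s C q s t') \<in> J q"
    and indep: "q < m \<Longrightarrow> (\<Sum>t\<in>T q. \<Sum>s\<in>I q. c s t *s C q s t) \<in> J q \<Longrightarrow>
      s \<in> I q \<Longrightarrow> t \<in> T q \<Longrightarrow> c s t = 0"
begin

lemma J_eq: "J q = span {C q' s t | q' s t. q' < q \<and> s \<in> I q' \<and> t \<in> T q'}"
  by (simp add: J_def)

lemma J_mono: "q \<le> q' \<Longrightarrow> J q \<subseteq> J q'"
  unfolding J_eq by (intro span_mono Collect_mono) (blast intro: less_le_trans)

lemma J_C: "q' < q \<Longrightarrow> s \<in> I q' \<Longrightarrow> t \<in> T q' \<Longrightarrow> C q' s t \<in> J q"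
  unfolding J_eq by (intro span_base) auto

lemma J_V: "q \<le> m \<Longrightarrow> J q \<subseteq> V"
  unfolding J_eq by (rule span_minimal[OF _ V]) (use C_V in auto)

lemma subspace_J: "subspace (J q)"
  unfolding J_eq by (rule subspace_span)

lemma alg_ideal_J:
  assumes q: "q \<le> m" shows "alg_ideal (J q)"
  unfolding alg_ideal_def
proof (intro conjI ballI)
  note J = subspace_add[OF subspace_J] subspace_scale[OF subspace_J] subspace_sum[OF subspace_J]
    subspace_0[OF subspace_J]
  fix a x assume a: "a \<in> V" and x: "x \<in> J q"
  have "x \<in> V \<and> a \<bullet> x \<in> J q \<and> x \<bullet> a \<in> J q"
    using x unfolding J_eq[of q]
  proof (induction rule: span_induct_alt)
    case base
    show ?case using a by (simp add: span_zero)
  next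
    case (step c y z)
    then obtain q' s t where y: "q' < q" "s \<in> I q'" "t \<in> T q'" "y = C q' s t" by blast
    have q': "q' < m" using y q by simp
    obtain \<rho> where \<rho>: "a \<bullet> y - (\<Sum>s'\<in>I q'. \<rho> s' *s C q' s' t) \<in> J q'"
      using left[OF q' a y(2)] y by blast
    have "(a \<bullet> y - (\<Sum>s'\<in>I q'. \<rho> s' *s C q' s' t)) + (\<Sum>s'\<in>I q'. \<rho> s' *s C q' s' t) \<in> J q"
      using \<rho> J_mono[of q' q] J_C y by (intro J) auto
    hence 1: "a \<bullet> y \<in> J q" by simp
    obtain \<rho> where \<rho>: "y \<bullet> a - (\<Sum>t'\<in>T q'. \<rho> t' *s C q' s t') \<in> J q'"
      using right[OF q' a y(3)] y by blast
    have "(y \<bullet> a - (\<Sum>t'\<in>T q'. \<rho> t' *s C q' s t')) + (\<Sum>t'\<in>T q'. \<rho> t' *s C q' s t') \<in> J q"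
      using \<rho> J_mono[of q' q] J_C y by (intro J) auto
    hence 2: "y \<bullet> a \<in> J q" by simp
    have "y \<in> V" using C_V[OF q'] y by simp
    thus ?case using 1 2 step(2) a J
      by (auto simp: J_eq[symmetric] mul_add_left mul_add_right mul_scale_left mul_scale_right)
  qed
  thus "a \<bullet> x \<in> J q" "x \<bullet> a \<in> J q" by auto
qed (use subspace_J J_V[OF q] in auto)

lemma spans:
  assumes q: "q < m" and x: "x \<in> J (Suc q)"
  shows "\<exists>c. x - (\<Sum>t\<in>T q. \<Sum>s\<in>I q. c s t *s C q s t) \<in> J q"
proof -
  let ?l = "\<lambda>c. \<Sum>t\<in>T q. \<Sum>s\<in>I q. c s t *s C q s t"
  show ?thesis
    using x unfolding J_eq[of "Suc q"]
  proof (induction rule: span_induct_alt)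
    case base
    have "0 - ?l (\<lambda>s t. 0) \<in> J q" using subspace_0[OF subspace_J] by simp
    thus ?case by (intro exI[of _ "\<lambda>s t. 0"])
  next
    case (step c y z)
    obtain d where d: "z - ?l d \<in> J q" using step(2) by blast
    obtain q' s0 t0 where y: "q' < Suc q" "s0 \<in> I q'" "t0 \<in> T q'" "y = C q' s0 t0" using step(1) by blast
    show ?case
    proof (cases "q' = q")
      case False
      hence "y \<in> J q" using J_C y by simp
      hence "c *s y + (z - ?l d) \<in> J q" using d subspace_add[OF subspace_J] subspace_scale[OF subspace_J] by blast
      thus ?thesis by (auto simp: algebra_simps)
    next
      case True
      let ?\<delta> = "\<lambda>s t. if s = s0 \<and> t = t0 then c else 0"
      have "(\<Sum>s\<in>I q. ?\<delta> s t *s C q s t) = (if t = t0 then c *s y else 0)" for t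
      proof (cases "t = t0")
        case t: True
        have "(\<Sum>s\<in>I q. ?\<delta> s t *s C q s t) = (\<Sum>s\<in>I q. if s = s0 then c *s y else 0)"
          by (rule sum.cong) (auto simp: t y True)
        thus ?thesis using fin(1)[OF q] y True t by simp
      qed simp
      hence "?l ?\<delta> = c *s y" using fin(2)[OF q] y True by simp
      moreover have "?l (\<lambda>s t. ?\<delta> s t + d s t) = ?l ?\<delta> + ?l d"
        by (simp add: scale_left_distrib sum.distrib)
      ultimately have "(c *s y + z) - ?l (\<lambda>s t. ?\<delta> s t + d s t) = z - ?l d" by simp
      hence "(c *s y + z) - ?l (\<lambda>s t. ?\<delta> s t + d s t) \<in> J q" using d by (simp only:)
      thus ?thesis by (intro exI[of _ "\<lambda>s t. ?\<delta> s t + d s t"])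
    qed
  qed
qed

end

locale cell_basis = pre_cell_basis +
  assumes pairing: "q < m \<Longrightarrow> \<exists>s\<in>I q. \<exists>t\<in>T q. \<exists>s'\<in>I q. \<exists>t'\<in>T q. C q s t \<bullet> C q s' t' \<notin> J q"
begin

lemma cell_layer: "q < m \<Longrightarrow> cell_layer scale V (\<bullet>) e (J q) (J (Suc q)) (I q) (T q) (C q)"
proof unfold_locales
  assume q: "q < m"
  show "alg_ideal (J q)" "alg_ideal (J (Suc q))" using q by (auto intro: alg_ideal_J)
  show "J q \<subseteq> J (Suc q)" by (rule J_mono) simp
  show "C q s t \<in> J (Suc q)" if "s \<in> I q" "t \<in> T q" for s t using that by (auto intro: J_C)
  show "finite (I q)" "finite (T q)" using fin[OF q] .
  show "\<exists>c. x - (\<Sum>t\<in>T q. \<Sum>s\<in>I q. c s t *s C q s t) \<in> J q" if "x \<in> J (Suc q)" for x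
    using spans[OF q that] .
  show "\<exists>\<rho>. \<forall>t\<in>T q. a \<bullet> C q s t - (\<Sum>s'\<in>I q. \<rho> s' *s C q s' t) \<in> J q"
    if "a \<in> V" "s \<in> I q" for a s using left[OF q that] .
  show "\<exists>\<rho>. \<forall>s\<in>I q. C q s t \<bullet> a - (\<Sum>t'\<in>T q. \<rho> t' *s C q s t') \<in> J q"
    if "a \<in> V" "t \<in> T q" for a t using right[OF q that] .
  show "c s t = 0" if "(\<Sum>t\<in>T q. \<Sum>s\<in>I q. c s t *s C q s t) \<in> J q" "s \<in> I q" "t \<in> T q" for c s t
    using indep[OF q that] .
  show "\<exists>s\<in>I q. \<exists>t\<in>T q. \<exists>s'\<in>I q. \<exists>t'\<in>T q. C q s t \<bullet> C q s' t' \<notin> J q"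
    using pairing[OF q] .
qed

theorem quasi_hereditary_alg: "quasi_hereditary alg"
  unfolding quasi_hereditary_def
proof (intro conjI exI[of _ m] exI[of _ J] allI impI)
  show "fin_dim_algebra alg" by (rule fin_dim_alg)
  show "J 0 = {\<zero>\<^bsub>alg\<^esub>}" by (simp add: J_eq)
  show "J m = carrier alg" using V_J J_V by auto
  show "ideal (J i) alg" if "i \<le> m" for i using ideal_alg[OF alg_ideal_J[OF that]] .
  fix i assume i: "i < m"
  interpret cell_layer scale V "(\<bullet>)" e "J i" "J (Suc i)" "I i" "T i" "C i" using cell_layer[OF i] .
  show "J i \<subset> J (Suc i)" using K_sub K_neq by blast
  show "heredity_ideal (alg Quot J i) ((+>\<^bsub>alg\<^esub>) (J i) ` J (Suc i))" by (rule heredity_J)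
qed

end

section \<open>Codeterminants\<close>

definition fscale :: "'k::field \<Rightarrow> ('d \<Rightarrow> 'k) \<Rightarrow> 'd \<Rightarrow> 'k" where
  "fscale c f = (\<lambda>x. c * f x)"

lemma fscale_apply [simp]: "fscale c f x = c * f x"
  by (simp add: fscale_def)

interpretation fs: vector_space fscale
  by unfold_locales (auto simp: fun_eq_iff algebra_simps)

lemma sum_fun_apply: "(sum f A) x = (\<Sum>i\<in>A. f i x)" for f :: "'i \<Rightarrow> 'd \<Rightarrow> 'k::comm_monoid_add"
  by (induction A rule: infinite_finite_induct) auto

definition content :: "('p \<Rightarrow> nat) \<Rightarrow> ('p \<Rightarrow> 'a) \<Rightarrow> 'p set \<Rightarrow> nat \<Rightarrow> 'a multiset" where
  "content f u Z j = image_mset u (mset_set {x\<in>Z. f x = j})"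

text \<open>Taking extensional maps makes the set finite for finite \<open>Z\<close>, so that its
  cardinality counts assignments of points to rows.\<close>

definition row_maps :: "(nat \<Rightarrow> 'a multiset) \<Rightarrow> ('p \<Rightarrow> 'a) \<Rightarrow> 'p set \<Rightarrow> ('p \<Rightarrow> nat) set" where
  "row_maps S u Z = {f \<in> Z \<rightarrow>\<^sub>E UNIV. content f u Z = S}"

type_synonym ('p, 'a, 'b) labelled = "'p set \<times> ('p \<Rightarrow> 'a) \<times> ('p \<Rightarrow> 'b)"

text \<open>A function on all labelled sets at once, since the arguments below compare different
  supports. The analogue for Schur algebras is Green's codeterminant. The value at infinite
  \<open>Z\<close> only makes the function total.\<close>

definition codet ::
  "(nat \<Rightarrow> 'a multiset) \<Rightarrow> (nat \<Rightarrow> 'b multiset) \<Rightarrow> ('p, 'a, 'b) labelled \<Rightarrow> 'k::field" where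
  "codet S T = (\<lambda>(Z, u, w). if finite Z then of_nat (card (row_maps S u Z \<inter> row_maps T w Z)) else 0)"

definition shape :: "(nat \<Rightarrow> 'a multiset) \<Rightarrow> nat \<Rightarrow> nat" where "shape S j = size (S j)"

lemma size_content: "size (content f u Z j) = card {x\<in>Z. f x = j}"
  by (simp add: content_def)

lemma content_cong: "(\<And>x. x \<in> Z \<Longrightarrow> f x = f' x) \<Longrightarrow> (\<And>x. x \<in> Z \<Longrightarrow> u x = u' x) \<Longrightarrow> content f u Z = content f' u' Z"
proof (rule ext)
  fix j assume *: "\<And>x. x \<in> Z \<Longrightarrow> f x = f' x" "\<And>x. x \<in> Z \<Longrightarrow> u x = u' x"
  hence "{x\<in>Z. f x = j} = {x\<in>Z. f' x = j}" by auto
  moreover have "image_mset u (mset_set {x\<in>Z. f' x = j}) = image_mset u' (mset_set {x\<in>Z. f' x = j})"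
    using *(2) by (cases "finite {x\<in>Z. f' x = j}") (auto intro!: image_mset_cong)
  ultimately show "content f u Z j = content f' u' Z j" unfolding content_def by simp
qed

lemma content_nonempty: "finite Z \<Longrightarrow> content f u Z j \<noteq> {#} \<longleftrightarrow> j \<in> f ` Z"
  by (auto simp: content_def mset_set_empty_iff)

lemma set_content: "finite Z \<Longrightarrow> set_mset (content f u Z j) = u ` {x\<in>Z. f x = j}"
  by (simp add: content_def)

lemma row_mapsD: "f \<in> row_maps S u Z \<Longrightarrow> content f u Z = S" "f \<in> row_maps S u Z \<Longrightarrow> f \<in> Z \<rightarrow>\<^sub>E UNIV"
  by (auto simp: row_maps_def)

lemma finite_row_maps: assumes "finite Z" shows "finite (row_maps S u Z)"
proof (cases "row_maps S u Z = {}")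
  case False
  then obtain f0 where f0: "content f0 u Z = S" by (auto simp: row_maps_def)
  have "row_maps S u Z \<subseteq> Z \<rightarrow>\<^sub>E (f0 ` Z)"
  proof
    fix f assume f: "f \<in> row_maps S u Z"
    have "j \<in> f ` Z \<longleftrightarrow> j \<in> f0 ` Z" for j
      unfolding content_nonempty[OF assms, symmetric, of _ _ u] row_mapsD(1)[OF f] f0 ..
    hence "f ` Z = f0 ` Z" by blast
    thus "f \<in> Z \<rightarrow>\<^sub>E (f0 ` Z)" using f by (auto simp: row_maps_def PiE_iff extensional_def)
  qed
  thus ?thesis using assms finite_subset by (blast intro: finite_PiE)
qed simp

lemma codet_nonzero_shape:
  assumes "codet S T (Z, u, w) \<noteq> 0"
  shows "finite Z" "\<exists>f. content f u Z = S \<and> content f w Z = T" "shape S = shape T"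
proof -
  show "finite Z" using assms by (auto simp: codet_def split: if_splits)
  have "row_maps S u Z \<inter> row_maps T w Z \<noteq> {}" using assms by (auto simp: codet_def split: if_splits)
  then obtain f where f: "content f u Z = S" "content f w Z = T" by (auto simp: row_maps_def)
  thus "\<exists>f. content f u Z = S \<and> content f w Z = T" by blast
  show "shape S = shape T" unfolding f[symmetric] by (simp add: shape_def fun_eq_iff size_content)
qed

text \<open>Turns counts into linear relations: a weight on row maps of content \<open>T\<close>
  that depends only on their content for the other label is a combination of codeterminants with the
  same \<open>T\<close>.\<close>

lemma codet_group:
  assumes Z: "finite Z" and F: "finite F"
    and h: "\<And>f. f \<in> row_maps T w Z \<Longrightarrow> g f = (if content f u Z \<in> F then h (content f u Z) else 0)"
  shows "(\<Sum>f\<in>row_maps T w Z. g f) = (\<Sum>S\<in>F. h S * codet S T (Z, u, w))"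
proof -
  have "(\<Sum>f\<in>row_maps T w Z. g f) = (\<Sum>f\<in>row_maps T w Z. \<Sum>S\<in>F. if content f u Z = S then h S else 0)"
    using F h by (intro sum.cong) auto
  also have "\<dots> = (\<Sum>S\<in>F. \<Sum>f\<in>row_maps T w Z. if content f u Z = S then h S else 0)" by (rule sum.swap)
  also have "\<dots> = (\<Sum>S\<in>F. h S * codet S T (Z, u, w))"
  proof (rule sum.cong[OF refl])
    fix S
    have "row_maps T w Z \<inter> {f. content f u Z = S} = row_maps S u Z \<inter> row_maps T w Z"
      by (auto simp: row_maps_def)
    thus "(\<Sum>f\<in>row_maps T w Z. if content f u Z = S then h S else 0) = h S * codet S T (Z, u, w)"
      using Z by (simp add: codet_def finite_row_maps sum.If_cases)
  qed
  finally show ?thesis .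
qed

lemma codet_swap: "codet S T (Z, u, w) = codet T S (Z, w, u)"
  by (simp add: codet_def Int_commute)

lemma content_permute: "bij \<pi> \<Longrightarrow> content (\<pi> \<circ> f) u Z (\<pi> j) = content f u Z j"
  by (simp add: content_def bij_is_inj inj_eq)

lemma row_maps_permute:
  assumes \<pi>: "bij \<pi>" and f: "f \<in> row_maps (S \<circ> \<pi>) u Z"
  shows "restrict (\<pi> \<circ> f) Z \<in> row_maps S u Z"
proof -
  have "content (restrict (\<pi> \<circ> f) Z) u Z j = S j" for j
  proof -
    obtain i where i: "j = \<pi> i" using \<pi> by (metis bij_pointE)
    have "content (restrict (\<pi> \<circ> f) Z) u Z = content (\<pi> \<circ> f) u Z" by (rule content_cong) auto
    thus ?thesis using content_permute[OF \<pi>, of f u Z i] row_mapsD(1)[OF f] i by simp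
  qed
  thus ?thesis by (auto simp: row_maps_def)
qed

text \<open>Row numbers are only names. This permits sorting a shape into a partition.\<close>

lemma codet_permute_rows:
  fixes S :: "nat \<Rightarrow> 'a multiset" and T :: "nat \<Rightarrow> 'b multiset"
  assumes \<pi>: "bij \<pi>" shows "codet (S \<circ> \<pi>) (T \<circ> \<pi>) = codet S T"
proof (rule ext, clarify)
  fix Z :: "'p set" and u w
  define \<sigma> where "\<sigma> = Hilbert_Choice.inv \<pi>"
  have i: "bij \<sigma>" "\<sigma> \<circ> \<pi> = id" "\<pi> \<circ> \<sigma> = id"
    using \<pi> by (auto simp: \<sigma>_def bij_imp_bij_inv bij_is_surj surj_iff[symmetric] bij_is_inj inj_iff[symmetric])
  have S: "(S \<circ> \<pi>) \<circ> \<sigma> = S" and T: "(T \<circ> \<pi>) \<circ> \<sigma> = T" using i(3) by (simp_all add: comp_assoc)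
  have r: "restrict (\<pi>' \<circ> restrict (\<pi>'' \<circ> f) Z) Z = f"
    if "\<pi>' \<circ> \<pi>'' = id" "f \<in> Z \<rightarrow>\<^sub>E UNIV" for \<pi>' \<pi>'' and f :: "'p \<Rightarrow> nat"
  proof
    fix x show "restrict (\<pi>' \<circ> restrict (\<pi>'' \<circ> f) Z) Z x = f x"
      using fun_cong[OF that(1), of "f x"] that(2) by (cases "x \<in> Z") (auto simp: PiE_iff extensional_def)
  qed
  have "bij_betw (\<lambda>f. restrict (\<pi> \<circ> f) Z)
    (row_maps (S \<circ> \<pi>) u Z \<inter> row_maps (T \<circ> \<pi>) w Z) (row_maps S u Z \<inter> row_maps T w Z)"
  proof (rule bij_betw_byWitness[where f' = "\<lambda>f. restrict (\<sigma> \<circ> f) Z"])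
    show "\<forall>f\<in>row_maps (S \<circ> \<pi>) u Z \<inter> row_maps (T \<circ> \<pi>) w Z. restrict (\<sigma> \<circ> restrict (\<pi> \<circ> f) Z) Z = f"
      "\<forall>f\<in>row_maps S u Z \<inter> row_maps T w Z. restrict (\<pi> \<circ> restrict (\<sigma> \<circ> f) Z) Z = f"
      using r[OF i(2)] r[OF i(3)] row_mapsD(2) by (metis IntD1)+
    show "(\<lambda>f. restrict (\<pi> \<circ> f) Z) ` (row_maps (S \<circ> \<pi>) u Z \<inter> row_maps (T \<circ> \<pi>) w Z)
        \<subseteq> row_maps S u Z \<inter> row_maps T w Z"
      using row_maps_permute[OF \<pi>, of _ S u Z] row_maps_permute[OF \<pi>, of _ T w Z] by blast
    show "(\<lambda>f. restrict (\<sigma> \<circ> f) Z) ` (row_maps S u Z \<inter> row_maps T w Z)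
        \<subseteq> row_maps (S \<circ> \<pi>) u Z \<inter> row_maps (T \<circ> \<pi>) w Z"
      using row_maps_permute[OF i(1), of _ "S \<circ> \<pi>" u Z] row_maps_permute[OF i(1), of _ "T \<circ> \<pi>" w Z]
      unfolding S T by blast
  qed
  thus "codet (S \<circ> \<pi>) (T \<circ> \<pi>) (Z, u, w) = codet S T (Z, u, w)"
    by (simp add: codet_def bij_betw_same_card)
qed

lemma ex_bij_of_image_mset_eq:
  assumes fin: "finite A" "finite B" and eq: "image_mset f (mset_set A) = image_mset g (mset_set B)"
  shows "\<exists>h. bij_betw h A B \<and> (\<forall>x\<in>A. g (h x) = f x)"
proof -
  have "card A = card B" using arg_cong[OF eq, of size] by simp
  then obtain b where b: "bij_betw b A B" using finite_same_card_bij fin by blast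
  have "image_mset g (mset_set B) = image_mset (g \<circ> b) (mset_set A)"
    using b by (metis bij_betw_def image_mset_mset_set multiset.map_comp)
  hence "image_mset f (mset_set A) = image_mset (g \<circ> b) (mset_set A)" using eq by simp
  then obtain p where p: "p permutes A" "\<forall>x\<in>A. f x = (g \<circ> b) (p x)"
    using image_mset_eq_implies_permutes[OF fin(1)] by metis
  have "bij_betw (b \<circ> p) A B" using bij_betw_trans[OF permutes_imp_bij[OF p(1)] b] .
  thus ?thesis using p(2) by auto
qed

lemma count_content:
  assumes "finite Z"
  shows "count (content f u Z j) a = count (image_mset (\<lambda>x. (f x, u x)) (mset_set Z)) (j, a)"
proof -
  have "{x\<in>Z. f x = j} \<inter> u -` {a} = Z \<inter> (\<lambda>x. (f x, u x)) -` {(j, a)}" by auto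
  thus ?thesis using assms by (simp add: content_def count_image_mset Int_commute)
qed

lemma content_eq_iff_pairs:
  assumes "finite Z" "finite Z'"
  shows "content f u Z = content f' u' Z' \<longleftrightarrow>
    image_mset (\<lambda>x. (f x, u x)) (mset_set Z) = image_mset (\<lambda>x. (f' x, u' x)) (mset_set Z')"
  unfolding multiset_eq_iff fun_eq_iff split_paired_All count_content[OF assms(1)] count_content[OF assms(2)] ..

text \<open>The content is a complete invariant of a finite labelled set with a row map. Hence every
  quantity invariant under label-preserving bijections is a function of the content, the principle
  behind all coefficients chosen by \<open>SOME\<close> below.\<close>

lemma content_iso:
  assumes "finite Z" "finite Z'" and "content f u Z = content f' u' Z'"
  shows "\<exists>h. bij_betw h Z Z' \<and> (\<forall>x\<in>Z. f' (h x) = f x \<and> u' (h x) = u x)"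
  using ex_bij_of_image_mset_eq[OF assms(1,2) assms(3)[unfolded content_eq_iff_pairs[OF assms(1,2)]]] by auto

lemma content_bij:
  assumes h: "bij_betw h Z Z'" and "\<And>x. x \<in> Z \<Longrightarrow> f' (h x) = f x" "\<And>x. x \<in> Z \<Longrightarrow> u' (h x) = u x"
  shows "content f' u' Z' = content f u Z"
proof
  fix j
  have i: "inj_on h {x\<in>Z. f x = j}" using h by (auto simp: bij_betw_def inj_on_def)
  have "{x\<in>Z'. f' x = j} = h ` {x\<in>Z. f x = j}"
    using assms by (auto simp: bij_betw_def)
  hence "content f' u' Z' j = image_mset (u' \<circ> h) (mset_set {x\<in>Z. f x = j})"
    unfolding content_def by (simp add: image_mset_mset_set[OF i, symmetric] multiset.map_comp)
  also have "\<dots> = content f u Z j"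
    unfolding content_def by (cases "finite {x\<in>Z. f x = j}") (auto intro!: image_mset_cong simp: assms(3))
  finally show "content f' u' Z' j = content f u Z j" .
qed

section \<open>Straightening\<close>

definition rows :: "(nat \<Rightarrow> 'a multiset) \<Rightarrow> bool" where
  "rows S \<longleftrightarrow> finite {j. S j \<noteq> {#}}"

definition tot :: "(nat \<Rightarrow> nat) \<Rightarrow> nat" where "tot \<eta> = (\<Sum>j | \<eta> j \<noteq> 0. \<eta> j)"

text \<open>The sum of a convex function of the row lengths refines the dominance order.\<close>

definition ent :: "(nat \<Rightarrow> nat) \<Rightarrow> nat" where "ent \<eta> = (\<Sum>j | \<eta> j \<noteq> 0. 3 ^ \<eta> j - 1)"

text \<open>The shapes here need not be partitions and the tableaux need not be standard;
  \<open>codet_in_span_std\<close> later rewrites these elements by standard ones.\<close>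

definition higher :: "(nat \<Rightarrow> nat) \<Rightarrow> (('p, 'a, 'b) labelled \<Rightarrow> 'k::field) set" where
  "higher \<eta> = {codet S T | S T. rows S \<and> shape T = shape S \<and> tot (shape S) = tot \<eta> \<and> ent \<eta> < ent (shape S)}"

definition tabloids :: "'a set \<Rightarrow> (nat \<Rightarrow> nat) \<Rightarrow> (nat \<Rightarrow> 'a multiset) set" where
  "tabloids A \<eta> = {S. shape S = \<eta> \<and> (\<forall>j. set_mset (S j) \<subseteq> A)}"

lemma rows_shape: "rows S \<longleftrightarrow> finite {j. shape S j \<noteq> 0}"
  by (simp add: rows_def shape_def)

lemma finite_tabloids:
  assumes A: "finite A" and \<eta>: "finite {j. \<eta> j \<noteq> 0}"
  shows "finite (tabloids A \<eta>)"
proof -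
  define B where "B = mset ` (\<Union>j\<in>{j. \<eta> j \<noteq> 0}. {xs. set xs \<subseteq> A \<and> length xs = \<eta> j})"
  have "finite B" unfolding B_def using A \<eta> by (intro finite_imageI finite_UN_I finite_lists_length_eq) auto
  hence "finite {S. \<forall>j. (j \<in> {j. \<eta> j \<noteq> 0} \<longrightarrow> S j \<in> B) \<and> (j \<notin> {j. \<eta> j \<noteq> 0} \<longrightarrow> S j = {#})}"
    by (rule finite_set_of_finite_funs[OF \<eta>])
  moreover have "tabloids A \<eta> \<subseteq> {S. \<forall>j. (j \<in> {j. \<eta> j \<noteq> 0} \<longrightarrow> S j \<in> B) \<and> (j \<notin> {j. \<eta> j \<noteq> 0} \<longrightarrow> S j = {#})}"
  proof (intro subsetI CollectI allI conjI impI)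
    fix S j assume S: "S \<in> tabloids A \<eta>"
    have sz: "size (S j) = \<eta> j" and st: "set_mset (S j) \<subseteq> A"
      using S by (auto simp: tabloids_def shape_def fun_eq_iff)
    show "S j = {#}" if "j \<notin> {j. \<eta> j \<noteq> 0}" using that sz by simp
    show "S j \<in> B" if j: "j \<in> {j. \<eta> j \<noteq> 0}"
    proof -
      obtain xs where xs: "mset xs = S j" using ex_mset by blast
      have "set xs \<subseteq> A" "length xs = \<eta> j" using st sz unfolding xs[symmetric] by auto
      thus ?thesis unfolding B_def xs[symmetric] using j by blast
    qed
  qed
  ultimately show ?thesis using finite_subset by blast
qed

lemma tot_superset: "finite I \<Longrightarrow> {j. \<eta> j \<noteq> 0} \<subseteq> I \<Longrightarrow> tot \<eta> = (\<Sum>j\<in>I. \<eta> j)"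
  unfolding tot_def by (rule sum.mono_neutral_left) auto

lemma ent_superset: "finite I \<Longrightarrow> {j. \<eta> j \<noteq> 0} \<subseteq> I \<Longrightarrow> ent \<eta> = (\<Sum>j\<in>I. 3 ^ \<eta> j - 1)"
  unfolding ent_def by (rule sum.mono_neutral_left) auto

section \<open>Garnir relations between two adjacent rows\<close>

lemma sum_mset_less:
  fixes rk :: "'a \<Rightarrow> nat"
  assumes "size R = size R'" "R \<noteq> {#}" "\<And>r r'. r \<in># R \<Longrightarrow> r' \<in># R' \<Longrightarrow> rk r' < rk r"
  shows "sum_mset (image_mset rk R') < sum_mset (image_mset rk R)"
  using assms
proof (induction R arbitrary: R')
  case (add r R)
  then obtain r' R1 where R': "R' = add_mset r' R1" by (metis size_eq_Suc_imp_eq_union size_add_mset)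
  have "sum_mset (image_mset rk R1) \<le> sum_mset (image_mset rk R)"
    using add.IH[of R1] add.prems R' by (cases "R = {#}") (auto intro: less_imp_le)
  thus ?case using add.prems(3)[of r r'] R' by simp
qed simp

text \<open>After cancelling what \<open>Q\<close> and \<open>A\<close> share, letters of
  \<open>A\<close>, all at least v, are replaced by as many different letters of \<open>B\<close>,
  all at most v.\<close>

lemma exchange_decreases:
  fixes v :: "'a::linorder" and rk :: "'a \<Rightarrow> nat"
  assumes A: "\<And>a. a \<in># A \<Longrightarrow> v \<le> a" and B: "\<And>b. b \<in># B \<Longrightarrow> b \<le> v"
    and Q: "Q \<subseteq># A + B" "size Q = size A" "Q \<noteq> A"
    and rk: "\<And>a b. a \<in># A + B \<Longrightarrow> b \<in># A + B \<Longrightarrow> a < b \<Longrightarrow> rk a < rk b"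
  shows "sum_mset (image_mset rk Q) < sum_mset (image_mset rk A)"
proof -
  have eq: "A = (A \<inter># Q) + (A - Q)" "Q = (A \<inter># Q) + (Q - A)"
    by (auto simp: multiset_eq_iff)
  have sz: "size (A - Q) = size (Q - A)"
    using arg_cong[OF eq(1), of size] arg_cong[OF eq(2), of size] Q(2) by simp
  have ne: "A - Q \<noteq> {#}"
  proof
    assume "A - Q = {#}"
    hence "Q - A = {#}" using sz by simp
    thus False using eq \<open>A - Q = {#}\<close> Q(3) by simp
  qed
  have "sum_mset (image_mset rk (Q - A)) < sum_mset (image_mset rk (A - Q))"
  proof (rule sum_mset_less[OF sz ne])
    fix r r' assume r: "r \<in># A - Q" and r': "r' \<in># Q - A"
    have rA: "r \<in># A" using r in_diffD by metis
    have "count Q r' \<le> count A r' + count B r'" using Q(1) by (metis count_union mset_subset_eq_count)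
    moreover have "count Q r' > count A r'" using r' by (simp add: in_diff_count)
    ultimately have "count B r' > 0" by linarith
    hence rB: "r' \<in># B" by simp
    have "r \<noteq> r'" using r r' by (auto simp: in_diff_count)
    hence "r' < r" using A[OF rA] B[OF rB] by simp
    thus "rk r' < rk r" using rk rA rB by simp
  qed
  thus ?thesis
    using arg_cong[OF eq(1), of "\<lambda>M. sum_mset (image_mset rk M)"]
      arg_cong[OF eq(2), of "\<lambda>M. sum_mset (image_mset rk M)"] by simp
qed

text \<open>Transport along the bijection of \<open>content_iso\<close>. Applied in both directions,
  it shows that the number of row maps related to \<open>f\<close> by an invariant relation
  \<open>P\<close> depends only on the content of \<open>f\<close>.\<close>

lemma count_row_maps_le:
  assumes fin: "finite Z" "finite Z2" and eq: "content f u Z = content g u2 Z2"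
    and P: "\<And>h f2. bij_betw h Z Z2 \<Longrightarrow> \<forall>x\<in>Z. g (h x) = f x \<Longrightarrow> P Z2 f2 g \<Longrightarrow> P Z (restrict (f2 \<circ> h) Z) f"
  shows "card {f2 \<in> row_maps S u2 Z2. P Z2 f2 g} \<le> card {f1 \<in> row_maps S u Z. P Z f1 f}"
proof -
  obtain h where h: "bij_betw h Z Z2" "\<forall>x\<in>Z. g (h x) = f x" "\<forall>x\<in>Z. u2 (h x) = u x"
    using content_iso[OF fin eq] by blast
  have Z2: "Z2 = h ` Z" using h(1) by (simp add: bij_betw_def)
  show ?thesis
  proof (rule card_inj_on_le[where f = "\<lambda>f2. restrict (f2 \<circ> h) Z"])
    show "inj_on (\<lambda>f2. restrict (f2 \<circ> h) Z) {f2 \<in> row_maps S u2 Z2. P Z2 f2 g}"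
    proof (rule inj_onI)
      fix a b assume a: "a \<in> {f2 \<in> row_maps S u2 Z2. P Z2 f2 g}" and b: "b \<in> {f2 \<in> row_maps S u2 Z2. P Z2 f2 g}"
        and e: "restrict (a \<circ> h) Z = restrict (b \<circ> h) Z"
      show "a = b"
      proof
        fix y show "a y = b y"
        proof (cases "y \<in> Z2")
          case True
          then obtain x where "x \<in> Z" "y = h x" using Z2 by blast
          thus ?thesis using fun_cong[OF e, of x] by simp
        next
          case False
          thus ?thesis using a b by (auto simp: row_maps_def PiE_iff extensional_def)
        qed
      qed
    qed
    show "(\<lambda>f2. restrict (f2 \<circ> h) Z) ` {f2 \<in> row_maps S u2 Z2. P Z2 f2 g} \<subseteq> {f1 \<in> row_maps S u Z. P Z f1 f}"
    proof (intro image_subsetI CollectI conjI)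
      fix f2 assume f2: "f2 \<in> {f2 \<in> row_maps S u2 Z2. P Z2 f2 g}"
      show "P Z (restrict (f2 \<circ> h) Z) f" using P[OF h(1,2)] f2 by blast
      have "content f2 u2 Z2 = content (restrict (f2 \<circ> h) Z) u Z"
        using h by (intro content_bij) auto
      thus "restrict (f2 \<circ> h) Z \<in> row_maps S u Z" using f2 by (simp add: row_maps_def)
    qed
    show "finite {f1 \<in> row_maps S u Z. P Z f1 f}" 
      by (rule finite_subset[OF _ finite_row_maps[OF fin(1)]]) auto
  qed
qed

text \<open>A violation of standardness at \<open>v\<close>: the letters of row j that are at least
  v and those of row j+1 that are at most v are together more than row j can hold. They will be
  collected in the empty row \<open>l\<close>; \<open>rk\<close> measures progress.\<close>

locale garnir =
  fixes S :: "nat \<Rightarrow> 'a::linorder multiset" and j l :: nat and v :: 'a and rk :: "'a \<Rightarrow> nat"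
  assumes rows_S: "rows S" and l: "l \<noteq> j" "l \<noteq> Suc j" "S l = {#}"
    and viol: "size {#a \<in># S j. a < v#} < size {#b \<in># S (Suc j). b \<le> v#}"
    and part: "size (S (Suc j)) \<le> size (S j)"
    and rk: "\<And>a b. a \<in># S j + S (Suc j) \<Longrightarrow> b \<in># S j + S (Suc j) \<Longrightarrow> a < b \<Longrightarrow> rk a < rk b"
begin

text \<open>Rows j and j+1 keep only the letters outside the conflict, and row \<open>l\<close>
  receives the conflicting ones. Being longer than row j, row \<open>l\<close> makes the new shape
  more dominant.\<close>

definition SS :: "nat \<Rightarrow> 'a multiset" where
  "SS = S(j := {#a \<in># S j. a < v#}, Suc j := {#b \<in># S (Suc j). \<not> b \<le> v#},
          l := {#a \<in># S j. \<not> a < v#} + {#b \<in># S (Suc j). b \<le> v#})"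

definition low :: "(nat \<Rightarrow> 'a multiset) set" where
  "low = {S'. (\<forall>i. i \<noteq> j \<longrightarrow> i \<noteq> Suc j \<longrightarrow> S' i = S i) \<and> S' j + S' (Suc j) = S j + S (Suc j) \<and>
    size (S' j) = size (S j) \<and> sum_mset (image_mset rk (S' j)) < sum_mset (image_mset rk (S j))}"

lemma low_shape: "S' \<in> low \<Longrightarrow> shape S' = shape S"
proof (rule ext)
  fix i assume S': "S' \<in> low"
  have "size (S' j + S' (Suc j)) = size (S j + S (Suc j))" using S' by (simp add: low_def)
  hence "size (S' (Suc j)) = size (S (Suc j))" using S' by (simp add: low_def)
  thus "shape S' i = shape S i"
    using S' by (cases "i = j \<or> i = Suc j") (auto simp: low_def shape_def)
qed

lemma low_letters: "S' \<in> low \<Longrightarrow> (\<Union>i. set_mset (S' i)) \<subseteq> (\<Union>i. set_mset (S i))"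
proof
  fix x assume S': "S' \<in> low" and "x \<in> (\<Union>i. set_mset (S' i))"
  then obtain i where i: "x \<in># S' i" by blast
  show "x \<in> (\<Union>i. set_mset (S i))"
  proof (cases "i = j \<or> i = Suc j")
    case True
    hence "x \<in># S' j + S' (Suc j)" using i by auto
    also have "S' j + S' (Suc j) = S j + S (Suc j)" using S' by (simp add: low_def)
    finally show ?thesis by auto
  next
    case False
    thus ?thesis using S' i by (auto simp: low_def)
  qed
qed

lemma finite_low: "finite low"
proof (rule finite_subset)
  have fin: "finite {i. S i \<noteq> {#}}" using rows_S by (simp add: rows_def)
  have "(\<Union>i. set_mset (S i)) = (\<Union>i\<in>{i. S i \<noteq> {#}}. set_mset (S i))"
    unfolding set_eq_iff UN_iff by (metis (mono_tags) UNIV_I empty_iff mem_Collect_eq set_mset_empty)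
  hence "finite (\<Union>i. set_mset (S i))" using fin by simp
  moreover have "finite {i. shape S i \<noteq> 0}" using rows_S by (simp add: rows_shape)
  ultimately show "finite (tabloids (\<Union>i. set_mset (S i)) (shape S))" by (rule finite_tabloids)
  show "low \<subseteq> tabloids (\<Union>i. set_mset (S i)) (shape S)"
  proof
    fix S' assume S': "S' \<in> low"
    thus "S' \<in> tabloids (\<Union>i. set_mset (S i)) (shape S)"
      using low_shape[OF S'] low_letters[OF S'] by (simp add: tabloids_def UN_subset_iff)
  qed
qed

lemma S_split: "S j = {#a \<in># S j. a < v#} + {#a \<in># S j. \<not> a < v#}"
  "S (Suc j) = {#b \<in># S (Suc j). b \<le> v#} + {#b \<in># S (Suc j). \<not> b \<le> v#}"
  by (rule multiset_partition)+

lemma rows_SS: "rows SS"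
  unfolding rows_def
proof (rule finite_subset)
  show "{i. SS i \<noteq> {#}} \<subseteq> insert l (insert j (insert (Suc j) {i. S i \<noteq> {#}}))" by (auto simp: SS_def)
  show "finite (insert l (insert j (insert (Suc j) {i. S i \<noteq> {#}})))" using rows_S by (simp add: rows_def)
qed

text \<open>The new row is at least one longer than row j, and row j is at least as long as row j+1;
  so it contributes at least three times the power of row j, more than the two old rows
  together.\<close>

lemma SS_tot_ent: "tot (shape SS) = tot (shape S)" "ent (shape S) < ent (shape SS)"
proof -
  define I where "I = {i. S i \<noteq> {#}} - {j, Suc j, l}"
  have I: "finite I" "j \<notin> I" "Suc j \<notin> I" "l \<notin> I" using rows_S by (auto simp: I_def rows_def)
  define I' where "I' = insert j (insert (Suc j) (insert l I))"
  have I': "finite I'" "{i. shape S i \<noteq> 0} \<subseteq> I'" "{i. shape SS i \<noteq> 0} \<subseteq> I'"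
    using I by (auto simp: I'_def I_def shape_def SS_def)
  define a1 a2 b1 b2 where "a1 = size {#a \<in># S j. a < v#}" and "a2 = size {#a \<in># S j. \<not> a < v#}"
    and "b1 = size {#b \<in># S (Suc j). b \<le> v#}" and "b2 = size {#b \<in># S (Suc j). \<not> b \<le> v#}"
  note ab = a1_def a2_def b1_def b2_def
  have sz: "shape S j = a1 + a2" "shape S (Suc j) = b1 + b2" "shape S l = 0"
    using S_split l(3) unfolding ab shape_def by (metis size_union, metis size_union, simp)
  have sz': "shape SS j = a1" "shape SS (Suc j) = b2" "shape SS l = a2 + b1"
    using l by (simp_all add: SS_def shape_def ab)
  have other: "shape SS i = shape S i" if "i \<in> I" for i using that by (auto simp: I_def SS_def shape_def)
  have sums: "(\<Sum>i\<in>I'. g (\<mu> i)) = g (\<mu> j) + (g (\<mu> (Suc j)) + (g (\<mu> l) + (\<Sum>i\<in>I. g (\<mu> i))))"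
    for g \<mu> :: "nat \<Rightarrow> nat" unfolding I'_def using I l by simp
  show "tot (shape SS) = tot (shape S)"
    using sums[of id "shape S"] sums[of id "shape SS"] other tot_superset[OF I'(1)] I' sz sz' by simp
  have "a1 < b1" using viol by (simp add: ab)
  moreover have "b1 + b2 \<le> a1 + a2" using part sz by (simp add: shape_def)
  ultimately have le: "Suc (a1 + a2) \<le> a2 + b1" "3 ^ (b1 + b2) \<le> (3::nat) ^ (a1 + a2)" by auto
  define g where "g x = 3 ^ x - (1::nat)" for x :: nat
  have "(3::nat) * 3 ^ (a1 + a2) \<le> 3 ^ (a2 + b1)" using power_increasing[OF le(1), of "3::nat"] by simp
  moreover have "(3::nat) ^ (a1 + a2) \<ge> 1" "(3::nat) ^ (b1 + b2) \<ge> 1" by simp_all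
  ultimately have "g (a1 + a2) + g (b1 + b2) < g (a2 + b1)"
    unfolding g_def using le(2) by linarith
  moreover have "(\<Sum>i\<in>I. g (shape SS i)) = (\<Sum>i\<in>I. g (shape S i))"
    using other by simp
  moreover have "g 0 = 0" by (simp add: g_def)
  ultimately show "ent (shape S) < ent (shape SS)"
    unfolding ent_superset[OF I'(1,2)] ent_superset[OF I'(1,3)] g_def[symmetric]
      sums[of g "shape S"] sums[of g "shape SS"] sz sz' by linarith
qed

text \<open>\<open>f'\<close> arises from \<open>f\<close> by distributing the points of row
  \<open>l\<close> among rows j and j+1.\<close>

definition compat :: "'p set \<Rightarrow> ('p \<Rightarrow> nat) \<Rightarrow> ('p \<Rightarrow> nat) \<Rightarrow> bool" where
  "compat Z f f' \<longleftrightarrow> (\<forall>x\<in>Z. if f x = l then f' x \<in> {j, Suc j} else f' x = f x)"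

lemma compat_bij:
  assumes h: "bij_betw h Z Z'" and f: "\<And>x. x \<in> Z \<Longrightarrow> f2 (h x) = f x" "\<And>x. x \<in> Z \<Longrightarrow> f2' (h x) = f' x"
  shows "compat Z' f2 f2' \<longleftrightarrow> compat Z f f'"
proof -
  have "Z' = h ` Z" using h by (simp add: bij_betw_def)
  thus ?thesis using f by (simp add: compat_def)
qed

text \<open>Returning the conflicting letters with the old row sizes either reproduces
  \<open>S\<close> or exchanges letters of row j against smaller ones from row j+1.\<close>

lemma compat_content:
  assumes Z: "finite Z" and c: "compat Z f f'" and f: "content f u Z = SS" and sh: "shape (content f' u Z) = shape S"
  shows "content f' u Z \<in> insert S low"
proof -
  define S' where "S' = content f' u Z"
  define Q where "Q i = image_mset u (mset_set {x\<in>Z. f x = l \<and> f' x = i})" for i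
  have fl: "f' x \<noteq> l" if "x \<in> Z" for x using c that l by (auto simp: compat_def split: if_splits)
  have other: "S' i = S i" if i: "i \<noteq> j" "i \<noteq> Suc j" for i
  proof (cases "i = l")
    case True
    have e: "{x\<in>Z. f' x = l} = {}" using fl by auto
    have "S' l = {#}" unfolding S'_def content_def e by simp
    thus ?thesis using True l by simp
  next
    case False
    have "{x\<in>Z. f' x = i} = {x\<in>Z. f x = i}" using c i False by (auto simp: compat_def split: if_splits)
    hence "S' i = SS i" unfolding S'_def f[symmetric] content_def by simp
    thus ?thesis using i False by (simp add: SS_def)
  qed
  have split: "S' i = SS i + Q i" if i: "i = j \<or> i = Suc j" for i
  proof -
    have "{x\<in>Z. f' x = i} = {x\<in>Z. f x = i} \<union> {x\<in>Z. f x = l \<and> f' x = i}"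
      using c i l by (auto simp: compat_def split: if_splits)
    moreover have "{x\<in>Z. f x = i} \<inter> {x\<in>Z. f x = l \<and> f' x = i} = {}" using i l by auto
    ultimately have "mset_set {x\<in>Z. f' x = i} = mset_set {x\<in>Z. f x = i} + mset_set {x\<in>Z. f x = l \<and> f' x = i}"
      using Z by (simp add: mset_set_Union)
    thus ?thesis unfolding S'_def f[symmetric] Q_def content_def by simp
  qed
  have QQ: "Q j + Q (Suc j) = SS l"
  proof -
    have "{x\<in>Z. f x = l} = {x\<in>Z. f x = l \<and> f' x = j} \<union> {x\<in>Z. f x = l \<and> f' x = Suc j}"
      using c by (auto simp: compat_def split: if_splits)
    moreover have "{x\<in>Z. f x = l \<and> f' x = j} \<inter> {x\<in>Z. f x = l \<and> f' x = Suc j} = {}" by auto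
    ultimately have "mset_set {x\<in>Z. f x = l} = mset_set {x\<in>Z. f x = l \<and> f' x = j} + mset_set {x\<in>Z. f x = l \<and> f' x = Suc j}"
      using Z by (simp add: mset_set_Union)
    thus ?thesis unfolding f[symmetric] Q_def content_def by simp
  qed
  let ?A1 = "{#a \<in># S j. a < v#}" and ?A2 = "{#a \<in># S j. \<not> a < v#}"
    and ?B1 = "{#b \<in># S (Suc j). b \<le> v#}" and ?B2 = "{#b \<in># S (Suc j). \<not> b \<le> v#}"
  have SS: "SS j = ?A1" "SS (Suc j) = ?B2" "SS l = ?A2 + ?B1" using l by (auto simp: SS_def)
  have sumS: "S' j + S' (Suc j) = S j + S (Suc j)"
  proof -
    have "S' j + S' (Suc j) = ?A1 + ?B2 + (Q j + Q (Suc j))" using split SS by (simp add: ac_simps)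
    also have "\<dots> = (?A1 + ?A2) + (?B1 + ?B2)" unfolding QQ SS by (simp only: ac_simps)
    also have "\<dots> = S j + S (Suc j)" unfolding S_split[symmetric] ..
    finally show ?thesis .
  qed
  have sz: "size (S' j) = size (S j)" using fun_cong[OF sh, of j] by (simp add: S'_def shape_def)
  have "size ?A1 + size ?A2 = size (S j)"
    by (simp only: size_union[symmetric] S_split(1)[symmetric])
  moreover have "size (S' j) = size ?A1 + size (Q j)" using split[of j] SS by simp
  ultimately have szQ: "size (Q j) = size ?A2" using sz by linarith
  show ?thesis
  proof (cases "Q j = ?A2")
    case True
    hence "S' j = S j" using split[of j] S_split(1) SS by simp
    hence "S' (Suc j) = S (Suc j)" using sumS by simp
    hence "S' = S" using other \<open>S' j = S j\<close> by (intro ext) metis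
    thus ?thesis by (simp add: S'_def)
  next
    case False
    have lt: "sum_mset (image_mset rk (Q j)) < sum_mset (image_mset rk ?A2)"
    proof (rule exchange_decreases[where B = ?B1 and v = v])
      show "Q j \<subseteq># ?A2 + ?B1" using QQ SS by (metis mset_subset_eq_add_left)
      show "rk a < rk b" if "a \<in># ?A2 + ?B1" "b \<in># ?A2 + ?B1" "a < b" for a b
        using rk[of a b] that by auto
    qed (use szQ False in auto)
    have "sum_mset (image_mset rk (S' j)) < sum_mset (image_mset rk (S j))"
    proof -
      have "sum_mset (image_mset rk ?A1) + sum_mset (image_mset rk ?A2) = sum_mset (image_mset rk (S j))"
        by (simp only: sum_mset.union[symmetric] image_mset_union[symmetric] S_split(1)[symmetric])
      moreover have "sum_mset (image_mset rk (S' j)) = sum_mset (image_mset rk ?A1) + sum_mset (image_mset rk (Q j))"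
        using split[of j] SS by simp
      ultimately show ?thesis using lt by linarith
    qed
    thus ?thesis using other sumS sz by (simp add: low_def S'_def)
  qed
qed

lemma compat_unique:
  assumes Z: "finite Z" and f': "content f' u Z = S"
  shows "card {f \<in> row_maps SS u Z. compat Z f f'} = 1"
proof -
  define g where "g = restrict (\<lambda>x. if f' x = j \<and> \<not> u x < v \<or> f' x = Suc j \<and> u x \<le> v then l else f' x) Z"
  have fl: "f' x \<noteq> l" if "x \<in> Z" for x
  proof
    assume "f' x = l"
    hence "l \<in> f' ` Z" using that by blast
    thus False using content_nonempty[OF Z, of f' u l] f' l by simp
  qed
  have filt: "image_mset u (mset_set {x\<in>Z. f' x = i \<and> P (u x)}) = {#a \<in># S i. P a#}" for i P
  proof -
    have "{x\<in>Z. f' x = i \<and> P (u x)} = {x \<in> {x\<in>Z. f' x = i}. P (u x)}" by auto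
    thus ?thesis unfolding f'[symmetric] content_def using Z
      by (simp add: filter_mset_image_mset filter_mset_mset_set)
  qed
  have "content g u Z i = SS i" for i
  proof -
    consider "i = l" | "i = j" | "i = Suc j" | "i \<noteq> l" "i \<noteq> j" "i \<noteq> Suc j" by blast
    thus ?thesis
    proof cases
      case 1
      have "{x\<in>Z. g x = l} = {x\<in>Z. f' x = j \<and> \<not> u x < v} \<union> {x\<in>Z. f' x = Suc j \<and> u x \<le> v}"
        using fl by (auto simp: g_def split: if_splits)
      moreover have "{x\<in>Z. f' x = j \<and> \<not> u x < v} \<inter> {x\<in>Z. f' x = Suc j \<and> u x \<le> v} = {}" by auto
      ultimately have "mset_set {x\<in>Z. g x = l} = mset_set {x\<in>Z. f' x = j \<and> \<not> u x < v} + mset_set {x\<in>Z. f' x = Suc j \<and> u x \<le> v}"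
        using Z by (simp add: mset_set_Union)
      thus ?thesis unfolding 1 content_def
        using filt[of j "\<lambda>a. \<not> a < v"] filt[of "Suc j" "\<lambda>a. a \<le> v"] by (simp add: SS_def)
    next
      case 2
      have "{x\<in>Z. g x = j} = {x\<in>Z. f' x = j \<and> u x < v}" using fl l by (auto simp: g_def split: if_splits)
      thus ?thesis unfolding 2 content_def using filt[of j "\<lambda>a. a < v"] l by (simp add: SS_def)
    next
      case 3
      have "{x\<in>Z. g x = Suc j} = {x\<in>Z. f' x = Suc j \<and> \<not> u x \<le> v}" using fl l by (auto simp: g_def split: if_splits)
      thus ?thesis unfolding 3 content_def using filt[of "Suc j" "\<lambda>a. \<not> a \<le> v"] l by (simp add: SS_def)
    next
      case 4
      have "{x\<in>Z. g x = i} = {x\<in>Z. f' x = i}" using 4 by (auto simp: g_def split: if_splits)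
      hence "content g u Z i = S i" unfolding f'[symmetric] content_def by simp
      thus ?thesis using 4 by (simp add: SS_def)
    qed
  qed
  hence g: "g \<in> row_maps SS u Z" by (auto simp: row_maps_def g_def)
  have gc: "compat Z g f'" using fl by (auto simp: compat_def g_def)
  have "f = g" if f: "f \<in> row_maps SS u Z" and c: "compat Z f f'" for f
  proof -
    \<comment> \<open>A point left by \<open>f\<close> in row j has a letter below v, one left in
      row j+1 a letter above v; \<open>g\<close> leaves all such points where they were. Equal row
      sizes then give equality.\<close>
    have sub: "{x\<in>Z. f x = i} \<subseteq> {x\<in>Z. g x = i}" if i: "i = j \<or> i = Suc j" for i
    proof
      fix x assume x: "x \<in> {x\<in>Z. f x = i}"
      hence "f' x = i" using c i l by (auto simp: compat_def split: if_splits)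
      moreover have "u x \<in># content f u Z i" using set_content[OF Z, of f u i] x by auto
      hence "u x \<in># SS i" using row_mapsD(1)[OF f] by simp
      ultimately show "x \<in> {x\<in>Z. g x = i}" using x i l by (auto simp: g_def SS_def)
    qed
    have eq: "{x\<in>Z. f x = i} = {x\<in>Z. g x = i}" if i: "i = j \<or> i = Suc j" for i
    proof (rule card_subset_eq[OF _ sub[OF i]])
      show "card {x\<in>Z. f x = i} = card {x\<in>Z. g x = i}"
        using row_mapsD(1)[OF f] row_mapsD(1)[OF g] size_content[of f u Z i] size_content[of g u Z i] by simp
    qed (use Z in simp)
    show "f = g"
    proof
      fix x show "f x = g x"
      proof (cases "x \<in> Z")
        case True
        have iff: "f x = i \<longleftrightarrow> g x = i" if "i = j \<or> i = Suc j" for i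
          using eq[OF that] True by blast
        have cf: "if f x = l then f' x \<in> {j, Suc j} else f' x = f x" using c True unfolding compat_def by blast
        have cg: "if g x = l then f' x \<in> {j, Suc j} else f' x = g x" using gc True unfolding compat_def by blast
        show ?thesis
          using iff[of j] iff[of "Suc j"] cf cg by (auto split: if_splits)
      next
        case False
        thus ?thesis using row_mapsD(2)[OF f] row_mapsD(2)[OF g] by (auto simp: PiE_iff extensional_def)
      qed
    qed
  qed
  hence "{f \<in> row_maps SS u Z. compat Z f f'} = {g}" using g gc by blast
  thus ?thesis by simp
qed

lemma count_compat_inv:
  fixes Z Z2 :: "'p set"
  assumes "finite Z" "finite Z2" "content f u Z = content g u2 Z2"
  shows "card {f1 \<in> row_maps R u Z. compat Z f1 f} = card {f1 \<in> row_maps R u2 Z2. compat Z2 f1 g}"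
    and "card {f1 \<in> row_maps R u Z. compat Z f f1} = card {f1 \<in> row_maps R u2 Z2. compat Z2 g f1}"
proof -
  have 1: "compat Z (restrict (f2 \<circ> h) Z) f"
    if "bij_betw h Z Z2" "\<forall>x\<in>Z. g (h x) = f x" "compat Z2 f2 g" for Z Z2 f2 g f and h :: "'x \<Rightarrow> 'x"
    using compat_bij[OF that(1), of f2 "restrict (f2 \<circ> h) Z" g f] that(2,3) by simp
  have 2: "compat Z f (restrict (f2 \<circ> h) Z)"
    if "bij_betw h Z Z2" "\<forall>x\<in>Z. g (h x) = f x" "compat Z2 g f2" for Z Z2 f2 g f and h :: "'x \<Rightarrow> 'x"
    using compat_bij[OF that(1), of g f f2 "restrict (f2 \<circ> h) Z"] that(2,3) by simp
  show "card {f1 \<in> row_maps R u Z. compat Z f1 f} = card {f1 \<in> row_maps R u2 Z2. compat Z2 f1 g}"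
    using count_row_maps_le[OF assms, where P = "\<lambda>Z f1 f. compat Z f1 f", OF 1]
      count_row_maps_le[OF assms(2,1) assms(3)[symmetric], where P = "\<lambda>Z f1 f. compat Z f1 f", OF 1]
    by (intro antisym) auto
  show "card {f1 \<in> row_maps R u Z. compat Z f f1} = card {f1 \<in> row_maps R u2 Z2. compat Z2 g f1}"
    using count_row_maps_le[OF assms, where P = "\<lambda>Z f1 f. compat Z f f1", OF 2]
      count_row_maps_le[OF assms(2,1) assms(3)[symmetric], where P = "\<lambda>Z f1 f. compat Z f f1", OF 2]
    by (intro antisym) auto
qed

text \<open>Count compatible pairs of a placement of content \<open>SS\<close> for \<open>u\<close>
  and one of content \<open>T\<close> for \<open>w\<close>. Grouped by the first, the count is a
  combination of codeterminants of the higher shape; grouped by the second, it is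
  \<open>codet S T\<close> plus terms from \<open>low\<close>. The coefficients on the second side
  see only \<open>u\<close>, hence do not depend on \<open>T\<close>.\<close>

lemma garnir_relation:
  "\<exists>h. \<forall>T. shape T = shape S \<longrightarrow>
    codet S T - (\<Sum>S'\<in>low. fscale (h S') (codet S' T))
      \<in> fs.span (higher (shape S) :: (('p, 'a, 'b) labelled \<Rightarrow> 'k::field) set)"
proof -
  define N where "N Z u f' = card {f \<in> row_maps SS u Z. compat Z f f'}"
    for Z :: "'p set" and u :: "'p \<Rightarrow> 'a" and f'
  \<comment> \<open>By \<open>count_compat_inv\<close>, \<open>N\<close> depends only on the content
    of f', so the choice is immaterial.\<close>
  define h :: "(nat \<Rightarrow> 'a multiset) \<Rightarrow> 'k" where
    "h S' = of_nat (SOME n. \<exists>Z u f'. finite Z \<and> content f' u Z = S' \<and> n = N Z u f')" for S'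
  have hN: "h (content f' u Z) = of_nat (N Z u f')" if "finite Z" for Z u f'
  proof -
    have "(SOME n. \<exists>Z2 u2 f2. finite Z2 \<and> content f2 u2 Z2 = content f' u Z \<and> n = N Z2 u2 f2) = N Z u f'"
    proof (rule some_equality)
      show "\<exists>Z2 u2 f2. finite Z2 \<and> content f2 u2 Z2 = content f' u Z \<and> N Z u f' = N Z2 u2 f2" using that by blast
      fix n assume "\<exists>Z2 u2 f2. finite Z2 \<and> content f2 u2 Z2 = content f' u Z \<and> n = N Z2 u2 f2"
      then obtain Z2 u2 f2 where "finite Z2" "content f2 u2 Z2 = content f' u Z" "n = N Z2 u2 f2" by blast
      thus "n = N Z u f'" using count_compat_inv(1)[of Z2 Z f2 u2 f' u SS] that by (simp add: N_def)
    qed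
    thus ?thesis by (simp add: h_def)
  qed
  have "codet S T - (\<Sum>S'\<in>low. fscale (- h S') (codet S' T))
      \<in> fs.span (higher (shape S) :: (('p, 'a, 'b) labelled \<Rightarrow> 'k::field) set)"
    if T: "shape T = shape S" for T :: "nat \<Rightarrow> 'b multiset"
  proof -
    define M where "M Z w f = card {f' \<in> row_maps T w Z. compat Z f f'}"
      for Z :: "'p set" and w :: "'p \<Rightarrow> 'b" and f
    define k :: "(nat \<Rightarrow> 'b multiset) \<Rightarrow> 'k" where
      "k T' = of_nat (SOME n. \<exists>Z w f. finite Z \<and> content f w Z = T' \<and> n = M Z w f)" for T'
    have kM: "k (content f w Z) = of_nat (M Z w f)" if "finite Z" for Z w f
    proof -
      have "(SOME n. \<exists>Z2 w2 f2. finite Z2 \<and> content f2 w2 Z2 = content f w Z \<and> n = M Z2 w2 f2) = M Z w f"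
      proof (rule some_equality)
        show "\<exists>Z2 w2 f2. finite Z2 \<and> content f2 w2 Z2 = content f w Z \<and> M Z w f = M Z2 w2 f2" using that by blast
        fix n assume "\<exists>Z2 w2 f2. finite Z2 \<and> content f2 w2 Z2 = content f w Z \<and> n = M Z2 w2 f2"
        then obtain Z2 w2 f2 where "finite Z2" "content f2 w2 Z2 = content f w Z" "n = M Z2 w2 f2" by blast
        thus "n = M Z w f" using count_compat_inv(2)[of Z2 Z f2 w2 f w T] that by (simp add: M_def)
      qed
      thus ?thesis by (simp add: k_def)
    qed
    \<comment> \<open>A finite set of contents containing every one that can occur: the letters come
      from \<open>T\<close>, the shape from \<open>SS\<close>.\<close>
    define F where "F = tabloids (\<Union>i\<in>{i. T i \<noteq> {#}}. set_mset (T i)) (shape SS)"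
    have "finite {i. T i \<noteq> {#}}" using rows_S T by (metis rows_def rows_shape)
    hence finF: "finite F" unfolding F_def using rows_SS by (intro finite_tabloids) (auto simp: rows_shape)
    have S_low: "S \<notin> low" by (simp add: low_def)
    have "codet S T (Z, u, w) + (\<Sum>S'\<in>low. h S' * codet S' T (Z, u, w)) = (\<Sum>T'\<in>F. k T' * codet SS T' (Z, u, w))"
      for Z :: "'p set" and u w
    proof (cases "finite Z")
      case Z: True
      have "(\<Sum>f'\<in>row_maps T w Z. of_nat (N Z u f') :: 'k) = (\<Sum>S'\<in>insert S low. h S' * codet S' T (Z, u, w))"
      proof (rule codet_group[OF Z])
        show "finite (insert S low)" using finite_low by simp
        fix f' assume f': "f' \<in> row_maps T w Z"
        show "of_nat (N Z u f') = (if content f' u Z \<in> insert S low then h (content f' u Z) else 0)"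
        proof (cases "content f' u Z \<in> insert S low")
          case False
          have "shape (content f' u Z) = shape (content f' w Z)" by (simp add: shape_def fun_eq_iff size_content)
          hence sh: "shape (content f' u Z) = shape S" using row_mapsD(1)[OF f'] T by simp
          have "{f \<in> row_maps SS u Z. compat Z f f'} = {}"
            using compat_content[OF Z _ _ sh] False row_mapsD(1) by blast
          hence "N Z u f' = 0" unfolding N_def by (simp only: card.empty)
          thus ?thesis using False by simp
        qed (simp add: hN[OF Z])
      qed
      also have "\<dots> = h S * codet S T (Z, u, w) + (\<Sum>S'\<in>low. h S' * codet S' T (Z, u, w))"
        using S_low finite_low by simp
      also have "h S * codet S T (Z, u, w) = codet S T (Z, u, w)"
      proof (cases "codet S T (Z, u, w) = (0::'k)")
        case False
        then obtain f' where "content f' u Z = S" using codet_nonzero_shape(2)[OF False] by blast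
        thus ?thesis using hN[OF Z, of f' u] compat_unique[OF Z] by (simp add: N_def)
      qed simp
      finally have 1: "(\<Sum>f'\<in>row_maps T w Z. of_nat (N Z u f') :: 'k) =
        codet S T (Z, u, w) + (\<Sum>S'\<in>low. h S' * codet S' T (Z, u, w))" .
      have "(\<Sum>f\<in>row_maps SS u Z. of_nat (M Z w f) :: 'k) = (\<Sum>T'\<in>F. k T' * codet T' SS (Z, w, u))"
      proof (rule codet_group[OF Z finF])
        fix f assume f: "f \<in> row_maps SS u Z"
        show "of_nat (M Z w f) = (if content f w Z \<in> F then k (content f w Z) else 0)"
        proof (cases "content f w Z \<in> F")
          case False
          have "shape (content f w Z) = shape (content f u Z)" by (simp add: shape_def fun_eq_iff size_content)
          hence sh: "shape (content f w Z) = shape SS" using row_mapsD(1)[OF f] by simp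
          have "{f' \<in> row_maps T w Z. compat Z f f'} = {}"
          proof (rule ccontr)
            assume "{f' \<in> row_maps T w Z. compat Z f f'} \<noteq> {}"
            then obtain f' where f': "content f' w Z = T" by (auto simp: row_maps_def)
            have "w x \<in> (\<Union>i\<in>{i. T i \<noteq> {#}}. set_mset (T i))" if "x \<in> Z" for x
            proof -
              have "w x \<in># T (f' x)" using that set_content[OF Z, of f' w "f' x"] f' by auto
              thus ?thesis by force
            qed
            hence "set_mset (content f w Z i) \<subseteq> (\<Union>i\<in>{i. T i \<noteq> {#}}. set_mset (T i))" for i
              unfolding set_content[OF Z] by blast
            thus False using False sh by (simp add: F_def tabloids_def)
          qed
          hence "M Z w f = 0" unfolding M_def by (simp only: card.empty)
          thus ?thesis using False by simp
        qed (simp add: kM[OF Z])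
      qed
      moreover have "codet T' SS (Z, w, u) = (codet SS T' (Z, u, w) :: 'k)" for T' by (rule codet_swap)
      \<comment> \<open>The double count of compatible pairs.\<close>
      moreover have "(\<Sum>f\<in>row_maps SS u Z. M Z w f) = (\<Sum>f'\<in>row_maps T w Z. N Z u f')"
        unfolding M_def N_def
        using sum.swap_restrict[OF finite_row_maps[OF Z, of SS u] finite_row_maps[OF Z, of T w],
          where g = "\<lambda>_ _. 1::nat" and R = "compat Z"]
        by simp
      hence "(\<Sum>f\<in>row_maps SS u Z. of_nat (M Z w f) :: 'k) = (\<Sum>f'\<in>row_maps T w Z. of_nat (N Z u f'))"
        by (metis of_nat_sum)
      ultimately show ?thesis using 1 by simp
    qed (simp add: codet_def)
    hence eq: "(codet S T :: ('p, 'a, 'b) labelled \<Rightarrow> 'k) - (\<Sum>S'\<in>low. fscale (- h S') (codet S' T)) = (\<Sum>T'\<in>F. fscale (k T') (codet SS T'))"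
      by (intro ext) (simp add: sum_fun_apply split_paired_all sum_negf)
    show ?thesis unfolding eq
    proof (intro fs.span_sum fs.span_scale fs.span_base)
      fix T' assume "T' \<in> F"
      hence "shape T' = shape SS" by (simp add: F_def tabloids_def)
      thus "codet SS T' \<in> higher (shape S)" using rows_SS SS_tot_ent by (auto simp: higher_def)
    qed
  qed
  thus ?thesis by (intro exI[of _ "\<lambda>S'. - h S'"]) blast
qed

end

text \<open>With each row sorted this is column strictness, so S is a semistandard tableau. The
  counting form hands the value \<open>v\<close> of a Garnir relation directly to the straightening
  step.\<close>

definition standard :: "(nat \<Rightarrow> 'a::linorder multiset) \<Rightarrow> bool" where
  "standard S \<longleftrightarrow> (\<forall>j v. size {#b \<in># S (Suc j). b \<le> v#} \<le> size {#a \<in># S j. a < v#})"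

text \<open>Repeated Garnir relations. The coefficients are quantified before \<open>T\<close>: the
  left action on a cell layer must have a matrix that does not depend on the right index.\<close>

lemma straighten_left:
  fixes A :: "'a::linorder set"
  assumes A: "finite A" and fin: "finite {j. \<eta> j \<noteq> 0}" and part: "\<And>j. \<eta> (Suc j) \<le> \<eta> j"
    and S: "S \<in> tabloids A \<eta>"
  shows "\<exists>h. \<forall>T. shape T = \<eta> \<longrightarrow>
    codet S T - (\<Sum>S'\<in>{S'\<in>tabloids A \<eta>. standard S'}. fscale (h S') (codet S' T))
      \<in> fs.span (higher \<eta> :: (('p, 'a, 'b) labelled \<Rightarrow> 'k::field) set)"
proof -
  define rk where "rk a = card {b\<in>A. b < a}" for a
  have rk: "rk a < rk b" if "a \<in> A" "a < b" for a b
    unfolding rk_def using A that by (intro psubset_card_mono) auto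
  obtain H where "\<forall>j\<in>{j. \<eta> j \<noteq> 0}. j < H" using fin unfolding finite_nat_set_iff_bounded by blast
  hence H: "j < H" if "\<eta> j \<noteq> 0" for j using that by simp
  define R where "R M = sum_mset (image_mset rk M)" for M
  \<comment> \<open>Upper rows weigh more, so moving smaller letters from row j+1 up into row j
    decreases the measure.\<close>
  define meas where "meas S = (\<Sum>i<H. (H - i) * R (S i))" for S
  define St where "St = {S'\<in>tabloids A \<eta>. standard S'}"
  have finSt: "finite St" using finite_tabloids[OF A fin] by (simp add: St_def)
  let ?hi = "fs.span (higher \<eta> :: (('p, 'a, 'b) labelled \<Rightarrow> 'k) set)"
  define good where "good Y \<longleftrightarrow> (\<exists>h. \<forall>T. shape T = \<eta> \<longrightarrow>
      Y T - (\<Sum>S'\<in>St. fscale (h S') (codet S' T)) \<in> ?hi)" for Y :: "(nat \<Rightarrow> 'b multiset) \<Rightarrow> ('p, 'a, 'b) labelled \<Rightarrow> 'k"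
  have good_sum: "good (\<lambda>T. \<Sum>i\<in>I. fscale (c i) (Y i T))" if Y: "\<And>i. i \<in> I \<Longrightarrow> good (Y i)"
    for I :: "(nat \<Rightarrow> 'a multiset) set" and c Y
  proof -
    obtain h where h: "\<And>i T. i \<in> I \<Longrightarrow> shape T = \<eta> \<Longrightarrow> Y i T - (\<Sum>S'\<in>St. fscale (h i S') (codet S' T)) \<in> ?hi"
    proof (atomize_elim)
      have "\<forall>i\<in>I. \<exists>h. \<forall>T. shape T = \<eta> \<longrightarrow> Y i T - (\<Sum>S'\<in>St. fscale (h S') (codet S' T)) \<in> ?hi"
        using Y unfolding good_def by blast
      from bchoice[OF this] obtain f where f: "\<forall>i\<in>I. \<forall>T. shape T = \<eta> \<longrightarrow>
        Y i T - (\<Sum>S'\<in>St. fscale (f i S') (codet S' T)) \<in> ?hi" by blast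
      show "\<exists>h. \<forall>i T. i \<in> I \<longrightarrow> shape T = \<eta> \<longrightarrow> Y i T - (\<Sum>S'\<in>St. fscale (h i S') (codet S' T)) \<in> ?hi"
        by (intro exI[of _ f]) (use f in blast)
    qed
    have step: "(\<Sum>i\<in>I. fscale (c i) (Y i T)) - (\<Sum>S'\<in>St. fscale (\<Sum>i\<in>I. c i * h i S') (codet S' T)) \<in> ?hi"
      if "shape T = \<eta>" for T
    proof -
      have "(\<Sum>S'\<in>St. fscale (\<Sum>i\<in>I. c i * h i S') (codet S' T)) =
          (\<Sum>i\<in>I. fscale (c i) (\<Sum>S'\<in>St. fscale (h i S') (codet S' T)))"
        unfolding fs.scale_sum_left fs.scale_sum_right fs.scale_scale by (rule sum.swap)
      hence "(\<Sum>i\<in>I. fscale (c i) (Y i T)) - (\<Sum>S'\<in>St. fscale (\<Sum>i\<in>I. c i * h i S') (codet S' T)) =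
          (\<Sum>i\<in>I. fscale (c i) (Y i T - (\<Sum>S'\<in>St. fscale (h i S') (codet S' T))))"
        by (simp add: sum_subtractf fs.scale_right_diff_distrib)
      thus ?thesis using h[OF _ that] by (simp only:) (intro fs.span_sum fs.span_scale)
    qed
    show ?thesis unfolding good_def by (intro exI[of _ "\<lambda>S'. \<Sum>i\<in>I. c i * h i S'"] allI impI) (rule step)
  qed
  have "good (codet S)" using S
  proof (induction "meas S" arbitrary: S rule: less_induct)
    case less
    have sh: "shape S = \<eta>" and lts: "\<And>i. set_mset (S i) \<subseteq> A" using less.prems by (auto simp: tabloids_def)
    show ?case
    proof (cases "standard S")
      case True
      have "S \<in> St" using True less.prems by (simp add: St_def)
      have "codet S T - (\<Sum>S'\<in>St. fscale (if S' = S then 1 else 0) (codet S' T)) \<in> ?hi" for T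
      proof -
        have "(\<Sum>S'\<in>St. fscale (if S' = S then 1 else 0) (codet S' T)) = (\<Sum>S'\<in>St. if S' = S then codet S T else 0)"
          by (rule sum.cong) (simp_all add: fscale_def zero_fun_def)
        also have "\<dots> = codet S T" using \<open>S \<in> St\<close> finSt by simp
        finally have eq: "(\<Sum>S'\<in>St. fscale (if S' = S then 1 else 0) (codet S' T)) = codet S T" .
        show ?thesis unfolding eq by (simp add: fs.span_zero)
      qed
      thus ?thesis unfolding good_def by (intro exI[of _ "\<lambda>S'. if S' = S then 1 else 0"]) blast
    next
      case False
      then obtain j v where jv: "size {#a \<in># S j. a < v#} < size {#b \<in># S (Suc j). b \<le> v#}"
        by (auto simp: standard_def not_le)
      have rowsS: "rows S" using fin sh by (simp add: rows_shape)
      have "finite ({i. S i \<noteq> {#}} \<union> {j, Suc j})" using rowsS by (simp add: rows_def)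
      then obtain l where l: "l \<notin> {i. S i \<noteq> {#}} \<union> {j, Suc j}" using ex_new_if_finite infinite_UNIV_nat by blast
      interpret garnir S j l v rk
      proof
        show "size (S (Suc j)) \<le> size (S j)" using part[of j] sh by (auto simp: shape_def)
        show "rk a < rk b" if "a \<in># S j + S (Suc j)" "b \<in># S j + S (Suc j)" "a < b" for a b
          using rk[of a b] that lts[of j] lts[of "Suc j"] by auto
      qed (use rowsS l jv in auto)
      have "size (S (Suc j)) \<noteq> 0" using jv size_filter_mset_lesseq[of "\<lambda>b. b \<le> v" "S (Suc j)"] by linarith
      hence "\<eta> (Suc j) \<noteq> 0" unfolding sh[symmetric] shape_def .
      hence jH: "Suc j < H" by (rule H)
      have low_good: "good (codet S')" if S': "S' \<in> low" for S'
      proof (rule less.hyps)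
        show "S' \<in> tabloids A \<eta>"
          using low_shape[OF S'] low_letters[OF S'] sh lts unfolding tabloids_def by (simp add: UN_subset_iff) blast
        define I where "I = {..<H} - {j, Suc j}"
        have sums: "(\<Sum>i<H. g i) = g j + (g (Suc j) + (\<Sum>i\<in>I. g i))" for g :: "nat \<Rightarrow> nat"
        proof -
          have "{..<H} = insert j (insert (Suc j) I)" using jH by (auto simp: I_def)
          moreover have "finite I" "j \<notin> insert (Suc j) I" "Suc j \<notin> I" by (auto simp: I_def)
          ultimately show ?thesis by simp
        qed
        have other: "(\<Sum>i\<in>I. (H - i) * R (S' i)) = (\<Sum>i\<in>I. (H - i) * R (S i))"
          using S' by (intro sum.cong) (auto simp: low_def I_def)
        have lt: "R (S' j) < R (S j)" using S' by (simp add: low_def R_def)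
        have "S' j + S' (Suc j) = S j + S (Suc j)" using S' by (simp add: low_def)
        hence "R (S' j + S' (Suc j)) = R (S j + S (Suc j))" by simp
        hence eq: "R (S' j) + R (S' (Suc j)) = R (S j) + R (S (Suc j))" by (simp add: R_def)
        have Hj: "H - j = Suc (H - Suc j)" using jH by simp
        \<comment> \<open>The rows j and j+1 together keep their letters, so only the rank sum of
          row j changes the measure.\<close>
        have "(H - j) * x + (H - Suc j) * y = x + (H - Suc j) * (x + y)" for x y
          unfolding Hj by (simp add: add_mult_distrib2)
        from this[of "R (S' j)" "R (S' (Suc j))"] this[of "R (S j)" "R (S (Suc j))"]
        show "meas S' < meas S"
          unfolding meas_def sums other using lt eq by simp
      qed
      obtain h where h: "\<And>T. shape T = \<eta> \<Longrightarrow> codet S T - (\<Sum>S'\<in>low. fscale (h S') (codet S' T)) \<in> ?hi"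
        using garnir_relation[where 'p='p and 'b='b and 'k='k] unfolding sh by blast
      obtain h2 where h2: "\<And>T. shape T = \<eta> \<Longrightarrow>
          (\<Sum>S'\<in>low. fscale (h S') (codet S' T)) - (\<Sum>S'\<in>St. fscale (h2 S') (codet S' T)) \<in> ?hi"
        using good_sum[of low codet h] low_good unfolding good_def by blast
      have "codet S T - (\<Sum>S'\<in>St. fscale (h2 S') (codet S' T)) \<in> ?hi" if "shape T = \<eta>" for T
        using fs.span_add[OF h[OF that] h2[OF that]] by simp
      thus ?thesis unfolding good_def by blast
    qed
  qed
  thus ?thesis unfolding good_def St_def .
qed

section \<open>Reduction to standard codeterminants\<close>

lemma ent_comp: "bij \<pi> \<Longrightarrow> ent (\<eta> \<circ> \<pi>) = ent \<eta>"
  unfolding ent_def by (rule sum.reindex_bij_witness[of _ "Hilbert_Choice.inv \<pi>" \<pi>])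
    (auto simp: bij_is_inj bij_is_surj surj_f_inv_f)

lemma tot_comp: "bij \<pi> \<Longrightarrow> tot (\<eta> \<circ> \<pi>) = tot \<eta>"
  unfolding tot_def by (rule sum.reindex_bij_witness[of _ "Hilbert_Choice.inv \<pi>" \<pi>])
    (auto simp: bij_is_inj bij_is_surj surj_f_inv_f)

text \<open>Within a fixed rank \<open>ent\<close> is bounded, so passing to ever higher shapes
  terminates.\<close>

lemma ent_le:
  assumes fin: "finite {j. \<eta> j \<noteq> 0}"
  shows "ent \<eta> \<le> tot \<eta> * 3 ^ tot \<eta>"
proof -
  have le: "\<eta> j \<le> tot \<eta>" if "\<eta> j \<noteq> 0" for j
    unfolding tot_def using fin that by (intro member_le_sum) auto
  have "ent \<eta> \<le> (\<Sum>j | \<eta> j \<noteq> 0. \<eta> j * 3 ^ tot \<eta>)"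
    unfolding ent_def
  proof (rule sum_mono)
    fix j assume "j \<in> {j. \<eta> j \<noteq> 0}"
    hence j: "\<eta> j \<noteq> 0" by simp
    have "3 ^ \<eta> j - 1 \<le> (3::nat) ^ tot \<eta>" using power_increasing[OF le[OF j], of "3::nat"] by linarith
    also have "\<dots> \<le> \<eta> j * 3 ^ tot \<eta>" using j by simp
    finally show "3 ^ \<eta> j - 1 \<le> \<eta> j * 3 ^ tot \<eta>" .
  qed
  also have "\<dots> = tot \<eta> * 3 ^ tot \<eta>" by (simp add: tot_def sum_distrib_right)
  finally show ?thesis .
qed

definition std_codets :: "nat \<Rightarrow> nat \<Rightarrow> (('p, 'a::linorder, 'b::linorder) labelled \<Rightarrow> 'k::field) set" where
  "std_codets i e = {codet S T | S T. rows S \<and> standard S \<and> standard T \<and> shape T = shape S \<and>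
     tot (shape S) = i \<and> e \<le> ent (shape S)}"

lemma span_higher_swap:
  fixes F :: "('p, 'a, 'b) labelled \<Rightarrow> 'k::field"
  assumes "F \<in> fs.span (higher \<eta>)"
  shows "(\<lambda>(Z, u, w). F (Z, w, u)) \<in> fs.span (higher \<eta>)"
  using assms
proof (induction rule: fs.span_induct_alt)
  case base
  have "(\<lambda>(Z, u, w). (0 :: ('p, 'a, 'b) labelled \<Rightarrow> 'k) (Z, w, u)) = 0" by (auto simp: fun_eq_iff)
  thus ?case using fs.span_zero by (simp only:)
next
  case (step c F G)
  obtain S T where ST: "F = codet S T" "rows S" "shape T = shape S" "tot (shape S) = tot \<eta>" "ent \<eta> < ent (shape S)"
    using step(1) by (auto simp: higher_def)
  have "(\<lambda>(Z, u, w). (fscale c F + G) (Z, w, u)) = fscale c (codet T S) + (\<lambda>(Z, u, w). G (Z, w, u))"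
    unfolding ST(1) by (auto simp: fun_eq_iff codet_swap[of S T])
  moreover have "codet T S \<in> higher \<eta>"
    unfolding higher_def using ST by (intro CollectI exI[of _ T] exI[of _ S]) (simp add: rows_shape)
  ultimately show ?case using step(2) by (simp only:) (rule fs.span_add[OF fs.span_scale[OF fs.span_base]])
qed

text \<open>Left straightening with the two labels exchanged; \<open>higher\<close> is stable under
  this exchange.\<close>

lemma straighten_right:
  fixes B :: "'b::linorder set"
  assumes B: "finite B" and fin: "finite {j. \<eta> j \<noteq> 0}" and part: "\<And>j. \<eta> (Suc j) \<le> \<eta> j"
    and T: "T \<in> tabloids B \<eta>"
  shows "\<exists>h. \<forall>S. shape S = \<eta> \<longrightarrow>
    codet S T - (\<Sum>T'\<in>{T'\<in>tabloids B \<eta>. standard T'}. fscale (h T') (codet S T'))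
      \<in> fs.span (higher \<eta> :: (('p, 'a, 'b) labelled \<Rightarrow> 'k::field) set)"
proof -
  let ?St = "{T'\<in>tabloids B \<eta>. standard T'}"
  obtain h where h: "\<And>S. shape S = \<eta> \<Longrightarrow> codet T S - (\<Sum>T'\<in>?St. fscale (h T') (codet T' S))
      \<in> fs.span (higher \<eta> :: (('p, 'b, 'a) labelled \<Rightarrow> 'k) set)"
    using straighten_left[OF B fin part T] by blast
  have "codet S T - (\<Sum>T'\<in>?St. fscale (h T') (codet S T'))
      \<in> fs.span (higher \<eta> :: (('p, 'a, 'b) labelled \<Rightarrow> 'k::field) set)" if "shape S = \<eta>" for S
  proof -
    have "(\<lambda>(Z, u, w). (codet T S - (\<Sum>T'\<in>?St. fscale (h T') (codet T' S)) :: ('p, 'b, 'a) labelled \<Rightarrow> 'k) (Z, w, u))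
        = codet S T - (\<Sum>T'\<in>?St. fscale (h T') (codet S T'))"
      by (auto simp: fun_eq_iff sum_fun_apply codet_swap[of S])
    thus ?thesis using span_higher_swap[OF h[OF that]] by simp
  qed
  thus ?thesis by blast
qed

text \<open>The outer induction goes upwards in \<open>ent\<close>, since both straightenings leave
  remainders of larger \<open>ent\<close>. The inner one sorts the rows, lowering the sum of j times
  the length of row j, until the shape is a partition and both tableaux can be straightened.\<close>

lemma codet_in_span_std:
  fixes S :: "nat \<Rightarrow> 'a::linorder multiset" and T :: "nat \<Rightarrow> 'b::linorder multiset"
  assumes "rows S" "shape T = shape S"
  shows "codet S T \<in> fs.span (std_codets (tot (shape S)) (ent (shape S)) :: (('p, 'a, 'b) labelled \<Rightarrow> 'k::field) set)"
  using assms
proof (induction "tot (shape S) * 3 ^ tot (shape S) - ent (shape S)" arbitrary: S T rule: less_induct)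
  case outer: less
  define i e where "i = tot (shape S)" and "e = ent (shape S)"
  define B where "B = i * 3 ^ i"
  let ?sp = "fs.span (std_codets i e :: (('p, 'a, 'b) labelled \<Rightarrow> 'k) set)"
  have higher: "F \<in> ?sp" if F: "F \<in> fs.span (higher \<eta>)" and eta: "tot \<eta> = i" "ent \<eta> = e" for F \<eta>
  proof -
    have "higher \<eta> \<subseteq> ?sp"
    proof
      fix G :: "('p, 'a, 'b) labelled \<Rightarrow> 'k" assume "G \<in> higher \<eta>"
      then obtain S' T' where G: "G = codet S' T'" "rows S'" "shape T' = shape S'"
        "tot (shape S') = i" "e < ent (shape S')" using eta by (auto simp: higher_def)
      have "ent (shape S') \<le> B" using ent_le[of "shape S'"] G by (simp add: rows_shape B_def)
      hence "G \<in> fs.span (std_codets i (ent (shape S')))"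
        using outer.hyps[of S' T'] G by (simp add: i_def[symmetric] e_def[symmetric] B_def)
      moreover have "std_codets i (ent (shape S')) \<subseteq> (std_codets i e :: (('p, 'a, 'b) labelled \<Rightarrow> 'k) set)"
        unfolding std_codets_def using G(5) by (intro Collect_mono) (metis less_imp_le order_trans)
      ultimately show "G \<in> ?sp" using fs.span_mono by blast
    qed
    thus ?thesis using F fs.span_minimal[OF _ fs.subspace_span] by blast
  qed
  have "codet S' T' \<in> ?sp" if "rows S'" "shape T' = shape S'" "tot (shape S') = i" "ent (shape S') = e" for S' T'
    using that
  proof (induction "\<Sum>j | shape S' j \<noteq> 0. j * shape S' j" arbitrary: S' T' rule: less_induct)
    case less
    define \<eta> where "\<eta> = shape S'"
    have fin: "finite {j. \<eta> j \<noteq> 0}" using less.prems(1) by (simp add: \<eta>_def rows_shape)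
    show ?case
    proof (cases "\<forall>j. \<eta> (Suc j) \<le> \<eta> j")
      case True
      define A where "A = (\<Union>j\<in>{j. S' j \<noteq> {#}}. set_mset (S' j))"
      define C where "C = (\<Union>j\<in>{j. T' j \<noteq> {#}}. set_mset (T' j))"
      have "rows T'" using less.prems by (simp add: rows_shape)
      hence AC: "finite A" "finite C" using less.prems(1) by (auto simp: A_def C_def rows_def)
      have "set_mset (S' j) \<subseteq> A" "set_mset (T' j) \<subseteq> C" for j
        unfolding A_def C_def by (cases "S' j = {#}", auto, cases "T' j = {#}", auto)
      hence tab: "S' \<in> tabloids A \<eta>" "T' \<in> tabloids C \<eta>"
        using less.prems(2) by (auto simp: tabloids_def \<eta>_def)
      have te: "tot \<eta> = i" "ent \<eta> = e" using less.prems by (auto simp: \<eta>_def)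
      obtain h where h: "\<And>T. shape T = \<eta> \<Longrightarrow>
          codet S' T - (\<Sum>S\<in>{S\<in>tabloids A \<eta>. standard S}. fscale (h S) (codet S T)) \<in> ?sp"
        using straighten_left[OF AC(1) fin _ tab(1)] True higher[OF _ te] by blast
      obtain k where k: "\<And>S. shape S = \<eta> \<Longrightarrow>
          codet S T' - (\<Sum>T\<in>{T\<in>tabloids C \<eta>. standard T}. fscale (k T) (codet S T)) \<in> ?sp"
        using straighten_right[OF AC(2) fin _ tab(2)] True higher[OF _ te] by blast
      have std: "codet S T \<in> ?sp" if "S \<in> tabloids A \<eta>" "T \<in> tabloids C \<eta>" "standard S" "standard T" for S T
        using that te fin by (intro fs.span_base) (auto simp: std_codets_def tabloids_def rows_shape)
      have "codet S T' \<in> ?sp" if S: "S \<in> tabloids A \<eta>" "standard S" for S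
      proof -
        have "(\<Sum>T\<in>{T\<in>tabloids C \<eta>. standard T}. fscale (k T) (codet S T)) \<in> ?sp"
          using std S by (intro fs.span_sum fs.span_scale) auto
        moreover have "shape S = \<eta>" using S by (simp add: tabloids_def)
        ultimately show ?thesis using fs.span_add[OF k] by fastforce
      qed
      hence "(\<Sum>S\<in>{S\<in>tabloids A \<eta>. standard S}. fscale (h S) (codet S T')) \<in> ?sp"
        by (intro fs.span_sum fs.span_scale) auto
      moreover have "shape T' = \<eta>" using less.prems by (simp add: \<eta>_def)
      ultimately show ?thesis using fs.span_add[OF h] by fastforce
    next
      case False
      then obtain j where j: "\<eta> j < \<eta> (Suc j)" by (auto simp: not_le)
      \<comment> \<open>Swapping two adjacent rows in the wrong order is one step of bubble sort;
        \<open>ent\<close> and \<open>tot\<close> do not change.\<close>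
      define \<pi> where "\<pi> = Transposition.transpose j (Suc j)"
      have \<pi>: "bij \<pi>" by (simp add: \<pi>_def)
      have sh: "shape (S' \<circ> \<pi>) = \<eta> \<circ> \<pi>" "shape (T' \<circ> \<pi>) = \<eta> \<circ> \<pi>"
        using less.prems(2) by (auto simp: shape_def \<eta>_def fun_eq_iff)
      define I where "I = insert j (insert (Suc j) {i. \<eta> i \<noteq> 0})"
      have I: "finite I" using fin by (simp add: I_def)
      have eq: "(\<Sum>x | \<mu> x \<noteq> 0. x * \<mu> x) = (\<Sum>x\<in>I. x * \<mu> x)" if "{x. \<mu> x \<noteq> 0} \<subseteq> I" for \<mu> :: "nat \<Rightarrow> nat"
        using I that by (intro sum.mono_neutral_left) auto
      have sub: "{x. (\<eta> \<circ> \<pi>) x \<noteq> 0} \<subseteq> I"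
        by (auto simp: I_def \<pi>_def Transposition.transpose_def)
      have split: "(\<Sum>x\<in>I. g x) = g j + (g (Suc j) + (\<Sum>x\<in>I - {j, Suc j}. g x))" for g :: "nat \<Rightarrow> nat"
      proof -
        have "I = insert j (insert (Suc j) (I - {j, Suc j}))" by (auto simp: I_def)
        thus ?thesis using I by (metis (no_types, lifting) Diff_iff finite_Diff finite_insert insertCI insertE n_not_Suc_n sum.insert)
      qed
      have "(\<Sum>x\<in>I - {j, Suc j}. x * (\<eta> \<circ> \<pi>) x) = (\<Sum>x\<in>I - {j, Suc j}. x * \<eta> x)"
        by (intro sum.cong) (auto simp: \<pi>_def Transposition.transpose_def)
      moreover have "(\<eta> \<circ> \<pi>) j = \<eta> (Suc j)" "(\<eta> \<circ> \<pi>) (Suc j) = \<eta> j" by (simp_all add: \<pi>_def)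
      moreover have "j * \<eta> (Suc j) + Suc j * \<eta> j < j * \<eta> j + Suc j * \<eta> (Suc j)" using j by (simp add: algebra_simps)
      ultimately have lt: "(\<Sum>x\<in>I. x * (\<eta> \<circ> \<pi>) x) < (\<Sum>x\<in>I. x * \<eta> x)"
        unfolding split by (simp only:)
      have "(\<Sum>x | shape (S' \<circ> \<pi>) x \<noteq> 0. x * shape (S' \<circ> \<pi>) x) < (\<Sum>x | shape S' x \<noteq> 0. x * shape S' x)"
      proof -
        have "{x. \<eta> x \<noteq> 0} \<subseteq> I" by (auto simp: I_def)
        thus ?thesis unfolding sh \<eta>_def[symmetric]
          using eq[OF sub] eq[of \<eta>] lt by (simp only:)
      qed
      moreover have "rows (S' \<circ> \<pi>)"
      proof -
        have "{x. shape (S' \<circ> \<pi>) x \<noteq> 0} \<subseteq> I" unfolding sh by (rule sub)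
        thus ?thesis using I finite_subset by (auto simp: rows_shape)
      qed
      ultimately have "codet (S' \<circ> \<pi>) (T' \<circ> \<pi>) \<in> ?sp"
        using less.prems sh by (intro less.hyps) (simp_all add: \<eta>_def[symmetric] ent_comp[OF \<pi>] tot_comp[OF \<pi>])
      thus ?thesis by (simp add: codet_permute_rows[OF \<pi>])
    qed
  qed
  thus ?case using outer.prems by (simp add: i_def e_def)
qed

section \<open>Column-antisymmetrized functionals\<close>

lemma codet_bij:
  assumes h: "bij_betw h Z Z'" and "\<And>x. x \<in> Z \<Longrightarrow> u' (h x) = u x" "\<And>x. x \<in> Z \<Longrightarrow> w' (h x) = w x"
  shows "codet S T (Z', u', w') = (codet S T (Z, u, w) :: 'k::field)"
proof (cases "finite Z")
  case True
  have fin: "finite Z'" using True h bij_betw_finite by blast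
  have inj: "inj_on (\<lambda>f. restrict (f \<circ> h) Z) (Z' \<rightarrow>\<^sub>E UNIV)"
  proof (rule inj_onI)
    fix a b assume a: "a \<in> Z' \<rightarrow>\<^sub>E UNIV" and b: "b \<in> Z' \<rightarrow>\<^sub>E UNIV"
      and e: "restrict (a \<circ> h) Z = restrict (b \<circ> h) Z"
    show "a = b"
    proof
      fix y show "a y = b y"
      proof (cases "y \<in> Z'")
        case True
        then obtain x where "x \<in> Z" "y = h x" using h by (auto simp: bij_betw_def)
        thus ?thesis using fun_cong[OF e, of x] by simp
      next
        case False
        thus ?thesis using a b by (auto simp: PiE_iff extensional_def)
      qed
    qed
  qed
  have "(\<lambda>f. restrict (f \<circ> h) Z) ` (row_maps S u' Z' \<inter> row_maps T w' Z') = row_maps S u Z \<inter> row_maps T w Z"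
  proof (intro equalityI subsetI)
    fix g assume "g \<in> (\<lambda>f. restrict (f \<circ> h) Z) ` (row_maps S u' Z' \<inter> row_maps T w' Z')"
    then obtain f where f: "f \<in> row_maps S u' Z'" "f \<in> row_maps T w' Z'" "g = restrict (f \<circ> h) Z" by blast
    have "content f u' Z' = content g u Z" "content f w' Z' = content g w Z"
      using assms f(3) by (auto intro!: content_bij[OF h])
    thus "g \<in> row_maps S u Z \<inter> row_maps T w Z" using f by (auto simp: row_maps_def)
  next
    fix g assume g: "g \<in> row_maps S u Z \<inter> row_maps T w Z"
    define f where "f = restrict (g \<circ> inv_into Z h) Z'"
    have fh: "f (h x) = g x" if "x \<in> Z" for x
      using that h by (auto simp: f_def bij_betw_def)
    have "g = restrict (f \<circ> h) Z"
      using g fh by (auto simp: fun_eq_iff restrict_def row_maps_def PiE_iff extensional_def)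
    moreover have "content f u' Z' = content g u Z" "content f w' Z' = content g w Z"
      using assms fh by (auto intro!: content_bij[OF h])
    hence "f \<in> row_maps S u' Z' \<inter> row_maps T w' Z'" using g by (auto simp: row_maps_def f_def)
    ultimately show "g \<in> (\<lambda>f. restrict (f \<circ> h) Z) ` (row_maps S u' Z' \<inter> row_maps T w' Z')" by blast
  qed
  moreover have "inj_on (\<lambda>f. restrict (f \<circ> h) Z) (row_maps S u' Z' \<inter> row_maps T w' Z')"
    by (rule inj_on_subset[OF inj]) (auto simp: row_maps_def)
  ultimately have "card (row_maps S u' Z' \<inter> row_maps T w' Z') = card (row_maps S u Z \<inter> row_maps T w Z)"
    by (metis card_image)
  thus ?thesis using True fin by (simp add: codet_def)
next
  case False
  hence "infinite Z'" using h bij_betw_finite by blast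
  thus ?thesis using False by (simp add: codet_def)
qed

definition cells :: "(nat \<Rightarrow> nat) \<Rightarrow> (nat \<times> nat) set" where
  "cells \<eta> = {(j, c). c < \<eta> j}"

definition col_perms :: "(nat \<Rightarrow> nat) \<Rightarrow> (nat \<times> nat \<Rightarrow> nat \<times> nat) set" where
  "col_perms \<eta> = {\<kappa>. \<kappa> permutes cells \<eta> \<and> (\<forall>x. snd (\<kappa> x) = snd x)}"

text \<open>The coefficient of the tabloid \<open>S\<close> in the polytabloid of the filling
  \<open>U\<close>.\<close>

definition col_det :: "(nat \<Rightarrow> nat) \<Rightarrow> (nat \<times> nat \<Rightarrow> 'a) \<Rightarrow> (nat \<Rightarrow> 'a multiset) \<Rightarrow> int" where
  "col_det \<eta> U S = (\<Sum>\<kappa>\<in>col_perms \<eta>. sign \<kappa> * of_bool (content fst (U \<circ> \<kappa>) (cells \<eta>) = S))"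

definition col_sum ::
  "(nat \<Rightarrow> nat) \<Rightarrow> (nat \<times> nat \<Rightarrow> 'a) \<Rightarrow> (nat \<times> nat \<Rightarrow> 'b) \<Rightarrow> (nat \<Rightarrow> 'a multiset) \<Rightarrow> (nat \<Rightarrow> 'b multiset) \<Rightarrow> 'k::field"
  where "col_sum \<eta> U W S T = (\<Sum>\<sigma>\<in>col_perms \<eta>. of_int (sign \<sigma>) * codet S T (cells \<eta>, U, W \<circ> \<sigma>))"

text \<open>Among sets of a given size, only the initial segment minimizes the sum of powers:
  removing the maximum, which is at least the size minus one, leaves a smaller instance.\<close>

lemma sum_powers_initial_segment:
  fixes C :: "nat set"
  assumes "finite C"
  shows "(\<Sum>c<card C. 3 ^ c) \<le> (\<Sum>c\<in>C. 3 ^ c :: nat)"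
    and "(\<Sum>c<card C. 3 ^ c) = (\<Sum>c\<in>C. 3 ^ c :: nat) \<Longrightarrow> C = {..<card C}"
proof -
  have "(\<Sum>c<card C. 3 ^ c) \<le> (\<Sum>c\<in>C. 3 ^ c :: nat) \<and>
    ((\<Sum>c<card C. 3 ^ c) = (\<Sum>c\<in>C. 3 ^ c :: nat) \<longrightarrow> C = {..<card C})" using assms
  proof (induction "card C" arbitrary: C)
    case 0 thus ?case by simp
  next
    case (Suc m)
    define M where "M = Max C"
    have ne: "C \<noteq> {}" using Suc by auto
    have M: "M \<in> C" unfolding M_def using Suc ne by simp
    have "C \<subseteq> {..M}" unfolding M_def using Suc by auto
    hence "card C \<le> Suc M" using card_mono[of "{..M}" C] by simp
    hence mM: "m \<le> M" using Suc by simp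
    have c: "card (C - {M}) = m" using Suc M by simp
    have IH: "(\<Sum>c<m. 3 ^ c) \<le> (\<Sum>c\<in>C - {M}. 3 ^ c :: nat)"
      "(\<Sum>c<m. 3 ^ c) = (\<Sum>c\<in>C - {M}. 3 ^ c :: nat) \<Longrightarrow> C - {M} = {..<m}"
      using Suc.hyps(1)[of "C - {M}"] c Suc.prems by auto
    have s: "(\<Sum>c\<in>C. 3 ^ c) = 3 ^ M + (\<Sum>c\<in>C - {M}. 3 ^ c :: nat)"
      using M Suc.prems by (simp add: sum.remove)
    have s': "(\<Sum>c<card C. 3 ^ c) = 3 ^ m + (\<Sum>c<m. 3 ^ c :: nat)" using Suc.hyps(2)[symmetric] by simp
    have p: "(3::nat) ^ m \<le> 3 ^ M" using mM by (simp add: power_increasing)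
    show ?case
    proof (intro conjI impI)
      show "(\<Sum>c<card C. 3 ^ c) \<le> (\<Sum>c\<in>C. 3 ^ c :: nat)" using s s' p IH by linarith
      assume eq: "(\<Sum>c<card C. 3 ^ c) = (\<Sum>c\<in>C. 3 ^ c :: nat)"
      hence 1: "(\<Sum>c<m. 3 ^ c) = (\<Sum>c\<in>C - {M}. 3 ^ c :: nat)" and "(3::nat) ^ m = 3 ^ M"
        using s s' p IH(1) by linarith+
      hence "m = M" by simp
      moreover have "C = insert M (C - {M})" using M by auto
      ultimately show "C = {..<card C}" using IH(2)[OF 1] Suc.hyps(2)[symmetric] by (auto simp: lessThan_Suc)
    qed
  qed
  thus "(\<Sum>c<card C. 3 ^ c) \<le> (\<Sum>c\<in>C. 3 ^ c :: nat)"
    "(\<Sum>c<card C. 3 ^ c) = (\<Sum>c\<in>C. 3 ^ c :: nat) \<Longrightarrow> C = {..<card C}" by auto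
qed

lemma geometric_3: "2 * (\<Sum>c<m. 3 ^ c) = 3 ^ m - (1::nat)"
proof (induction m)
  case (Suc m)
  have "(1::nat) \<le> 3 ^ m" by simp
  thus ?case using Suc by (simp add: algebra_simps)
qed simp

locale partition_shape =
  fixes \<eta> :: "nat \<Rightarrow> nat"
  assumes finite_support: "finite {j. \<eta> j \<noteq> 0}" and decreasing: "\<eta> (Suc j) \<le> \<eta> j"
begin

lemma antimono: "i \<le> j \<Longrightarrow> \<eta> j \<le> \<eta> i"
  using lift_Suc_antimono_le[of \<eta> i j] decreasing by blast

lemma cells_Sigma: "cells \<eta> = (SIGMA j:{j. \<eta> j \<noteq> 0}. {..<\<eta> j})"
  by (auto simp: cells_def)

lemma finite_cells [simp]: "finite (cells \<eta>)"
  unfolding cells_Sigma using finite_support by auto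

lemma card_cells: "card (cells \<eta>) = tot \<eta>"
  unfolding cells_Sigma tot_def using finite_support by (simp add: card_SigmaI)

text \<open>A cell of column c has weight 2 * 3^c, and a row of length x sums to 3^x - 1. This is
  the meaning of \<open>ent\<close> on diagrams.\<close>

lemma sum_cells: "(\<Sum>x\<in>cells \<eta>. 2 * 3 ^ snd x) = ent \<eta>"
proof -
  have "(\<Sum>x\<in>cells \<eta>. 2 * 3 ^ snd x) = (\<Sum>j | \<eta> j \<noteq> 0. \<Sum>c<\<eta> j. 2 * 3 ^ c :: nat)"
    unfolding cells_Sigma using finite_support by (subst sum.Sigma) (auto simp: case_prod_beta)
  thus ?thesis by (simp add: ent_def sum_distrib_left[symmetric] geometric_3)
qed

lemma finite_col_perms [simp]: "finite (col_perms \<eta>)"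
  by (rule finite_subset[OF _ finite_permutations[OF finite_cells]]) (auto simp: col_perms_def)

lemma col_permsD: "\<kappa> \<in> col_perms \<eta> \<Longrightarrow> \<kappa> permutes cells \<eta>" "\<kappa> \<in> col_perms \<eta> \<Longrightarrow> snd (\<kappa> x) = snd x"
  unfolding col_perms_def by blast+

lemma col_perms_id: "id \<in> col_perms \<eta>"
  by (simp add: col_perms_def permutes_id)

lemma col_perms_comp: "\<kappa> \<in> col_perms \<eta> \<Longrightarrow> \<kappa>' \<in> col_perms \<eta> \<Longrightarrow> \<kappa> \<circ> \<kappa>' \<in> col_perms \<eta>"
proof -
  assume k: "\<kappa> \<in> col_perms \<eta>" "\<kappa>' \<in> col_perms \<eta>"
  have "\<kappa> \<circ> \<kappa>' permutes cells \<eta>" using col_permsD(1) k permutes_compose by blast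
  moreover have "snd ((\<kappa> \<circ> \<kappa>') x) = snd x" for x
    by (simp only: comp_def col_permsD(2)[OF k(1)] col_permsD(2)[OF k(2)])
  ultimately show ?thesis unfolding col_perms_def by blast
qed

lemma col_perms_inv: "\<kappa> \<in> col_perms \<eta> \<Longrightarrow> Hilbert_Choice.inv \<kappa> \<in> col_perms \<eta>"
proof -
  assume k: "\<kappa> \<in> col_perms \<eta>"
  have "snd (Hilbert_Choice.inv \<kappa> x) = snd x" for x
    using col_permsD(2)[OF k, of "Hilbert_Choice.inv \<kappa> x"] permutes_inverses(1)[OF col_permsD(1)[OF k], of x] by simp
  thus ?thesis using permutes_inv[OF col_permsD(1)[OF k]] by (simp add: col_perms_def)
qed

lemma sign_comp: "\<kappa> \<in> col_perms \<eta> \<Longrightarrow> \<kappa>' \<in> col_perms \<eta> \<Longrightarrow> sign (\<kappa> \<circ> \<kappa>') = sign \<kappa> * sign \<kappa>'"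
proof -
  assume k: "\<kappa> \<in> col_perms \<eta>" "\<kappa>' \<in> col_perms \<eta>"
  have "permutation \<kappa>" "permutation \<kappa>'"
    using permutes_imp_permutation[OF finite_cells col_permsD(1)] k by auto
  thus ?thesis by (rule sign_compose)
qed

section \<open>Vanishing and factorization of antisymmetrized codeterminants\<close>

definition col_inj :: "(nat \<times> nat \<Rightarrow> nat) \<Rightarrow> bool" where
  "col_inj f \<longleftrightarrow> (\<forall>x\<in>cells \<eta>. \<forall>y\<in>cells \<eta>. snd x = snd y \<longrightarrow> f x = f y \<longrightarrow> x = y)"

text \<open>If f puts two cells of one column into the same row, composing with their transposition
  leaves every content unchanged and flips every sign.\<close>

lemma antisym_zero:
  assumes f: "\<not> col_inj f"
  shows "(\<Sum>\<sigma>\<in>col_perms \<eta>. sign \<sigma> * of_bool (content f (W \<circ> \<sigma>) (cells \<eta>) = T)) = (0::int)"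
proof -
  obtain x y where xy: "x \<in> cells \<eta>" "y \<in> cells \<eta>" "snd x = snd y" "f x = f y" "x \<noteq> y"
    using f by (auto simp: col_inj_def)
  define \<tau> where "\<tau> = Transposition.transpose x y"
  have t: "\<tau> \<in> col_perms \<eta>"
    using xy by (auto simp: \<tau>_def col_perms_def permutes_swap_id Transposition.transpose_def)
  have tt: "\<tau> \<circ> \<tau> = id" by (simp add: \<tau>_def)
  have sg: "sign \<tau> = -1" using xy by (simp add: \<tau>_def sign_swap_id)
  have c: "content f (W \<circ> (\<sigma> \<circ> \<tau>)) (cells \<eta>) = content f (W \<circ> \<sigma>) (cells \<eta>)" for \<sigma>
  proof (rule content_bij)
    show "bij_betw \<tau> (cells \<eta>) (cells \<eta>)" using col_permsD(1)[OF t] by (rule permutes_imp_bij)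
    show "f (\<tau> z) = f z" for z using xy by (auto simp: \<tau>_def Transposition.transpose_def)
    show "(W \<circ> (\<sigma> \<circ> \<tau>)) (\<tau> z) = (W \<circ> \<sigma>) z" for z using fun_cong[OF tt, of z] by simp
  qed
  let ?s = "\<lambda>\<sigma>. sign \<sigma> * of_bool (content f (W \<circ> \<sigma>) (cells \<eta>) = T) :: int"
  have "(\<Sum>\<sigma>\<in>col_perms \<eta>. ?s \<sigma>) = (\<Sum>\<sigma>\<in>col_perms \<eta>. ?s (\<sigma> \<circ> \<tau>))"
    by (rule sum.reindex_bij_witness[of _ "\<lambda>\<sigma>. \<sigma> \<circ> \<tau>" "\<lambda>\<sigma>. \<sigma> \<circ> \<tau>"])
      (use t tt in \<open>auto simp: comp_assoc intro: col_perms_comp\<close>)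
  also have "\<dots> = (\<Sum>\<sigma>\<in>col_perms \<eta>. - ?s \<sigma>)"
    by (rule sum.cong) (simp_all add: c sign_comp[OF _ t] sg)
  also have "\<dots> = - (\<Sum>\<sigma>\<in>col_perms \<eta>. ?s \<sigma>)" by (rule sum_negf)
  finally show ?thesis by simp
qed

text \<open>Under such an f the cells assigned to row j lie in \<mu> j different columns, so their
  weight is at least that of the first \<mu> j columns. Summing over rows gives the inequality, and
  equality forces every row to occupy an initial segment of columns.\<close>

lemma col_inj_columns:
  assumes f: "col_inj f" and sh: "\<And>j. card {x\<in>cells \<eta>. f x = j} = \<mu> j" and fin: "finite {j. \<mu> j \<noteq> 0}"
  shows "ent \<mu> \<le> ent \<eta>"
    and "ent \<mu> = ent \<eta> \<Longrightarrow> x \<in> cells \<eta> \<Longrightarrow> snd x < \<mu> (f x)"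
    and "ent \<mu> = ent \<eta> \<Longrightarrow> c < \<mu> j \<Longrightarrow> \<exists>x\<in>cells \<eta>. f x = j \<and> snd x = c"
proof -
  define R where "R j = {x\<in>cells \<eta>. f x = j}" for j
  have inj: "inj_on snd (R j)" for j using f by (auto simp: col_inj_def R_def inj_on_def)
  have finR: "finite (R j)" for j by (simp add: R_def)
  have cR: "card (snd ` R j) = \<mu> j" for j using card_image[OF inj] sh by (simp add: R_def)
  have Rs: "f x \<in> {j. \<mu> j \<noteq> 0}" if "x \<in> cells \<eta>" for x
  proof -
    have "x \<in> R (f x)" using that by (simp add: R_def)
    hence "card (R (f x)) \<noteq> 0" using finR by auto
    thus ?thesis using sh by (simp add: R_def)
  qed
  have split: "ent \<eta> = (\<Sum>j | \<mu> j \<noteq> 0. 2 * (\<Sum>c\<in>snd ` R j. 3 ^ c))"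
  proof -
    have "ent \<eta> = (\<Sum>j | \<mu> j \<noteq> 0. \<Sum>x | x \<in> cells \<eta> \<and> f x = j. 2 * 3 ^ snd x)"
      unfolding sum_cells[symmetric] using Rs by (intro sum.group[symmetric] fin finite_cells) auto
    also have "\<dots> = (\<Sum>j | \<mu> j \<noteq> 0. 2 * (\<Sum>c\<in>snd ` R j. 3 ^ c))"
      by (rule sum.cong) (simp_all add: R_def[symmetric] sum.reindex[OF inj] sum_distrib_left)
    finally show ?thesis .
  qed
  have ent: "ent \<mu> = (\<Sum>j | \<mu> j \<noteq> 0. 2 * (\<Sum>c<card (snd ` R j). 3 ^ c))"
    by (simp add: ent_def cR geometric_3)
  have le: "2 * (\<Sum>c<card (snd ` R j). 3 ^ c) \<le> 2 * (\<Sum>c\<in>snd ` R j. 3 ^ c :: nat)" for j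
    using sum_powers_initial_segment(1)[of "snd ` R j"] finR by simp
  show "ent \<mu> \<le> ent \<eta>" unfolding split ent by (rule sum_mono) (rule le)
  assume eq: "ent \<mu> = ent \<eta>"
  have seg: "snd ` R j = {..<\<mu> j}" for j
  proof (cases "\<mu> j = 0")
    case True
    hence "R j = {}" using sh[of j] finR[of j] by (simp add: R_def)
    thus ?thesis using True by simp
  next
    case False
    have "2 * (\<Sum>c<card (snd ` R j). 3 ^ c) = 2 * (\<Sum>c\<in>snd ` R j. 3 ^ c :: nat)"
      using eq unfolding split ent
      by (rule sum_mono_inv) (use le fin False in auto)
    thus ?thesis using sum_powers_initial_segment(2)[of "snd ` R j"] finR cR by simp
  qed
  show "snd x < \<mu> (f x)" if "x \<in> cells \<eta>"
  proof -
    have "snd x \<in> snd ` R (f x)" using that by (auto simp: R_def)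
    thus ?thesis unfolding seg by simp
  qed
  show "\<exists>x\<in>cells \<eta>. f x = j \<and> snd x = c" if "c < \<mu> j"
  proof -
    have "c \<in> snd ` R j" using that unfolding seg by simp
    thus ?thesis by (auto simp: R_def)
  qed
qed

lemma col_sum_eq:
  "(col_sum \<eta> U W S T :: 'c::field) = of_int (\<Sum>f\<in>row_maps S U (cells \<eta>).
     \<Sum>\<sigma>\<in>col_perms \<eta>. sign \<sigma> * of_bool (content f (W \<circ> \<sigma>) (cells \<eta>) = T))"
proof -
  have "codet S T (cells \<eta>, U, W \<circ> \<sigma>) = (of_int (\<Sum>f\<in>row_maps S U (cells \<eta>). of_bool (content f (W \<circ> \<sigma>) (cells \<eta>) = T)) :: 'c)" for \<sigma>
  proof -
    have "row_maps S U (cells \<eta>) \<inter> row_maps T (W \<circ> \<sigma>) (cells \<eta>) =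
        row_maps S U (cells \<eta>) \<inter> {f. content f (W \<circ> \<sigma>) (cells \<eta>) = T}" by (auto simp: row_maps_def)
    thus ?thesis by (simp add: codet_def sum_of_bool_eq finite_row_maps Int_def)
  qed
  note cd = this
  have "(col_sum \<eta> U W S T :: 'c) = of_int (\<Sum>\<sigma>\<in>col_perms \<eta>. sign \<sigma> *
      (\<Sum>f\<in>row_maps S U (cells \<eta>). of_bool (content f (W \<circ> \<sigma>) (cells \<eta>) = T)))"
    unfolding col_sum_def of_int_sum[of _ "col_perms \<eta>"] of_int_mult cd ..
  also have "(\<Sum>\<sigma>\<in>col_perms \<eta>. sign \<sigma> * (\<Sum>f\<in>row_maps S U (cells \<eta>). of_bool (content f (W \<circ> \<sigma>) (cells \<eta>) = T)))
    = (\<Sum>f\<in>row_maps S U (cells \<eta>). \<Sum>\<sigma>\<in>col_perms \<eta>. sign \<sigma> * of_bool (content f (W \<circ> \<sigma>) (cells \<eta>) = T) :: int)"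
    unfolding sum_distrib_left by (rule sum.swap)
  finally show ?thesis .
qed

lemma row_maps_size: "f \<in> row_maps S U (cells \<eta>) \<Longrightarrow> card {x\<in>cells \<eta>. f x = j} = shape S j"
  using row_mapsD(1)[of f S U "cells \<eta>"] size_content[of f U "cells \<eta>" j] by (simp add: shape_def)

text \<open>No row map can be injective on columns, so every inner sum vanishes. If
  \<open>ent\<close> is larger this is the inequality of \<open>col_inj_columns\<close>; in case of
  equality an injective map would make all column lengths agree, and a partition is determined by
  them.\<close>

lemma col_sum_zero:
  assumes rows: "rows S" and ne: "shape S \<noteq> \<eta>"
    and ent: "ent \<eta> < ent (shape S) \<or> ent (shape S) = ent \<eta> \<and> (\<forall>j. shape S (Suc j) \<le> shape S j)"
  shows "col_sum \<eta> U W S T = 0"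
proof -
  have fin: "finite {j. shape S j \<noteq> 0}" using rows by (simp add: rows_shape)
  have "\<not> col_inj f" if f: "f \<in> row_maps S U (cells \<eta>)" for f
  proof
    assume inj: "col_inj f"
    note cc = col_inj_columns[OF inj row_maps_size[OF f] fin]
    have eq: "ent (shape S) = ent \<eta>" and dec: "\<And>j. shape S (Suc j) \<le> shape S j" using ent cc(1) by auto
    interpret mu: partition_shape "shape S" using fin dec by unfold_locales
    \<comment> \<open>Both sides count the cells of column c, once by \<open>fst\<close> and once by
      f.\<close>
    have card_eq: "card {j. c < \<eta> j} = card {j. c < shape S j}" for c
    proof -
      have 1: "bij_betw fst {x\<in>cells \<eta>. snd x = c} {j. c < \<eta> j}"
        by (rule bij_betwI[of _ _ _ "\<lambda>j. (j, c)"]) (auto simp: cells_def)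
      have 2: "bij_betw f {x\<in>cells \<eta>. snd x = c} {j. c < shape S j}"
        unfolding bij_betw_def
      proof
        show "inj_on f {x\<in>cells \<eta>. snd x = c}" using inj by (auto simp: inj_on_def col_inj_def)
        show "f ` {x\<in>cells \<eta>. snd x = c} = {j. c < shape S j}"
          using cc(2)[OF eq] cc(3)[OF eq] by fastforce
      qed
      show ?thesis using bij_betw_same_card[OF 1] bij_betw_same_card[OF 2] by simp
    qed
    have seg: "c < \<mu> j \<longleftrightarrow> j < card {j. c < \<mu> j}" if "partition_shape \<mu>" for \<mu> c j
    proof -
      interpret p: partition_shape \<mu> by fact
      have fin: "finite {j. c < \<mu> j}" by (rule finite_subset[OF _ p.finite_support]) auto
      have d: "i \<in> {j. c < \<mu> j}" if "j \<in> {j. c < \<mu> j}" "i \<le> j" for i j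
        using p.antimono[OF that(2)] that(1) by simp
      show ?thesis
      proof
        assume "c < \<mu> j"
        hence "{..j} \<subseteq> {j. c < \<mu> j}" using d by auto
        from card_mono[OF fin this] show "j < card {j. c < \<mu> j}" by simp
      next
        assume j: "j < card {j. c < \<mu> j}"
        show "c < \<mu> j"
        proof (rule ccontr)
          assume "\<not> c < \<mu> j"
          hence "{j. c < \<mu> j} \<subseteq> {..<j}" using d[of _ j] by (auto simp: not_less) (meson not_less)
          from card_mono[OF _ this] j show False by simp
        qed
      qed
    qed
    have "c < \<eta> j \<longleftrightarrow> c < shape S j" for c j
      using seg[OF partition_shape_axioms, of c j] seg[OF mu.partition_shape_axioms, of c j] card_eq by simp
    hence "\<eta> j = shape S j" for j by (metis linorder_neqE_nat nat_neq_iff)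
    thus False using ne by auto
  qed
  hence "(\<Sum>f\<in>row_maps S U (cells \<eta>). \<Sum>\<sigma>\<in>col_perms \<eta>.
      sign \<sigma> * of_bool (content f (W \<circ> \<sigma>) (cells \<eta>) = T)) = (0::int)"
    using antisym_zero by (intro sum.neutral) blast
  thus ?thesis unfolding col_sum_eq by (simp only: of_int_0)
qed

text \<open>With row sizes \<eta> equality holds in \<open>col_inj_columns\<close>, so (f x, snd x)
  is again a cell and x maps to it by a column permutation.\<close>

lemma col_inj_bij:
  "bij_betw (\<lambda>\<kappa>. restrict (fst \<circ> \<kappa>) (cells \<eta>)) (col_perms \<eta>)
     {f \<in> cells \<eta> \<rightarrow>\<^sub>E UNIV. col_inj f \<and> (\<forall>j. card {x\<in>cells \<eta>. f x = j} = \<eta> j)}"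
  (is "bij_betw ?r _ ?F")
proof -
  have in_F: "?r \<kappa> \<in> ?F" if k: "\<kappa> \<in> col_perms \<eta>" for \<kappa>
  proof -
    have inj: "inj \<kappa>" using col_permsD(1)[OF k] permutes_inj by blast
    have "card {x\<in>cells \<eta>. ?r \<kappa> x = j} = \<eta> j" for j
    proof -
      have "bij_betw \<kappa> {x\<in>cells \<eta>. ?r \<kappa> x = j} {x\<in>cells \<eta>. fst x = j}" (is "bij_betw _ ?A _")
        unfolding bij_betw_def
      proof
        show "inj_on \<kappa> {x\<in>cells \<eta>. ?r \<kappa> x = j}" using inj inj_on_subset by blast
        show "\<kappa> ` {x\<in>cells \<eta>. ?r \<kappa> x = j} = {x\<in>cells \<eta>. fst x = j}"
        proof (intro equalityI subsetI)
          fix y assume "y \<in> \<kappa> ` {x\<in>cells \<eta>. ?r \<kappa> x = j}"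
          thus "y \<in> {x\<in>cells \<eta>. fst x = j}" using permutes_in_image[OF col_permsD(1)[OF k]] by auto
        next
          fix y assume y: "y \<in> {x\<in>cells \<eta>. fst x = j}"
          then obtain x where "x \<in> cells \<eta>" "y = \<kappa> x" using permutes_image[OF col_permsD(1)[OF k]] by blast
          thus "y \<in> \<kappa> ` {x\<in>cells \<eta>. ?r \<kappa> x = j}" using y by auto
        qed
      qed
      from bij_betw_same_card[OF this] have "card ?A = card {x\<in>cells \<eta>. fst x = j}" .
      also have "{x\<in>cells \<eta>. fst x = j} = Pair j ` {..<\<eta> j}" by (auto simp: cells_def)
      also have "card \<dots> = \<eta> j" by (subst card_image) (auto simp: inj_on_def)
      finally show ?thesis .
    qed
    moreover have "col_inj (?r \<kappa>)"
      unfolding col_inj_def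
    proof (intro ballI impI)
      fix x y assume xy: "x \<in> cells \<eta>" "y \<in> cells \<eta>" "snd x = snd y" "?r \<kappa> x = ?r \<kappa> y"
      have "fst (\<kappa> x) = fst (\<kappa> y)" using xy by simp
      moreover have "snd (\<kappa> x) = snd (\<kappa> y)" using xy(3) by (simp only: col_permsD(2)[OF k])
      ultimately have "\<kappa> x = \<kappa> y" by (rule prod_eqI)
      thus "x = y" using inj by (simp add: inj_eq)
    qed
    ultimately show ?thesis by auto
  qed
  have inj: "inj_on ?r (col_perms \<eta>)"
  proof (rule inj_onI)
    fix \<kappa> \<kappa>' assume k: "\<kappa> \<in> col_perms \<eta>" "\<kappa>' \<in> col_perms \<eta>" "?r \<kappa> = ?r \<kappa>'"
    show "\<kappa> = \<kappa>'"
    proof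
      fix x show "\<kappa> x = \<kappa>' x"
      proof (cases "x \<in> cells \<eta>")
        case True
        thus ?thesis using fun_cong[OF k(3), of x] col_permsD(2)[OF k(1), of x] col_permsD(2)[OF k(2), of x]
          by (simp add: prod_eq_iff)
      next
        case False
        thus ?thesis using permutes_not_in[OF col_permsD(1)[OF k(1)]] permutes_not_in[OF col_permsD(1)[OF k(2)]] by simp
      qed
    qed
  qed
  have "f \<in> ?r ` col_perms \<eta>" if f: "f \<in> ?F" for f
  proof -
    have ci: "col_inj f" and sz: "\<And>j. card {x\<in>cells \<eta>. f x = j} = \<eta> j" using f by auto
    note cc = col_inj_columns[OF ci sz finite_support]
    define \<kappa> where "\<kappa> x = (if x \<in> cells \<eta> then (f x, snd x) else x)" for x
    have "\<kappa> ` cells \<eta> \<subseteq> cells \<eta>" using cc(2) by (auto simp: \<kappa>_def cells_def)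
    moreover have ij: "inj_on \<kappa> (cells \<eta>)" using ci by (auto simp: inj_on_def \<kappa>_def col_inj_def)
    ultimately have "bij_betw \<kappa> (cells \<eta>) (cells \<eta>)"
      using endo_inj_surj[OF finite_cells] by (simp add: bij_betw_def)
    hence "\<kappa> permutes cells \<eta>" by (rule bij_imp_permutes) (simp add: \<kappa>_def)
    hence "\<kappa> \<in> col_perms \<eta>" by (auto simp: col_perms_def \<kappa>_def)
    moreover have "f = ?r \<kappa>" using f by (auto simp: fun_eq_iff \<kappa>_def PiE_iff extensional_def)
    ultimately show ?thesis by blast
  qed
  thus ?thesis using in_F inj unfolding bij_betw_def by blast
qed

lemma content_col_perm:
  assumes k: "\<kappa> \<in> col_perms \<eta>"
  shows "content (restrict (fst \<circ> \<kappa>) (cells \<eta>)) u (cells \<eta>) = content fst (u \<circ> Hilbert_Choice.inv \<kappa>) (cells \<eta>)"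
proof (rule content_bij[symmetric])
  show "bij_betw \<kappa> (cells \<eta>) (cells \<eta>)" using col_permsD(1)[OF k] by (rule permutes_imp_bij)
  show "fst (\<kappa> x) = restrict (fst \<circ> \<kappa>) (cells \<eta>) x" if "x \<in> cells \<eta>" for x using that by simp
  show "(u \<circ> Hilbert_Choice.inv \<kappa>) (\<kappa> x) = u x" for x
    using permutes_inverses(2)[OF col_permsD(1)[OF k]] by simp
qed

text \<open>Only row maps of the form \<open>fst \<circ> \<kappa>\<close> contribute. Substituting
  \<sigma> \<circ> \<kappa> for \<sigma> then moves the sign of \<kappa> to the first factor and
  separates the two sums.\<close>

lemma col_sum_factor:
  assumes S: "shape S = \<eta>"
  shows "col_sum \<eta> U W S T = of_int (col_det \<eta> U S * col_det \<eta> W T)"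
proof -
  let ?inv = "\<lambda>\<kappa>. Hilbert_Choice.inv \<kappa> :: nat \<times> nat \<Rightarrow> nat \<times> nat"
  let ?D = "\<lambda>f. \<Sum>\<sigma>\<in>col_perms \<eta>. sign \<sigma> * of_bool (content f (W \<circ> \<sigma>) (cells \<eta>) = T) :: int"
  let ?F = "{f \<in> cells \<eta> \<rightarrow>\<^sub>E UNIV. col_inj f \<and> (\<forall>j. card {x\<in>cells \<eta>. f x = j} = \<eta> j)}"
  have finF: "finite ?F" using bij_betw_finite[OF col_inj_bij] by simp
  have "(\<Sum>f\<in>row_maps S U (cells \<eta>). ?D f) = (\<Sum>f\<in>{f\<in>row_maps S U (cells \<eta>). col_inj f}. ?D f)"
    by (rule sum.mono_neutral_right) (use antisym_zero in \<open>auto simp: finite_row_maps simp del: sum_mult_of_bool_eq\<close>)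
  also have "{f\<in>row_maps S U (cells \<eta>). col_inj f} = {f\<in>?F. content f U (cells \<eta>) = S}"
    using row_maps_size[of _ S U] S by (auto simp: row_maps_def)
  also have "(\<Sum>f\<in>\<dots>. ?D f) = (\<Sum>f\<in>?F. of_bool (content f U (cells \<eta>) = S) * ?D f)"
    unfolding sum.inter_filter[OF finF]
    by (rule sum.cong[OF refl]) (simp del: sum_mult_of_bool_eq)
  also have "\<dots> = (\<Sum>\<kappa>\<in>col_perms \<eta>. of_bool (content fst (U \<circ> ?inv \<kappa>) (cells \<eta>) = S) *
      (\<Sum>\<sigma>\<in>col_perms \<eta>. sign \<sigma> * of_bool (content fst ((W \<circ> \<sigma>) \<circ> ?inv \<kappa>) (cells \<eta>) = T)))"
    unfolding sum.reindex_bij_betw[OF col_inj_bij, symmetric]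
    by (rule sum.cong) (simp_all add: content_col_perm)
  also have "\<dots> = (\<Sum>\<kappa>\<in>col_perms \<eta>. of_bool (content fst (U \<circ> \<kappa>) (cells \<eta>) = S) *
      (\<Sum>\<sigma>\<in>col_perms \<eta>. sign \<sigma> * of_bool (content fst ((W \<circ> \<sigma>) \<circ> \<kappa>) (cells \<eta>) = T)))"
  proof -
    have ii: "?inv (?inv \<kappa>) = \<kappa>" if "\<kappa> \<in> col_perms \<eta>" for \<kappa>
      using permutes_inv_inv[OF col_permsD(1)[OF that]] .
    show ?thesis
      by (rule sum.reindex_bij_witness[of _ ?inv ?inv]) (auto simp: ii col_perms_inv)
  qed
  also have "\<dots> = (\<Sum>\<kappa>\<in>col_perms \<eta>. of_bool (content fst (U \<circ> \<kappa>) (cells \<eta>) = S) * (sign \<kappa> * col_det \<eta> W T))"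
  proof (rule sum.cong[OF refl])
    fix \<kappa> assume k: "\<kappa> \<in> col_perms \<eta>"
    note p = permutes_inv_o[OF col_permsD(1)[OF k]]
    have sq: "sign \<kappa> * sign \<kappa> = (1::int)" by (simp add: sign_def)
    have "col_det \<eta> W T = (\<Sum>\<sigma>\<in>col_perms \<eta>. sign (\<sigma> \<circ> \<kappa>) * of_bool (content fst (W \<circ> (\<sigma> \<circ> \<kappa>)) (cells \<eta>) = T))"
      unfolding col_det_def
      by (rule sum.reindex_bij_witness[of _ "\<lambda>\<sigma>. \<sigma> \<circ> \<kappa>" "\<lambda>\<sigma>. \<sigma> \<circ> ?inv \<kappa>"])
        (use p k in \<open>auto simp: comp_assoc intro: col_perms_comp col_perms_inv\<close>)
    also have "\<dots> = sign \<kappa> * (\<Sum>\<sigma>\<in>col_perms \<eta>. sign \<sigma> * of_bool (content fst ((W \<circ> \<sigma>) \<circ> \<kappa>) (cells \<eta>) = T))"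
      unfolding sum_distrib_left by (rule sum.cong) (auto simp: sign_comp[OF _ k] comp_assoc)
    finally have "sign \<kappa> * col_det \<eta> W T = (sign \<kappa> * sign \<kappa>) * (\<Sum>\<sigma>\<in>col_perms \<eta>. sign \<sigma> * of_bool (content fst ((W \<circ> \<sigma>) \<circ> \<kappa>) (cells \<eta>) = T))"
      by (simp only: mult.assoc)
    thus "of_bool (content fst (U \<circ> \<kappa>) (cells \<eta>) = S) *
        (\<Sum>\<sigma>\<in>col_perms \<eta>. sign \<sigma> * of_bool (content fst ((W \<circ> \<sigma>) \<circ> \<kappa>) (cells \<eta>) = T)) =
        of_bool (content fst (U \<circ> \<kappa>) (cells \<eta>) = S) * (sign \<kappa> * col_det \<eta> W T)"
      unfolding sq by simp
  qed
  also have "\<dots> = col_det \<eta> U S * col_det \<eta> W T"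
    unfolding col_det_def[of \<eta> U S] sum_distrib_right by (rule sum.cong) simp_all
  finally show ?thesis unfolding col_sum_eq by (rule arg_cong)
qed

subsection \<open>Triangularity\<close>

definition fill :: "(nat \<Rightarrow> 'a::linorder multiset) \<Rightarrow> nat \<times> nat \<Rightarrow> 'a" where
  "fill S = (\<lambda>(j, c). sorted_list_of_multiset (S j) ! c)"

text \<open>The cumulative counts that define the dominance order on tabloids.\<close>

definition rank_sum :: "nat \<Rightarrow> 'a::linorder \<Rightarrow> (nat \<Rightarrow> 'a multiset) \<Rightarrow> nat" where
  "rank_sum j v S = (\<Sum>i<j. size {#a \<in># S i. a \<le> v#})"

lemma length_sorted: "length (sorted_list_of_multiset M) = size M"
  by (metis mset_sorted_list_of_multiset size_mset)

lemma content_fill: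
  assumes S: "shape S = \<eta>"
  shows "content fst (fill S) (cells \<eta>) = S"
proof
  fix j
  have "{x\<in>cells \<eta>. fst x = j} = Pair j ` {..<\<eta> j}" by (auto simp: cells_def)
  hence "content fst (fill S) (cells \<eta>) j = image_mset (fill S) (image_mset (Pair j) (mset_set {..<\<eta> j}))"
    unfolding content_def by (simp add: image_mset_mset_set inj_on_def)
  also have "\<dots> = image_mset (\<lambda>c. sorted_list_of_multiset (S j) ! c) (mset_set {0..<length (sorted_list_of_multiset (S j))})"
    using S by (auto simp: multiset.map_comp comp_def fill_def length_sorted shape_def atLeast0LessThan)
  also have "\<dots> = mset (sorted_list_of_multiset (S j))"
    by (metis map_nth mset_map mset_upt)
  finally show "content fst (fill S) (cells \<eta>) j = S j" by simp
qed

lemma fill_mem: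
  assumes "shape S = \<eta>" "x \<in> cells \<eta>"
  shows "fill S x \<in># S (fst x)"
proof -
  have "fill S x \<in> fill S ` {y\<in>cells \<eta>. fst y = fst x}" using assms by blast
  thus ?thesis using content_fill[OF assms(1)] set_content[OF finite_cells, of fst "fill S" "fst x"] by simp
qed

lemma sorted_nth_le_iff:
  fixes xs :: "'a::linorder list"
  assumes "sorted xs" "c < length xs"
  shows "xs ! c \<le> v \<longleftrightarrow> c < size {#a \<in># mset xs. a \<le> v#}"
    and "xs ! c < v \<longleftrightarrow> c < size {#a \<in># mset xs. a < v#}"
proof -
  have key: "P (xs ! c) \<longleftrightarrow> c < size {#a \<in># mset xs. P a#}" if P: "\<And>a b. a \<le> b \<Longrightarrow> P b \<Longrightarrow> P a" for P
  proof -
    have sz: "size {#a \<in># mset xs. P a#} = card {i. i < length xs \<and> P (xs ! i)}"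
      by (simp add: length_filter_conv_card flip: mset_filter)
    show ?thesis
    proof
      assume "P (xs ! c)"
      hence "{..c} \<subseteq> {i. i < length xs \<and> P (xs ! i)}"
        using assms P by (auto intro: sorted_nth_mono)
      from card_mono[OF _ this] show "c < size {#a \<in># mset xs. P a#}" unfolding sz by simp
    next
      assume c: "c < size {#a \<in># mset xs. P a#}"
      show "P (xs ! c)"
      proof (rule ccontr)
        assume n: "\<not> P (xs ! c)"
        have "{i. i < length xs \<and> P (xs ! i)} \<subseteq> {..<c}"
        proof
          fix i assume i: "i \<in> {i. i < length xs \<and> P (xs ! i)}"
          show "i \<in> {..<c}"
          proof (rule ccontr)
            assume "i \<notin> {..<c}"
            hence "xs ! c \<le> xs ! i" using assms i by (auto intro: sorted_nth_mono)
            thus False using P n i by blast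
          qed
        qed
        from card_mono[OF _ this] c show False unfolding sz by simp
      qed
    qed
  qed
  show "xs ! c \<le> v \<longleftrightarrow> c < size {#a \<in># mset xs. a \<le> v#}" by (rule key) simp
  show "xs ! c < v \<longleftrightarrow> c < size {#a \<in># mset xs. a < v#}" by (rule key) simp
qed

definition col_strict :: "(nat \<times> nat \<Rightarrow> 'a::linorder) \<Rightarrow> bool" where
  "col_strict U \<longleftrightarrow> (\<forall>i j c. c < \<eta> j \<longrightarrow> i < j \<longrightarrow> U (i, c) < U (j, c))"

lemma col_strictD: "col_strict U \<Longrightarrow> c < \<eta> j \<Longrightarrow> i < j \<Longrightarrow> U (i, c) < U (j, c)"
  by (simp add: col_strict_def)

lemma fill_column_strict:
  assumes S: "shape S = \<eta>" "standard S"
  shows "col_strict (fill S)"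
  unfolding col_strict_def
proof (intro allI impI)
  fix i j c assume "c < \<eta> j" "i < j"
  thus "fill S (i, c) < fill S (j, c)"
proof (induction j)
  case (Suc j)
  have c: "c < \<eta> j" using Suc.prems decreasing[of j] by simp
  let ?xs = "sorted_list_of_multiset (S j)" and ?ys = "sorted_list_of_multiset (S (Suc j))"
  have len: "c < length ?xs" "c < length ?ys" using c Suc.prems S(1) by (auto simp: length_sorted shape_def)
  have "c < size {#b \<in># S (Suc j). b \<le> ?ys ! c#}"
    using sorted_nth_le_iff(1)[OF _ len(2), of "?ys ! c"] by simp
  also have "\<dots> \<le> size {#a \<in># S j. a < ?ys ! c#}" using S(2) by (simp add: standard_def)
  finally have "?xs ! c < ?ys ! c" using sorted_nth_le_iff(2)[OF _ len(1), of "?ys ! c"] by simp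
  hence "fill S (j, c) < fill S (Suc j, c)" by (simp add: fill_def)
  thus ?case using Suc.IH Suc.prems c by (cases "i = j") (auto intro: less_trans)
qed simp
qed

text \<open>Permuting the entries within the columns of a column-strict filling can only lower the
  number of entries \<open>\<le> v\<close> in the first \<open>j\<close> rows, since in each column the cells with small
  entries and the cells in the first rows both form initial segments.\<close>

lemma col_count_le:
  fixes U :: "nat \<times> nat \<Rightarrow> 'a::linorder"
  assumes k: "\<kappa> \<in> col_perms \<eta>" and U: "col_strict U"
  shows "card {x\<in>cells \<eta>. snd x = c \<and> fst x < j \<and> U (\<kappa> x) \<le> v} \<le>
         card {x\<in>cells \<eta>. snd x = c \<and> fst x < j \<and> U x \<le> v}"
proof (cases "\<forall>x\<in>cells \<eta>. snd x = c \<longrightarrow> fst x < j \<longrightarrow> U x \<le> v")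
  case True
  thus ?thesis by (intro card_mono) auto
next
  case False
  then obtain i where i: "(i, c) \<in> cells \<eta>" "i < j" "v < U (i, c)" by (auto simp: not_le)
  have below: "fst x < j" if "x \<in> cells \<eta>" "snd x = c" "U x \<le> v" for x
  proof (rule ccontr)
    assume "\<not> fst x < j"
    hence "i < fst x" using i by simp
    hence "U (i, c) < U (fst x, c)" using col_strictD[OF U] that by (auto simp: cells_def)
    thus False using i that by auto
  qed
  show ?thesis
  proof (rule card_inj_on_le[of \<kappa>])
    show "inj_on \<kappa> {x\<in>cells \<eta>. snd x = c \<and> fst x < j \<and> U (\<kappa> x) \<le> v}"
      using permutes_inj[OF col_permsD(1)[OF k]] inj_on_subset by blast
    show "\<kappa> ` {x\<in>cells \<eta>. snd x = c \<and> fst x < j \<and> U (\<kappa> x) \<le> v} \<subseteq> {x\<in>cells \<eta>. snd x = c \<and> fst x < j \<and> U x \<le> v}"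
    proof (rule image_subsetI)
      fix x assume x: "x \<in> {x\<in>cells \<eta>. snd x = c \<and> fst x < j \<and> U (\<kappa> x) \<le> v}"
      have "\<kappa> x \<in> cells \<eta>" using x permutes_in_image[OF col_permsD(1)[OF k]] by blast
      moreover have "snd (\<kappa> x) = c" using x col_permsD(2)[OF k, of x] by simp
      ultimately show "\<kappa> x \<in> {x\<in>cells \<eta>. snd x = c \<and> fst x < j \<and> U x \<le> v}" using x below by simp
    qed
  qed simp
qed

lemma rank_sum_content:
  "rank_sum j v (content fst u (cells \<eta>)) = card {x\<in>cells \<eta>. fst x < j \<and> u x \<le> v}"
proof -
  have "size {#a \<in># content fst u (cells \<eta>) i. a \<le> v#} = card {x\<in>cells \<eta>. fst x = i \<and> u x \<le> v}" for i
  proof -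
    have "{x \<in> {x\<in>cells \<eta>. fst x = i}. u x \<le> v} = {x\<in>cells \<eta>. fst x = i \<and> u x \<le> v}" by auto
    thus ?thesis by (simp add: content_def filter_mset_image_mset filter_mset_mset_set)
  qed
  hence "rank_sum j v (content fst u (cells \<eta>)) = (\<Sum>i<j. card {x\<in>cells \<eta>. fst x = i \<and> u x \<le> v})"
    by (simp add: rank_sum_def)
  also have "\<dots> = card (\<Union>i<j. {x\<in>cells \<eta>. fst x = i \<and> u x \<le> v})"
    by (subst card_UN_disjoint) auto
  also have "(\<Union>i<j. {x\<in>cells \<eta>. fst x = i \<and> u x \<le> v}) = {x\<in>cells \<eta>. fst x < j \<and> u x \<le> v}" by auto
  finally show ?thesis .
qed

lemma rank_sum_columns:
  "rank_sum j v (content fst u (cells \<eta>)) =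
    (\<Sum>c\<in>snd ` cells \<eta>. card {x\<in>cells \<eta>. snd x = c \<and> fst x < j \<and> u x \<le> v})"
proof -
  have eq: "{x\<in>cells \<eta>. fst x < j \<and> u x \<le> v} = (\<Union>c\<in>snd ` cells \<eta>. {x\<in>cells \<eta>. snd x = c \<and> fst x < j \<and> u x \<le> v})"
    by auto
  show ?thesis unfolding rank_sum_content eq by (rule card_UN_disjoint) auto
qed

lemma rank_sum_le:
  fixes U :: "nat \<times> nat \<Rightarrow> 'a::linorder"
  assumes k: "\<kappa> \<in> col_perms \<eta>" and U: "col_strict U"
  shows "rank_sum j v (content fst (U \<circ> \<kappa>) (cells \<eta>)) \<le> rank_sum j v (content fst U (cells \<eta>))"
  unfolding rank_sum_columns using col_count_le[OF k U] by (intro sum_mono) simp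

text \<open>Equal cumulative counts agree column by column. The difference between rows j+1 and j
  tells whether the entry of a cell is at most v, so \<kappa> preserves every entry; column
  strictness then fixes the cell.\<close>

lemma rank_sum_eq_id:
  fixes U :: "nat \<times> nat \<Rightarrow> 'a::linorder"
  assumes k: "\<kappa> \<in> col_perms \<eta>" and U: "col_strict U"
    and eq: "\<And>j v. j \<le> H \<Longrightarrow> v \<in> U ` cells \<eta> \<Longrightarrow>
      rank_sum j v (content fst (U \<circ> \<kappa>) (cells \<eta>)) = rank_sum j v (content fst U (cells \<eta>))"
    and H: "\<And>j. \<eta> j \<noteq> 0 \<Longrightarrow> j < H"
  shows "\<kappa> = id"
proof
  fix x
  show "\<kappa> x = id x"
  proof (cases "x \<in> cells \<eta>")
    case x: True
    obtain j c where jc: "x = (j, c)" by (cases x)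
    have jH: "j < H" using H x jc by (auto simp: cells_def)
    have kx: "\<kappa> x \<in> cells \<eta>" using x permutes_in_image[OF col_permsD(1)[OF k]] by blast
    let ?N = "\<lambda>u j v. card {x\<in>cells \<eta>. snd x = c \<and> fst x < j \<and> u x \<le> v}"
    \<comment> \<open>The sums over all columns agree while each term on the left is at most the one
      on the right, so every term agrees.\<close>
    have N: "?N (U \<circ> \<kappa>) j v = ?N U j v" if "j \<le> H" "v \<in> U ` cells \<eta>" for j v
    proof (rule sum_mono_inv[where f = "\<lambda>c. card {x\<in>cells \<eta>. snd x = c \<and> fst x < j \<and> (U \<circ> \<kappa>) x \<le> v}"
          and g = "\<lambda>c. card {x\<in>cells \<eta>. snd x = c \<and> fst x < j \<and> U x \<le> v}" and I = "snd ` cells \<eta>"])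
      show "c \<in> snd ` cells \<eta>" using x jc by force
    qed (use eq[OF that] col_count_le[OF k U] in \<open>auto simp: rank_sum_columns\<close>)
    have step: "?N u (Suc j) v = ?N u j v + of_bool (u x \<le> v)" for u :: "nat \<times> nat \<Rightarrow> 'a" and v
    proof (cases "u x \<le> v")
      case True
      have "{y\<in>cells \<eta>. snd y = c \<and> fst y < Suc j \<and> u y \<le> v} =
          insert x {y\<in>cells \<eta>. snd y = c \<and> fst y < j \<and> u y \<le> v}"
        using True x jc by (auto simp: less_Suc_eq)
      thus ?thesis using True jc by simp
    next
      case False
      have "{y\<in>cells \<eta>. snd y = c \<and> fst y < Suc j \<and> u y \<le> v} =
          {y\<in>cells \<eta>. snd y = c \<and> fst y < j \<and> u y \<le> v}"
        using False jc by (auto simp: less_Suc_eq)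
      thus ?thesis using False by simp
    qed
    have iff: "U (\<kappa> x) \<le> v \<longleftrightarrow> U x \<le> v" if v: "v \<in> U ` cells \<eta>" for v
    proof -
      have "(of_bool ((U \<circ> \<kappa>) x \<le> v) :: nat) = of_bool (U x \<le> v)"
        using N[of j v] N[of "Suc j" v] step[of "U \<circ> \<kappa>" v] step[of U v] jH v by linarith
      thus ?thesis by (simp add: of_bool_def split: if_splits)
    qed
    have "U (\<kappa> x) = U x"
      using iff[of "U x"] iff[of "U (\<kappa> x)"] x kx by (intro antisym) auto
    moreover have "snd (\<kappa> x) = c" using col_permsD(2)[OF k, of x] jc by simp
    hence "\<kappa> x = (fst (\<kappa> x), c)" by (metis prod.collapse)
    ultimately have "U (fst (\<kappa> x), c) = U (j, c)" using jc by metis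
    moreover have "c < \<eta> (fst (\<kappa> x))" "c < \<eta> j"
      using kx x jc \<open>snd (\<kappa> x) = c\<close> by (auto simp: cells_def case_prod_beta)
    ultimately have "fst (\<kappa> x) = j"
      using col_strictD[OF U, of c j "fst (\<kappa> x)"] col_strictD[OF U, of c "fst (\<kappa> x)" j] by (cases "fst (\<kappa> x)" j rule: linorder_cases) auto
    hence "\<kappa> x = (j, c)" using \<open>snd (\<kappa> x) = c\<close> by (intro prod_eqI) auto
    thus ?thesis using jc by simp
  next
    case False
    thus ?thesis using permutes_not_in[OF col_permsD(1)[OF k]] by simp
  qed
qed

text \<open>A column permutation other than the identity lowers some cumulative count of a standard
  filling and raises none, so it lowers their sum \<open>m\<close>. The identity contributes the
  diagonal entry 1, which survives in every characteristic.\<close>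

lemma col_det_unitriangular:
  assumes A: "finite A"
  shows "\<exists>m :: (nat \<Rightarrow> 'a::linorder multiset) \<Rightarrow> nat. \<forall>S\<in>{S\<in>tabloids A \<eta>. standard S}.
    col_det \<eta> (fill S) S = 1 \<and> (\<forall>S'. col_det \<eta> (fill S) S' \<noteq> 0 \<longrightarrow> S' = S \<or> m S' < m S)"
proof -
  obtain H where "\<forall>j\<in>{j. \<eta> j \<noteq> 0}. j < H" using finite_support unfolding finite_nat_set_iff_bounded by blast
  hence H: "j < H" if "\<eta> j \<noteq> 0" for j using that by simp
  \<comment> \<open>\<open>H\<close> bounds the nonempty rows and \<open>A\<close> contains all
    letters, so these finitely many counts suffice to recognize the identity.\<close>
  define m where "m S = (\<Sum>(j, v)\<in>{..H} \<times> A. rank_sum j v S)" for S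
  have "col_det \<eta> (fill S) S = 1 \<and> (\<forall>S'. col_det \<eta> (fill S) S' \<noteq> 0 \<longrightarrow> S' = S \<or> m S' < m S)"
    if S: "S \<in> tabloids A \<eta>" "standard S" for S
  proof -
    have sh: "shape S = \<eta>" using S by (simp add: tabloids_def)
    have U: "col_strict (fill S)" using fill_column_strict[OF sh S(2)] .
    have sub: "fill S ` cells \<eta> \<subseteq> A" using fill_mem[OF sh] S by (force simp: tabloids_def)
    let ?c = "\<lambda>\<kappa>. content fst (fill S \<circ> \<kappa>) (cells \<eta>)"
    have key: "?c \<kappa> = S \<and> \<kappa> = id \<or> m (?c \<kappa>) < m S" if k: "\<kappa> \<in> col_perms \<eta>" for \<kappa>
    proof (cases "\<forall>p\<in>{..H} \<times> A. rank_sum (fst p) (snd p) (?c \<kappa>) = rank_sum (fst p) (snd p) S")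
      case True
      have "\<kappa> = id"
      proof (rule rank_sum_eq_id[OF k U _ H])
        fix j v assume "j \<le> H" "v \<in> fill S ` cells \<eta>"
        thus "rank_sum j v (?c \<kappa>) = rank_sum j v (content fst (fill S) (cells \<eta>))"
          using True sub content_fill[OF sh] by auto
      qed auto
      thus ?thesis using content_fill[OF sh] by simp
    next
      case False
      have le: "rank_sum j v (?c \<kappa>) \<le> rank_sum j v S" for j v
        using rank_sum_le[OF k U, of j v] content_fill[OF sh] by simp
      have "m (?c \<kappa>) < m S"
        unfolding m_def
      proof (rule sum_strict_mono_ex1)
        show "finite ({..H} \<times> A)" using A by simp
        show "\<forall>p\<in>{..H} \<times> A. (case p of (j, v) \<Rightarrow> rank_sum j v (?c \<kappa>)) \<le> (case p of (j, v) \<Rightarrow> rank_sum j v S)"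
          using le by auto
        obtain p where "p \<in> {..H} \<times> A" "rank_sum (fst p) (snd p) (?c \<kappa>) \<noteq> rank_sum (fst p) (snd p) S"
          using False by blast
        thus "\<exists>p\<in>{..H} \<times> A. (case p of (j, v) \<Rightarrow> rank_sum j v (?c \<kappa>)) < (case p of (j, v) \<Rightarrow> rank_sum j v S)"
          using le by (intro bexI[of _ p]) (auto simp: case_prod_beta less_le)
      qed
      thus ?thesis by simp
    qed
    have "col_det \<eta> (fill S) S = (\<Sum>\<kappa>\<in>col_perms \<eta>. if \<kappa> = id then 1 else 0)"
      unfolding col_det_def
    proof (rule sum.cong[OF refl])
      fix \<kappa> assume k: "\<kappa> \<in> col_perms \<eta>"
      show "sign \<kappa> * of_bool (?c \<kappa> = S) = (if \<kappa> = id then 1 else (0::int))"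
        using key[OF k] content_fill[OF sh] by auto
    qed
    hence "col_det \<eta> (fill S) S = 1" using col_perms_id by simp
    moreover have "S' = S \<or> m S' < m S" if ne: "col_det \<eta> (fill S) S' \<noteq> 0" for S'
    proof -
      obtain \<kappa> where "\<kappa> \<in> col_perms \<eta>" "sign \<kappa> * of_bool (?c \<kappa> = S') \<noteq> (0::int)"
        using ne sum.not_neutral_contains_not_neutral unfolding col_det_def by blast
      thus ?thesis using key[of \<kappa>] by (auto split: if_splits)
    qed
    ultimately show ?thesis by blast
  qed
  thus ?thesis by blast
qed

end

lemma unitriangular_injective:
  fixes D :: "'x \<Rightarrow> 'x \<Rightarrow> int" and d :: "'x \<Rightarrow> 'k::field"
  assumes fin: "finite A" and D: "\<And>x. x \<in> A \<Longrightarrow> D x x = 1"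
    and tri: "\<And>x y. x \<in> A \<Longrightarrow> D x y \<noteq> 0 \<Longrightarrow> y = x \<or> m y < (m x :: nat)"
    and zero: "\<And>x. x \<in> A \<Longrightarrow> (\<Sum>y\<in>A. d y * of_int (D x y)) = 0"
  shows "x \<in> A \<Longrightarrow> d x = 0"
proof (induction "m x" arbitrary: x rule: less_induct)
  case less
  have "(\<Sum>y\<in>A. d y * of_int (D x y)) = (\<Sum>y\<in>A. if y = x then d x else 0)"
  proof (rule sum.cong[OF refl])
    fix y assume y: "y \<in> A"
    show "d y * of_int (D x y) = (if y = x then d x else 0)"
      using tri[OF less.prems, of y] less.hyps[of y] y D[OF less.prems] by (cases "D x y = 0") auto
  qed
  thus ?case using zero[OF less.prems] fin less.prems by simp
qed

section \<open>The algebra in terms of configurations\<close>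

text \<open>Block numbers start at 0, matching \<open>block\<close>.\<close>

definition blk :: "nat list \<Rightarrow> nat \<Rightarrow> nat" where
  "blk \<nu> t = (LEAST b. t \<le> sum_list (take (Suc b) \<nu>))"

definition conf :: "nat \<Rightarrow> nat list \<Rightarrow> (nat \<Rightarrow> nat) \<Rightarrow> (nat \<times> nat) multiset" where
  "conf r \<nu> m = image_mset (\<lambda>t. (m t, blk \<nu> t)) (mset_set {1..r})"

definition push :: "(nat \<Rightarrow> nat) \<Rightarrow> (nat \<times> nat) multiset \<Rightarrow> (nat \<times> nat) multiset" where
  "push m y = image_mset (map_prod m id) y"

text \<open>A configuration records how many elements of each block of \<open>\<nu>\<close> a map sends to each point;
  these data describe the cosets \<open>m \<SS>\<^sub>\<nu>\<close>.\<close>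

definition confs :: "nat \<Rightarrow> nat list \<Rightarrow> (nat \<times> nat) multiset set" where
  "confs r \<nu> = {y. image_mset snd y = image_mset (blk \<nu>) (mset_set {1..r}) \<and> fst ` set_mset y \<subseteq> {1..r}}"

lemma sum_take_mono: "i \<le> j \<Longrightarrow> sum_list (take i \<nu>) \<le> sum_list (take j (\<nu> :: nat list))"
proof -
  assume "i \<le> j"
  hence "take j \<nu> = take i \<nu> @ take (j - i) (drop i \<nu>)" using take_add[of i "j - i" \<nu>] by simp
  thus ?thesis by simp
qed

lemma mem_block_iff:
  assumes \<nu>: "\<nu> \<in> compositions r n" and t: "t \<in> {1..r}" and b: "b < n"
  shows "t \<in> block \<nu> b \<longleftrightarrow> blk \<nu> t = b"
proof -
  have ex: "t \<le> sum_list (take (Suc (n - 1)) \<nu>)"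
    using \<nu> t b by (simp add: compositions_def)
  show ?thesis
  proof
    assume tb: "t \<in> block \<nu> b"
    show "blk \<nu> t = b" unfolding blk_def
    proof (rule Least_equality)
      show "t \<le> sum_list (take (Suc b) \<nu>)" using tb by (simp add: block_def)
      fix b' assume t': "t \<le> sum_list (take (Suc b') \<nu>)"
      show "b \<le> b'"
      proof (rule ccontr)
        assume "\<not> b \<le> b'"
        hence "sum_list (take (Suc b') \<nu>) \<le> sum_list (take b \<nu>)" by (intro sum_take_mono) simp
        thus False using t' tb by (simp add: block_def)
      qed
    qed
  next
    assume eq: "blk \<nu> t = b"
    have 1: "t \<le> sum_list (take (Suc b) \<nu>)"
      using LeastI[of "\<lambda>b. t \<le> sum_list (take (Suc b) \<nu>)", OF ex] eq unfolding blk_def by simp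
    have "sum_list (take b \<nu>) < t"
    proof (cases b)
      case 0 thus ?thesis using t by simp
    next
      case (Suc b')
      hence "\<not> t \<le> sum_list (take (Suc b') \<nu>)"
        using not_less_Least[of b' "\<lambda>b. t \<le> sum_list (take (Suc b) \<nu>)"] eq unfolding blk_def by simp
      thus ?thesis using Suc by simp
    qed
    thus "t \<in> block \<nu> b" using 1 by (simp add: block_def)
  qed
qed

lemma blk_less:
  assumes \<nu>: "\<nu> \<in> compositions r n" and t: "t \<in> {1..r}"
  shows "blk \<nu> t < n"
proof -
  have "n \<noteq> 0" using \<nu> t by (auto simp: compositions_def)
  moreover have "blk \<nu> t \<le> n - 1" unfolding blk_def
    using \<nu> t calculation by (intro Least_le) (simp add: compositions_def)
  ultimately show ?thesis by simp
qed

lemma block_subset: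
  assumes \<nu>: "\<nu> \<in> compositions r n" shows "block \<nu> b \<subseteq> {1..r}"
proof -
  have "sum_list (take (Suc b) \<nu>) \<le> r"
    using sum_take_mono[of "Suc b" "max (Suc b) (length \<nu>)" \<nu>] \<nu> by (simp add: compositions_def)
  thus ?thesis by (auto simp: block_def)
qed

lemma young_iff:
  assumes \<nu>: "\<nu> \<in> compositions r n"
  shows "\<sigma> \<in> young r \<nu> \<longleftrightarrow> \<sigma> permutes {1..r} \<and> (\<forall>t\<in>{1..r}. blk \<nu> (\<sigma> t) = blk \<nu> t)"
proof
  assume s: "\<sigma> \<in> young r \<nu>"
  hence p: "\<sigma> permutes {1..r}" and bl: "\<And>i. i < n \<Longrightarrow> \<sigma> ` block \<nu> i = block \<nu> i"
    using \<nu> by (auto simp: young_def compositions_def)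
  have "blk \<nu> (\<sigma> t) = blk \<nu> t" if t: "t \<in> {1..r}" for t
  proof -
    have b: "blk \<nu> t < n" using blk_less[OF \<nu> t] .
    have "t \<in> block \<nu> (blk \<nu> t)" using mem_block_iff[OF \<nu> t b] by simp
    hence "\<sigma> t \<in> block \<nu> (blk \<nu> t)" using bl[OF b] by blast
    moreover have "\<sigma> t \<in> {1..r}" using permutes_in_image[OF p] t by blast
    ultimately show ?thesis using mem_block_iff[OF \<nu> _ b] by blast
  qed
  thus "\<sigma> permutes {1..r} \<and> (\<forall>t\<in>{1..r}. blk \<nu> (\<sigma> t) = blk \<nu> t)" using p by blast
next
  assume a: "\<sigma> permutes {1..r} \<and> (\<forall>t\<in>{1..r}. blk \<nu> (\<sigma> t) = blk \<nu> t)"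
  have "\<sigma> ` block \<nu> i = block \<nu> i" if i: "i < n" for i
  proof (rule endo_inj_surj)
    show "finite (block \<nu> i)" using finite_subset[OF block_subset[OF \<nu>]] by blast
    show "\<sigma> ` block \<nu> i \<subseteq> block \<nu> i"
    proof (rule image_subsetI)
      fix t assume t: "t \<in> block \<nu> i"
      hence tr: "t \<in> {1..r}" using block_subset[OF \<nu>] by blast
      hence "\<sigma> t \<in> {1..r}" using a permutes_in_image[of \<sigma> "{1..r}" t] by blast
      moreover have "blk \<nu> (\<sigma> t) = i" using a tr t mem_block_iff[OF \<nu> tr i] by auto
      ultimately show "\<sigma> t \<in> block \<nu> i" using mem_block_iff[OF \<nu> _ i] by blast
    qed
    show "inj_on \<sigma> (block \<nu> i)" using a permutes_inj inj_on_subset by blast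
  qed
  thus "\<sigma> \<in> young r \<nu>" using a \<nu> by (simp add: young_def compositions_def)
qed

section \<open>Configurations as names for cosets\<close>

lemma push_push: "push m (push m' y) = push (m \<circ> m') y"
  by (auto simp: push_def multiset.map_comp intro!: image_mset_cong)

lemma push_id [simp]: "push id y = y"
  by (simp add: push_def prod.map_id0)

lemma push_conf: "push m (conf r \<nu> m') = conf r \<nu> (m \<circ> m')"
  by (simp add: push_def conf_def multiset.map_comp comp_def)

lemma conf_in: "m \<in> full_transf r \<Longrightarrow> conf r \<nu> m \<in> confs r \<nu>"
  by (auto simp: confs_def conf_def multiset.map_comp comp_def full_transf_def)

lemma push_in: "m \<in> full_transf r \<Longrightarrow> y \<in> confs r \<nu> \<Longrightarrow> push m y \<in> confs r \<nu>"
  by (auto simp: confs_def push_def multiset.map_comp comp_def full_transf_def image_subset_iff)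

lemma size_confs: "y \<in> confs r \<nu> \<Longrightarrow> size y = r"
proof -
  assume "y \<in> confs r \<nu>"
  hence "size (image_mset snd y) = size (image_mset (blk \<nu>) (mset_set {1..r}))"
    by (simp only: confs_def mem_Collect_eq)
  thus ?thesis by simp
qed

lemma finite_confs: "finite (confs r \<nu>)"
proof -
  let ?B = "blk \<nu> ` {1..r}"
  have sub: "confs r \<nu> \<subseteq> mset ` {xs. set xs \<subseteq> {1..r} \<times> ?B \<and> length xs = r}"
  proof
    fix y assume y: "y \<in> confs r \<nu>"
    obtain xs where xs: "mset xs = y" using ex_mset by blast
    have "length xs = r" using size_confs[OF y] xs by auto
    moreover have "set xs \<subseteq> {1..r} \<times> ?B"
    proof
      fix p assume p: "p \<in> set xs"
      have "snd p \<in># image_mset snd y" using p xs by auto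
      also have "image_mset snd y = image_mset (blk \<nu>) (mset_set {1..r})" using y by (simp add: confs_def)
      finally have "snd p \<in> ?B" by simp
      moreover have "fst ` set_mset y \<subseteq> {1..r}" using y by (simp only: confs_def mem_Collect_eq)
      moreover have "p \<in># y" using p xs by auto
      ultimately have "fst p \<in> {1..r}" by blast
      with \<open>snd p \<in> ?B\<close> show "p \<in> {1..r} \<times> ?B" by (cases p) simp
    qed
    ultimately show "y \<in> mset ` {xs. set xs \<subseteq> {1..r} \<times> ?B \<and> length xs = r}" using xs by blast
  qed
  have fin: "finite {xs. set xs \<subseteq> {1..r} \<times> ?B \<and> length xs = r}"
    by (rule finite_lists_length_eq) simp
  show ?thesis by (rule finite_subset[OF sub finite_imageI[OF fin]])
qed

text \<open>List the pairs of \<open>y\<close>; the second components are exactly the block numbers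
  of 1, ..., r, so a label-preserving matching assigns to each t a pair, whose first component is
  the value at t.\<close>

lemma ex_conf:
  assumes y: "y \<in> confs r \<nu>" shows "\<exists>m\<in>full_transf r. conf r \<nu> m = y"
proof -
  obtain xs where xs: "mset xs = y" using ex_mset by blast
  have len: "length xs = r" using size_confs[OF y] xs by auto
  have all: "image_mset (\<lambda>i. xs ! i) (mset_set {0..<r}) = y"
    unfolding xs[symmetric] len[symmetric] mset_upt[symmetric] mset_map[symmetric] map_nth ..
  have "image_mset (\<lambda>i. snd (xs ! i)) (mset_set {0..<r}) = image_mset snd y"
    unfolding all[symmetric] multiset.map_comp comp_def ..
  also have "\<dots> = image_mset (blk \<nu>) (mset_set {1..r})" using y by (simp add: confs_def)
  finally obtain h where h: "bij_betw h {1..r} {0..<r}" "\<forall>t\<in>{1..r}. snd (xs ! h t) = blk \<nu> t"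
    using ex_bij_of_image_mset_eq[of "{1..r}" "{0..<r}" "blk \<nu>" "\<lambda>i. snd (xs ! i)"] by auto
  define m where "m t = (if t \<in> {1..r} then fst (xs ! h t) else t)" for t
  have "conf r \<nu> m = image_mset (\<lambda>t. xs ! h t) (mset_set {1..r})"
    unfolding conf_def using h(2) by (intro image_mset_cong) (auto simp: m_def prod_eq_iff)
  also have "\<dots> = image_mset (\<lambda>i. xs ! i) (image_mset h (mset_set {1..r}))" by (simp add: multiset.map_comp comp_def)
  also have "image_mset h (mset_set {1..r}) = mset_set {0..<r}"
    using h(1) by (simp add: image_mset_mset_set bij_betw_def)
  also have "image_mset (\<lambda>i. xs ! i) (mset_set {0..<r}) = y" by (rule all)
  finally have c: "conf r \<nu> m = y" .
  have "m t \<in> {1..r}" if t: "t \<in> {1..r}" for t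
  proof -
    have "h t < length xs" using h(1) t len by (auto simp: bij_betw_def)
    hence "xs ! h t \<in># y" using xs nth_mem_mset by blast
    thus ?thesis using y t unfolding confs_def m_def by auto
  qed
  hence "m \<in> full_transf r" by (auto simp: full_transf_def m_def)
  thus ?thesis using c by blast
qed

text \<open>Equal multisets of pairs give a permutation of {1..r} matching the pairs, and respecting
  the second component means lying in the Young subgroup.\<close>

lemma conf_eq_iff:
  assumes \<nu>: "\<nu> \<in> compositions r n" and m: "m \<in> full_transf r" "m' \<in> full_transf r"
  shows "conf r \<nu> m = conf r \<nu> m' \<longleftrightarrow> (\<exists>\<tau>\<in>young r \<nu>. m = m' \<circ> \<tau>)"
proof
  assume "conf r \<nu> m = conf r \<nu> m'"
  then obtain p where p: "p permutes {1..r}" "\<forall>t\<in>{1..r}. (m t, blk \<nu> t) = (m' (p t), blk \<nu> (p t))"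
    unfolding conf_def using image_mset_eq_implies_permutes[of "{1..r}"] by blast
  have "m t = (m' \<circ> p) t" for t
  proof (cases "t \<in> {1..r}")
    case False
    have "m' t = t" using m(2) False by (simp add: full_transf_def)
    moreover have "m t = t" using m(1) False by (simp add: full_transf_def)
    ultimately show ?thesis using permutes_not_in[OF p(1) False] by simp
  qed (use p(2) in auto)
  moreover have "p \<in> young r \<nu>" using young_iff[OF \<nu>] p by auto
  ultimately show "\<exists>\<tau>\<in>young r \<nu>. m = m' \<circ> \<tau>" by blast
next
  assume "\<exists>\<tau>\<in>young r \<nu>. m = m' \<circ> \<tau>"
  then obtain \<tau> where t: "\<tau> \<in> young r \<nu>" "m = m' \<circ> \<tau>" by blast
  have p: "\<tau> permutes {1..r}" "\<forall>t\<in>{1..r}. blk \<nu> (\<tau> t) = blk \<nu> t" using young_iff[OF \<nu>] t by auto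
  have "conf r \<nu> m = image_mset (\<lambda>t. (m' t, blk \<nu> t)) (image_mset \<tau> (mset_set {1..r}))"
    unfolding conf_def t(2) multiset.map_comp using p by (intro image_mset_cong) auto
  also have "image_mset \<tau> (mset_set {1..r}) = mset_set {1..r}"
    using permutes_image[OF p(1)] permutes_inj_on[OF p(1)] by (simp add: image_mset_mset_set)
  finally show "conf r \<nu> m = conf r \<nu> m'" by (simp add: conf_def)
qed

definition rep :: "nat \<Rightarrow> nat list \<Rightarrow> (nat \<times> nat) multiset \<Rightarrow> nat \<Rightarrow> nat" where
  "rep r \<nu> y = (SOME m. m \<in> full_transf r \<and> conf r \<nu> m = y)"

lemma rep:
  assumes "y \<in> confs r \<nu>" shows "rep r \<nu> y \<in> full_transf r" "conf r \<nu> (rep r \<nu> y) = y"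
  using someI_ex[of "\<lambda>m. m \<in> full_transf r \<and> conf r \<nu> m = y"] ex_conf[OF assms] by (auto simp: rep_def)

text \<open>Double cosets become orbits of the left Young subgroup on configurations.\<close>

lemma double_coset_conf:
  assumes \<nu>: "\<nu> \<in> compositions r n" and m: "m \<in> full_transf r" "m' \<in> full_transf r"
  shows "m' \<in> double_coset r \<mu> m \<nu> \<longleftrightarrow> (\<exists>s\<in>young r \<mu>. conf r \<nu> m' = push s (conf r \<nu> m))"
proof -
  have "(\<exists>\<tau>\<in>young r \<nu>. m' = s \<circ> m \<circ> \<tau>) \<longleftrightarrow> conf r \<nu> m' = push s (conf r \<nu> m)" if "s \<in> young r \<mu>" for s
    using conf_eq_iff[OF \<nu> m(2) full_transf_comp[OF _ m(1)], of s] that young_subset by (auto simp: push_conf)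
  thus ?thesis unfolding double_coset_def by blast
qed

lemma card_conf_fibre:
  assumes \<nu>: "\<nu> \<in> compositions r n" and D: "D \<in> double_cosets r \<mu> \<nu>" and y: "y \<in> conf r \<nu> ` D"
  shows "card {m\<in>D. conf r \<nu> m = y} = n_R r \<nu> D"
proof -
  obtain m0 where m0: "m0 \<in> D" "y = conf r \<nu> m0" using y by blast
  have "{m\<in>D. conf r \<nu> m = y} = (\<lambda>\<tau>. m0 \<circ> \<tau>) ` young r \<nu>"
  proof (intro equalityI subsetI)
    fix m assume m: "m \<in> {m\<in>D. conf r \<nu> m = y}"
    have "m \<in> full_transf r" "m0 \<in> full_transf r" using m m0 double_cosets_subset[OF D] by auto
    thus "m \<in> (\<lambda>\<tau>. m0 \<circ> \<tau>) ` young r \<nu>" using conf_eq_iff[OF \<nu>] m m0 by blast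
  next
    fix m assume "m \<in> (\<lambda>\<tau>. m0 \<circ> \<tau>) ` young r \<nu>"
    then obtain \<tau> where t: "\<tau> \<in> young r \<nu>" "m = m0 \<circ> \<tau>" by blast
    have mD: "m \<in> D" using double_cosets_closed_right[OF D m0(1) t(1)] t(2) by simp
    have "m \<in> full_transf r" "m0 \<in> full_transf r" using mD m0 double_cosets_subset[OF D] by auto
    thus "m \<in> {m\<in>D. conf r \<nu> m = y}" using conf_eq_iff[OF \<nu>] t mD m0 by blast
  qed
  thus ?thesis using n_R_eq[OF D m0(1)] by simp
qed

lemma n_R_pos: "D \<in> double_cosets r \<mu> \<nu> \<Longrightarrow> n_R r \<nu> D > 0"
proof -
  assume D: "D \<in> double_cosets r \<mu> \<nu>"
  then obtain m where m: "m \<in> D" using double_cosets_nonempty by blast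
  have "(\<lambda>\<tau>. m \<circ> \<tau>) ` young r \<nu> \<noteq> {}" using young_id by blast
  thus ?thesis unfolding n_R_eq[OF D m] using finite_young by (simp add: card_gt_0_iff)
qed

lemma sum_over_fibres:
  fixes g :: "_ \<Rightarrow> nat"
  assumes \<nu>: "\<nu> \<in> compositions r n" and D: "D \<in> double_cosets r \<mu> \<nu>"
  shows "(\<Sum>m\<in>D. g (conf r \<nu> m)) = n_R r \<nu> D * (\<Sum>y\<in>conf r \<nu> ` D. g y)"
proof -
  have fin: "finite D" using finite_subset[OF double_cosets_subset[OF D] finite_full_transf] .
  have "(\<Sum>m\<in>D. g (conf r \<nu> m)) = (\<Sum>y\<in>conf r \<nu> ` D. \<Sum>m\<in>{m\<in>D. conf r \<nu> m = y}. g (conf r \<nu> m))"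
    by (rule sum.image_gen[OF fin])
  also have "\<dots> = (\<Sum>y\<in>conf r \<nu> ` D. n_R r \<nu> D * g y)"
    using card_conf_fibre[OF \<nu> D] by (intro sum.cong) auto
  finally show ?thesis by (simp add: sum_distrib_left)
qed

lemma push_young_bij:
  assumes s: "s \<in> young r \<mu>" shows "bij_betw (push s) (confs r \<nu>) (confs r \<nu>)"
proof (rule bij_betw_byWitness[where f' = "push (Hilbert_Choice.inv s)"])
  have "push (Hilbert_Choice.inv s) (push s y) = y" "push s (push (Hilbert_Choice.inv s) y) = y" for y
    using young_inv(2,3)[OF s] by (simp_all add: push_push)
  thus "\<forall>y\<in>confs r \<nu>. push (Hilbert_Choice.inv s) (push s y) = y"
    "\<forall>y\<in>confs r \<nu>. push s (push (Hilbert_Choice.inv s) y) = y" by auto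
  show "push s ` confs r \<nu> \<subseteq> confs r \<nu>" "push (Hilbert_Choice.inv s) ` confs r \<nu> \<subseteq> confs r \<nu>"
    using push_in s young_inv(1)[OF s] young_subset by blast+
qed

text \<open>Dividing by the \<^const>\<open>n_R\<close> means counting cosets of the right Young subgroups instead of maps.\<close>

lemma struct_const_count:
  assumes \<mu>: "\<mu> \<in> compositions r n" and \<nu>: "\<nu> \<in> compositions r n" and \<pi>: "\<pi> \<in> compositions r n"
    and D1: "D1 \<in> double_cosets r \<mu> \<nu>" and D2: "D2 \<in> double_cosets r \<nu> \<pi>"
    and D: "D \<in> double_cosets r \<mu> \<pi>" and z: "z \<in> conf r \<pi> ` D"
  shows "struct_const_R r (\<mu>, D1, \<nu>) (\<nu>, D2, \<pi>) (\<mu>, D, \<pi>) =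
    int (\<Sum>y\<in>conf r \<nu> ` D1. card {z'\<in>conf r \<pi> ` D2. push (rep r \<nu> y) z' = z})"
proof -
  have fin: "finite D1" "finite D2" "finite D"
    using finite_subset[OF double_cosets_subset finite_full_transf] D1 D2 D by blast+
  note full = subsetD[OF double_cosets_subset[OF D1]] subsetD[OF double_cosets_subset[OF D2]] subsetD[OF double_cosets_subset[OF D]]
  define P where "P m = {(m1, m2). m1 \<in> D1 \<and> m2 \<in> D2 \<and> m1 \<circ> m2 = m}" for m
  define G where "G m1 = card {z'\<in>conf r \<pi> ` D2. push m1 z' = z}" for m1
  have finP: "finite (P m)" for m
    by (rule finite_subset[of _ "D1 \<times> D2"]) (auto simp: P_def fin)
  have a: "expansion_coeff r \<mu> \<pi> D1 D2 D = int (card (P m))" if "m \<in> D" for m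
    using expansion_coeff_eq[OF D1 D2 D that] by (simp add: P_def)
  let ?Z = "{m\<in>D. conf r \<pi> m = z}"
  have "int (n_R r \<pi> D) * expansion_coeff r \<mu> \<pi> D1 D2 D = (\<Sum>m\<in>?Z. int (card (P m)))"
  proof -
    have "(\<Sum>m\<in>?Z. int (card (P m))) = (\<Sum>m\<in>?Z. expansion_coeff r \<mu> \<pi> D1 D2 D)"
      by (rule sum.cong[OF refl], rule a[symmetric]) simp
    thus ?thesis using card_conf_fibre[OF \<pi> D z] by simp
  qed
  also have "\<dots> = int (card (\<Union>m\<in>?Z. P m))"
    using fin finP by (subst card_UN_disjoint) (auto simp: P_def)
  \<comment> \<open>Fix the configuration of the product instead of the product itself;
    \<open>D\<close> contains the whole coset, so the left side loses nothing.\<close>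
  also have "(\<Union>m\<in>?Z. P m) = (SIGMA m1:D1. {m2\<in>D2. push m1 (conf r \<pi> m2) = z})"
  proof (intro equalityI subsetI)
    fix p assume "p \<in> (\<Union>m\<in>?Z. P m)"
    thus "p \<in> (SIGMA m1:D1. {m2\<in>D2. push m1 (conf r \<pi> m2) = z})" by (auto simp: P_def push_conf)
  next
    fix p assume p: "p \<in> (SIGMA m1:D1. {m2\<in>D2. push m1 (conf r \<pi> m2) = z})"
    then obtain m1 m2 where m: "p = (m1, m2)" "m1 \<in> D1" "m2 \<in> D2" "conf r \<pi> (m1 \<circ> m2) = z"
      by (auto simp: push_conf)
    obtain m0 where m0: "m0 \<in> D" "conf r \<pi> m0 = z" using z by blast
    have "\<exists>\<tau>\<in>young r \<pi>. m1 \<circ> m2 = m0 \<circ> \<tau>"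
      using conf_eq_iff[OF \<pi> full_transf_comp[OF full(1)[OF m(2)] full(2)[OF m(3)]] full(3)[OF m0(1)]] m m0
      by simp
    hence "m1 \<circ> m2 \<in> D" using double_cosets_closed_right[OF D m0(1)] by auto
    thus "p \<in> (\<Union>m\<in>?Z. P m)" using m by (auto simp: P_def)
  qed
  also have "card \<dots> = (\<Sum>m1\<in>D1. card {m2\<in>D2. push m1 (conf r \<pi> m2) = z})"
    using fin by (subst card_SigmaI) auto
  also have "\<dots> = (\<Sum>m1\<in>D1. n_R r \<pi> D2 * G m1)"
  proof (rule sum.cong[OF refl])
    fix m1
    have "card {m2\<in>D2. push m1 (conf r \<pi> m2) = z} = (\<Sum>m2\<in>D2. of_bool (push m1 (conf r \<pi> m2) = z))"
      using fin by (simp add: sum_of_bool_eq Int_def)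
    also have "\<dots> = n_R r \<pi> D2 * (\<Sum>z'\<in>conf r \<pi> ` D2. of_bool (push m1 z' = z))"
      by (rule sum_over_fibres[OF \<pi> D2])
    also have "(\<Sum>z'\<in>conf r \<pi> ` D2. of_bool (push m1 z' = z)) = G m1"
      using fin by (simp add: G_def sum_of_bool_eq Int_def)
    finally show "card {m2\<in>D2. push m1 (conf r \<pi> m2) = z} = n_R r \<pi> D2 * G m1" .
  qed
  \<comment> \<open>\<open>G\<close> is constant on cosets of the middle Young subgroup, because
    that subgroup permutes the configurations of \<open>D2\<close>. This lets the factor
    \<open>n_R\<close> of \<open>D1\<close> be extracted next.\<close>
  also have "\<dots> = n_R r \<pi> D2 * (\<Sum>m1\<in>D1. G (rep r \<nu> (conf r \<nu> m1)))"
    unfolding sum_distrib_left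
  proof (rule sum.cong[OF refl])
    fix m1 assume m1: "m1 \<in> D1"
    have y: "conf r \<nu> m1 \<in> confs r \<nu>" using conf_in full m1 by blast
    obtain \<tau> where t: "\<tau> \<in> young r \<nu>" "m1 = rep r \<nu> (conf r \<nu> m1) \<circ> \<tau>"
      using conf_eq_iff[OF \<nu> full(1)[OF m1] rep(1)[OF y]] rep(2)[OF y] by auto
    have closed: "push \<sigma> z' \<in> conf r \<pi> ` D2" if "z' \<in> conf r \<pi> ` D2" "\<sigma> \<in> young r \<nu>" for \<sigma> z'
      using that double_cosets_closed_left[OF D2 _ that(2)] by (auto simp: push_conf)
    have cancel: "push \<tau> (push (Hilbert_Choice.inv \<tau>) z') = z'" "push (Hilbert_Choice.inv \<tau>) (push \<tau> z') = z'" for z'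
      using young_inv(2,3)[OF t(1)] by (simp_all add: push_push)
    have "bij_betw (push \<tau>) {z'\<in>conf r \<pi> ` D2. push m1 z' = z}
       {z'\<in>conf r \<pi> ` D2. push (rep r \<nu> (conf r \<nu> m1)) z' = z}"
    proof (rule bij_betw_byWitness[where f' = "push (Hilbert_Choice.inv \<tau>)"])
      show "push \<tau> ` {z'\<in>conf r \<pi> ` D2. push m1 z' = z} \<subseteq> {z'\<in>conf r \<pi> ` D2. push (rep r \<nu> (conf r \<nu> m1)) z' = z}"
      proof (rule image_subsetI)
        fix z' assume z': "z' \<in> {z'\<in>conf r \<pi> ` D2. push m1 z' = z}"
        have "push (rep r \<nu> (conf r \<nu> m1)) (push \<tau> z') = push m1 z'" unfolding push_push t(2)[symmetric] ..
        thus "push \<tau> z' \<in> {z'\<in>conf r \<pi> ` D2. push (rep r \<nu> (conf r \<nu> m1)) z' = z}" using z' closed t(1) by auto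
      qed
      show "push (Hilbert_Choice.inv \<tau>) ` {z'\<in>conf r \<pi> ` D2. push (rep r \<nu> (conf r \<nu> m1)) z' = z}
          \<subseteq> {z'\<in>conf r \<pi> ` D2. push m1 z' = z}"
      proof (rule image_subsetI)
        fix z' assume z': "z' \<in> {z'\<in>conf r \<pi> ` D2. push (rep r \<nu> (conf r \<nu> m1)) z' = z}"
        have "push m1 (push (Hilbert_Choice.inv \<tau>) z') = push (rep r \<nu> (conf r \<nu> m1)) (push \<tau> (push (Hilbert_Choice.inv \<tau>) z'))"
          by (subst t(2)) (simp only: push_push comp_assoc)
        also have "\<dots> = z" using z' by (simp add: cancel)
        finally show "push (Hilbert_Choice.inv \<tau>) z' \<in> {z'\<in>conf r \<pi> ` D2. push m1 z' = z}"
          using z' closed young_inv(1)[OF t(1)] by auto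
      qed
    qed (auto simp: cancel)
    thus "n_R r \<pi> D2 * G m1 = n_R r \<pi> D2 * G (rep r \<nu> (conf r \<nu> m1))" by (simp add: G_def bij_betw_same_card)
  qed
  also have "(\<Sum>m1\<in>D1. G (rep r \<nu> (conf r \<nu> m1))) = n_R r \<nu> D1 * (\<Sum>y\<in>conf r \<nu> ` D1. G (rep r \<nu> y))"
    by (rule sum_over_fibres[OF \<nu> D1])
  finally have "int (n_R r \<pi> D) * expansion_coeff r \<mu> \<pi> D1 D2 D =
      int (\<Sum>y\<in>conf r \<nu> ` D1. G (rep r \<nu> y)) * (int (n_R r \<nu> D1) * int (n_R r \<pi> D2))"
    by (simp add: algebra_simps)
  moreover have "int (n_R r \<nu> D1) * int (n_R r \<pi> D2) \<noteq> 0" using n_R_pos[OF D1] n_R_pos[OF D2] by simp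
  ultimately have "int (n_R r \<pi> D) * expansion_coeff r \<mu> \<pi> D1 D2 D div (int (n_R r \<nu> D1) * int (n_R r \<pi> D2)) =
      int (\<Sum>y\<in>conf r \<nu> ` D1. G (rep r \<nu> y))"
    by simp
  thus ?thesis by (simp add: G_def)
qed

subsection \<open>Products\<close>

text \<open>An algebra element as a function on configurations; by \<open>ev_push\<close> it is
  constant on the orbits of the left Young subgroup.\<close>

definition ev :: "nat \<Rightarrow> (coset_index \<Rightarrow> 'k) \<Rightarrow> nat list \<Rightarrow> nat list \<Rightarrow> (nat \<times> nat) multiset \<Rightarrow> 'k" where
  "ev r f \<mu> \<nu> y = f (\<mu>, double_coset r \<mu> (rep r \<nu> y) \<nu>, \<nu>)"

text \<open>The kernel of right multiplication by g, see \<open>ev_mult\<close>. It does not depend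
  on the representative of y, see \<open>sharp_conf\<close>.\<close>

definition sharp ::
  "nat \<Rightarrow> (coset_index \<Rightarrow> 'k::comm_monoid_add) \<Rightarrow> nat list \<Rightarrow> nat list \<Rightarrow> (nat \<times> nat) multiset \<Rightarrow> (nat \<times> nat) multiset \<Rightarrow> 'k" where
  "sharp r g \<nu> \<pi> y z = (\<Sum>z'\<in>{z'\<in>confs r \<pi>. push (rep r \<nu> y) z' = z}. ev r g \<nu> \<pi> z')"

definition S_carrier :: "nat \<Rightarrow> nat \<Rightarrow> (coset_index \<Rightarrow> 'k::comm_ring_1) set" where
  "S_carrier r n = carrier (S_R r n)"

definition S_mult :: "nat \<Rightarrow> nat \<Rightarrow> (coset_index \<Rightarrow> 'k::comm_ring_1) \<Rightarrow> (coset_index \<Rightarrow> 'k) \<Rightarrow> coset_index \<Rightarrow> 'k" where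
  "S_mult r n = monoid.mult (S_R r n)"

definition S_one :: "nat \<Rightarrow> nat \<Rightarrow> coset_index \<Rightarrow> 'k::comm_ring_1" where
  "S_one r n = one (S_R r n)"

lemma finite_compositions: "finite (compositions r n)"
proof (rule finite_subset)
  show "compositions r n \<subseteq> {xs. set xs \<subseteq> {..r} \<and> length xs = n}"
    using member_le_sum_list by (auto simp: compositions_def)
  show "finite {xs. set xs \<subseteq> {..r} \<and> length xs = n}" by (rule finite_lists_length_eq) simp
qed

lemma basis_index_Sigma:
  "basis_index r n = (SIGMA \<mu>:compositions r n. (\<lambda>(\<nu>, D). (D, \<nu>)) ` (SIGMA \<nu>:compositions r n. double_cosets r \<mu> \<nu>))"
  by (auto simp: basis_index_def image_iff)

lemma finite_basis_index: "finite (basis_index r n)"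
  unfolding basis_index_Sigma
  by (intro finite_SigmaI finite_imageI finite_compositions finite_double_cosets)

lemma dc_rep_in:
  "y \<in> confs r \<nu> \<Longrightarrow> double_coset r \<mu> (rep r \<nu> y) \<nu> \<in> double_cosets r \<mu> \<nu>"
  using rep(1) by (auto simp: double_cosets_def)

lemma dc_rep:
  assumes \<nu>: "\<nu> \<in> compositions r n" and D: "D \<in> double_cosets r \<mu> \<nu>" and m: "m \<in> D"
  shows "double_coset r \<mu> (rep r \<nu> (conf r \<nu> m)) \<nu> = D"
proof -
  have full: "m \<in> full_transf r" using double_cosets_subset[OF D] m by blast
  note c = conf_in[OF full, of \<nu>]
  have "rep r \<nu> (conf r \<nu> m) \<in> double_coset r \<mu> m \<nu>"
    using double_coset_conf[OF \<nu> full rep(1)[OF c]] rep(2)[OF c] young_id by force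
  from double_coset_eq[OF this] show ?thesis using double_cosets_eq[OF D m] by simp
qed

lemma ev_conf: "\<nu> \<in> compositions r n \<Longrightarrow> D \<in> double_cosets r \<mu> \<nu> \<Longrightarrow> m \<in> D \<Longrightarrow> ev r f \<mu> \<nu> (conf r \<nu> m) = f (\<mu>, D, \<nu>)"
  by (simp add: ev_def dc_rep)

lemma ev_push:
  assumes \<nu>: "\<nu> \<in> compositions r n" and y: "y \<in> confs r \<nu>" and s: "s \<in> young r \<mu>"
  shows "ev r f \<mu> \<nu> (push s y) = ev r f \<mu> \<nu> y"
proof -
  have sf: "s \<in> full_transf r" using s young_subset by blast
  have py: "push s y \<in> confs r \<nu>" using push_in[OF sf y] .
  have "rep r \<nu> (push s y) \<in> double_coset r \<mu> (rep r \<nu> y) \<nu>"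
    using double_coset_conf[OF \<nu> rep(1)[OF y] rep(1)[OF py]] rep(2)[OF y] rep(2)[OF py] s by auto
  from double_coset_eq[OF this] show ?thesis by (simp add: ev_def)
qed

lemma S_ext:
  assumes f: "f \<in> S_carrier r n" and g: "g \<in> S_carrier r n"
    and eq: "\<And>\<mu> \<nu> y. \<mu> \<in> compositions r n \<Longrightarrow> \<nu> \<in> compositions r n \<Longrightarrow> y \<in> confs r \<nu> \<Longrightarrow> ev r f \<mu> \<nu> y = ev r g \<mu> \<nu> y"
  shows "f = g"
proof (rule ext)
  fix x show "f x = g x"
  proof (cases "x \<in> basis_index r n")
    case True
    then obtain \<mu> D \<nu> where x: "x = (\<mu>, D, \<nu>)" "\<mu> \<in> compositions r n" "\<nu> \<in> compositions r n" "D \<in> double_cosets r \<mu> \<nu>"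
      by (auto simp: basis_index_def)
    obtain m where m: "m \<in> D" using double_cosets_nonempty[OF x(4)] by blast
    have "conf r \<nu> m \<in> confs r \<nu>" using conf_in double_cosets_subset[OF x(4)] m by blast
    from eq[OF x(2,3) this] show ?thesis unfolding ev_conf[OF x(3,4) m] x(1) .
  next
    case False
    thus ?thesis using f g by (simp add: S_carrier_def S_R_def del: split_paired_All)
  qed
qed

lemma sum_over_cosets:
  assumes \<nu>: "\<nu> \<in> compositions r n"
  shows "(\<Sum>y\<in>confs r \<nu>. g y) = (\<Sum>D\<in>double_cosets r \<mu> \<nu>. \<Sum>y\<in>conf r \<nu> ` D. g y)"
proof -
  have un: "confs r \<nu> = (\<Union>D\<in>double_cosets r \<mu> \<nu>. conf r \<nu> ` D)"
  proof (intro equalityI subsetI)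
    fix y assume y: "y \<in> confs r \<nu>"
    have "y \<in> conf r \<nu> ` double_coset r \<mu> (rep r \<nu> y) \<nu>"
      using rep(2)[OF y] double_coset_self by (metis image_eqI)
    thus "y \<in> (\<Union>D\<in>double_cosets r \<mu> \<nu>. conf r \<nu> ` D)" using dc_rep_in[OF y] by blast
  next
    fix y assume "y \<in> (\<Union>D\<in>double_cosets r \<mu> \<nu>. conf r \<nu> ` D)"
    thus "y \<in> confs r \<nu>" using double_cosets_subset conf_in by blast
  qed
  have disj: "conf r \<nu> ` D \<inter> conf r \<nu> ` D' = {}"
    if D: "D \<in> double_cosets r \<mu> \<nu>" "D' \<in> double_cosets r \<mu> \<nu>" "D \<noteq> D'" for D D'
  proof (rule ccontr)
    assume "conf r \<nu> ` D \<inter> conf r \<nu> ` D' \<noteq> {}"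
    then obtain m m' where m: "m \<in> D" "m' \<in> D'" "conf r \<nu> m = conf r \<nu> m'" by blast
    have "D = D'" using dc_rep[OF \<nu> D(1) m(1)] dc_rep[OF \<nu> D(2) m(2)] m(3) by simp
    thus False using D(3) by simp
  qed
  have fin: "finite (conf r \<nu> ` D)" if "D \<in> double_cosets r \<mu> \<nu>" for D
    using finite_subset[OF double_cosets_subset[OF that] finite_full_transf] by blast
  show ?thesis unfolding un
    by (rule sum.UNION_disjoint) (use finite_double_cosets fin disj in auto)
qed

text \<open>After \<open>struct_const_count\<close> no normalizing factor remains, so a product is a
  sum over intermediate configurations, as for matrices.\<close>

lemma ev_mult:
  assumes \<mu>: "\<mu> \<in> compositions r n" and \<pi>: "\<pi> \<in> compositions r n" and z: "z \<in> confs r \<pi>"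
  shows "ev r (S_mult r n f g) \<mu> \<pi> z =
    (\<Sum>\<nu>\<in>compositions r n. \<Sum>y\<in>confs r \<nu>. ev r f \<mu> \<nu> y * sharp r g \<nu> \<pi> y z)"
proof -
  define D where "D = double_coset r \<mu> (rep r \<pi> z) \<pi>"
  have D: "D \<in> double_cosets r \<mu> \<pi>" using dc_rep_in[OF z] by (simp add: D_def)
  have zD: "z \<in> conf r \<pi> ` D" using rep(2)[OF z] double_coset_self unfolding D_def by (metis image_eqI)
  have idx: "(\<mu>, D, \<pi>) \<in> basis_index r n" using \<mu> \<pi> D by (simp add: basis_index_def)
  let ?Cm = "compositions r n"
  have inner: "(\<Sum>x2\<in>basis_index r n. f x1 * g x2 * of_int (struct_const_R r x1 x2 (\<mu>, D, \<pi>))) =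
      (if fst x1 = \<mu> then \<Sum>D2\<in>double_cosets r (snd (snd x1)) \<pi>. f x1 * g (snd (snd x1), D2, \<pi>) *
          of_int (struct_const_R r x1 (snd (snd x1), D2, \<pi>) (\<mu>, D, \<pi>)) else 0)"
    if "x1 \<in> basis_index r n" for x1
  proof -
    obtain \<mu>1 D1 \<nu> where x1: "x1 = (\<mu>1, D1, \<nu>)" by (cases x1)
    have \<nu>: "\<nu> \<in> ?Cm" using that x1 by (simp add: basis_index_def)
    show ?thesis
    proof (cases "\<mu>1 = \<mu>")
      case True
      have inj: "inj_on (\<lambda>D2. (\<nu>, D2, \<pi>)) (double_cosets r \<nu> \<pi>)" by (auto simp: inj_on_def)
      have "(\<Sum>x2\<in>basis_index r n. f x1 * g x2 * of_int (struct_const_R r x1 x2 (\<mu>, D, \<pi>))) =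
          (\<Sum>x2\<in>(\<lambda>D2. (\<nu>, D2, \<pi>)) ` double_cosets r \<nu> \<pi>. f x1 * g x2 * of_int (struct_const_R r x1 x2 (\<mu>, D, \<pi>)))"
      proof (rule sum.mono_neutral_right[OF finite_basis_index])
        show "(\<lambda>D2. (\<nu>, D2, \<pi>)) ` double_cosets r \<nu> \<pi> \<subseteq> basis_index r n"
          using \<nu> \<pi> by (auto simp: basis_index_def)
        show "\<forall>x2\<in>basis_index r n - (\<lambda>D2. (\<nu>, D2, \<pi>)) ` double_cosets r \<nu> \<pi>.
            f x1 * g x2 * of_int (struct_const_R r x1 x2 (\<mu>, D, \<pi>)) = 0"
          by (auto simp: x1 basis_index_def image_iff)
      qed
      thus ?thesis using True by (simp add: x1 sum.reindex[OF inj])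
    next
      case False
      have "struct_const_R r x1 x2 (\<mu>, D, \<pi>) = 0" for x2
        using False by (cases x2) (simp add: x1)
      thus ?thesis using False x1 by simp
    qed
  qed
  have "S_mult r n f g (\<mu>, D, \<pi>) = (\<Sum>x1\<in>basis_index r n. \<Sum>x2\<in>basis_index r n.
      f x1 * g x2 * of_int (struct_const_R r x1 x2 (\<mu>, D, \<pi>)))"
    using idx by (simp add: S_mult_def S_R_def)
  also have "\<dots> = (\<Sum>x1\<in>basis_index r n. if fst x1 = \<mu> then \<Sum>D2\<in>double_cosets r (snd (snd x1)) \<pi>. f x1 * g (snd (snd x1), D2, \<pi>) *
          of_int (struct_const_R r x1 (snd (snd x1), D2, \<pi>) (\<mu>, D, \<pi>)) else 0)"
    by (rule sum.cong[OF refl]) (rule inner)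
  also have "\<dots> = (\<Sum>x1\<in>(\<lambda>(\<nu>, D1). (\<mu>, D1, \<nu>)) ` (SIGMA \<nu>:?Cm. double_cosets r \<mu> \<nu>).
      \<Sum>D2\<in>double_cosets r (snd (snd x1)) \<pi>. f x1 * g (snd (snd x1), D2, \<pi>) *
          of_int (struct_const_R r x1 (snd (snd x1), D2, \<pi>) (\<mu>, D, \<pi>)))"
  proof -
    have eq: "(\<lambda>(\<nu>, D1). (\<mu>, D1, \<nu>)) ` (SIGMA \<nu>:?Cm. double_cosets r \<mu> \<nu>) = {x1\<in>basis_index r n. fst x1 = \<mu>}"
      using \<mu> by (auto simp: basis_index_def image_iff)
    show ?thesis unfolding eq by (rule sum.inter_filter[OF finite_basis_index, symmetric])
  qed
  also have "\<dots> = (\<Sum>(\<nu>, D1)\<in>(SIGMA \<nu>:?Cm. double_cosets r \<mu> \<nu>).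
      \<Sum>D2\<in>double_cosets r \<nu> \<pi>. f (\<mu>, D1, \<nu>) * g (\<nu>, D2, \<pi>) *
          of_int (struct_const_R r (\<mu>, D1, \<nu>) (\<nu>, D2, \<pi>) (\<mu>, D, \<pi>)))"
  proof -
    have inj: "inj_on (\<lambda>(\<nu>, D1). (\<mu>, D1, \<nu>)) (SIGMA \<nu>:?Cm. double_cosets r \<mu> \<nu>)" by (auto simp: inj_on_def)
    show ?thesis unfolding sum.reindex[OF inj] by (rule sum.cong) auto
  qed
  also have "\<dots> = (\<Sum>\<nu>\<in>?Cm. \<Sum>D1\<in>double_cosets r \<mu> \<nu>.
      \<Sum>D2\<in>double_cosets r \<nu> \<pi>. f (\<mu>, D1, \<nu>) * g (\<nu>, D2, \<pi>) *
          of_int (struct_const_R r (\<mu>, D1, \<nu>) (\<nu>, D2, \<pi>) (\<mu>, D, \<pi>)))"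
    using finite_compositions finite_double_cosets by (subst sum.Sigma) auto
  also have "\<dots> = (\<Sum>\<nu>\<in>?Cm. \<Sum>D1\<in>double_cosets r \<mu> \<nu>. \<Sum>y\<in>conf r \<nu> ` D1. ev r f \<mu> \<nu> y * sharp r g \<nu> \<pi> y z)"
  proof (intro sum.cong[OF refl])
    fix \<nu> D1 assume \<nu>: "\<nu> \<in> ?Cm" and D1: "D1 \<in> double_cosets r \<mu> \<nu>"
    have fin1: "finite (conf r \<nu> ` D1)"
      using finite_subset[OF double_cosets_subset[OF D1] finite_full_transf] by blast
    have "(\<Sum>D2\<in>double_cosets r \<nu> \<pi>. f (\<mu>, D1, \<nu>) * g (\<nu>, D2, \<pi>) *
          of_int (struct_const_R r (\<mu>, D1, \<nu>) (\<nu>, D2, \<pi>) (\<mu>, D, \<pi>))) =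
      (\<Sum>D2\<in>double_cosets r \<nu> \<pi>. \<Sum>y\<in>conf r \<nu> ` D1. \<Sum>z'\<in>conf r \<pi> ` D2.
          if push (rep r \<nu> y) z' = z then ev r f \<mu> \<nu> y * ev r g \<nu> \<pi> z' else 0)"
    proof (rule sum.cong[OF refl])
      fix D2 assume D2: "D2 \<in> double_cosets r \<nu> \<pi>"
      have fin2: "finite (conf r \<pi> ` D2)"
        using finite_subset[OF double_cosets_subset[OF D2] finite_full_transf] by blast
      have sc: "struct_const_R r (\<mu>, D1, \<nu>) (\<nu>, D2, \<pi>) (\<mu>, D, \<pi>) =
          int (\<Sum>y\<in>conf r \<nu> ` D1. \<Sum>z'\<in>conf r \<pi> ` D2. if push (rep r \<nu> y) z' = z then 1 else 0)"
        unfolding struct_const_count[OF \<mu> \<nu> \<pi> D1 D2 D zD]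
        using fin2 by (simp add: sum.If_cases Int_def)
      have "f (\<mu>, D1, \<nu>) * g (\<nu>, D2, \<pi>) * of_int (struct_const_R r (\<mu>, D1, \<nu>) (\<nu>, D2, \<pi>) (\<mu>, D, \<pi>)) =
        (\<Sum>y\<in>conf r \<nu> ` D1. \<Sum>z'\<in>conf r \<pi> ` D2.
          f (\<mu>, D1, \<nu>) * g (\<nu>, D2, \<pi>) * (if push (rep r \<nu> y) z' = z then 1 else 0))"
        unfolding sc of_nat_sum of_int_sum sum_distrib_left
        by (intro sum.cong refl) auto
      also have "\<dots> = (\<Sum>y\<in>conf r \<nu> ` D1. \<Sum>z'\<in>conf r \<pi> ` D2.
          if push (rep r \<nu> y) z' = z then ev r f \<mu> \<nu> y * ev r g \<nu> \<pi> z' else 0)"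
        by (intro sum.cong refl) (auto simp: ev_conf[OF \<nu> D1] ev_conf[OF \<pi> D2])
      finally show "f (\<mu>, D1, \<nu>) * g (\<nu>, D2, \<pi>) * of_int (struct_const_R r (\<mu>, D1, \<nu>) (\<nu>, D2, \<pi>) (\<mu>, D, \<pi>)) =
        (\<Sum>y\<in>conf r \<nu> ` D1. \<Sum>z'\<in>conf r \<pi> ` D2.
          if push (rep r \<nu> y) z' = z then ev r f \<mu> \<nu> y * ev r g \<nu> \<pi> z' else 0)" .
    qed
    also have "\<dots> = (\<Sum>y\<in>conf r \<nu> ` D1. \<Sum>D2\<in>double_cosets r \<nu> \<pi>. \<Sum>z'\<in>conf r \<pi> ` D2.
          if push (rep r \<nu> y) z' = z then ev r f \<mu> \<nu> y * ev r g \<nu> \<pi> z' else 0)"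
      by (rule sum.swap)
    also have "\<dots> = (\<Sum>y\<in>conf r \<nu> ` D1. ev r f \<mu> \<nu> y * sharp r g \<nu> \<pi> y z)"
    proof (rule sum.cong[OF refl])
      fix y
      have "(\<Sum>D2\<in>double_cosets r \<nu> \<pi>. \<Sum>z'\<in>conf r \<pi> ` D2.
          if push (rep r \<nu> y) z' = z then ev r f \<mu> \<nu> y * ev r g \<nu> \<pi> z' else 0) =
          (\<Sum>z'\<in>confs r \<pi>. if push (rep r \<nu> y) z' = z then ev r f \<mu> \<nu> y * ev r g \<nu> \<pi> z' else 0)"
        by (rule sum_over_cosets[OF \<pi>, symmetric])
      also have "\<dots> = ev r f \<mu> \<nu> y * sharp r g \<nu> \<pi> y z"
        unfolding sharp_def sum_distrib_left by (rule sum.inter_filter[OF finite_confs, symmetric])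
      finally show "(\<Sum>D2\<in>double_cosets r \<nu> \<pi>. \<Sum>z'\<in>conf r \<pi> ` D2.
          if push (rep r \<nu> y) z' = z then ev r f \<mu> \<nu> y * ev r g \<nu> \<pi> z' else 0) = ev r f \<mu> \<nu> y * sharp r g \<nu> \<pi> y z" .
    qed
    finally show "(\<Sum>D2\<in>double_cosets r \<nu> \<pi>. f (\<mu>, D1, \<nu>) * g (\<nu>, D2, \<pi>) *
          of_int (struct_const_R r (\<mu>, D1, \<nu>) (\<nu>, D2, \<pi>) (\<mu>, D, \<pi>))) =
        (\<Sum>y\<in>conf r \<nu> ` D1. ev r f \<mu> \<nu> y * sharp r g \<nu> \<pi> y z)" .
  qed
  also have "\<dots> = (\<Sum>\<nu>\<in>?Cm. \<Sum>y\<in>confs r \<nu>. ev r f \<mu> \<nu> y * sharp r g \<nu> \<pi> y z)"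
    by (intro sum.cong refl sum_over_cosets[symmetric])
  finally show ?thesis by (simp add: ev_def D_def)
qed

lemma sharp_conf:
  assumes \<nu>: "\<nu> \<in> compositions r n" and \<pi>: "\<pi> \<in> compositions r n" and m: "m \<in> full_transf r"
  shows "sharp r g \<nu> \<pi> (conf r \<nu> m) z = (\<Sum>z'\<in>{z'\<in>confs r \<pi>. push m z' = z}. ev r g \<nu> \<pi> z')"
proof -
  define R where "R = rep r \<nu> (conf r \<nu> m)"
  obtain \<tau> where t: "\<tau> \<in> young r \<nu>" "m = R \<circ> \<tau>"
    using conf_eq_iff[OF \<nu> m rep(1)[OF conf_in[OF m, of \<nu>]]] rep(2)[OF conf_in[OF m, of \<nu>]] unfolding R_def by auto
  have cancel: "push \<tau> (push (Hilbert_Choice.inv \<tau>) z') = z'" "push (Hilbert_Choice.inv \<tau>) (push \<tau> z') = z'" for z'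
    using young_inv(2,3)[OF t(1)] by (simp_all add: push_push)
  have pin: "push \<tau> z' \<in> confs r \<pi>" "push (Hilbert_Choice.inv \<tau>) z' \<in> confs r \<pi>" if "z' \<in> confs r \<pi>" for z'
    using push_in[OF _ that] t(1) young_inv(1)[OF t(1)] young_subset by blast+
  have pm: "push m z' = push R (push \<tau> z')" for z' by (simp add: push_push t(2))
  have "(\<Sum>z'\<in>{z'\<in>confs r \<pi>. push m z' = z}. ev r g \<nu> \<pi> z') = (\<Sum>z'\<in>{z'\<in>confs r \<pi>. push R z' = z}. ev r g \<nu> \<pi> z')"
  proof (rule sum.reindex_bij_witness[of _ "push (Hilbert_Choice.inv \<tau>)" "push \<tau>"])
    show "ev r g \<nu> \<pi> (push \<tau> z') = ev r g \<nu> \<pi> z'" if "z' \<in> {z'\<in>confs r \<pi>. push m z' = z}" for z'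
      using ev_push[OF \<pi> _ t(1)] that by blast
  qed (auto simp: cancel pm pin)
  thus ?thesis by (simp add: sharp_def R_def)
qed

text \<open>Right multiplication commutes with pushing forward along m: both sides sum over lifts
  under the composite of m with a representative of y.\<close>

lemma sharp_equivariant:
  assumes \<nu>: "\<nu> \<in> compositions r n" and \<pi>: "\<pi> \<in> compositions r n" and m: "m \<in> full_transf r" and y: "y \<in> confs r \<nu>"
  shows "(\<Sum>w\<in>{w\<in>confs r \<pi>. push m w = z}. sharp r g \<nu> \<pi> y w) = sharp r g \<nu> \<pi> (push m y) z"
proof -
  define R where "R = rep r \<nu> y"
  have R: "R \<in> full_transf r" "conf r \<nu> R = y" using rep[OF y] by (simp_all add: R_def)
  have "push m y = conf r \<nu> (m \<circ> R)" using R by (simp add: push_conf[symmetric])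
  hence "sharp r g \<nu> \<pi> (push m y) z = (\<Sum>z'\<in>{z'\<in>confs r \<pi>. push (m \<circ> R) z' = z}. ev r g \<nu> \<pi> z')"
    using sharp_conf[OF \<nu> \<pi> full_transf_comp[OF m R(1)]] by simp
  also have "\<dots> = (\<Sum>w\<in>{w\<in>confs r \<pi>. push m w = z}. \<Sum>z'\<in>{z' \<in> {z'\<in>confs r \<pi>. push (m \<circ> R) z' = z}. push R z' = w}. ev r g \<nu> \<pi> z')"
    by (rule sum.group[symmetric]) (auto simp: finite_confs push_push push_in[OF R(1)])
  also have "\<dots> = (\<Sum>w\<in>{w\<in>confs r \<pi>. push m w = z}. sharp r g \<nu> \<pi> y w)"
  proof (rule sum.cong[OF refl])
    fix w assume "w \<in> {w\<in>confs r \<pi>. push m w = z}"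
    hence "{z' \<in> {z'\<in>confs r \<pi>. push (m \<circ> R) z' = z}. push R z' = w} = {z'\<in>confs r \<pi>. push R z' = w}"
      by (auto simp: push_push[symmetric])
    thus "(\<Sum>z'\<in>{z' \<in> {z'\<in>confs r \<pi>. push (m \<circ> R) z' = z}. push R z' = w}. ev r g \<nu> \<pi> z') = sharp r g \<nu> \<pi> y w"
      by (simp add: sharp_def R_def)
  qed
  finally show ?thesis by simp
qed

lemma S_mult_closed: "S_mult r n f g \<in> S_carrier r n"
  by (simp add: S_mult_def S_carrier_def S_R_def)

text \<open>By equivariance the kernel of a product is the product of the kernels; the rest
  exchanges finite sums.\<close>

lemma S_mult_assoc: "S_mult r n (S_mult r n f g) h = S_mult r n f (S_mult r n g h)"
proof (rule S_ext[OF S_mult_closed S_mult_closed])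
  fix \<mu> \<rho> z assume \<mu>: "\<mu> \<in> compositions r n" and \<rho>: "\<rho> \<in> compositions r n" and z: "z \<in> confs r \<rho>"
  let ?Cm = "compositions r n"
  have sm: "sharp r (S_mult r n g h) \<nu> \<rho> y z = (\<Sum>\<pi>\<in>?Cm. \<Sum>x\<in>confs r \<pi>. sharp r g \<nu> \<pi> y x * sharp r h \<pi> \<rho> x z)"
    if \<nu>: "\<nu> \<in> ?Cm" and y: "y \<in> confs r \<nu>" for \<nu> y
  proof -
    define R where "R = rep r \<nu> y"
    have R: "R \<in> full_transf r" using rep(1)[OF y] by (simp add: R_def)
    have "sharp r (S_mult r n g h) \<nu> \<rho> y z =
        (\<Sum>w\<in>{w\<in>confs r \<rho>. push R w = z}. \<Sum>\<pi>\<in>?Cm. \<Sum>u\<in>confs r \<pi>. ev r g \<nu> \<pi> u * sharp r h \<pi> \<rho> u w)"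
      unfolding sharp_def[of r "S_mult r n g h"] R_def[symmetric] by (rule sum.cong) (auto simp: ev_mult[OF \<nu> \<rho>])
    also have "\<dots> = (\<Sum>\<pi>\<in>?Cm. \<Sum>w\<in>{w\<in>confs r \<rho>. push R w = z}. \<Sum>u\<in>confs r \<pi>. ev r g \<nu> \<pi> u * sharp r h \<pi> \<rho> u w)"
      by (rule sum.swap)
    also have "\<dots> = (\<Sum>\<pi>\<in>?Cm. \<Sum>x\<in>confs r \<pi>. sharp r g \<nu> \<pi> y x * sharp r h \<pi> \<rho> x z)"
    proof (rule sum.cong[OF refl])
      fix \<pi> assume \<pi>: "\<pi> \<in> ?Cm"
      have "(\<Sum>w\<in>{w\<in>confs r \<rho>. push R w = z}. \<Sum>u\<in>confs r \<pi>. ev r g \<nu> \<pi> u * sharp r h \<pi> \<rho> u w) =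
          (\<Sum>u\<in>confs r \<pi>. ev r g \<nu> \<pi> u * (\<Sum>w\<in>{w\<in>confs r \<rho>. push R w = z}. sharp r h \<pi> \<rho> u w))"
        unfolding sum_distrib_left by (rule sum.swap)
      also have "\<dots> = (\<Sum>u\<in>confs r \<pi>. ev r g \<nu> \<pi> u * sharp r h \<pi> \<rho> (push R u) z)"
        by (rule sum.cong) (auto simp: sharp_equivariant[OF \<pi> \<rho> R])
      also have "\<dots> = (\<Sum>x\<in>confs r \<pi>. \<Sum>u\<in>{u\<in>confs r \<pi>. push R u = x}. ev r g \<nu> \<pi> u * sharp r h \<pi> \<rho> (push R u) z)"
        by (rule sum.group[symmetric]) (auto simp: finite_confs push_in[OF R])
      also have "\<dots> = (\<Sum>x\<in>confs r \<pi>. sharp r g \<nu> \<pi> y x * sharp r h \<pi> \<rho> x z)"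
        unfolding sharp_def[of r g] sum_distrib_right R_def[symmetric] by (intro sum.cong refl) auto
      finally show "(\<Sum>w\<in>{w\<in>confs r \<rho>. push R w = z}. \<Sum>u\<in>confs r \<pi>. ev r g \<nu> \<pi> u * sharp r h \<pi> \<rho> u w) =
          (\<Sum>x\<in>confs r \<pi>. sharp r g \<nu> \<pi> y x * sharp r h \<pi> \<rho> x z)" .
    qed
    finally show ?thesis .
  qed
  have "ev r (S_mult r n (S_mult r n f g) h) \<mu> \<rho> z =
      (\<Sum>\<pi>\<in>?Cm. \<Sum>x\<in>confs r \<pi>. \<Sum>\<nu>\<in>?Cm. \<Sum>y\<in>confs r \<nu>. ev r f \<mu> \<nu> y * sharp r g \<nu> \<pi> y x * sharp r h \<pi> \<rho> x z)"
    unfolding ev_mult[OF \<mu> \<rho> z] by (intro sum.cong refl) (simp add: ev_mult[OF \<mu>] sum_distrib_right)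
  also have "\<dots> = (\<Sum>\<pi>\<in>?Cm. \<Sum>\<nu>\<in>?Cm. \<Sum>x\<in>confs r \<pi>. \<Sum>y\<in>confs r \<nu>. ev r f \<mu> \<nu> y * sharp r g \<nu> \<pi> y x * sharp r h \<pi> \<rho> x z)"
    by (rule sum.cong[OF refl]) (rule sum.swap)
  also have "\<dots> = (\<Sum>\<nu>\<in>?Cm. \<Sum>\<pi>\<in>?Cm. \<Sum>x\<in>confs r \<pi>. \<Sum>y\<in>confs r \<nu>. ev r f \<mu> \<nu> y * sharp r g \<nu> \<pi> y x * sharp r h \<pi> \<rho> x z)"
    by (rule sum.swap)
  also have "\<dots> = (\<Sum>\<nu>\<in>?Cm. \<Sum>\<pi>\<in>?Cm. \<Sum>y\<in>confs r \<nu>. \<Sum>x\<in>confs r \<pi>. ev r f \<mu> \<nu> y * sharp r g \<nu> \<pi> y x * sharp r h \<pi> \<rho> x z)"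
    by (rule sum.cong[OF refl], rule sum.cong[OF refl]) (rule sum.swap)
  also have "\<dots> = (\<Sum>\<nu>\<in>?Cm. \<Sum>y\<in>confs r \<nu>. \<Sum>\<pi>\<in>?Cm. \<Sum>x\<in>confs r \<pi>. ev r f \<mu> \<nu> y * sharp r g \<nu> \<pi> y x * sharp r h \<pi> \<rho> x z)"
    by (rule sum.cong[OF refl]) (rule sum.swap)
  also have "\<dots> = (\<Sum>\<nu>\<in>?Cm. \<Sum>y\<in>confs r \<nu>. ev r f \<mu> \<nu> y * sharp r (S_mult r n g h) \<nu> \<rho> y z)"
    by (intro sum.cong refl) (simp add: sm sum_distrib_left mult.assoc)
  also have "\<dots> = ev r (S_mult r n f (S_mult r n g h)) \<mu> \<rho> z"
    by (rule ev_mult[OF \<mu> \<rho> z, symmetric])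
  finally show "ev r (S_mult r n (S_mult r n f g) h) \<mu> \<rho> z = ev r (S_mult r n f (S_mult r n g h)) \<mu> \<rho> z" .
qed

section \<open>Identity element and algebra structure\<close>

lemma young_double_coset: "young r \<mu> = double_coset r \<mu> id \<mu>"
proof (intro equalityI subsetI)
  fix s assume "s \<in> young r \<mu>"
  hence "s = s \<circ> id \<circ> id \<and> s \<in> young r \<mu> \<and> id \<in> young r \<mu>" using young_id by simp
  thus "s \<in> double_coset r \<mu> id \<mu>" unfolding double_coset_def by blast
next
  fix s assume "s \<in> double_coset r \<mu> id \<mu>"
  thus "s \<in> young r \<mu>" unfolding double_coset_def using young_comp by auto
qed

lemma id_full: "id \<in> full_transf r" by (simp add: full_transf_def)

lemma S_one_closed: "S_one r n \<in> S_carrier r n"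
proof -
  have "young r \<mu> \<in> double_cosets r \<mu> \<mu>" for \<mu>
    unfolding young_double_coset double_cosets_def using id_full by blast
  thus ?thesis by (auto simp: S_one_def S_carrier_def S_R_def basis_index_def)
qed

lemma ev_one:
  assumes \<mu>: "\<mu> \<in> compositions r n" and \<nu>: "\<nu> \<in> compositions r n" and y: "y \<in> confs r \<nu>"
  shows "ev r (S_one r n) \<mu> \<nu> y = (if \<nu> = \<mu> \<and> y = conf r \<mu> id then 1 else 0)"
proof (cases "\<nu> = \<mu>")
  case True
  have "double_coset r \<mu> (rep r \<mu> y) \<mu> = young r \<mu> \<longleftrightarrow> rep r \<mu> y \<in> young r \<mu>"
    using double_coset_self[of "rep r \<mu> y" r \<mu> \<mu>] double_coset_eq[of "rep r \<mu> y" r \<mu> id \<mu>]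
    unfolding young_double_coset by blast
  also have "\<dots> \<longleftrightarrow> conf r \<mu> (rep r \<mu> y) = conf r \<mu> id"
    using conf_eq_iff[OF \<mu> rep(1) id_full] y True by auto
  also have "\<dots> \<longleftrightarrow> y = conf r \<mu> id" using rep(2) y True by simp
  finally show ?thesis using True \<mu> by (simp add: ev_def S_one_def S_R_def)
qed (simp add: ev_def S_one_def S_R_def)

lemma S_one_left:
  assumes g: "g \<in> S_carrier r n" shows "S_mult r n (S_one r n) g = g"
proof (rule S_ext[OF S_mult_closed g])
  fix \<mu> \<pi> z assume \<mu>: "\<mu> \<in> compositions r n" and \<pi>: "\<pi> \<in> compositions r n" and z: "z \<in> confs r \<pi>"
  have "ev r (S_mult r n (S_one r n) g) \<mu> \<pi> z = (\<Sum>\<nu>\<in>compositions r n. \<Sum>y\<in>confs r \<nu>.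
      if \<nu> = \<mu> \<and> y = conf r \<mu> id then sharp r g \<mu> \<pi> (conf r \<mu> id) z else 0)"
    unfolding ev_mult[OF \<mu> \<pi> z] by (intro sum.cong refl) (simp add: ev_one[OF \<mu>])
  also have "\<dots> = (\<Sum>\<nu>\<in>compositions r n. if \<nu> = \<mu> then sharp r g \<mu> \<pi> (conf r \<mu> id) z else 0)"
    using conf_in[OF id_full] finite_confs by (intro sum.cong refl) auto
  also have "\<dots> = sharp r g \<mu> \<pi> (conf r \<mu> id) z" using \<mu> finite_compositions by simp
  also have "\<dots> = (\<Sum>z'\<in>{z'\<in>confs r \<pi>. z' = z}. ev r g \<mu> \<pi> z')" by (simp add: sharp_conf[OF \<mu> \<pi> id_full])
  also have "{z'\<in>confs r \<pi>. z' = z} = {z}" using z by auto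
  finally show "ev r (S_mult r n (S_one r n) g) \<mu> \<pi> z = ev r g \<mu> \<pi> z" by simp
qed

lemma S_one_right:
  assumes g: "g \<in> S_carrier r n" shows "S_mult r n g (S_one r n) = g"
proof (rule S_ext[OF S_mult_closed g])
  fix \<mu> \<pi> z assume \<mu>: "\<mu> \<in> compositions r n" and \<pi>: "\<pi> \<in> compositions r n" and z: "z \<in> confs r \<pi>"
  have sh: "sharp r (S_one r n) \<nu> \<pi> y z = (if \<nu> = \<pi> \<and> y = z then 1 else (0::'a))"
    if \<nu>: "\<nu> \<in> compositions r n" and y: "y \<in> confs r \<nu>" for \<nu> y
  proof -
    have "sharp r (S_one r n) \<nu> \<pi> y z = (\<Sum>z'\<in>{z'\<in>confs r \<pi>. push (rep r \<nu> y) z' = z}.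
        if z' = conf r \<nu> id then (if \<pi> = \<nu> then 1 else 0) else (0::'a))"
      unfolding sharp_def by (rule sum.cong) (auto simp: ev_one[OF \<nu> \<pi>])
    also have "\<dots> = (if conf r \<nu> id \<in> {z'\<in>confs r \<pi>. push (rep r \<nu> y) z' = z} then (if \<pi> = \<nu> then 1 else 0) else 0)"
      by (simp add: finite_confs)
    also have "push (rep r \<nu> y) (conf r \<nu> id) = y" using rep(2)[OF y] by (simp add: push_conf)
    hence "(if conf r \<nu> id \<in> {z'\<in>confs r \<pi>. push (rep r \<nu> y) z' = z} then (if \<pi> = \<nu> then 1 else 0) else 0)
       = (if \<nu> = \<pi> \<and> y = z then 1 else (0::'a))" using conf_in[OF id_full, of r \<nu>] by auto
    finally show ?thesis .
  qed
  have "ev r (S_mult r n g (S_one r n)) \<mu> \<pi> z = (\<Sum>\<nu>\<in>compositions r n. \<Sum>y\<in>confs r \<nu>.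
      if \<nu> = \<pi> \<and> y = z then ev r g \<mu> \<pi> z else 0)"
    unfolding ev_mult[OF \<mu> \<pi> z] by (intro sum.cong refl) (simp add: sh)
  also have "\<dots> = (\<Sum>\<nu>\<in>compositions r n. if \<nu> = \<pi> then ev r g \<mu> \<pi> z else 0)"
    using z finite_confs by (intro sum.cong refl) auto
  also have "\<dots> = ev r g \<mu> \<pi> z" using \<pi> finite_compositions by simp
  finally show "ev r (S_mult r n g (S_one r n)) \<mu> \<pi> z = ev r g \<mu> \<pi> z" .
qed

lemma S_mult_bilinear:
  fixes x y z :: "coset_index \<Rightarrow> 'k::field"
  shows "S_mult r n (x + y) z = S_mult r n x z + S_mult r n y z"
    and "S_mult r n x (y + z) = S_mult r n x y + S_mult r n x z"
    and "S_mult r n (fscale c x) y = fscale c (S_mult r n x y)"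
    and "S_mult r n x (fscale c y) = fscale c (S_mult r n x y)"
  by (simp_all add: S_mult_def S_R_def fun_eq_iff sum.distrib sum_distrib_left algebra_simps)

lemma vs_algebra_S: "vs_algebra fscale (S_carrier r n) (S_mult r n) (S_one r n :: coset_index \<Rightarrow> 'k::field)"
proof (intro vs_algebra.intro vs_algebra_axioms.intro)
  show "vector_space (fscale :: 'k \<Rightarrow> (coset_index \<Rightarrow> 'k) \<Rightarrow> _)" by (rule fs.vector_space_axioms)
  let ?V = "S_carrier r n :: (coset_index \<Rightarrow> 'k) set"
  have V: "f \<in> ?V \<longleftrightarrow> (\<forall>x. x \<notin> basis_index r n \<longrightarrow> f x = 0)" for f by (simp add: S_carrier_def S_R_def del: split_paired_All)
  show "fs.subspace ?V" unfolding fs.subspace_def by (simp add: V)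
  show "\<exists>B. finite B \<and> B \<subseteq> ?V \<and> ?V \<subseteq> fs.span B"
  proof (intro exI conjI)
    let ?\<delta> = "\<lambda>x y. if y = x then 1 else (0::'k)"
    show "finite (?\<delta> ` basis_index r n)" using finite_basis_index by blast
    show "?\<delta> ` basis_index r n \<subseteq> ?V" by (auto simp: V)
    show "?V \<subseteq> fs.span (?\<delta> ` basis_index r n)"
    proof
      fix f assume f: "f \<in> ?V"
      have "f = (\<Sum>x\<in>basis_index r n. fscale (f x) (?\<delta> x))"
      proof
        fix y
        have "(\<Sum>x\<in>basis_index r n. fscale (f x) (?\<delta> x)) y = (\<Sum>x\<in>basis_index r n. if x = y then f y else 0)"
          unfolding sum_fun_apply by (rule sum.cong) auto
        also have "\<dots> = f y" using f finite_basis_index by (simp add: V del: split_paired_All)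
        finally show "f y = (\<Sum>x\<in>basis_index r n. fscale (f x) (?\<delta> x)) y" by simp
      qed
      moreover have "(\<Sum>x\<in>basis_index r n. fscale (f x) (?\<delta> x)) \<in> fs.span (?\<delta> ` basis_index r n)"
        by (intro fs.span_sum fs.span_scale fs.span_base) blast
      ultimately show "f \<in> fs.span (?\<delta> ` basis_index r n)" by (simp only:)
    qed
  qed
qed (simp_all add: S_mult_closed S_one_closed S_mult_assoc S_one_left S_one_right S_mult_bilinear)

lemma alg_S: "vs_algebra.alg fscale (S_carrier r n) (S_mult r n) (S_one r n) = (S_R r n :: ('k::field, coset_index \<Rightarrow> 'k) module)"
  unfolding vs_algebra.alg_def[OF vs_algebra_S]
  unfolding S_carrier_def S_mult_def S_one_def
  by (simp add: S_R_def zero_fun_def) (auto simp: fun_eq_iff)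

section \<open>Codeterminants in the algebra\<close>

definition supp :: "(nat \<times> nat) multiset \<Rightarrow> nat set" where "supp y = fst ` set_mset y"

definition vec :: "(nat \<times> nat) multiset \<Rightarrow> nat \<Rightarrow> nat multiset" where
  "vec y x = image_mset snd (filter_mset (\<lambda>p. fst p = x) y)"

text \<open>The points are the image of the underlying map, so their number is the rank. The first
  label, the block of \<mu>, sees the left Young subgroup; the second is the multiset of blocks of
  \<nu> in the fibre.\<close>

definition point :: "nat list \<Rightarrow> (nat \<times> nat) multiset \<Rightarrow> (nat, nat, nat multiset) labelled" where
  "point \<mu> y = (supp y, blk \<mu>, vec y)"

lemma finite_supp [simp]: "finite (supp y)" by (simp add: supp_def)

lemma supp_subset: "y \<in> confs r \<nu> \<Longrightarrow> supp y \<subseteq> {1..r}"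
  unfolding confs_def supp_def by blast

lemma count_vec: "count (vec y x) b = count y (x, b)"
proof -
  have eq: "snd -` {b} \<inter> set_mset (filter_mset (\<lambda>p. fst p = x) y) = (if (x, b) \<in># y then {(x, b)} else {})"
    by auto
  show ?thesis unfolding vec_def count_image_mset eq by (simp add: not_in_iff)
qed

lemma vec_empty_iff: "vec y x = {#} \<longleftrightarrow> x \<notin> supp y"
  unfolding vec_def image_mset_is_empty_iff set_mset_eq_empty_iff[symmetric] supp_def by force

lemma conf_eqI:
  assumes "supp y = supp z" "\<And>x. x \<in> supp y \<Longrightarrow> vec y x = vec z x" shows "y = z"
proof (rule multiset_eqI)
  fix p :: "nat \<times> nat"
  obtain x b where p: "p = (x, b)" by (cases p)
  have "vec y x = vec z x"
    using assms vec_empty_iff[of y x] vec_empty_iff[of z x] by (cases "x \<in> supp y") auto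
  thus "count y p = count z p" unfolding p count_vec[symmetric] by simp
qed

lemma supp_push: "supp (push m y) = m ` supp y"
  by (simp add: supp_def push_def image_image)

lemma vec_push:
  assumes inj: "inj_on m (supp y)" and x: "x \<in> supp y"
  shows "vec (push m y) (m x) = vec y x"
proof -
  have "filter_mset (\<lambda>p. m (fst p) = m x) y = filter_mset (\<lambda>p. fst p = x) y"
    using inj x by (intro filter_mset_cong refl) (auto simp: supp_def inj_on_def)
  thus ?thesis by (simp add: vec_def push_def filter_mset_image_mset multiset.map_comp comp_def)
qed

lemma push_cong: "(\<And>x. x \<in> supp y \<Longrightarrow> m x = m' x) \<Longrightarrow> push m y = push m' y"
  unfolding push_def
proof (rule image_mset_cong)
  fix p assume m: "\<And>x. x \<in> supp y \<Longrightarrow> m x = m' x" and p: "p \<in># y"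
  have "m (fst p) = m' (fst p)" using m p by (simp add: supp_def)
  thus "map_prod m id p = map_prod m' id p" by (cases p) simp
qed

lemma push_ident: "(\<And>x. x \<in> supp y \<Longrightarrow> m x = x) \<Longrightarrow> push m y = y"
  using push_cong[of y m id] by simp

lemma sum_vec: "(\<Sum>x\<in>supp y. vec y x) = image_mset snd y"
proof (rule multiset_eqI)
  fix b
  have "count (image_mset snd y) b = (\<Sum>p\<in>{p\<in>set_mset y. snd p = b}. count y p)"
    unfolding count_image_mset by (rule sum.cong) auto
  also have "\<dots> = (\<Sum>x\<in>supp y. \<Sum>p\<in>{p\<in>{p\<in>set_mset y. snd p = b}. fst p = x}. count y p)"
    by (rule sum.group[symmetric]) (auto simp: supp_def)
  also have "\<dots> = (\<Sum>x\<in>supp y. count y (x, b))"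
  proof (rule sum.cong[OF refl])
    fix x
    have "{p\<in>{p\<in>set_mset y. snd p = b}. fst p = x} = (if (x, b) \<in># y then {(x, b)} else {})" by auto
    thus "(\<Sum>p\<in>{p\<in>{p\<in>set_mset y. snd p = b}. fst p = x}. count y p) = count y (x, b)"
      by (simp add: not_in_iff)
  qed
  finally show "count (\<Sum>x\<in>supp y. vec y x) b = count (image_mset snd y) b"
    by (simp add: count_sum count_vec)
qed

definition of_vec :: "nat set \<Rightarrow> (nat \<Rightarrow> nat multiset) \<Rightarrow> (nat \<times> nat) multiset" where
  "of_vec Z v = (\<Sum>x\<in>Z. image_mset (Pair x) (v x))"

lemma of_vec:
  assumes Z: "finite Z" and ne: "\<And>x. x \<in> Z \<Longrightarrow> v x \<noteq> {#}"
  shows "supp (of_vec Z v) = Z" "x \<in> Z \<Longrightarrow> vec (of_vec Z v) x = v x"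
    "image_mset snd (of_vec Z v) = (\<Sum>x\<in>Z. v x)"
proof -
  have set: "set_mset (of_vec Z v) = (\<Union>x\<in>Z. Pair x ` set_mset (v x))"
    using Z by (simp add: of_vec_def set_mset_sum)
  show "supp (of_vec Z v) = Z"
  proof
    show "supp (of_vec Z v) \<subseteq> Z" unfolding supp_def set by auto
    show "Z \<subseteq> supp (of_vec Z v)"
    proof
      fix x assume x: "x \<in> Z"
      then obtain b where "b \<in># v x" using ne by (meson multiset_nonemptyE)
      hence "(x, b) \<in># of_vec Z v" using x unfolding set by blast
      thus "x \<in> supp (of_vec Z v)" unfolding supp_def by force
    qed
  qed
  show "image_mset snd (of_vec Z v) = (\<Sum>x\<in>Z. v x)"
    unfolding of_vec_def by (induction Z rule: infinite_finite_induct) (auto simp: multiset.map_comp comp_def)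
  show "vec (of_vec Z v) x = v x" if x: "x \<in> Z"
  proof (rule multiset_eqI)
    fix b
    have c: "count (image_mset (Pair x') M) (x, b) = (if x' = x then count M b else 0)" for x' :: nat and M :: "nat multiset"
      by (induction M) auto
    have "count (vec (of_vec Z v) x) b = (\<Sum>x'\<in>Z. if x' = x then count (v x') b else 0)"
      by (simp add: count_vec of_vec_def count_sum c)
    thus "count (vec (of_vec Z v) x) b = count (v x) b" using Z x by simp
  qed
qed

text \<open>The complements of \<open>Z\<close> and \<open>Z2\<close> carry equal multisets of
  labels, so they can be matched too. With \<phi> the block map the result lies in the Young
  subgroup.\<close>

lemma extend_to_permutation:
  fixes \<phi> :: "nat \<Rightarrow> 'x"
  assumes Z: "Z \<subseteq> {1..r}" "Z2 \<subseteq> {1..r}" and h: "bij_betw h Z Z2" "\<And>x. x \<in> Z \<Longrightarrow> \<phi> (h x) = \<phi> x"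
  shows "\<exists>s. s permutes {1..r} \<and> (\<forall>t\<in>{1..r}. \<phi> (s t) = \<phi> t) \<and> (\<forall>x\<in>Z. s x = h x)"
proof -
  have fin: "finite Z" "finite Z2" using Z finite_subset by blast+
  have split: "image_mset \<phi> (mset_set {1..r}) = image_mset \<phi> (mset_set Y) + image_mset \<phi> (mset_set ({1..r} - Y))"
    if "Y \<subseteq> {1..r}" for Y
  proof -
    have "mset_set {1..r} = mset_set (Y \<union> ({1..r} - Y))" using that by (simp add: Un_absorb1)
    also have "\<dots> = mset_set Y + mset_set ({1..r} - Y)"
      using that finite_subset[OF that] by (intro mset_set_Union) auto
    finally show ?thesis by simp
  qed
  have "image_mset \<phi> (mset_set Z2) = image_mset \<phi> (image_mset h (mset_set Z))"
    using h(1) by (simp add: image_mset_mset_set bij_betw_def)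
  also have "\<dots> = image_mset \<phi> (mset_set Z)"
    unfolding multiset.map_comp using h(2) fin by (intro image_mset_cong) auto
  finally have "image_mset \<phi> (mset_set ({1..r} - Z)) = image_mset \<phi> (mset_set ({1..r} - Z2))"
    using split[OF Z(1)] split[OF Z(2)] by simp
  then obtain k where k: "bij_betw k ({1..r} - Z) ({1..r} - Z2)" "\<forall>x\<in>{1..r} - Z. \<phi> (k x) = \<phi> x"
    using ex_bij_of_image_mset_eq[of "{1..r} - Z" "{1..r} - Z2" \<phi> \<phi>] by auto
  define s where "s x = (if x \<in> Z then h x else if x \<in> {1..r} then k x else x)" for x
  have "bij_betw s Z Z2" using h(1) by (rule bij_betw_cong[THEN iffD1, rotated]) (simp add: s_def)
  moreover have "bij_betw s ({1..r} - Z) ({1..r} - Z2)"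
    using k(1) by (rule bij_betw_cong[THEN iffD1, rotated]) (simp add: s_def)
  ultimately have "bij_betw s (Z \<union> ({1..r} - Z)) (Z2 \<union> ({1..r} - Z2))"
    by (rule bij_betw_combine) auto
  hence "bij_betw s {1..r} {1..r}" using Z by (simp add: Un_absorb1)
  hence "s permutes {1..r}" using Z by (intro bij_imp_permutes) (auto simp: s_def)
  moreover have "\<phi> (s t) = \<phi> t" if "t \<in> {1..r}" for t using that h(2) k(2) by (simp add: s_def)
  ultimately show ?thesis by (auto simp: s_def intro!: exI[of _ s])
qed

lemma permutes_full: "s permutes {1..r} \<Longrightarrow> s \<in> full_transf r"
  using permutes_in_image[of s "{1..r}"] permutes_not_in[of s "{1..r}"] by (auto simp: full_transf_def)

text \<open>Invariance under the left Young subgroup, which makes the values of \<open>pull\<close>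
  on double cosets well defined.\<close>

lemma codet_point_push:
  assumes \<mu>: "\<mu> \<in> compositions r n" and y: "y \<in> confs r \<nu>" and s: "s \<in> young r \<mu>"
  shows "codet S T (point \<mu> (push s y)) = codet S T (point \<mu> y)"
proof -
  have p: "s permutes {1..r}" and b: "\<And>t. t \<in> {1..r} \<Longrightarrow> blk \<mu> (s t) = blk \<mu> t"
    using s young_iff[OF \<mu>] by auto
  have inj: "inj_on s (supp y)" using permutes_inj[OF p] inj_on_subset by blast
  have bij: "bij_betw s (supp y) (supp (push s y))" using inj by (simp add: bij_betw_def supp_push)
  show ?thesis unfolding point_def
    by (rule codet_bij[OF bij]) (use b supp_subset[OF y] vec_push[OF inj] in auto)
qed

definition pull ::
  "nat \<Rightarrow> nat \<Rightarrow> nat list \<Rightarrow> nat list \<Rightarrow> ((nat, nat, nat multiset) labelled \<Rightarrow> 'k::field) \<Rightarrow> coset_index \<Rightarrow> 'k" where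
  "pull r n \<mu> \<nu> F = (\<lambda>(\<mu>', D, \<nu>'). if \<mu>' = \<mu> \<and> \<nu>' = \<nu> \<and> (\<mu>', D, \<nu>') \<in> basis_index r n
     then F (point \<mu> (conf r \<nu> (SOME m. m \<in> D))) else 0)"

lemma pull_linear: "pull r n \<mu> \<nu> (F + G) = pull r n \<mu> \<nu> F + pull r n \<mu> \<nu> G"
  "pull r n \<mu> \<nu> (fscale c F) = fscale c (pull r n \<mu> \<nu> F)" "pull r n \<mu> \<nu> 0 = 0"
  "pull r n \<mu> \<nu> (F - G) = pull r n \<mu> \<nu> F - pull r n \<mu> \<nu> G"
  by (auto simp: pull_def fun_eq_iff)

lemma pull_sum: "pull r n \<mu> \<nu> (\<Sum>i\<in>A. F i) = (\<Sum>i\<in>A. pull r n \<mu> \<nu> (F i))"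
  by (induction A rule: infinite_finite_induct) (simp_all only: sum.infinite sum.empty sum.insert pull_linear not_False_eq_True)

lemma pull_span: "F \<in> fs.span B \<Longrightarrow> pull r n \<mu> \<nu> F \<in> fs.span (pull r n \<mu> \<nu> ` B)"
proof (induction rule: fs.span_induct_alt)
  case base
  show ?case unfolding pull_linear by (rule fs.span_zero)
next
  case (step c F G)
  show ?case unfolding pull_linear by (intro fs.span_add fs.span_scale step(2) fs.span_base imageI step(1))
qed

definition cod ::
  "nat \<Rightarrow> nat \<Rightarrow> nat list \<Rightarrow> (nat \<Rightarrow> nat multiset) \<Rightarrow> nat list \<Rightarrow> (nat \<Rightarrow> nat multiset multiset) \<Rightarrow> coset_index \<Rightarrow> 'k::field"
  where "cod r n \<mu> S \<nu> T = pull r n \<mu> \<nu> (codet S T)"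

lemma pull_closed: "pull r n \<mu> \<nu> F \<in> S_carrier r n"
  by (auto simp: pull_def S_carrier_def S_R_def)

lemma ev_cod:
  assumes \<mu>: "\<mu>' \<in> compositions r n" and \<nu>: "\<nu>' \<in> compositions r n" and y: "y \<in> confs r \<nu>'"
  shows "ev r (cod r n \<mu> S \<nu> T) \<mu>' \<nu>' y = (if \<mu>' = \<mu> \<and> \<nu>' = \<nu> then codet S T (point \<mu> y) else 0)"
proof (cases "\<mu>' = \<mu> \<and> \<nu>' = \<nu>")
  case True
  define D where "D = double_coset r \<mu> (rep r \<nu> y) \<nu>"
  have D: "D \<in> double_cosets r \<mu> \<nu>" using dc_rep_in[of y r \<nu> \<mu>] y True by (simp add: D_def)
  define m where "m = (SOME m. m \<in> D)"
  have m: "m \<in> D" unfolding m_def using double_cosets_nonempty[OF D] some_in_eq by blast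
  have "rep r \<nu> y \<in> full_transf r" "m \<in> full_transf r"
    using rep(1) y True double_cosets_subset[OF D] m by auto
  then obtain s where s: "s \<in> young r \<mu>" "conf r \<nu> m = push s y"
    using double_coset_conf[of \<nu> r n "rep r \<nu> y" m \<mu>] m rep(2)[of y r \<nu>] \<nu> y True unfolding D_def by auto
  have "codet S T (point \<mu> (conf r \<nu> m)) = (codet S T (point \<mu> y) :: 'a)"
    unfolding s(2) using codet_point_push \<mu> y True s(1) by blast
  thus ?thesis using True \<mu> \<nu> D by (simp add: ev_def cod_def pull_def D_def[symmetric] m_def[symmetric] basis_index_def)
qed (auto simp: ev_def cod_def pull_def)

lemma cod_nonzero:
  assumes "cod r n \<mu> S \<nu> T \<noteq> (0 :: coset_index \<Rightarrow> 'k::field)"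
  shows "\<mu> \<in> compositions r n" "\<nu> \<in> compositions r n"
    "\<exists>y f. y \<in> confs r \<nu> \<and> content f (blk \<mu>) (supp y) = S \<and> content f (vec y) (supp y) = T"
proof -
  have "\<exists>\<mu>' \<nu>' y. \<mu>' \<in> compositions r n \<and> \<nu>' \<in> compositions r n \<and> y \<in> confs r \<nu>' \<and>
      ev r (cod r n \<mu> S \<nu> T :: coset_index \<Rightarrow> 'k) \<mu>' \<nu>' y \<noteq> 0"
  proof (rule ccontr)
    assume n: "\<not> ?thesis"
    have "cod r n \<mu> S \<nu> T = (0 :: coset_index \<Rightarrow> 'k)"
    proof (rule S_ext)
      show "0 \<in> (S_carrier r n :: (coset_index \<Rightarrow> 'k) set)" by (auto simp: S_carrier_def S_R_def)
      show "cod r n \<mu> S \<nu> T \<in> (S_carrier r n :: (coset_index \<Rightarrow> 'k) set)"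
        unfolding cod_def by (rule pull_closed)
      fix \<mu>' \<nu>' y assume "\<mu>' \<in> compositions r n" "\<nu>' \<in> compositions r n" "y \<in> confs r \<nu>'"
      thus "ev r (cod r n \<mu> S \<nu> T :: coset_index \<Rightarrow> 'k) \<mu>' \<nu>' y = ev r 0 \<mu>' \<nu>' y"
        using n by (auto simp: ev_def[of r 0])
    qed
    thus False using assms by contradiction
  qed
  then obtain \<mu>' \<nu>' y where *: "\<mu>' \<in> compositions r n" "\<nu>' \<in> compositions r n" "y \<in> confs r \<nu>'"
      "ev r (cod r n \<mu> S \<nu> T :: coset_index \<Rightarrow> 'k) \<mu>' \<nu>' y \<noteq> 0" by blast
  hence e: "\<mu>' = \<mu>" "\<nu>' = \<nu>" and ne: "codet S T (point \<mu> y) \<noteq> (0::'k)"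
    using ev_cod[OF *(1-3), of \<mu> S \<nu> T] by (auto split: if_splits)
  show "\<mu> \<in> compositions r n" "\<nu> \<in> compositions r n" using * e by auto
  show "\<exists>y f. y \<in> confs r \<nu> \<and> content f (blk \<mu>) (supp y) = S \<and> content f (vec y) (supp y) = T"
    using codet_nonzero_shape(2)[OF ne[unfolded point_def]] *(3) e by blast
qed

lemma tot_shape_content:
  assumes "finite Z" shows "tot (shape (content f u Z)) = card Z"
proof -
  have "tot (shape (content f u Z)) = (\<Sum>j\<in>f ` Z. card {x\<in>Z. f x = j})"
    using assms by (subst tot_superset[of "f ` Z"]) (auto simp: shape_def size_content card_eq_0_iff)
  also have "\<dots> = card Z" using sum.image_gen[OF assms, of "\<lambda>_. 1::nat" f] by simp
  finally show ?thesis .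
qed

lemma rows_content: "finite Z \<Longrightarrow> rows (content f u Z)"
  unfolding rows_def using content_nonempty[of Z f u] by (simp add: Collect_mem_eq)

lemma codet_point_card: "codet S T (point \<mu> y) \<noteq> (0::'k::field) \<Longrightarrow> card (supp y) = tot (shape S) \<and> shape T = shape S"
  using codet_nonzero_shape(2,3)[of S T "supp y" "blk \<mu>" "vec y"] tot_shape_content[OF finite_supp]
  unfolding point_def by metis

section \<open>Left and right action on codeterminants modulo smaller rank\<close>

definition low_rank :: "nat \<Rightarrow> nat \<Rightarrow> nat \<Rightarrow> (coset_index \<Rightarrow> 'k::field) set" where
  "low_rank r n i = {f \<in> S_carrier r n. \<forall>\<mu>\<in>compositions r n. \<forall>\<nu>\<in>compositions r n. \<forall>y\<in>confs r \<nu>.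
     i \<le> card (supp y) \<longrightarrow> ev r f \<mu> \<nu> y = 0}"

lemma ev_add: "ev r (f + g) \<mu> \<nu> y = ev r f \<mu> \<nu> y + ev r g \<mu> \<nu> y"
  and ev_diff: "ev r (f' - g') \<mu> \<nu> y = ev r f' \<mu> \<nu> y - ev r g' \<mu> \<nu> y"
  and ev_scale: "ev r (fscale c h) \<mu> \<nu> y = c * ev r h \<mu> \<nu> y"
  by (simp_all add: ev_def)

lemma ev_sum: "ev r (\<Sum>i\<in>A. f i) \<mu> \<nu> y = (\<Sum>i\<in>A. ev r (f i) \<mu> \<nu> y)"
  by (simp add: ev_def sum_fun_apply)

text \<open>If y is the configuration of m, this counts the sections of m over \<open>Z\<close>
  whose blocks, arranged by f, have content \<open>S\<close>; see
  \<open>sections_count\<close>.\<close>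

definition wgt :: "(nat \<times> nat) multiset \<Rightarrow> nat set \<Rightarrow> (nat \<Rightarrow> nat) \<Rightarrow> (nat \<Rightarrow> nat multiset) \<Rightarrow> nat" where
  "wgt y Z f S = (\<Sum>\<beta>\<in>{\<beta> \<in> Z \<rightarrow>\<^sub>E UNIV. content f \<beta> Z = S}. \<Prod>x\<in>Z. count y (x, \<beta> x))"

lemma finite_labels:
  assumes Z: "finite Z" shows "finite {\<beta> \<in> Z \<rightarrow>\<^sub>E UNIV. content f \<beta> Z = S}"
proof (rule finite_subset)
  show "{\<beta> \<in> Z \<rightarrow>\<^sub>E UNIV. content f \<beta> Z = S} \<subseteq> (\<Pi>\<^sub>E x\<in>Z. set_mset (S (f x)))"
  proof
    fix \<beta> assume b: "\<beta> \<in> {\<beta> \<in> Z \<rightarrow>\<^sub>E UNIV. content f \<beta> Z = S}"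
    have "\<beta> x \<in># S (f x)" if "x \<in> Z" for x
      using set_content[OF Z, of f \<beta> "f x"] b that by auto
    thus "\<beta> \<in> (\<Pi>\<^sub>E x\<in>Z. set_mset (S (f x)))" using b by (auto simp: PiE_iff)
  qed
  show "finite (\<Pi>\<^sub>E x\<in>Z. set_mset (S (f x)))" using Z by (intro finite_PiE) auto
qed

lemma count_conf: "count (conf r \<mu> m) (x, b) = card {t\<in>{1..r}. m t = x \<and> blk \<mu> t = b}"
proof -
  have "{1..r} \<inter> (\<lambda>t. (m t, blk \<mu> t)) -` {(x, b)} = {t\<in>{1..r}. m t = x \<and> blk \<mu> t = b}" by auto
  thus ?thesis by (simp add: conf_def count_image_mset Int_commute)
qed

text \<open>Group the sections by the block labels \<beta> of their values; those with given labels
  are chosen independently, point by point, in the fibres of m.\<close>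

lemma sections_count:
  assumes Z: "finite Z"
  shows "card {g \<in> (\<Pi>\<^sub>E x\<in>Z. {t\<in>{1..r}. m t = x}). content f (blk \<mu> \<circ> g) Z = S} = wgt (conf r \<mu> m) Z f S"
proof -
  let ?B = "{\<beta> \<in> Z \<rightarrow>\<^sub>E UNIV. content f \<beta> Z = S}"
  let ?P = "\<lambda>\<beta>. \<Pi>\<^sub>E x\<in>Z. {t\<in>{1..r}. m t = x \<and> blk \<mu> t = \<beta> x}"
  have eq: "{g \<in> (\<Pi>\<^sub>E x\<in>Z. {t\<in>{1..r}. m t = x}). content f (blk \<mu> \<circ> g) Z = S} = (\<Union>\<beta>\<in>?B. ?P \<beta>)"
  proof (intro equalityI subsetI)
    fix g assume g: "g \<in> {g \<in> (\<Pi>\<^sub>E x\<in>Z. {t\<in>{1..r}. m t = x}). content f (blk \<mu> \<circ> g) Z = S}"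
    have "content f (restrict (blk \<mu> \<circ> g) Z) Z = content f (blk \<mu> \<circ> g) Z" by (rule content_cong) auto
    hence "restrict (blk \<mu> \<circ> g) Z \<in> ?B" using g by simp
    moreover have "g \<in> ?P (restrict (blk \<mu> \<circ> g) Z)" using g by (auto simp: PiE_iff)
    ultimately show "g \<in> (\<Union>\<beta>\<in>?B. ?P \<beta>)" by blast
  next
    fix g assume "g \<in> (\<Union>\<beta>\<in>?B. ?P \<beta>)"
    then obtain \<beta> where b: "\<beta> \<in> ?B" "g \<in> ?P \<beta>" by blast
    have "content f (blk \<mu> \<circ> g) Z = content f \<beta> Z" using b(2) by (intro content_cong) (auto simp: PiE_iff)
    thus "g \<in> {g \<in> (\<Pi>\<^sub>E x\<in>Z. {t\<in>{1..r}. m t = x}). content f (blk \<mu> \<circ> g) Z = S}"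
      using b by (auto simp: PiE_iff)
  qed
  have "?P \<beta> \<inter> ?P \<beta>' = {}" if b: "\<beta> \<in> ?B" "\<beta>' \<in> ?B" "\<beta> \<noteq> \<beta>'" for \<beta> \<beta>'
  proof (rule ccontr)
    assume "?P \<beta> \<inter> ?P \<beta>' \<noteq> {}"
    then obtain g where g: "g \<in> ?P \<beta>" "g \<in> ?P \<beta>'" by blast
    have "\<beta> x = \<beta>' x" for x
      using g b(1,2) by (cases "x \<in> Z") (auto simp: PiE_iff extensional_def)
    thus False using b(3) by blast
  qed
  hence "card (\<Union>\<beta>\<in>?B. ?P \<beta>) = (\<Sum>\<beta>\<in>?B. card (?P \<beta>))"
    using finite_labels[OF Z] Z by (intro card_UN_disjoint) (auto intro!: finite_PiE)
  also have "\<dots> = wgt (conf r \<mu> m) Z f S"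
    unfolding wgt_def using Z by (intro sum.cong refl) (simp only: card_PiE count_conf)
  finally show ?thesis using eq by simp
qed

text \<open>A configuration above \<open>z\<close> of the same rank is a section of \<open>m\<close> over the support of \<open>z\<close>.\<close>

lemma kernel_sum:
  assumes m: "m \<in> full_transf r" and z: "z \<in> confs r \<nu>" and cz: "card (supp z) = tot (shape S)"
  shows "(\<Sum>z'\<in>{z'\<in>confs r \<nu>. push m z' = z}. codet S T (point \<mu> z') :: 'k::field) =
    (\<Sum>f\<in>row_maps T (vec z) (supp z). of_nat (wgt (conf r \<mu> m) (supp z) f S))"
proof -
  let ?Z = "supp z"
  let ?L = "SIGMA z':{z'\<in>confs r \<nu>. push m z' = z}. row_maps S (blk \<mu>) (supp z') \<inter> row_maps T (vec z') (supp z')"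
  let ?G = "\<lambda>f. {g \<in> (\<Pi>\<^sub>E x\<in>?Z. {t\<in>{1..r}. m t = x}). content f (blk \<mu> \<circ> g) ?Z = S}"
  let ?R = "SIGMA f:row_maps T (vec z) ?Z. ?G f"
  define gg where "gg z' = restrict (inv_into (supp z') m) ?Z" for z'
  \<comment> \<open>A pair of a lift z' and a row map on its support corresponds to the transported
    row map on the support of z together with the section that inverts m.\<close>
  define fw where "fw p = (restrict (snd p \<circ> gg (fst p)) ?Z, gg (fst p))" for p :: "(nat \<times> nat) multiset \<times> (nat \<Rightarrow> nat)"
  define bw where "bw p = (push (snd p) z, restrict (fst p \<circ> m) (snd p ` ?Z))" for p :: "(nat \<Rightarrow> nat) \<times> (nat \<Rightarrow> nat)"
  have finG: "finite (?G f)" for f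
  proof (rule finite_subset)
    show "?G f \<subseteq> (\<Pi>\<^sub>E x\<in>?Z. {1..r})" by (auto simp: PiE_def)
    show "finite (\<Pi>\<^sub>E x\<in>?Z. {1..r})" by (intro finite_PiE) auto
  qed
  have L: "fw p \<in> ?R \<and> bw (fw p) = p" if p: "p \<in> ?L" for p
  proof -
    obtain z' f where pz: "p = (z', f)" by (cases p)
    have z': "z' \<in> confs r \<nu>" "push m z' = z" and f: "f \<in> row_maps S (blk \<mu>) (supp z')" "f \<in> row_maps T (vec z') (supp z')"
      using p pz by auto
    have mZ: "m ` supp z' = ?Z" using z'(2) supp_push by metis
    \<comment> \<open>Equality of ranks makes m injective on the support of z'; this fails exactly
      when rank is lost.\<close>
    have "card (supp z') = card ?Z"
      using tot_shape_content[OF finite_supp, of f "blk \<mu>" z'] row_mapsD(1)[OF f(1)] cz by simp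
    hence inj: "inj_on m (supp z')" using mZ by (intro eq_card_imp_inj_on) auto
    define g where "g = gg z'"
    have gm: "g (m x) = x" if "x \<in> supp z'" for x
      using that inj mZ by (auto simp: g_def gg_def)
    have gZ: "g ` ?Z = supp z'" using gm mZ by (metis (no_types, lifting) image_cong image_ident image_image)
    have mg: "m (g x) = x" "g x \<in> supp z'" if "x \<in> ?Z" for x
    proof -
      obtain x' where "x' \<in> supp z'" "x = m x'" using \<open>x \<in> ?Z\<close> mZ by blast
      thus "m (g x) = x" "g x \<in> supp z'" by (simp_all add: gm)
    qed
    have bij: "bij_betw g ?Z (supp z')" using mg gZ by (auto simp: bij_betw_def intro: inj_on_inverseI)
    have vz: "vec z' (g x) = vec z x" if "x \<in> ?Z" for x
      using vec_push[OF inj mg(2)[OF that]] mg(1)[OF that] z'(2) by simp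
    have c1: "content f (vec z') (supp z') = content (restrict (f \<circ> g) ?Z) (vec z) ?Z"
      by (rule content_bij[OF bij]) (auto simp: vz)
    have c2: "content f (blk \<mu>) (supp z') = content (restrict (f \<circ> g) ?Z) (blk \<mu> \<circ> g) ?Z"
      by (rule content_bij[OF bij]) auto
    have "restrict (f \<circ> g) ?Z \<in> row_maps T (vec z) ?Z" using c1 row_mapsD(1)[OF f(2)] by (simp add: row_maps_def)
    moreover have "g \<in> ?G (restrict (f \<circ> g) ?Z)"
    proof -
      have "g \<in> extensional ?Z" by (simp add: g_def gg_def)
      moreover have "m (g x) = x \<and> g x \<in> {1..r}" if "x \<in> ?Z" for x
        using mg[OF that] supp_subset[OF z'(1)] by blast
      ultimately show ?thesis using c2 row_mapsD(1)[OF f(1)] by (simp add: PiE_iff)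
    qed
    moreover have "push g z = z'"
      unfolding z'(2)[symmetric] push_push by (rule push_ident) (simp add: gm)
    moreover have "restrict (restrict (f \<circ> g) ?Z \<circ> m) (supp z') = f"
    proof
      fix x show "restrict (restrict (f \<circ> g) ?Z \<circ> m) (supp z') x = f x"
        using gm[of x] mZ row_mapsD(2)[OF f(1)] by (cases "x \<in> supp z'") (auto simp: PiE_iff extensional_def)
    qed
    ultimately show ?thesis unfolding pz by (simp add: fw_def bw_def g_def[symmetric] gZ)
  qed
  have R: "bw p \<in> ?L \<and> fw (bw p) = p" if p: "p \<in> ?R" for p
  proof -
    obtain f g where pf: "p = (f, g)" by (cases p)
    have f: "f \<in> row_maps T (vec z) ?Z" and g: "g \<in> (\<Pi>\<^sub>E x\<in>?Z. {t\<in>{1..r}. m t = x})" and c: "content f (blk \<mu> \<circ> g) ?Z = S"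
      using p pf by auto
    have mg: "m (g x) = x" "g x \<in> {1..r}" if "x \<in> ?Z" for x using g that by (auto simp: PiE_iff)
    have inj: "inj_on g ?Z" using mg(1) by (rule inj_on_inverseI)
    have bij: "bij_betw g ?Z (g ` ?Z)" using inj by (simp add: bij_betw_def)
    define z' where "z' = push g z"
    have sz: "supp z' = g ` ?Z" by (simp add: z'_def supp_push)
    have "image_mset snd z' = image_mset snd z" by (simp add: z'_def push_def multiset.map_comp comp_def)
    moreover have "g ` ?Z \<subseteq> {1..r}" using mg(2) by (rule image_subsetI)
    hence "fst ` set_mset z' \<subseteq> {1..r}" using sz by (simp only: supp_def)
    ultimately have "z' \<in> confs r \<nu>" using z by (simp add: confs_def)
    moreover have "push m z' = z" unfolding z'_def push_push by (rule push_ident) (simp add: mg)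
    moreover have "content (restrict (f \<circ> m) (g ` ?Z)) (blk \<mu>) (g ` ?Z) = content f (blk \<mu> \<circ> g) ?Z"
      by (rule content_bij[OF bij]) (auto simp: mg)
    moreover have "content (restrict (f \<circ> m) (g ` ?Z)) (vec z') (g ` ?Z) = content f (vec z) ?Z"
      by (rule content_bij[OF bij]) (auto simp: mg z'_def vec_push[OF inj])
    ultimately have "bw p \<in> ?L" using c row_mapsD(1)[OF f] unfolding pf bw_def
      by (simp add: z'_def[symmetric] sz row_maps_def)
    moreover have "gg z' = g"
    proof
      fix x show "gg z' x = g x"
      proof (cases "x \<in> ?Z")
        case True
        have "inj_on m (g ` ?Z)" using mg by (auto simp: inj_on_def)
        hence "inv_into (g ` ?Z) m (m (g x)) = g x" using True by (intro inv_into_f_f) auto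
        thus ?thesis using True mg by (simp add: gg_def sz)
      next
        case False
        thus ?thesis using PiE_arb[OF g False] by (simp add: gg_def)
      qed
    qed
    moreover have "restrict (restrict (f \<circ> m) (g ` ?Z) \<circ> g) ?Z = f"
    proof
      fix x show "restrict (restrict (f \<circ> m) (g ` ?Z) \<circ> g) ?Z x = f x"
        using mg[of x] row_mapsD(2)[OF f] by (cases "x \<in> ?Z") (auto simp: PiE_iff extensional_def)
    qed
    ultimately show ?thesis unfolding pf by (simp add: fw_def bw_def z'_def[symmetric])
  qed
  have "bij_betw fw ?L ?R"
    by (rule bij_betw_byWitness[where f' = bw]) (use L R in blast)+
  hence "card ?L = card ?R" by (rule bij_betw_same_card)
  moreover have "card ?L = (\<Sum>z'\<in>{z'\<in>confs r \<nu>. push m z' = z}. card (row_maps S (blk \<mu>) (supp z') \<inter> row_maps T (vec z') (supp z')))"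
    by (intro card_SigmaI) (auto simp: finite_confs finite_row_maps)
  moreover have "card ?R = (\<Sum>f\<in>row_maps T (vec z) ?Z. wgt (conf r \<mu> m) ?Z f S)"
    using finG finite_row_maps[OF finite_supp] sections_count[OF finite_supp] by (subst card_SigmaI) auto
  ultimately have "(\<Sum>z'\<in>{z'\<in>confs r \<nu>. push m z' = z}. card (row_maps S (blk \<mu>) (supp z') \<inter> row_maps T (vec z') (supp z'))) =
      (\<Sum>f\<in>row_maps T (vec z) ?Z. wgt (conf r \<mu> m) ?Z f S)" by simp
  from arg_cong[OF this, of "of_nat :: nat \<Rightarrow> 'k"] show ?thesis
    by (simp add: codet_def point_def)
qed

lemma vec_push_inj:
  assumes "inj s" shows "vec (push s y) (s x) = vec y x"
proof (cases "x \<in> supp y")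
  case True
  thus ?thesis using vec_push[OF inj_on_subset[OF assms]] by simp
next
  case False
  hence "s x \<notin> supp (push s y)" using assms by (auto simp: supp_push inj_def)
  thus ?thesis using False vec_empty_iff by metis
qed

lemma sharp_cod:
  assumes "\<kappa> \<in> compositions r n" "\<nu>' \<in> compositions r n"
  shows "sharp r (cod r n \<mu> S \<nu> T) \<kappa> \<nu>' y z = (if \<kappa> = \<mu> \<and> \<nu>' = \<nu>
    then \<Sum>z'\<in>{z'\<in>confs r \<nu>. push (rep r \<mu> y) z' = z}. codet S T (point \<mu> z') else 0)"
proof -
  have "sharp r (cod r n \<mu> S \<nu> T) \<kappa> \<nu>' y z = (\<Sum>z'\<in>{z'\<in>confs r \<nu>'. push (rep r \<kappa> y) z' = z}.
      if \<kappa> = \<mu> \<and> \<nu>' = \<nu> then codet S T (point \<mu> z') else 0)"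
    unfolding sharp_def by (rule sum.cong) (auto simp: ev_cod[OF assms])
  thus ?thesis by (cases "\<kappa> = \<mu> \<and> \<nu>' = \<nu>") auto
qed

text \<open>In the top rank the factor \<open>a\<close> enters only through a weight in front of
  each row map of content \<open>T\<close>; summation over row maps and over configurations can be
  exchanged.\<close>

lemma ev_left_action:
  assumes \<mu>: "\<mu> \<in> compositions r n" and \<mu>': "\<mu>' \<in> compositions r n" and \<nu>: "\<nu> \<in> compositions r n"
    and z: "z \<in> confs r \<nu>" and cz: "card (supp z) = tot (shape S)"
  shows "ev r (S_mult r n a (cod r n \<mu> S \<nu> T)) \<mu>' \<nu> z = (\<Sum>f\<in>row_maps T (vec z) (supp z).
    \<Sum>y\<in>confs r \<mu>. ev r a \<mu>' \<mu> y * of_nat (wgt y (supp z) f S))"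
proof -
  have "ev r (S_mult r n a (cod r n \<mu> S \<nu> T)) \<mu>' \<nu> z = (\<Sum>\<kappa>\<in>compositions r n. if \<kappa> = \<mu> then
      \<Sum>y\<in>confs r \<mu>. ev r a \<mu>' \<mu> y * (\<Sum>z'\<in>{z'\<in>confs r \<nu>. push (rep r \<mu> y) z' = z}. codet S T (point \<mu> z')) else 0)"
    unfolding ev_mult[OF \<mu>' \<nu> z] by (intro sum.cong refl) (auto simp: sharp_cod[OF _ \<nu>])
  also have "\<dots> = (\<Sum>y\<in>confs r \<mu>. ev r a \<mu>' \<mu> y * (\<Sum>z'\<in>{z'\<in>confs r \<nu>. push (rep r \<mu> y) z' = z}. codet S T (point \<mu> z')))"
    using \<mu> finite_compositions by simp
  also have "\<dots> = (\<Sum>y\<in>confs r \<mu>. \<Sum>f\<in>row_maps T (vec z) (supp z). ev r a \<mu>' \<mu> y * of_nat (wgt y (supp z) f S))"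
    by (rule sum.cong[OF refl]) (simp add: kernel_sum[OF rep(1) z cz] rep(2) sum_distrib_left)
  finally show ?thesis by (simp only: sum.swap[of _ "row_maps T (vec z) (supp z)"])
qed

lemma wgt_push:
  assumes s: "s permutes {1..r}" and h: "bij_betw s Z Z2" and f: "\<And>x. x \<in> Z \<Longrightarrow> f2 (s x) = f x"
  shows "wgt (push s y) Z2 f2 S = wgt y Z f S"
proof -
  have inj: "inj s" using permutes_inj[OF s] .
  have Z2: "Z2 = s ` Z" using h by (simp add: bij_betw_def)
  have cnt: "count (push s y) (s x, b) = count y (x, b)" for x b
    unfolding count_vec[symmetric] vec_push_inj[OF inj] ..
  let ?is = "Hilbert_Choice.inv s"
  have inv_s: "?is (s x) = x" for x using permutes_inverses(2)[OF s] .
  show ?thesis unfolding wgt_def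
  proof (rule sum.reindex_bij_witness[of _ "\<lambda>\<beta>. restrict (\<beta> \<circ> ?is) Z2" "\<lambda>\<beta>. restrict (\<beta> \<circ> s) Z"])
    fix \<beta> assume b: "\<beta> \<in> {\<beta> \<in> Z2 \<rightarrow>\<^sub>E UNIV. content f2 \<beta> Z2 = S}"
    show "restrict (restrict (\<beta> \<circ> s) Z \<circ> ?is) Z2 = \<beta>"
      using b by (auto simp: fun_eq_iff Z2 inv_s PiE_iff extensional_def)
    have "content f2 \<beta> Z2 = content f (restrict (\<beta> \<circ> s) Z) Z" by (rule content_bij[OF h]) (auto simp: f)
    thus "restrict (\<beta> \<circ> s) Z \<in> {\<beta> \<in> Z \<rightarrow>\<^sub>E UNIV. content f \<beta> Z = S}" using b by auto
    have "(\<Prod>x\<in>Z2. count (push s y) (x, \<beta> x)) = (\<Prod>x\<in>Z. count (push s y) (s x, \<beta> (s x)))"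
      using prod.reindex_bij_betw[OF h, of "\<lambda>x. count (push s y) (x, \<beta> x)"] by simp
    thus "(\<Prod>x\<in>Z. count y (x, restrict (\<beta> \<circ> s) Z x)) = (\<Prod>x\<in>Z2. count (push s y) (x, \<beta> x))"
      by (simp add: cnt)
  next
    fix \<beta> assume b: "\<beta> \<in> {\<beta> \<in> Z \<rightarrow>\<^sub>E UNIV. content f \<beta> Z = S}"
    show "restrict (restrict (\<beta> \<circ> ?is) Z2 \<circ> s) Z = \<beta>"
      using b by (auto simp: fun_eq_iff Z2 inv_s PiE_iff extensional_def)
    have "content f2 (restrict (\<beta> \<circ> ?is) Z2) Z2 = content f \<beta> Z" by (rule content_bij[OF h]) (auto simp: f inv_s Z2)
    thus "restrict (\<beta> \<circ> ?is) Z2 \<in> {\<beta> \<in> Z2 \<rightarrow>\<^sub>E UNIV. content f2 \<beta> Z2 = S}" using b by auto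
  qed
qed

definition vectors :: "nat \<Rightarrow> nat \<Rightarrow> nat multiset set" where
  "vectors r n = {v. size v \<le> r \<and> set_mset v \<subseteq> {..<n}}"

lemma finite_vectors: "finite (vectors r n)"
proof (rule finite_subset)
  show "vectors r n \<subseteq> mset ` {xs. set xs \<subseteq> {..<n} \<and> length xs \<le> r}"
  proof
    fix v assume v: "v \<in> vectors r n"
    obtain xs where "mset xs = v" using ex_mset by blast
    thus "v \<in> mset ` {xs. set xs \<subseteq> {..<n} \<and> length xs \<le> r}" using v by (auto simp: vectors_def)
  qed
  show "finite (mset ` {xs. set xs \<subseteq> {..<n} \<and> length xs \<le> r})"
    by (intro finite_imageI finite_lists_length_le) simp
qed

lemma vec_in_vectors:
  assumes \<nu>: "\<nu> \<in> compositions r n" and y: "y \<in> confs r \<nu>" shows "vec y x \<in> vectors r n"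
proof -
  have "size (vec y x) \<le> size y" by (simp add: vec_def size_filter_mset_lesseq)
  moreover have "set_mset (vec y x) \<subseteq> set_mset (image_mset snd y)" by (auto simp: vec_def)
  moreover have "set_mset (image_mset snd y) \<subseteq> {..<n}"
  proof -
    have "image_mset snd y = image_mset (blk \<nu>) (mset_set {1..r})" using y by (simp add: confs_def)
    thus ?thesis using blk_less[OF \<nu>] by auto
  qed
  ultimately show ?thesis using size_confs[OF y] by (auto simp: vectors_def)
qed

lemma subspace_S: "fs.subspace (S_carrier r n :: (coset_index \<Rightarrow> 'k::field) set)"
  using vs_algebra.V[OF vs_algebra_S] .

text \<open>The weight \<open>H\<close> depends only on the content of the row map for the blocks of
  \<mu>', so \<open>codet_group\<close> expands it in codeterminants with the same \<open>T\<close>.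
  Higher ranks give zero since pushing forward cannot enlarge a support.\<close>

lemma left_action:
  fixes a :: "coset_index \<Rightarrow> 'k::field"
  assumes \<mu>: "\<mu> \<in> compositions r n"
  shows "\<exists>h. \<forall>\<nu>\<in>compositions r n. \<forall>T. shape T = shape S \<longrightarrow>
    S_mult r n a (cod r n \<mu> S \<nu> T) -
      (\<Sum>\<mu>'\<in>compositions r n. \<Sum>S'\<in>tabloids {..<n} (shape S). fscale (h \<mu>' S') (cod r n \<mu>' S' \<nu> T))
    \<in> low_rank r n (tot (shape S))"
proof (cases "rows S")
  case False
  have z: "cod r n \<mu> S \<nu> T = (0 :: coset_index \<Rightarrow> 'k)" for \<nu> T
    using cod_nonzero(3)[of r n \<mu> S \<nu> T] rows_content[OF finite_supp] False by metis
  have "S_mult r n a 0 = 0" by (simp add: S_mult_def S_R_def fun_eq_iff)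
  thus ?thesis unfolding z
    by (intro exI[of _ "\<lambda>_ _. 0"]) (simp add: low_rank_def ev_def S_carrier_def S_R_def fscale_def zero_fun_def sum_fun_apply)
next
  case rows: True
  define H where "H \<mu>' Z f = (\<Sum>y\<in>confs r \<mu>. ev r a \<mu>' \<mu> y * of_nat (wgt y Z f S))" for \<mu>' Z f
  have H_inv: "H \<mu>' Z f = H \<mu>' Z2 f2"
    if \<mu>': "\<mu>' \<in> compositions r n" and Z: "Z \<subseteq> {1..r}" "Z2 \<subseteq> {1..r}"
      and eq: "content f (blk \<mu>') Z = content f2 (blk \<mu>') Z2" for \<mu>' Z Z2 f f2
  proof -
    have fin: "finite Z" "finite Z2" using Z finite_subset by blast+
    obtain h where h: "bij_betw h Z Z2" "\<forall>x\<in>Z. f2 (h x) = f x \<and> blk \<mu>' (h x) = blk \<mu>' x"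
      using content_iso[OF fin eq] by blast
    \<comment> \<open>Equal contents give a matching of the points that preserves blocks; its
      extension is an element of the Young subgroup, under which \<open>a\<close> is
      invariant.\<close>
    obtain s where s: "s permutes {1..r}" "\<forall>t\<in>{1..r}. blk \<mu>' (s t) = blk \<mu>' t" "\<forall>x\<in>Z. s x = h x"
      using extend_to_permutation[OF Z h(1), of "blk \<mu>'"] h(2) by blast
    have sy: "s \<in> young r \<mu>'" using young_iff[OF \<mu>'] s by blast
    have hs: "bij_betw s Z Z2" using h(1) by (rule bij_betw_cong[THEN iffD1, rotated]) (use s(3) in simp)
    have "H \<mu>' Z2 f2 = (\<Sum>y\<in>confs r \<mu>. ev r a \<mu>' \<mu> (push s y) * of_nat (wgt (push s y) Z2 f2 S))"
      unfolding H_def by (rule sum.reindex_bij_betw[OF push_young_bij[OF sy], symmetric])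
    also have "\<dots> = H \<mu>' Z f"
      unfolding H_def using s(3) h(2) by (intro sum.cong refl) (simp add: ev_push[OF \<mu> _ sy] wgt_push[OF s(1) hs, of f2 f])
    finally show ?thesis by simp
  qed
  define h where "h \<mu>' S' = (SOME c. \<exists>Z f. Z \<subseteq> {1..r} \<and> content f (blk \<mu>') Z = S' \<and> c = H \<mu>' Z f)" for \<mu>' S'
  have hH: "h \<mu>' (content f (blk \<mu>') Z) = H \<mu>' Z f" if "\<mu>' \<in> compositions r n" "Z \<subseteq> {1..r}" for \<mu>' f Z
    unfolding h_def
  proof (rule some_equality)
    show "\<exists>Z' f'. Z' \<subseteq> {1..r} \<and> content f' (blk \<mu>') Z' = content f (blk \<mu>') Z \<and> H \<mu>' Z f = H \<mu>' Z' f'"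
      using that by blast
    fix c assume "\<exists>Z' f'. Z' \<subseteq> {1..r} \<and> content f' (blk \<mu>') Z' = content f (blk \<mu>') Z \<and> c = H \<mu>' Z' f'"
    thus "c = H \<mu>' Z f" using H_inv[OF that(1)] that(2) by blast
  qed
  have finT: "finite (tabloids {..<n} (shape S))" using rows by (intro finite_tabloids) (auto simp: rows_shape)
  have "S_mult r n a (cod r n \<mu> S \<nu> T) -
      (\<Sum>\<mu>'\<in>compositions r n. \<Sum>S'\<in>tabloids {..<n} (shape S). fscale (h \<mu>' S') (cod r n \<mu>' S' \<nu> T))
    \<in> low_rank r n (tot (shape S))" (is "?d \<in> _")
    if \<nu>: "\<nu> \<in> compositions r n" and T: "shape T = shape S" for \<nu> and T :: "nat \<Rightarrow> nat multiset multiset"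
    unfolding low_rank_def
  proof (intro CollectI conjI ballI impI)
    show "?d \<in> S_carrier r n"
      by (intro fs.subspace_diff[OF subspace_S] fs.subspace_sum[OF subspace_S] fs.subspace_scale[OF subspace_S])
        (simp_all add: S_mult_closed cod_def pull_closed)
    fix \<mu>' \<nu>' z assume \<mu>': "\<mu>' \<in> compositions r n" and \<nu>': "\<nu>' \<in> compositions r n" and z: "z \<in> confs r \<nu>'"
      and cz: "tot (shape S) \<le> card (supp z)"
    have evd: "ev r ?d \<mu>' \<nu>' z = ev r (S_mult r n a (cod r n \<mu> S \<nu> T)) \<mu>' \<nu>' z -
        (if \<nu>' = \<nu> then \<Sum>S'\<in>tabloids {..<n} (shape S). h \<mu>' S' * codet S' T (point \<mu>' z) else 0)"
    proof -
      have "(\<Sum>\<mu>''\<in>compositions r n. \<Sum>S'\<in>tabloids {..<n} (shape S). h \<mu>'' S' * ev r (cod r n \<mu>'' S' \<nu> T) \<mu>' \<nu>' z)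
        = (\<Sum>\<mu>''\<in>compositions r n. if \<mu>'' = \<mu>' then
            (if \<nu>' = \<nu> then \<Sum>S'\<in>tabloids {..<n} (shape S). h \<mu>' S' * codet S' T (point \<mu>' z) else 0) else 0)"
        by (rule sum.cong) (auto simp: ev_cod[OF \<mu>' \<nu>' z])
      thus ?thesis using \<mu>' finite_compositions by (simp add: ev_diff ev_sum ev_scale)
    qed
    show "ev r ?d \<mu>' \<nu>' z = 0"
    proof (cases "\<nu>' = \<nu>")
      case False
      have "ev r (S_mult r n a (cod r n \<mu> S \<nu> T)) \<mu>' \<nu>' z = 0"
        unfolding ev_mult[OF \<mu>' \<nu>' z] using False by (intro sum.neutral ballI) (simp add: sharp_cod[OF _ \<nu>'])
      thus ?thesis unfolding evd using False by simp
    next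
      case eq: True
      show ?thesis
      proof (cases "card (supp z) = tot (shape S)")
        case True
        have "ev r (S_mult r n a (cod r n \<mu> S \<nu> T)) \<mu>' \<nu>' z = (\<Sum>f\<in>row_maps T (vec z) (supp z). H \<mu>' (supp z) f)"
          unfolding eq H_def using ev_left_action[OF \<mu> \<mu>' \<nu> z[unfolded eq] True] .
        also have "\<dots> = (\<Sum>S'\<in>tabloids {..<n} (shape S). h \<mu>' S' * codet S' T (supp z, blk \<mu>', vec z))"
        proof (rule codet_group[OF finite_supp finT])
          fix f assume f: "f \<in> row_maps T (vec z) (supp z)"
          have "shape (content f (blk \<mu>') (supp z)) = shape (content f (vec z) (supp z))"
            by (simp add: shape_def fun_eq_iff size_content)
          hence "shape (content f (blk \<mu>') (supp z)) = shape S" using row_mapsD(1)[OF f] T by simp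
          moreover have "set_mset (content f (blk \<mu>') (supp z) j) \<subseteq> {..<n}" for j
            unfolding set_content[OF finite_supp] using blk_less[OF \<mu>'] supp_subset[OF z] by auto
          ultimately have "content f (blk \<mu>') (supp z) \<in> tabloids {..<n} (shape S)" by (simp add: tabloids_def)
          thus "H \<mu>' (supp z) f = (if content f (blk \<mu>') (supp z) \<in> tabloids {..<n} (shape S)
              then h \<mu>' (content f (blk \<mu>') (supp z)) else 0)"
            using hH[OF \<mu>' supp_subset[OF z]] by simp
        qed
        finally show ?thesis unfolding evd using eq by (simp add: point_def)
      next
        case False
        have 1: "codet S' T (point \<mu>' z) = (0::'k)" if "S' \<in> tabloids {..<n} (shape S)" for S'
          using codet_point_card[of S' T \<mu>' z] False that by (auto simp: tabloids_def)
        have "sharp r (cod r n \<mu> S \<nu> T) \<kappa> \<nu>' y z = (0::'k)" if "\<kappa> \<in> compositions r n" for \<kappa> y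
        proof -
          have "codet S T (point \<mu> z') = (0::'k)" if z': "push (rep r \<mu> y) z' = z" for z'
          proof (rule ccontr)
            assume "codet S T (point \<mu> z') \<noteq> (0::'k)"
            hence "card (supp z') = tot (shape S)" using codet_point_card by blast
            moreover have "card (supp z) \<le> card (supp z')" unfolding z'[symmetric] supp_push by (rule card_image_le) simp
            ultimately show False using False cz by simp
          qed
          thus ?thesis by (simp add: sharp_cod[OF that \<nu>'])
        qed
        hence "ev r (S_mult r n a (cod r n \<mu> S \<nu> T)) \<mu>' \<nu>' z = 0"
          unfolding ev_mult[OF \<mu>' \<nu>' z] by (intro sum.neutral ballI) simp
        thus ?thesis unfolding evd using 1 by simp
      qed
    qed
  qed
  thus ?thesis by blast
qed

text \<open>A nonzero kernel from y to z forces the support of z into that of y. In the same rank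
  the supports coincide, so the points, their rows and their blocks of \<mu> remain and only the
  fibres change.\<close>

lemma right_action:
  fixes a :: "coset_index \<Rightarrow> 'k::field"
  assumes \<nu>: "\<nu> \<in> compositions r n"
  shows "\<exists>h. \<forall>\<mu>\<in>compositions r n. \<forall>S. shape S = shape T \<longrightarrow>
    S_mult r n (cod r n \<mu> S \<nu> T) a -
      (\<Sum>\<nu>'\<in>compositions r n. \<Sum>T'\<in>tabloids (vectors r n) (shape T). fscale (h \<nu>' T') (cod r n \<mu> S \<nu>' T'))
    \<in> low_rank r n (tot (shape T))"
proof (cases "rows T")
  case False
  have z: "cod r n \<mu> S \<nu> T = (0 :: coset_index \<Rightarrow> 'k)" for \<mu> S
    using cod_nonzero(3)[of r n \<mu> S \<nu> T] rows_content[OF finite_supp] False by metis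
  have "S_mult r n 0 a = 0" by (simp add: S_mult_def S_R_def fun_eq_iff)
  thus ?thesis unfolding z
    by (intro exI[of _ "\<lambda>_ _. 0"]) (simp add: low_rank_def ev_def S_carrier_def S_R_def fscale_def zero_fun_def sum_fun_apply)
next
  case rows: True
  define H where "H \<pi> z f = (\<Sum>y\<in>{y\<in>confs r \<nu>. supp y = supp z \<and> content f (vec y) (supp z) = T}. sharp r a \<nu> \<pi> y z)" for \<pi> z f
  have H_inv: "H \<pi> z f = H \<pi> z2 f2"
    if \<pi>: "\<pi> \<in> compositions r n" and z: "z \<in> confs r \<pi>" "z2 \<in> confs r \<pi>"
      and eq: "content f (vec z) (supp z) = content f2 (vec z2) (supp z2)" for \<pi> z z2 f f2
  proof -
    obtain h where h: "bij_betw h (supp z) (supp z2)" "\<forall>x\<in>supp z. f2 (h x) = f x \<and> vec z2 (h x) = vec z x"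
      using content_iso[OF finite_supp finite_supp eq] by blast
    \<comment> \<open>Any permutation extending the matching will do, hence the trivial label: right
      multiplication commutes with all left translations, and \<open>T\<close> records only
      fibres.\<close>
    obtain s where s: "s permutes {1..r}" "\<forall>x\<in>supp z. s x = h x"
      using extend_to_permutation[OF supp_subset[OF z(1)] supp_subset[OF z(2)] h(1), of "\<lambda>_. ()"] by blast
    have inj: "inj s" using permutes_inj[OF s(1)] .
    have sf: "s \<in> full_transf r" "Hilbert_Choice.inv s \<in> full_transf r"
      using permutes_full s(1) permutes_inv by blast+
    have sz: "s ` supp z = supp z2" using h(1) s(2) by (auto simp: bij_betw_def)
    have pz: "push s z = z2"
    proof (rule conf_eqI)
      show "supp (push s z) = supp z2" using sz by (simp add: supp_push)
      fix x assume "x \<in> supp (push s z)"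
      then obtain x' where x': "x' \<in> supp z" "x = s x'" by (auto simp: supp_push)
      have "vec z2 (s x') = vec z x'" using h(2) s(2) x'(1) by simp
      thus "vec (push s z) x = vec z2 x" using vec_push_inj[OF inj, of z x'] x'(2) by simp
    qed
    have cancel: "push (Hilbert_Choice.inv s) (push s y) = y" "push s (push (Hilbert_Choice.inv s) y) = y" for y
      using permutes_inv_o[OF s(1)] by (simp_all add: push_push)
    have bij: "bij_betw s (supp z) (supp z2)" using sz inj_on_subset[OF inj subset_UNIV] by (simp add: bij_betw_def)
    have cond: "supp (push s y) = supp z2 \<and> content f2 (vec (push s y)) (supp z2) = T \<longleftrightarrow>
        supp y = supp z \<and> content f (vec y) (supp z) = T" for y
    proof -
      have "supp (push s y) = supp z2 \<longleftrightarrow> supp y = supp z"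
        unfolding supp_push sz[symmetric] by (rule inj_image_eq_iff[OF inj])
      moreover have "content f2 (vec (push s y)) (supp z2) = content f (vec y) (supp z)"
      proof (rule content_bij[OF bij])
        fix x assume x: "x \<in> supp z"
        show "vec (push s y) (s x) = vec y x" by (rule vec_push_inj[OF inj])
        show "f2 (s x) = f x" using h(2) s(2) x by simp
      qed
      ultimately show ?thesis by simp
    qed
    have sh: "sharp r a \<nu> \<pi> (push s y) z2 = sharp r a \<nu> \<pi> y z" if y: "y \<in> confs r \<nu>" for y
    proof -
      have "{w\<in>confs r \<pi>. push s w = z2} = {z}"
      proof -
        have "w = z" if "push s w = z2" for w using cancel(1)[of w] cancel(1)[of z] that pz by simp
        thus ?thesis using z(1) pz by blast
      qed
      thus ?thesis using sharp_equivariant[OF \<nu> \<pi> sf(1) y, of a z2] by simp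
    qed
    have "H \<pi> z2 f2 = H \<pi> z f" unfolding H_def
    proof (rule sum.reindex_bij_witness[of _ "push s" "push (Hilbert_Choice.inv s)"])
      fix y assume y: "y \<in> {y\<in>confs r \<nu>. supp y = supp z2 \<and> content f2 (vec y) (supp z2) = T}"
      show "push s (push (Hilbert_Choice.inv s) y) = y" by (rule cancel)
      have "push (Hilbert_Choice.inv s) y \<in> confs r \<nu>" using push_in[OF sf(2)] y by blast
      thus "push (Hilbert_Choice.inv s) y \<in> {y\<in>confs r \<nu>. supp y = supp z \<and> content f (vec y) (supp z) = T}"
        using cond[of "push (Hilbert_Choice.inv s) y"] y by (simp add: cancel)
      thus "sharp r a \<nu> \<pi> (push (Hilbert_Choice.inv s) y) z = sharp r a \<nu> \<pi> y z2"
        using sh[of "push (Hilbert_Choice.inv s) y"] by (simp add: cancel)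
    next
      fix y assume y: "y \<in> {y\<in>confs r \<nu>. supp y = supp z \<and> content f (vec y) (supp z) = T}"
      show "push (Hilbert_Choice.inv s) (push s y) = y" by (rule cancel)
      show "push s y \<in> {y\<in>confs r \<nu>. supp y = supp z2 \<and> content f2 (vec y) (supp z2) = T}"
        using cond[of y] y push_in[OF sf(1)] by blast
    qed
    thus ?thesis by simp
  qed
  define h where "h \<pi> T' = (SOME c. \<exists>z f. z \<in> confs r \<pi> \<and> content f (vec z) (supp z) = T' \<and> c = H \<pi> z f)" for \<pi> T'
  have hH: "h \<pi> (content f (vec z) (supp z)) = H \<pi> z f" if "\<pi> \<in> compositions r n" "z \<in> confs r \<pi>" for \<pi> f z
    unfolding h_def
  proof (rule some_equality)
    show "\<exists>z' f'. z' \<in> confs r \<pi> \<and> content f' (vec z') (supp z') = content f (vec z) (supp z) \<and> H \<pi> z f = H \<pi> z' f'"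
      using that by blast
    fix c assume "\<exists>z' f'. z' \<in> confs r \<pi> \<and> content f' (vec z') (supp z') = content f (vec z) (supp z) \<and> c = H \<pi> z' f'"
    thus "c = H \<pi> z f" using H_inv[OF that(1)] that(2) by blast
  qed
  have finT: "finite (tabloids (vectors r n) (shape T))"
    using rows by (intro finite_tabloids finite_vectors) (auto simp: rows_shape)
  have "S_mult r n (cod r n \<mu> S \<nu> T) a -
      (\<Sum>\<nu>'\<in>compositions r n. \<Sum>T'\<in>tabloids (vectors r n) (shape T). fscale (h \<nu>' T') (cod r n \<mu> S \<nu>' T'))
    \<in> low_rank r n (tot (shape T))" (is "?d \<in> _")
    if \<mu>: "\<mu> \<in> compositions r n" and S: "shape S = shape T" for \<mu> and S :: "nat \<Rightarrow> nat multiset"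
    unfolding low_rank_def
  proof (intro CollectI conjI ballI impI)
    show "?d \<in> S_carrier r n"
      by (intro fs.subspace_diff[OF subspace_S] fs.subspace_sum[OF subspace_S] fs.subspace_scale[OF subspace_S])
        (simp_all add: S_mult_closed cod_def pull_closed)
    fix \<mu>' \<pi> z assume \<mu>': "\<mu>' \<in> compositions r n" and \<pi>: "\<pi> \<in> compositions r n" and z: "z \<in> confs r \<pi>"
      and cz: "tot (shape T) \<le> card (supp z)"
    have evd: "ev r ?d \<mu>' \<pi> z = ev r (S_mult r n (cod r n \<mu> S \<nu> T) a) \<mu>' \<pi> z -
        (if \<mu>' = \<mu> then \<Sum>T'\<in>tabloids (vectors r n) (shape T). h \<pi> T' * codet S T' (point \<mu> z) else 0)"
    proof -
      have "(\<Sum>\<nu>'\<in>compositions r n. \<Sum>T'\<in>tabloids (vectors r n) (shape T). h \<nu>' T' * ev r (cod r n \<mu> S \<nu>' T') \<mu>' \<pi> z)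
        = (\<Sum>\<nu>'\<in>compositions r n. if \<nu>' = \<pi> then
            (if \<mu>' = \<mu> then \<Sum>T'\<in>tabloids (vectors r n) (shape T). h \<pi> T' * codet S T' (point \<mu> z) else 0) else 0)"
        by (rule sum.cong) (auto simp: ev_cod[OF \<mu>' \<pi> z])
      thus ?thesis using \<pi> finite_compositions by (simp add: ev_diff ev_sum ev_scale)
    qed
    have evm: "ev r (S_mult r n (cod r n \<mu> S \<nu> T) a) \<mu>' \<pi> z =
        (if \<mu>' = \<mu> then \<Sum>y\<in>confs r \<nu>. codet S T (point \<mu> y) * sharp r a \<nu> \<pi> y z else 0)"
    proof -
      have "ev r (S_mult r n (cod r n \<mu> S \<nu> T) a) \<mu>' \<pi> z = (\<Sum>\<kappa>\<in>compositions r n. if \<kappa> = \<nu> then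
          (if \<mu>' = \<mu> then \<Sum>y\<in>confs r \<nu>. codet S T (point \<mu> y) * sharp r a \<nu> \<pi> y z else 0) else 0)"
        unfolding ev_mult[OF \<mu>' \<pi> z] by (intro sum.cong refl) (auto simp: ev_cod[OF \<mu>'])
      thus ?thesis using \<nu> finite_compositions by simp
    qed
    \<comment> \<open>z is pushed forward along a representative of y, whose image is the support of
      y.\<close>
    have supp_le: "supp z \<subseteq> supp y" if y: "y \<in> confs r \<nu>" and ne: "sharp r a \<nu> \<pi> y z \<noteq> 0" for y
    proof -
      have "{z'\<in>confs r \<pi>. push (rep r \<nu> y) z' = z} \<noteq> {}" using ne unfolding sharp_def by force
      then obtain z' where z': "z' \<in> confs r \<pi>" "push (rep r \<nu> y) z' = z" by blast
      have "supp z = rep r \<nu> y ` supp z'" using z'(2) supp_push by metis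
      also have "\<dots> \<subseteq> rep r \<nu> y ` {1..r}" using supp_subset[OF z'(1)] by blast
      also have "\<dots> = supp (conf r \<nu> (rep r \<nu> y))" by (simp add: supp_def conf_def image_image)
      finally show ?thesis using rep(2)[OF y] by simp
    qed
    show "ev r ?d \<mu>' \<pi> z = 0"
    proof (cases "\<mu>' = \<mu>")
      case False
      thus ?thesis unfolding evd evm by simp
    next
      case eq: True
      show ?thesis
      proof (cases "card (supp z) = tot (shape T)")
        case True
        have "(\<Sum>y\<in>confs r \<nu>. codet S T (point \<mu> y) * sharp r a \<nu> \<pi> y z) =
            (\<Sum>y\<in>confs r \<nu>. \<Sum>f\<in>row_maps S (blk \<mu>) (supp z). if supp y = supp z \<and> content f (vec y) (supp z) = T then sharp r a \<nu> \<pi> y z else 0)"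
        proof (rule sum.cong[OF refl])
          fix y assume y: "y \<in> confs r \<nu>"
          show "codet S T (point \<mu> y) * sharp r a \<nu> \<pi> y z =
            (\<Sum>f\<in>row_maps S (blk \<mu>) (supp z). if supp y = supp z \<and> content f (vec y) (supp z) = T then sharp r a \<nu> \<pi> y z else 0)"
          proof (cases "supp y = supp z")
            case sy: True
            have "row_maps S (blk \<mu>) (supp z) \<inter> {f. content f (vec y) (supp z) = T} =
                row_maps S (blk \<mu>) (supp y) \<inter> row_maps T (vec y) (supp y)" by (auto simp: row_maps_def sy)
            thus ?thesis using sy by (simp add: codet_def point_def sum.If_cases finite_row_maps)
          next
            case ny: False
            have "codet S T (point \<mu> y) * sharp r a \<nu> \<pi> y z = 0"
            proof (rule ccontr)
              assume ne: "codet S T (point \<mu> y) * sharp r a \<nu> \<pi> y z \<noteq> 0"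
              hence "card (supp y) = tot (shape S)" using codet_point_card[of S T \<mu> y] by auto
              hence "card (supp z) = card (supp y)" using True S by simp
              moreover have "supp z \<subseteq> supp y" using supp_le[OF y] ne by auto
              ultimately show False using card_subset_eq[of "supp y" "supp z"] ny by simp
            qed
            thus ?thesis using ny by simp
          qed
        qed
        also have "\<dots> = (\<Sum>f\<in>row_maps S (blk \<mu>) (supp z). H \<pi> z f)"
          unfolding H_def sum.inter_filter[OF finite_confs] by (rule sum.swap)
        also have "\<dots> = (\<Sum>T'\<in>tabloids (vectors r n) (shape T). h \<pi> T' * codet T' S (supp z, vec z, blk \<mu>))"
        proof (rule codet_group[OF finite_supp finT])
          fix f assume f: "f \<in> row_maps S (blk \<mu>) (supp z)"
          have "shape (content f (vec z) (supp z)) = shape (content f (blk \<mu>) (supp z))"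
            by (simp add: shape_def fun_eq_iff size_content)
          hence "shape (content f (vec z) (supp z)) = shape T" using row_mapsD(1)[OF f] S by simp
          moreover have "set_mset (content f (vec z) (supp z) j) \<subseteq> vectors r n" for j
            unfolding set_content[OF finite_supp] using vec_in_vectors[OF \<pi> z] by auto
          ultimately have "content f (vec z) (supp z) \<in> tabloids (vectors r n) (shape T)" by (simp add: tabloids_def)
          thus "H \<pi> z f = (if content f (vec z) (supp z) \<in> tabloids (vectors r n) (shape T)
              then h \<pi> (content f (vec z) (supp z)) else 0)"
            using hH[OF \<pi> z] by simp
        qed
        finally show ?thesis unfolding evd evm using eq by (simp add: point_def codet_swap[of S])
      next
        case False
        have 1: "codet S T' (point \<mu> z) = (0::'k)" for T'
          using codet_point_card[of S T' \<mu> z] False S by auto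
        have "codet S T (point \<mu> y) * sharp r a \<nu> \<pi> y z = 0" if y: "y \<in> confs r \<nu>" for y
        proof (rule ccontr)
          assume ne: "codet S T (point \<mu> y) * sharp r a \<nu> \<pi> y z \<noteq> 0"
          hence "card (supp y) = tot (shape T)" using codet_point_card[of S T \<mu> y] S by auto
          moreover have "card (supp z) \<le> card (supp y)" using supp_le[OF y] ne by (intro card_mono) auto
          ultimately show False using False cz by simp
        qed
        hence "(\<Sum>y\<in>confs r \<nu>. codet S T (point \<mu> y) * sharp r a \<nu> \<pi> y z) = 0" by (intro sum.neutral ballI)
        thus ?thesis unfolding evd evm using 1 by simp
      qed
    qed
  qed
  thus ?thesis by blast
qed

section \<open>The cellular filtration\<close>

definition shapes :: "nat \<Rightarrow> (nat \<Rightarrow> nat) set" where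
  "shapes r = {\<eta>. partition_shape \<eta> \<and> 1 \<le> tot \<eta> \<and> tot \<eta> \<le> r}"

text \<open>Besides being standard, \<open>S\<close> must be realizable by points of {1..r};
  unrealizable tableaux have zero codeterminants and would destroy independence.\<close>

definition left_tabs :: "nat \<Rightarrow> nat \<Rightarrow> (nat \<Rightarrow> nat) \<Rightarrow> (nat list \<times> (nat \<Rightarrow> nat multiset)) set" where
  "left_tabs r n \<eta> = {(\<mu>, S). \<mu> \<in> compositions r n \<and> standard S \<and> shape S = \<eta> \<and>
     (\<exists>Z f. Z \<subseteq> {1..r} \<and> content f (blk \<mu>) Z = S)}"

definition right_tabs :: "nat \<Rightarrow> nat \<Rightarrow> (nat \<Rightarrow> nat) \<Rightarrow> (nat list \<times> (nat \<Rightarrow> nat multiset multiset)) set" where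
  "right_tabs r n \<eta> = {(\<nu>, T). \<nu> \<in> compositions r n \<and> standard T \<and> shape T = \<eta> \<and>
     (\<exists>y f. y \<in> confs r \<nu> \<and> content f (vec y) (supp y) = T)}"

definition cell ::
  "nat \<Rightarrow> nat \<Rightarrow> nat list \<times> (nat \<Rightarrow> nat multiset) \<Rightarrow> nat list \<times> (nat \<Rightarrow> nat multiset multiset) \<Rightarrow> coset_index \<Rightarrow> 'k::field"
  where "cell r n s t = cod r n (fst s) (snd s) (fst t) (snd t)"

definition filt :: "nat \<Rightarrow> nat \<Rightarrow> (nat \<Rightarrow> nat) set \<Rightarrow> (coset_index \<Rightarrow> 'k::field) set" where
  "filt r n K = fs.span {cell r n s t | s t \<eta>. \<eta> \<in> K \<and> s \<in> left_tabs r n \<eta> \<and> t \<in> right_tabs r n \<eta>}"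

lemma filt_mono: "K \<subseteq> K' \<Longrightarrow> filt r n K \<subseteq> filt r n K'"
  unfolding filt_def by (intro fs.span_mono Collect_mono) blast

lemma subspace_filt: "fs.subspace (filt r n K)"
  unfolding filt_def by (rule fs.subspace_span)

lemmas filt_closed = fs.subspace_0[OF subspace_filt] fs.subspace_add[OF subspace_filt]
  fs.subspace_diff[OF subspace_filt] fs.subspace_scale[OF subspace_filt] fs.subspace_sum[OF subspace_filt]

text \<open>Take v to be the largest letter of row j+1: the whole row is then counted on the left of
  the standardness inequality.\<close>

lemma partition_shape_standard:
  assumes rows: "rows S" and std: "standard S" shows "partition_shape (shape S)"
proof
  show "finite {j. shape S j \<noteq> 0}" using rows by (simp add: rows_shape)
  fix j
  show "shape S (Suc j) \<le> shape S j"
  proof (cases "S (Suc j) = {#}")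
    case False
    define v where "v = Max (set_mset (S (Suc j)))"
    have "{#b \<in># S (Suc j). b \<le> v#} = S (Suc j)"
      unfolding v_def by (rule filter_mset_eq_conv[THEN iffD2]) auto
    hence "shape S (Suc j) \<le> size {#a \<in># S j. a < v#}"
      using std unfolding standard_def shape_def by metis
    also have "\<dots> \<le> shape S j" by (simp add: shape_def size_filter_mset_lesseq)
    finally show ?thesis .
  qed (simp add: shape_def)
qed

lemma shape_in_shapes:
  assumes r: "1 \<le> r" and rows: "rows S" and std: "standard S" and y: "y \<in> confs r \<nu>"
    and c: "content f (blk \<mu>) (supp y) = S"
  shows "shape S \<in> shapes r"
proof -
  have t: "tot (shape S) = card (supp y)" using tot_shape_content[OF finite_supp, of f "blk \<mu>" y] c by simp
  have "y \<noteq> {#}" using size_confs[OF y] r by auto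
  hence "supp y \<noteq> {}" by (simp add: supp_def)
  hence "1 \<le> card (supp y)" by (simp add: Suc_le_eq card_gt_0_iff)
  moreover have "card (supp y) \<le> r" using card_mono[OF _ supp_subset[OF y]] by simp
  ultimately show ?thesis using partition_shape_standard[OF rows std] by (simp add: shapes_def t)
qed

lemma cell_nonzero:
  assumes "cod r n \<mu> S \<nu> T \<noteq> (0 :: coset_index \<Rightarrow> 'k::field)" and "standard S" "standard T" "shape T = shape S"
  shows "(\<mu>, S) \<in> left_tabs r n (shape S)" "(\<nu>, T) \<in> right_tabs r n (shape S)"
proof -
  obtain y f where y: "y \<in> confs r \<nu>" "content f (blk \<mu>) (supp y) = S" "content f (vec y) (supp y) = T"
    using cod_nonzero(3)[OF assms(1)] by blast
  show "(\<mu>, S) \<in> left_tabs r n (shape S)"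
    unfolding left_tabs_def using cod_nonzero(1)[OF assms(1)] assms(2) y(2) supp_subset[OF y(1)] by blast
  show "(\<nu>, T) \<in> right_tabs r n (shape S)"
    unfolding right_tabs_def using cod_nonzero(2)[OF assms(1)] assms(3,4) y(1,3) by blast
qed

text \<open>The expansion in standard codeterminants, pulled back to the algebra. Terms that become
  zero drop out, and the others are realizable, hence cells.\<close>

lemma cod_in_filt:
  assumes r: "1 \<le> r" and "rows S" "shape T = shape S"
  shows "cod r n \<mu> S \<nu> T \<in> (filt r n {\<eta>\<in>shapes r. tot \<eta> = tot (shape S) \<and> ent (shape S) \<le> ent \<eta>} :: (coset_index \<Rightarrow> 'k::field) set)"
proof -
  let ?K = "{\<eta>\<in>shapes r. tot \<eta> = tot (shape S) \<and> ent (shape S) \<le> ent \<eta>}"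
  let ?B = "std_codets (tot (shape S)) (ent (shape S)) :: ((nat, nat, nat multiset) labelled \<Rightarrow> 'k) set"
  have gen: "pull r n \<mu> \<nu> ` ?B \<subseteq> filt r n ?K"
  proof (rule image_subsetI)
    fix F assume "F \<in> ?B"
    then obtain S' T' where F: "F = codet S' T'" "rows S'" "standard S'" "standard T'" "shape T' = shape S'"
      "tot (shape S') = tot (shape S)" "ent (shape S) \<le> ent (shape S')" unfolding std_codets_def by blast
    show "pull r n \<mu> \<nu> F \<in> filt r n ?K"
    proof (cases "cod r n \<mu> S' \<nu> T' = (0 :: coset_index \<Rightarrow> 'k)")
      case True
      show ?thesis unfolding F(1) cod_def[symmetric] True by (rule filt_closed)
    next
      case False
      obtain y f where y: "y \<in> confs r \<nu>" "content f (blk \<mu>) (supp y) = S'"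
        using cod_nonzero(3)[OF False] by blast
      have "shape S' \<in> ?K" using shape_in_shapes[OF r F(2,3) y] F(6,7) by simp
      hence "cell r n (\<mu>, S') (\<nu>, T') \<in> (filt r n ?K :: (coset_index \<Rightarrow> 'k) set)"
        unfolding filt_def using cell_nonzero[OF False F(3,4,5)] by (intro fs.span_base) blast
      thus ?thesis unfolding F(1) cod_def[symmetric] cell_def fst_conv snd_conv .
    qed
  qed
  have "cod r n \<mu> S \<nu> T \<in> fs.span (pull r n \<mu> \<nu> ` ?B)"
    unfolding cod_def by (rule pull_span[OF codet_in_span_std[OF assms(2,3)]])
  thus ?thesis by (rule subsetD[OF fs.span_minimal[OF gen subspace_filt]])
qed

lemma higher_in_filt:
  assumes r: "1 \<le> r" and F: "F \<in> fs.span (higher \<eta>)"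
  shows "pull r n \<mu> \<nu> F \<in> (filt r n {\<eta>'\<in>shapes r. tot \<eta>' = tot \<eta> \<and> ent \<eta> < ent \<eta>'} :: (coset_index \<Rightarrow> 'k::field) set)"
proof -
  let ?K = "{\<eta>'\<in>shapes r. tot \<eta>' = tot \<eta> \<and> ent \<eta> < ent \<eta>'}"
  have gen: "pull r n \<mu> \<nu> ` higher \<eta> \<subseteq> (filt r n ?K :: (coset_index \<Rightarrow> 'k) set)"
  proof (rule image_subsetI)
    fix F :: "(nat, nat, nat multiset) labelled \<Rightarrow> 'k" assume "F \<in> higher \<eta>"
    then obtain S T where F: "F = codet S T" "rows S" "shape T = shape S" "tot (shape S) = tot \<eta>" "ent \<eta> < ent (shape S)"
      unfolding higher_def by blast
    have "{\<eta>\<in>shapes r. tot \<eta> = tot (shape S) \<and> ent (shape S) \<le> ent \<eta>} \<subseteq> ?K" using F(4,5) by auto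
    thus "pull r n \<mu> \<nu> F \<in> filt r n ?K"
      unfolding F(1) cod_def[symmetric] by (rule subsetD[OF filt_mono cod_in_filt[OF r F(2,3)]])
  qed
  show ?thesis by (rule subsetD[OF fs.span_minimal[OF gen subspace_filt] pull_span[OF F]])
qed

text \<open>A basis element of the algebra is the codeterminant whose rows are the classes of points
  with equal labels.\<close>

lemma basis_codeterminant:
  assumes b: "(\<mu>, D, \<nu>) \<in> basis_index r n"
  shows "\<exists>S T. rows S \<and> shape T = shape S \<and> tot (shape S) = card (supp (conf r \<nu> (SOME m. m \<in> D))) \<and>
    cod r n \<mu> S \<nu> T = (\<lambda>x. if x = (\<mu>, D, \<nu>) then 1 else 0 :: 'k::field)"
proof -
  have \<mu>: "\<mu> \<in> compositions r n" and \<nu>: "\<nu> \<in> compositions r n" and D: "D \<in> double_cosets r \<mu> \<nu>"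
    using b by (auto simp: basis_index_def)
  define el where "el D = (SOME m::nat \<Rightarrow> nat. m \<in> D)" for D
  have el: "el D' \<in> D'" "el D' \<in> full_transf r" if "D' \<in> double_cosets r \<mu> \<nu>" for D'
  proof -
    show "el D' \<in> D'" unfolding el_def using double_cosets_nonempty[OF that] some_in_eq by blast
    thus "el D' \<in> full_transf r" using double_cosets_subset[OF that] by blast
  qed
  define y where "y = conf r \<nu> (el D)"
  have y: "y \<in> confs r \<nu>" unfolding y_def by (rule conf_in[OF el(2)[OF D]])
  \<comment> \<open>Points with the same pair of labels share a row, numbered by
    \<open>en\<close>.\<close>
  define p where "p z x = (blk \<mu> x, vec z x)" for z x
  let ?P = "p y ` supp y"
  obtain en :: "nat \<times> nat multiset \<Rightarrow> nat" where en: "inj_on en ?P"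
    using finite_imp_inj_to_nat_seg[OF finite_imageI[OF finite_supp, of "p y" y]] by blast
  define g where "g x = en (p y x)" for x
  define S where "S = content g (blk \<mu>) (supp y)"
  define T where "T = content g (vec y) (supp y)"
  \<comment> \<open>In these tableaux every row uses one letter on each side, so any placement with
    these contents is forced by the labels.\<close>
  have row: "p z x \<in> ?P \<and> f x = en (p z x)"
    if f: "content f (blk \<mu>) (supp z) = S" "content f (vec z) (supp z) = T" and x: "x \<in> supp z" for f z x
  proof -
    have bx: "blk \<mu> x \<in># S (f x)" "vec z x \<in># T (f x)"
      unfolding f[symmetric] set_content[OF finite_supp] using x by auto
    then obtain x' where x': "x' \<in> supp y" "g x' = f x" "blk \<mu> x = blk \<mu> x'"
      unfolding S_def set_content[OF finite_supp] by auto
    obtain x'' where x'': "x'' \<in> supp y" "g x'' = f x" "vec z x = vec y x''"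
      using bx(2) unfolding T_def set_content[OF finite_supp] by auto
    have "p y x' = p y x''" using inj_onD[OF en, of "p y x'" "p y x''"] x'(1,2) x''(1,2) by (simp add: g_def)
    hence "p z x = p y x'" using x'(3) x''(3) by (simp add: p_def)
    thus ?thesis using x'(1,2) by (simp add: g_def)
  qed
  have one: "codet S T (point \<mu> y) = (1::'k)"
  proof -
    have "row_maps S (blk \<mu>) (supp y) \<inter> row_maps T (vec y) (supp y) = {restrict g (supp y)}" (is "?L = ?R")
    proof
      show "?L \<subseteq> ?R"
      proof
        fix f assume f: "f \<in> ?L"
        have fc: "content f (blk \<mu>) (supp y) = S" "content f (vec y) (supp y) = T"
          using f by (simp_all add: row_maps_def)
        have fE: "f \<in> supp y \<rightarrow>\<^sub>E UNIV" using f by (simp add: row_maps_def)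
        have "f x = restrict g (supp y) x" for x
        proof (cases "x \<in> supp y")
          case True
          thus ?thesis using row[OF fc True] by (simp only: restrict_apply g_def if_True)
        next
          case False
          thus ?thesis using PiE_arb[OF fE False] by simp
        qed
        thus "f \<in> ?R" by blast
      qed
      have "content (restrict g (supp y)) (blk \<mu>) (supp y) = S" "content (restrict g (supp y)) (vec y) (supp y) = T"
        unfolding S_def T_def by (rule content_cong; simp)+
      thus "?R \<subseteq> ?L" by (simp add: row_maps_def)
    qed
    thus ?thesis by (simp add: codet_def point_def)
  qed
  \<comment> \<open>A nonzero value means the same multiset of label pairs as y; the matching
    extends to an element of the left Young subgroup, so both configurations lie in one
    orbit.\<close>
  have same: "D' = D" if D': "D' \<in> double_cosets r \<mu> \<nu>" and ne: "codet S T (point \<mu> (conf r \<nu> (el D'))) \<noteq> (0::'k)" for D'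
  proof -
    define z where "z = conf r \<nu> (el D')"
    have z: "z \<in> confs r \<nu>" unfolding z_def by (rule conf_in[OF el(2)[OF D']])
    obtain f where f: "content f (blk \<mu>) (supp z) = S" "content f (vec z) (supp z) = T"
      using codet_nonzero_shape(2)[OF ne[unfolded point_def]] unfolding z_def by blast
    have "content g (blk \<mu>) (supp y) = content f (blk \<mu>) (supp z)" using f(1) by (simp add: S_def)
    then obtain h where h: "bij_betw h (supp y) (supp z)" "\<forall>x\<in>supp y. f (h x) = g x \<and> blk \<mu> (h x) = blk \<mu> x"
      using content_iso[OF finite_supp finite_supp] by blast
    have v: "vec z (h x) = vec y x" if x: "x \<in> supp y" for x
    proof -
      have hx: "h x \<in> supp z" using h(1) x by (auto simp: bij_betw_def)
      have "en (p z (h x)) = en (p y x)" using row[OF f hx] h(2) x by (simp add: g_def)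
      hence "p z (h x) = p y x" using row[OF f hx] x by (intro inj_onD[OF en]) auto
      thus ?thesis by (simp add: p_def)
    qed
    obtain s where s: "s permutes {1..r}" "\<forall>t\<in>{1..r}. blk \<mu> (s t) = blk \<mu> t" "\<forall>x\<in>supp y. s x = h x"
      using extend_to_permutation[OF supp_subset[OF y] supp_subset[OF z] h(1), of "blk \<mu>"] h(2) by blast
    have sy: "s \<in> young r \<mu>" using young_iff[OF \<mu>] s(1,2) by blast
    have inj: "inj s" using permutes_inj[OF s(1)] .
    have "push s y = z"
    proof (rule conf_eqI)
      have "s ` supp y = h ` supp y" using s(3) by (intro image_cong) auto
      thus "supp (push s y) = supp z" using h(1) by (simp add: supp_push bij_betw_def)
      fix x assume "x \<in> supp (push s y)"
      then obtain x' where x': "x' \<in> supp y" "x = s x'" by (auto simp: supp_push)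
      show "vec (push s y) x = vec z x"
        unfolding x'(2) vec_push_inj[OF inj] using v[OF x'(1)] s(3) x'(1) by simp
    qed
    hence "el D' \<in> double_coset r \<mu> (el D) \<nu>"
      using double_coset_conf[OF \<nu> el(2)[OF D] el(2)[OF D'], of \<mu>] sy unfolding y_def z_def by metis
    hence "el D' \<in> D" using double_cosets_eq[OF D el(1)[OF D]] by simp
    thus ?thesis using double_cosets_eq[OF D] double_cosets_eq[OF D' el(1)[OF D']] by simp
  qed
  have cod: "cod r n \<mu> S \<nu> T x = (if x = (\<mu>, D, \<nu>) then 1 else 0 :: 'k)" for x
  proof -
    obtain \<mu>' D' \<nu>' where x: "x = (\<mu>', D', \<nu>')" using prod_cases3 by blast
    show ?thesis
    proof (cases "\<mu>' = \<mu> \<and> \<nu>' = \<nu> \<and> D' \<in> double_cosets r \<mu> \<nu>")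
      case True
      hence "cod r n \<mu> S \<nu> T x = (codet S T (point \<mu> (conf r \<nu> (el D'))) :: 'k)"
        using \<mu> \<nu> by (simp add: x cod_def pull_def basis_index_def el_def)
      thus ?thesis using same[of D'] True one by (cases "D' = D") (auto simp: x y_def)
    next
      case False
      thus ?thesis using D by (auto simp: x cod_def pull_def basis_index_def)
    qed
  qed
  show ?thesis
  proof (intro exI conjI)
    show "rows S" unfolding S_def by (rule rows_content[OF finite_supp])
    show "shape T = shape S" by (simp add: S_def T_def shape_def fun_eq_iff size_content)
    show "tot (shape S) = card (supp (conf r \<nu> (SOME m. m \<in> D)))"
      using tot_shape_content[OF finite_supp, of g "blk \<mu>" y] unfolding S_def y_def el_def .
    show "cod r n \<mu> S \<nu> T = (\<lambda>x. if x = (\<mu>, D, \<nu>) then 1 else 0 :: 'k)" by (rule ext) (rule cod)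
  qed
qed

text \<open>Expand f in the given basis. Only basis elements of rank below i occur, and each is a
  codeterminant of its own rank. With i = r + 1 this shows that the cells span.\<close>

lemma low_rank_in_filt:
  assumes r: "1 \<le> r" and f: "f \<in> low_rank r n i"
  shows "f \<in> (filt r n {\<eta>\<in>shapes r. tot \<eta> < i} :: (coset_index \<Rightarrow> 'k::field) set)"
proof -
  let ?d = "\<lambda>b x. if x = b then 1 else 0 :: 'k"
  have fV: "f x = 0" if "x \<notin> basis_index r n" for x
    using f that by (simp add: low_rank_def S_carrier_def S_R_def del: split_paired_All)
  have "f = (\<Sum>b\<in>basis_index r n. fscale (f b) (?d b))"
  proof
    fix x
    have "(\<Sum>b\<in>basis_index r n. fscale (f b) (?d b)) x = (\<Sum>b\<in>basis_index r n. if b = x then f b else 0)"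
      unfolding sum_fun_apply by (rule sum.cong) auto
    thus "f x = (\<Sum>b\<in>basis_index r n. fscale (f b) (?d b)) x"
      using fV[of x] finite_basis_index by simp
  qed
  moreover have "fscale (f b) (?d b) \<in> filt r n {\<eta>\<in>shapes r. tot \<eta> < i}" if b: "b \<in> basis_index r n" for b
  proof (cases "f b = 0")
    case True
    hence "fscale (f b) (?d b) = 0" by (simp add: fscale_def fun_eq_iff)
    thus ?thesis by (simp only: filt_closed)
  next
    case False
    obtain \<mu> D \<nu> where bb: "b = (\<mu>, D, \<nu>)" using prod_cases3 by blast
    have \<mu>: "\<mu> \<in> compositions r n" and \<nu>: "\<nu> \<in> compositions r n" and D: "D \<in> double_cosets r \<mu> \<nu>"
      using b bb by (auto simp: basis_index_def)
    define m where "m = (SOME m. m \<in> D)"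
    have m: "m \<in> D" unfolding m_def using double_cosets_nonempty[OF D] some_in_eq by blast
    hence y: "conf r \<nu> m \<in> confs r \<nu>" using conf_in double_cosets_subset[OF D] by blast
    have "ev r f \<mu> \<nu> (conf r \<nu> m) \<noteq> 0" using False bb by (simp add: ev_conf[OF \<nu> D m])
    hence lt: "card (supp (conf r \<nu> m)) < i" using f \<mu> \<nu> y unfolding low_rank_def by (force simp: not_less)
    obtain S T where S: "rows S" "shape T = shape S" "tot (shape S) = card (supp (conf r \<nu> m))"
      "cod r n \<mu> S \<nu> T = ?d b"
      using basis_codeterminant[OF b[unfolded bb]] unfolding bb m_def by blast
    have sub: "{\<eta>\<in>shapes r. tot \<eta> = tot (shape S) \<and> ent (shape S) \<le> ent \<eta>} \<subseteq> {\<eta>\<in>shapes r. tot \<eta> < i}"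
      using lt S(3) by auto
    have "cod r n \<mu> S \<nu> T \<in> (filt r n {\<eta>\<in>shapes r. tot \<eta> < i} :: (coset_index \<Rightarrow> 'k) set)"
      by (rule subsetD[OF filt_mono[OF sub] cod_in_filt[OF r S(1,2)]])
    hence "?d b \<in> filt r n {\<eta>\<in>shapes r. tot \<eta> < i}" unfolding S(4) .
    thus ?thesis by (rule filt_closed)
  qed
  ultimately show ?thesis using filt_closed(5) by (metis (no_types, lifting))
qed

section \<open>Action within one cell layer\<close>

lemma left_tabs_tabloids:
  assumes "(\<mu>, S) \<in> left_tabs r n \<eta>"
  shows "\<mu> \<in> compositions r n" "S \<in> tabloids {..<n} \<eta>" "standard S"
proof -
  obtain Z f where Z: "\<mu> \<in> compositions r n" "standard S" "shape S = \<eta>" "Z \<subseteq> {1..r}" "content f (blk \<mu>) Z = S"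
    using assms unfolding left_tabs_def by blast
  show "\<mu> \<in> compositions r n" "standard S" by fact+
  have "set_mset (S j) \<subseteq> {..<n}" for j
    unfolding Z(5)[symmetric] set_content[OF finite_subset[OF Z(4) finite_atLeastAtMost]]
    using Z(4) blk_less[OF Z(1)] by auto
  thus "S \<in> tabloids {..<n} \<eta>" using Z(3) by (simp add: tabloids_def)
qed

lemma right_tabs_tabloids:
  assumes "(\<nu>, T) \<in> right_tabs r n \<eta>"
  shows "\<nu> \<in> compositions r n" "T \<in> tabloids (vectors r n) \<eta>" "standard T"
proof -
  obtain y f where y: "\<nu> \<in> compositions r n" "standard T" "shape T = \<eta>" "y \<in> confs r \<nu>" "content f (vec y) (supp y) = T"
    using assms unfolding right_tabs_def by blast
  show "\<nu> \<in> compositions r n" "standard T" by fact+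
  have "set_mset (T j) \<subseteq> vectors r n" for j
    unfolding y(5)[symmetric] set_content[OF finite_supp] using vec_in_vectors[OF y(1,4)] by auto
  thus "T \<in> tabloids (vectors r n) \<eta>" using y(3) by (simp add: tabloids_def)
qed

definition std_tabs :: "'a::linorder set \<Rightarrow> (nat \<Rightarrow> nat) \<Rightarrow> (nat \<Rightarrow> 'a multiset) set" where
  "std_tabs A \<eta> = {S\<in>tabloids A \<eta>. standard S}"

lemma finite_std_tabs: "partition_shape \<eta> \<Longrightarrow> finite A \<Longrightarrow> finite (std_tabs A \<eta>)"
  unfolding std_tabs_def using finite_tabloids partition_shape.finite_support by (intro finite_subset[OF Collect_restrict]) blast

lemma left_tabs_subset: "left_tabs r n \<eta> \<subseteq> compositions r n \<times> std_tabs {..<n} \<eta>"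
  using left_tabs_tabloids unfolding std_tabs_def by auto

lemma right_tabs_subset: "right_tabs r n \<eta> \<subseteq> compositions r n \<times> std_tabs (vectors r n) \<eta>"
  using right_tabs_tabloids unfolding std_tabs_def by auto

lemma finite_left_tabs: "partition_shape \<eta> \<Longrightarrow> finite (left_tabs r n \<eta>)"
  by (rule finite_subset[OF left_tabs_subset]) (intro finite_cartesian_product finite_compositions finite_std_tabs finite_lessThan)

lemma finite_right_tabs: "partition_shape \<eta> \<Longrightarrow> finite (right_tabs r n \<eta>)"
  by (rule finite_subset[OF right_tabs_subset]) (intro finite_cartesian_product finite_compositions finite_std_tabs finite_vectors)

definition below :: "nat \<Rightarrow> (nat \<Rightarrow> nat) \<Rightarrow> (nat \<Rightarrow> nat) set" where
  "below r \<eta> = {\<eta>'\<in>shapes r. tot \<eta>' < tot \<eta> \<or> tot \<eta>' = tot \<eta> \<and> ent \<eta> < ent \<eta>'}"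

lemma higher_in_below: "1 \<le> r \<Longrightarrow> F \<in> fs.span (higher \<eta>) \<Longrightarrow> pull r n \<mu> \<nu> F \<in> filt r n (below r \<eta>)"
  by (rule subsetD[OF filt_mono higher_in_filt]) (auto simp: below_def)

lemma low_rank_in_below: "1 \<le> r \<Longrightarrow> f \<in> low_rank r n (tot \<eta>) \<Longrightarrow> f \<in> filt r n (below r \<eta>)"
  by (rule subsetD[OF filt_mono low_rank_in_filt]) (auto simp: below_def)

text \<open>Substitutes the straightening of each term into an expansion, so the coefficient
  matrices multiply, and drops the indices outside \<open>I\<close>, whose elements are
  zero.\<close>

lemma combine_straightening:
  fixes g :: "'x \<Rightarrow> 'y \<Rightarrow> 'k::field" and W :: "(coset_index \<Rightarrow> 'k) set" and F :: "'m \<Rightarrow> 'y \<Rightarrow> coset_index \<Rightarrow> 'k"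
  assumes W: "fs.subspace W" and a: "v - (\<Sum>\<mu>\<in>M. \<Sum>S\<in>A. fscale (h \<mu> S) (G \<mu> S)) \<in> W"
    and g: "\<And>\<mu> S. \<mu> \<in> M \<Longrightarrow> S \<in> A \<Longrightarrow> G \<mu> S - (\<Sum>S'\<in>B. fscale (g S S') (F \<mu> S')) \<in> W"
    and fin: "finite M" "finite B" and I: "I \<subseteq> M \<times> B" and z: "\<And>\<mu> S. \<mu> \<in> M \<Longrightarrow> S \<in> B \<Longrightarrow> (\<mu>, S) \<notin> I \<Longrightarrow> F \<mu> S = 0"
  shows "v - (\<Sum>s\<in>I. fscale (\<Sum>S\<in>A. h (fst s) S * g S (snd s)) (F (fst s) (snd s))) \<in> W"
proof -
  have "(\<Sum>s\<in>I. fscale (\<Sum>S\<in>A. h (fst s) S * g S (snd s)) (F (fst s) (snd s))) =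
      (\<Sum>s\<in>M \<times> B. fscale (\<Sum>S\<in>A. h (fst s) S * g S (snd s)) (F (fst s) (snd s)))"
  proof (rule sum.mono_neutral_left)
    show "finite (M \<times> B)" using fin by simp
    show "\<forall>s\<in>M \<times> B - I. fscale (\<Sum>S\<in>A. h (fst s) S * g S (snd s)) (F (fst s) (snd s)) = 0"
    proof
      fix s assume "s \<in> M \<times> B - I"
      hence "F (fst s) (snd s) = 0" by (intro z) auto
      thus "fscale (\<Sum>S\<in>A. h (fst s) S * g S (snd s)) (F (fst s) (snd s)) = 0" by (simp add: fun_eq_iff)
    qed
  qed (rule I)
  also have "\<dots> = (\<Sum>\<mu>\<in>M. \<Sum>S'\<in>B. fscale (\<Sum>S\<in>A. h \<mu> S * g S S') (F \<mu> S'))"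
    by (simp add: sum.cartesian_product case_prod_beta)
  also have "\<dots> = (\<Sum>\<mu>\<in>M. \<Sum>S\<in>A. fscale (h \<mu> S) (\<Sum>S'\<in>B. fscale (g S S') (F \<mu> S')))"
  proof (rule sum.cong[OF refl])
    fix \<mu>
    show "(\<Sum>S'\<in>B. fscale (\<Sum>S\<in>A. h \<mu> S * g S S') (F \<mu> S')) = (\<Sum>S\<in>A. fscale (h \<mu> S) (\<Sum>S'\<in>B. fscale (g S S') (F \<mu> S')))"
      by (rule ext) (simp add: sum_fun_apply sum_distrib_left sum_distrib_right mult.assoc sum.swap[of _ A])
  qed
  finally have eq: "(\<Sum>s\<in>I. fscale (\<Sum>S\<in>A. h (fst s) S * g S (snd s)) (F (fst s) (snd s))) =
    (\<Sum>\<mu>\<in>M. \<Sum>S\<in>A. fscale (h \<mu> S) (\<Sum>S'\<in>B. fscale (g S S') (F \<mu> S')))" .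
  have "(\<Sum>\<mu>\<in>M. \<Sum>S\<in>A. fscale (h \<mu> S) (G \<mu> S - (\<Sum>S'\<in>B. fscale (g S S') (F \<mu> S')))) \<in> W"
    by (intro fs.subspace_sum[OF W] fs.subspace_scale[OF W] g)
  from fs.subspace_add[OF W a this] show ?thesis
    unfolding eq by (simp only: fs.scale_right_diff_distrib sum_subtractf diff_add_eq add_diff_eq diff_add_cancel add_diff_cancel_right')
qed

lemma pull_straighten:
  "pull r n \<mu> \<nu> (G - (\<Sum>i\<in>A. fscale (c i) (F i))) = pull r n \<mu> \<nu> G - (\<Sum>i\<in>A. fscale (c i) (pull r n \<mu> \<nu> (F i)))"
  by (simp only: pull_linear pull_sum)

text \<open>\<open>left_action\<close> followed by \<open>straighten_left\<close>. Neither set of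
  coefficients depends on the right tableau, as required of the layer.\<close>

lemma cell_left:
  fixes a :: "coset_index \<Rightarrow> 'k::field"
  assumes r: "1 \<le> r" and \<eta>: "partition_shape \<eta>" and s: "s \<in> left_tabs r n \<eta>"
  shows "\<exists>\<rho>. \<forall>t\<in>right_tabs r n \<eta>. S_mult r n a (cell r n s t) - (\<Sum>s'\<in>left_tabs r n \<eta>. fscale (\<rho> s') (cell r n s' t))
    \<in> filt r n (below r \<eta>)"
proof -
  obtain \<mu> S where sp: "s = (\<mu>, S)" by (cases s)
  note S = left_tabs_tabloids[OF s[unfolded sp]]
  have shS: "shape S = \<eta>" using S(2) by (simp add: tabloids_def)
  obtain h where h: "\<And>\<nu> T. \<nu> \<in> compositions r n \<Longrightarrow> shape T = \<eta> \<Longrightarrow>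
    S_mult r n a (cod r n \<mu> S \<nu> T) -
      (\<Sum>\<mu>'\<in>compositions r n. \<Sum>S'\<in>tabloids {..<n} \<eta>. fscale (h \<mu>' S') (cod r n \<mu>' S' \<nu> T))
    \<in> low_rank r n (tot \<eta>)"
    using left_action[OF S(1), of S a] unfolding shS by blast
  have "\<forall>S'\<in>tabloids {..<n} \<eta>. \<exists>g. \<forall>T. shape T = \<eta> \<longrightarrow>
    codet S' T - (\<Sum>S''\<in>std_tabs {..<n} \<eta>. fscale (g S'') (codet S'' T))
      \<in> fs.span (higher \<eta> :: ((nat, nat, nat multiset) labelled \<Rightarrow> 'k) set)"
    unfolding std_tabs_def
    by (intro ballI straighten_left[OF finite_lessThan partition_shape.finite_support[OF \<eta>] partition_shape.decreasing[OF \<eta>]])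
  from bchoice[OF this] obtain g where g: "\<And>S' T. S' \<in> tabloids {..<n} \<eta> \<Longrightarrow> shape T = \<eta> \<Longrightarrow>
    codet S' T - (\<Sum>S''\<in>std_tabs {..<n} \<eta>. fscale (g S' S'') (codet S'' T))
      \<in> fs.span (higher \<eta> :: ((nat, nat, nat multiset) labelled \<Rightarrow> 'k) set)" by blast
  show ?thesis
  proof (intro exI ballI)
    fix t assume t: "t \<in> right_tabs r n \<eta>"
    obtain \<nu> T where tp: "t = (\<nu>, T)" by (cases t)
    note T = right_tabs_tabloids[OF t[unfolded tp]]
    have shT: "shape T = \<eta>" using T(2) by (simp add: tabloids_def)
    have "S_mult r n a (cod r n \<mu> S \<nu> T) - (\<Sum>s'\<in>left_tabs r n \<eta>.
        fscale (\<Sum>S'\<in>tabloids {..<n} \<eta>. h (fst s') S' * g S' (snd s')) (cod r n (fst s') (snd s') \<nu> T)) \<in> filt r n (below r \<eta>)"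
    proof (rule combine_straightening[OF subspace_filt low_rank_in_below[OF r h[OF T(1) shT]]])
      fix \<mu>' S' assume S': "\<mu>' \<in> compositions r n" "S' \<in> tabloids {..<n} \<eta>"
      show "cod r n \<mu>' S' \<nu> T - (\<Sum>S''\<in>std_tabs {..<n} \<eta>. fscale (g S' S'') (cod r n \<mu>' S'' \<nu> T)) \<in> filt r n (below r \<eta>)"
        unfolding cod_def pull_straighten[symmetric] by (rule higher_in_below[OF r g[OF S'(2) shT]])
    next
      fix \<mu>' S' assume S': "S' \<in> std_tabs {..<n} \<eta>" "(\<mu>', S') \<notin> left_tabs r n \<eta>"
      have sh: "shape S' = \<eta>" "standard S'" using S'(1) by (auto simp: std_tabs_def tabloids_def)
      show "cod r n \<mu>' S' \<nu> T = (0 :: coset_index \<Rightarrow> 'k)"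
        using cell_nonzero(1)[OF _ sh(2) T(3), of r n \<mu>' \<nu>] S'(2) shT sh(1) by fastforce
    qed (use left_tabs_subset finite_compositions finite_std_tabs[OF \<eta> finite_lessThan] in auto)
    thus "S_mult r n a (cell r n s t) - (\<Sum>s'\<in>left_tabs r n \<eta>.
        fscale (\<Sum>S'\<in>tabloids {..<n} \<eta>. h (fst s') S' * g S' (snd s')) (cell r n s' t)) \<in> filt r n (below r \<eta>)"
      by (simp only: cell_def sp tp fst_conv snd_conv)
  qed
qed

lemma cell_right:
  fixes a :: "coset_index \<Rightarrow> 'k::field"
  assumes r: "1 \<le> r" and \<eta>: "partition_shape \<eta>" and t: "t \<in> right_tabs r n \<eta>"
  shows "\<exists>\<rho>. \<forall>s\<in>left_tabs r n \<eta>. S_mult r n (cell r n s t) a - (\<Sum>t'\<in>right_tabs r n \<eta>. fscale (\<rho> t') (cell r n s t'))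
    \<in> filt r n (below r \<eta>)"
proof -
  obtain \<nu> T where tp: "t = (\<nu>, T)" by (cases t)
  note T = right_tabs_tabloids[OF t[unfolded tp]]
  have shT: "shape T = \<eta>" using T(2) by (simp add: tabloids_def)
  obtain h where h: "\<And>\<mu> S. \<mu> \<in> compositions r n \<Longrightarrow> shape S = \<eta> \<Longrightarrow>
    S_mult r n (cod r n \<mu> S \<nu> T) a -
      (\<Sum>\<nu>'\<in>compositions r n. \<Sum>T'\<in>tabloids (vectors r n) \<eta>. fscale (h \<nu>' T') (cod r n \<mu> S \<nu>' T'))
    \<in> low_rank r n (tot \<eta>)"
    using right_action[OF T(1), of T a] unfolding shT by blast
  have "\<forall>T'\<in>tabloids (vectors r n) \<eta>. \<exists>g. \<forall>S. shape S = \<eta> \<longrightarrow>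
    codet S T' - (\<Sum>T''\<in>std_tabs (vectors r n) \<eta>. fscale (g T'') (codet S T''))
      \<in> fs.span (higher \<eta> :: ((nat, nat, nat multiset) labelled \<Rightarrow> 'k) set)"
    unfolding std_tabs_def
    by (intro ballI straighten_right[OF finite_vectors partition_shape.finite_support[OF \<eta>] partition_shape.decreasing[OF \<eta>]])
  from bchoice[OF this] obtain g where g: "\<And>T' S. T' \<in> tabloids (vectors r n) \<eta> \<Longrightarrow> shape S = \<eta> \<Longrightarrow>
    codet S T' - (\<Sum>T''\<in>std_tabs (vectors r n) \<eta>. fscale (g T' T'') (codet S T''))
      \<in> fs.span (higher \<eta> :: ((nat, nat, nat multiset) labelled \<Rightarrow> 'k) set)" by blast
  show ?thesis
  proof (intro exI ballI)
    fix s assume s: "s \<in> left_tabs r n \<eta>"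
    obtain \<mu> S where sp: "s = (\<mu>, S)" by (cases s)
    note S = left_tabs_tabloids[OF s[unfolded sp]]
    have shS: "shape S = \<eta>" using S(2) by (simp add: tabloids_def)
    have "S_mult r n (cod r n \<mu> S \<nu> T) a - (\<Sum>t'\<in>right_tabs r n \<eta>.
        fscale (\<Sum>T'\<in>tabloids (vectors r n) \<eta>. h (fst t') T' * g T' (snd t')) (cod r n \<mu> S (fst t') (snd t'))) \<in> filt r n (below r \<eta>)"
    proof (rule combine_straightening[OF subspace_filt low_rank_in_below[OF r h[OF S(1) shS]]])
      fix \<nu>' T' assume T': "\<nu>' \<in> compositions r n" "T' \<in> tabloids (vectors r n) \<eta>"
      show "cod r n \<mu> S \<nu>' T' - (\<Sum>T''\<in>std_tabs (vectors r n) \<eta>. fscale (g T' T'') (cod r n \<mu> S \<nu>' T'')) \<in> filt r n (below r \<eta>)"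
        unfolding cod_def pull_straighten[symmetric] by (rule higher_in_below[OF r g[OF T'(2) shS]])
    next
      fix \<nu>' T' assume T': "T' \<in> std_tabs (vectors r n) \<eta>" "(\<nu>', T') \<notin> right_tabs r n \<eta>"
      have sh: "shape T' = \<eta>" "standard T'" using T'(1) by (auto simp: std_tabs_def tabloids_def)
      show "cod r n \<mu> S \<nu>' T' = (0 :: coset_index \<Rightarrow> 'k)"
        using cell_nonzero(2)[OF _ S(3) sh(2), of r n \<mu> \<nu>'] T'(2) shS sh(1) by fastforce
    qed (use right_tabs_subset finite_compositions finite_std_tabs[OF \<eta> finite_vectors] in auto)
    thus "S_mult r n (cell r n s t) a - (\<Sum>t'\<in>right_tabs r n \<eta>.
        fscale (\<Sum>T'\<in>tabloids (vectors r n) \<eta>. h (fst t') T' * g T' (snd t')) (cell r n s t')) \<in> filt r n (below r \<eta>)"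
      by (simp only: cell_def sp tp fst_conv snd_conv)
  qed
qed

section \<open>Linear independence\<close>

text \<open>The column antisymmetrizer functional, transported along an embedding \<open>h\<close> of the cells
  of \<open>\<eta>\<close> into \<open>{1..r}\<close>.\<close>

definition probe ::
  "nat \<Rightarrow> (nat \<Rightarrow> nat) \<Rightarrow> (nat \<times> nat \<Rightarrow> nat) \<Rightarrow> nat list \<Rightarrow> nat list \<Rightarrow> (nat \<times> nat \<Rightarrow> nat multiset) \<Rightarrow>
    (coset_index \<Rightarrow> 'k::field) \<Rightarrow> 'k" where
  "probe r \<eta> h \<mu> \<nu> W f = (\<Sum>\<sigma>\<in>col_perms \<eta>. of_int (sign \<sigma>) *
     ev r f \<mu> \<nu> (of_vec (h ` cells \<eta>) (W \<circ> \<sigma> \<circ> inv_into (cells \<eta>) h)))"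

lemma probe_linear:
  "probe r \<eta> h \<mu> \<nu> W (f + g) = probe r \<eta> h \<mu> \<nu> W f + probe r \<eta> h \<mu> \<nu> W g"
  "probe r \<eta> h \<mu> \<nu> W (fscale c f) = c * probe r \<eta> h \<mu> \<nu> W f"
  "probe r \<eta> h \<mu> \<nu> W 0 = 0"
  unfolding probe_def ev_add ev_scale
  by (simp_all add: distrib_left sum.distrib sum_distrib_left mult.left_commute ev_def[of r 0])

lemma probe_sum: "probe r \<eta> h \<mu> \<nu> W (\<Sum>i\<in>A. f i) = (\<Sum>i\<in>A. probe r \<eta> h \<mu> \<nu> W (f i))"
  by (induction A rule: infinite_finite_induct) (simp_all only: sum.infinite sum.empty sum.insert probe_linear not_False_eq_True)

text \<open>The embedding h realizes the labels \<open>U\<close> as blocks of \<mu>0, and the fibres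
  \<open>W\<close> use up the blocks of \<nu>0 exactly; so the test points are genuine
  configurations.\<close>

locale probe_data = partition_shape +
  fixes r n :: nat and h :: "nat \<times> nat \<Rightarrow> nat" and \<mu>0 \<nu>0 :: "nat list"
    and U :: "nat \<times> nat \<Rightarrow> nat" and W :: "nat \<times> nat \<Rightarrow> nat multiset"
  assumes \<mu>0: "\<mu>0 \<in> compositions r n" and \<nu>0: "\<nu>0 \<in> compositions r n"
    and h: "inj_on h (cells \<eta>)" "h ` cells \<eta> \<subseteq> {1..r}" "\<And>x. x \<in> cells \<eta> \<Longrightarrow> blk \<mu>0 (h x) = U x"
    and W: "\<And>x. x \<in> cells \<eta> \<Longrightarrow> W x \<noteq> {#}" "(\<Sum>x\<in>cells \<eta>. W x) = image_mset (blk \<nu>0) (mset_set {1..r})"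
begin

text \<open>Permuting the fibres within columns does not change their total, so each summand of the
  probe is evaluated at an element of \<open>confs r \<nu>0\<close>.\<close>

lemma probe_point:
  assumes s: "\<sigma> \<in> col_perms \<eta>"
  defines "y \<equiv> of_vec (h ` cells \<eta>) (W \<circ> \<sigma> \<circ> inv_into (cells \<eta>) h)"
  shows "y \<in> confs r \<nu>0" "supp y = h ` cells \<eta>" "x \<in> cells \<eta> \<Longrightarrow> vec y (h x) = W (\<sigma> x)"
proof -
  let ?v = "W \<circ> \<sigma> \<circ> inv_into (cells \<eta>) h"
  have p: "\<sigma> permutes cells \<eta>" using col_permsD(1)[OF s] .
  have v: "?v (h x) = W (\<sigma> x)" if "x \<in> cells \<eta>" for x using that h(1) by simp
  have ne: "?v z \<noteq> {#}" if "z \<in> h ` cells \<eta>" for z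
  proof -
    obtain x where x: "x \<in> cells \<eta>" "z = h x" using \<open>z \<in> h ` cells \<eta>\<close> by blast
    show ?thesis unfolding x(2) v[OF x(1)] using x(1) W(1) permutes_in_image[OF p] by blast
  qed
  show sy: "supp y = h ` cells \<eta>" unfolding y_def by (rule of_vec(1)) (simp, rule ne)
  have vy: "vec y z = ?v z" if "z \<in> h ` cells \<eta>" for z
    unfolding y_def by (rule of_vec(2)) (simp, rule ne, assumption, rule that)
  have iy: "image_mset snd y = (\<Sum>z\<in>h ` cells \<eta>. ?v z)" unfolding y_def by (rule of_vec(3)) (simp, rule ne)
  have "(\<Sum>z\<in>h ` cells \<eta>. ?v z) = (\<Sum>x\<in>cells \<eta>. W (\<sigma> x))"
    using h(1) by (subst sum.reindex) (auto intro!: sum.cong)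
  also have "\<dots> = (\<Sum>x\<in>cells \<eta>. W x)" using sum.permute[OF p, of W] by (simp add: comp_def)
  finally show "y \<in> confs r \<nu>0"
    using h(2) W(2) sy unfolding confs_def supp_def by (simp only: iy mem_Collect_eq)
  show "vec y (h x) = W (\<sigma> x)" if "x \<in> cells \<eta>" using vy[of "h x"] v[OF that] that by simp
qed

lemma probe_cod:
  "probe r \<eta> h \<mu>0 \<nu>0 W (cod r n \<mu> S \<nu> T) = (if \<mu> = \<mu>0 \<and> \<nu> = \<nu>0 then col_sum \<eta> U W S T else 0 :: 'k::field)"
proof -
  have "ev r (cod r n \<mu> S \<nu> T) \<mu>0 \<nu>0 (of_vec (h ` cells \<eta>) (W \<circ> \<sigma> \<circ> inv_into (cells \<eta>) h)) =
      (if \<mu> = \<mu>0 \<and> \<nu> = \<nu>0 then codet S T (cells \<eta>, U, W \<circ> \<sigma>) else 0 :: 'k)" if s: "\<sigma> \<in> col_perms \<eta>" for \<sigma>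
  proof -
    let ?y = "of_vec (h ` cells \<eta>) (W \<circ> \<sigma> \<circ> inv_into (cells \<eta>) h)"
    note y = probe_point[OF s]
    have bij: "bij_betw h (cells \<eta>) (supp ?y)" using h(1) y(2) by (simp add: bij_betw_def)
    have "codet S T (point \<mu>0 ?y) = (codet S T (cells \<eta>, U, W \<circ> \<sigma>) :: 'k)"
      unfolding point_def by (rule codet_bij[OF bij]) (simp_all only: h(3) y(3) comp_apply[of W \<sigma>])
    thus ?thesis using ev_cod[OF \<mu>0 \<nu>0 y(1), of \<mu> S \<nu> T] by auto
  qed
  thus ?thesis by (cases "\<mu> = \<mu>0 \<and> \<nu> = \<nu>0") (auto simp: probe_def col_sum_def)
qed

text \<open>Shapes of another rank give zero since a nonzero codeterminant needs as many points as
  its shape has cells; shapes of the same rank are killed by \<open>col_sum_zero\<close>.\<close>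

lemma probe_filt:
  assumes K: "\<And>\<eta>'. \<eta>' \<in> K \<Longrightarrow> \<eta>' \<in> shapes r \<and> \<eta>' \<noteq> \<eta> \<and> (tot \<eta>' \<noteq> tot \<eta> \<or> ent \<eta> \<le> ent \<eta>')"
    and f: "f \<in> filt r n K"
  shows "probe r \<eta> h \<mu>0 \<nu>0 W f = (0 :: 'k::field)"
  using f unfolding filt_def
proof (induction rule: fs.span_induct_alt)
  case base
  show ?case by (rule probe_linear)
next
  case (step c x y)
  then obtain s t \<eta>' where x: "x = cell r n s t" "\<eta>' \<in> K" "s \<in> left_tabs r n \<eta>'" "t \<in> right_tabs r n \<eta>'" by blast
  obtain \<mu> S \<nu> T where st: "s = (\<mu>, S)" "t = (\<nu>, T)" by (cases s, cases t)
  have S: "shape S = \<eta>'" using left_tabs_tabloids(2)[OF x(3)[unfolded st]] by (simp add: tabloids_def)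
  have ps: "partition_shape \<eta>'" using K[OF x(2)] by (simp add: shapes_def)
  have rows: "rows S" using partition_shape.finite_support[OF ps] by (simp add: rows_shape S)
  have "col_sum \<eta> U W S T = (0::'k)"
  proof (cases "tot \<eta>' = tot \<eta>")
    case True
    hence "ent \<eta> < ent (shape S) \<or> ent (shape S) = ent \<eta> \<and> (\<forall>j. shape S (Suc j) \<le> shape S j)"
      using K[OF x(2)] partition_shape.decreasing[OF ps] unfolding S by auto
    thus ?thesis using K[OF x(2)] by (intro col_sum_zero[OF rows]) (simp_all add: S)
  next
    case False
    have "codet S T (cells \<eta>, U, W \<circ> \<sigma>) = (0::'k)" for \<sigma>
    proof (rule ccontr)
      assume "codet S T (cells \<eta>, U, W \<circ> \<sigma>) \<noteq> (0::'k)"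
      then obtain f where "content f U (cells \<eta>) = S" using codet_nonzero_shape(2) by blast
      hence "tot (shape S) = card (cells \<eta>)" using tot_shape_content[OF finite_cells, of f U] by simp
      thus False using False by (simp add: S card_cells)
    qed
    thus ?thesis by (simp add: col_sum_def)
  qed
  hence "probe r \<eta> h \<mu>0 \<nu>0 W x = (0::'k)" unfolding x(1) cell_def probe_cod st by simp
  thus ?case using step(2) by (simp only: probe_linear) simp
qed

end

lemma ex_embedding:
  assumes \<eta>: "partition_shape \<eta>" and S: "(\<mu>, S) \<in> left_tabs r n \<eta>"
  shows "\<exists>h. inj_on h (cells \<eta>) \<and> h ` cells \<eta> \<subseteq> {1..r} \<and> (\<forall>x\<in>cells \<eta>. blk \<mu> (h x) = partition_shape.fill S x)"
proof -
  interpret partition_shape \<eta> by fact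
  obtain Z f where Z: "Z \<subseteq> {1..r}" "content f (blk \<mu>) Z = S" using S unfolding left_tabs_def by blast
  have "shape S = \<eta>" using S by (simp add: left_tabs_def)
  hence "content fst (fill S) (cells \<eta>) = content f (blk \<mu>) Z" using content_fill Z(2) by simp
  then obtain h where "bij_betw h (cells \<eta>) Z" "\<forall>x\<in>cells \<eta>. blk \<mu> (h x) = fill S x"
    using content_iso[OF finite_cells finite_subset[OF Z(1) finite_atLeastAtMost]] by blast
  thus ?thesis using Z(1) by (auto simp: bij_betw_def)
qed

lemma fill_right:
  assumes \<eta>: "partition_shape \<eta>" and T: "(\<nu>, T) \<in> right_tabs r n \<eta>"
  shows "\<And>x. x \<in> cells \<eta> \<Longrightarrow> partition_shape.fill T x \<noteq> {#}" "(\<Sum>x\<in>cells \<eta>. partition_shape.fill T x) = image_mset (blk \<nu>) (mset_set {1..r})"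
proof -
  interpret partition_shape \<eta> by fact
  obtain y f where y: "y \<in> confs r \<nu>" "content f (vec y) (supp y) = T" using T unfolding right_tabs_def by blast
  have "shape T = \<eta>" using T by (simp add: right_tabs_def)
  hence "content fst (fill T) (cells \<eta>) = content f (vec y) (supp y)" using content_fill y(2) by simp
  then obtain h where h: "bij_betw h (cells \<eta>) (supp y)" "\<forall>x\<in>cells \<eta>. vec y (h x) = fill T x"
    using content_iso[OF finite_cells finite_supp] by blast
  show "fill T x \<noteq> {#}" if "x \<in> cells \<eta>" for x
    using h that vec_empty_iff[of y "h x"] by (auto simp: bij_betw_def)
  have "(\<Sum>x\<in>cells \<eta>. fill T x) = (\<Sum>x\<in>cells \<eta>. vec y (h x))" using h(2) by simp
  also have "\<dots> = (\<Sum>x\<in>supp y. vec y x)" by (rule sum.reindex_bij_betw[OF h(1)])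
  finally show "(\<Sum>x\<in>cells \<eta>. fill T x) = image_mset (blk \<nu>) (mset_set {1..r})"
    using y(1) by (simp add: sum_vec confs_def)
qed

text \<open>The probes built from standard fillings S1 and T1 kill the filtration and turn the
  relation into a matrix equation, with unitriangular matrices on both sides of the coefficient
  matrix.\<close>

lemma cell_indep:
  fixes c :: "_ \<Rightarrow> _ \<Rightarrow> 'k::field"
  assumes \<eta>: "partition_shape \<eta>"
    and K: "\<And>\<eta>'. \<eta>' \<in> K \<Longrightarrow> \<eta>' \<in> shapes r \<and> \<eta>' \<noteq> \<eta> \<and> (tot \<eta>' \<noteq> tot \<eta> \<or> ent \<eta> \<le> ent \<eta>')"
    and z: "(\<Sum>t\<in>right_tabs r n \<eta>. \<Sum>s\<in>left_tabs r n \<eta>. fscale (c s t) (cell r n s t)) \<in> filt r n K"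
    and s: "s \<in> left_tabs r n \<eta>" and t: "t \<in> right_tabs r n \<eta>"
  shows "c s t = 0"
proof -
  interpret partition_shape \<eta> by fact
  obtain \<mu> S0 \<nu> T0 where st: "s = (\<mu>, S0)" "t = (\<nu>, T0)" by (cases s, cases t)
  let ?A = "{S. (\<mu>, S) \<in> left_tabs r n \<eta>}" and ?B = "{T. (\<nu>, T) \<in> right_tabs r n \<eta>}"
  let ?D = "\<lambda>S1 S. col_det \<eta> (fill S1) S" and ?E = "\<lambda>T1 T. col_det \<eta> (fill T1) T"
  have finA: "finite ?A" by (rule finite_subset[of _ "snd ` left_tabs r n \<eta>"]) (force, simp add: finite_left_tabs[OF \<eta>])
  have finB: "finite ?B" by (rule finite_subset[of _ "snd ` right_tabs r n \<eta>"]) (force, simp add: finite_right_tabs[OF \<eta>])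
  have eq: "(\<Sum>S\<in>?A. (\<Sum>T\<in>?B. c (\<mu>, S) (\<nu>, T) * of_int (?E T1 T)) * of_int (?D S1 S)) = 0"
    if S1: "S1 \<in> ?A" and T1: "T1 \<in> ?B" for S1 T1
  proof -
    obtain h where h: "inj_on h (cells \<eta>)" "h ` cells \<eta> \<subseteq> {1..r}" "\<forall>x\<in>cells \<eta>. blk \<mu> (h x) = fill S1 x"
      using ex_embedding[OF \<eta>] S1 by blast
    have T1': "(\<nu>, T1) \<in> right_tabs r n \<eta>" and S1': "(\<mu>, S1) \<in> left_tabs r n \<eta>" using S1 T1 by auto
    interpret probe_data \<eta> r n h \<mu> \<nu> "fill S1" "fill T1"
      by unfold_locales
        (use h left_tabs_tabloids(1)[OF S1'] right_tabs_tabloids(1)[OF T1'] fill_right[OF \<eta> T1'] in auto)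
    let ?p = "probe r \<eta> h \<mu> \<nu> (fill T1)"
    have p: "?p (cell r n s t) = (if fst s = \<mu> \<and> fst t = \<nu> then of_int (?D S1 (snd s)) * of_int (?E T1 (snd t)) else 0 :: 'k)"
      if "s \<in> left_tabs r n \<eta>" for s t
    proof -
      have "shape (snd s) = \<eta>" using that by (auto simp: left_tabs_def)
      thus ?thesis by (simp add: cell_def probe_cod col_sum_factor)
    qed
    have "0 = ?p (\<Sum>t\<in>right_tabs r n \<eta>. \<Sum>s\<in>left_tabs r n \<eta>. fscale (c s t) (cell r n s t))"
      using probe_filt[OF K z] by simp
    also have "\<dots> = (\<Sum>t\<in>right_tabs r n \<eta>. \<Sum>s\<in>left_tabs r n \<eta>. c s t * ?p (cell r n s t))"
      by (simp only: probe_sum probe_linear)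
    also have "\<dots> = (\<Sum>t\<in>right_tabs r n \<eta>. \<Sum>s\<in>left_tabs r n \<eta>. if fst t = \<nu> then if fst s = \<mu>
        then c s t * of_int (?E T1 (snd t)) * of_int (?D S1 (snd s)) else 0 else 0)"
      by (intro sum.cong refl) (simp add: p)
    also have "\<dots> = (\<Sum>t\<in>{t\<in>right_tabs r n \<eta>. fst t = \<nu>}. \<Sum>s\<in>{s\<in>left_tabs r n \<eta>. fst s = \<mu>}.
        c s t * of_int (?E T1 (snd t)) * of_int (?D S1 (snd s)))"
      unfolding sum.inter_filter[OF finite_right_tabs[OF \<eta>]] sum.inter_filter[OF finite_left_tabs[OF \<eta>]]
      by (intro sum.cong refl) simp
    also have "{t\<in>right_tabs r n \<eta>. fst t = \<nu>} = Pair \<nu> ` ?B" by force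
    also have "{s\<in>left_tabs r n \<eta>. fst s = \<mu>} = Pair \<mu> ` ?A" by force
    also have "(\<Sum>t\<in>Pair \<nu> ` ?B. \<Sum>s\<in>Pair \<mu> ` ?A. c s t * of_int (?E T1 (snd t)) * of_int (?D S1 (snd s))) =
        (\<Sum>T\<in>?B. \<Sum>S\<in>?A. c (\<mu>, S) (\<nu>, T) * of_int (?E T1 T) * of_int (?D S1 S))"
      by (subst sum.reindex, simp add: inj_on_def, subst sum.reindex, simp add: inj_on_def) simp
    also have "\<dots> = (\<Sum>S\<in>?A. (\<Sum>T\<in>?B. c (\<mu>, S) (\<nu>, T) * of_int (?E T1 T)) * of_int (?D S1 S))"
      by (subst sum.swap) (simp add: sum_distrib_right)
    finally show ?thesis by simp
  qed
  have A: "S \<in> std_tabs {..<n} \<eta>" if "S \<in> ?A" for S using that left_tabs_subset by blast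
  have B: "T \<in> std_tabs (vectors r n) \<eta>" if "T \<in> ?B" for T using that right_tabs_subset by blast
  obtain m where m: "\<forall>S\<in>std_tabs {..<n} \<eta>. ?D S S = 1 \<and> (\<forall>S'. ?D S S' \<noteq> 0 \<longrightarrow> S' = S \<or> m S' < (m S :: nat))"
    using col_det_unitriangular[OF finite_lessThan, of n] unfolding std_tabs_def by blast
  obtain m' where m': "\<forall>T\<in>std_tabs (vectors r n) \<eta>. ?E T T = 1 \<and> (\<forall>T'. ?E T T' \<noteq> 0 \<longrightarrow> T' = T \<or> m' T' < (m' T :: nat))"
    using col_det_unitriangular[OF finite_vectors, of r n] unfolding std_tabs_def by blast
  \<comment> \<open>The left matrix is cancelled first, for each fixed T1; the right one
    follows.\<close>
  have "(\<Sum>T\<in>?B. c (\<mu>, S0) (\<nu>, T) * of_int (?E T1 T)) = 0" if T1: "T1 \<in> ?B" for T1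
  proof (rule unitriangular_injective[of ?A ?D m "\<lambda>S. \<Sum>T\<in>?B. c (\<mu>, S) (\<nu>, T) * of_int (?E T1 T)"])
    show "S0 \<in> ?A" using s st by simp
  qed (use finA m A eq T1 in blast)+
  thus ?thesis unfolding st
  proof (intro unitriangular_injective[of ?B ?E m' "\<lambda>T. c (\<mu>, S0) (\<nu>, T)"])
    show "T0 \<in> ?B" using t st by simp
  qed (use finB m' B in blast)+
qed

section \<open>Nonvanishing products\<close>

text \<open>The entries determine the row of a cell, so a column permutation that keeps the tabloid
  keeps every cell in its row.\<close>

lemma (in partition_shape) col_det_rows:
  assumes U: "\<And>x y. x \<in> cells \<eta> \<Longrightarrow> y \<in> cells \<eta> \<Longrightarrow> U x = U y \<Longrightarrow> fst x = fst y"
  shows "col_det \<eta> U (content fst U (cells \<eta>)) = 1"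
proof -
  have "\<kappa> = id" if k: "\<kappa> \<in> col_perms \<eta>" and c: "content fst (U \<circ> \<kappa>) (cells \<eta>) = content fst U (cells \<eta>)" for \<kappa>
  proof
    fix x
    show "\<kappa> x = id x"
    proof (cases "x \<in> cells \<eta>")
      case True
      have "U (\<kappa> x) \<in># content fst (U \<circ> \<kappa>) (cells \<eta>) (fst x)" using True by (auto simp: set_content)
      hence "U (\<kappa> x) \<in> U ` {z\<in>cells \<eta>. fst z = fst x}" unfolding c by (simp add: set_content)
      then obtain z where z: "z \<in> cells \<eta>" "fst z = fst x" "U (\<kappa> x) = U z" by auto
      have "\<kappa> x \<in> cells \<eta>" using permutes_in_image[OF col_permsD(1)[OF k]] True by simp
      hence "fst (\<kappa> x) = fst x" using U[OF _ z(1)] z by simp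
      thus ?thesis using col_permsD(2)[OF k] by (simp add: prod_eq_iff)
    next
      case False
      thus ?thesis using permutes_not_in[OF col_permsD(1)[OF k]] by simp
    qed
  qed
  hence "col_det \<eta> U (content fst U (cells \<eta>)) = (\<Sum>\<kappa>\<in>col_perms \<eta>. if \<kappa> = id then 1 else 0)"
    unfolding col_det_def by (intro sum.cong) auto
  thus ?thesis using col_perms_id by simp
qed

lemma card_blk:
  assumes \<nu>: "\<nu> \<in> compositions r n"
  shows "card {t\<in>{1..r}. blk \<nu> t = b} = (if b < n then \<nu> ! b else 0)"
proof (cases "b < n")
  case True
  have "{t\<in>{1..r}. blk \<nu> t = b} = block \<nu> b"
    using mem_block_iff[OF \<nu> _ True] block_subset[OF \<nu>, of b] by auto
  moreover have "card (block \<nu> b) = \<nu> ! b"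
    using True \<nu> by (simp add: block_def compositions_def take_Suc_conv_app_nth)
  ultimately show ?thesis using True by simp
next
  case False
  hence "{t\<in>{1..r}. blk \<nu> t = b} = {}" using blk_less[OF \<nu>] by force
  thus ?thesis using False by simp
qed

lemma image_mset_constant: "finite A \<Longrightarrow> (\<And>x. x \<in> A \<Longrightarrow> f x = c) \<Longrightarrow> image_mset f (mset_set A) = replicate_mset (card A) c"
  by (induction A rule: finite_induct) auto

lemma content_self: "finite Z \<Longrightarrow> content f f Z c = replicate_mset (card {x\<in>Z. f x = c}) c"
  unfolding content_def by (rule image_mset_constant) auto

text \<open>The cells of \<open>\<eta>\<close> use up the letter \<open>c\<close> in row \<open>c\<close>; the remaining \<open>k * w\<close> points lie in block \<open>d\<close>
  of \<open>\<nu>\<close> and are distributed evenly over \<open>k\<close> marked cells of row \<open>c0\<close>.\<close>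

locale marked_shape = partition_shape +
  fixes r n c0 d k w :: nat and \<nu> :: "nat list"
  assumes \<nu>: "\<nu> \<in> compositions r n" and nth: "b < n \<Longrightarrow> \<nu> ! b = \<eta> b + (if b = d then k * w else 0)"
    and support: "n \<le> b \<Longrightarrow> \<eta> b = 0" and marked: "0 < k \<Longrightarrow> d < n \<and> d \<noteq> c0 \<and> 0 < w"
    and k_le: "k \<le> \<eta> c0"
begin

text \<open>The fibre over a cell of row c: a single point of block c, or in the marked case a point
  of block \<open>c0\<close> and \<open>w\<close> further points of block \<open>d\<close>.\<close>

definition label :: "bool \<Rightarrow> nat \<Rightarrow> nat multiset" where
  "label b c = (if b then add_mset c0 (replicate_mset w d) else {#c#})"

definition mark :: "nat \<times> nat \<Rightarrow> bool" where "mark x \<longleftrightarrow> fst x = c0 \<and> snd x < k"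

definition W :: "nat \<times> nat \<Rightarrow> nat multiset" where "W x = label (mark x) (fst x)"

definition S0 :: "nat \<Rightarrow> nat multiset" where "S0 = content fst fst (cells \<eta>)"

definition T0 :: "nat \<Rightarrow> nat multiset multiset" where "T0 = content fst W (cells \<eta>)"

lemma card_row: "card {x\<in>cells \<eta>. fst x = c} = \<eta> c"
proof -
  have "{x\<in>cells \<eta>. fst x = c} = Pair c ` {..<\<eta> c}" by (auto simp: cells_def)
  thus ?thesis by (simp add: card_image inj_on_def)
qed

lemma card_marked: "card {x\<in>cells \<eta>. mark x} = k"
proof -
  have "{x\<in>cells \<eta>. mark x} = Pair c0 ` {..<k}" using k_le by (auto simp: cells_def mark_def)
  thus ?thesis by (simp add: card_image inj_on_def)
qed

lemma shape_S0: "shape S0 = \<eta>" and shape_T0: "shape T0 = \<eta>"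
  by (simp_all add: fun_eq_iff shape_def S0_def T0_def size_content card_row)

lemma S0_eq: "S0 c = replicate_mset (\<eta> c) c"
  unfolding S0_def content_self[OF finite_cells] card_row ..

lemma standard_S0: "standard S0"
  unfolding standard_def
proof (intro allI)
  fix j v
  have f: "filter_mset P (S0 c) = (if P c then S0 c else {#})" for P c
    by (auto simp: S0_eq intro: multiset_eqI)
  have "size (S0 (Suc j)) \<le> size (S0 j)" using decreasing[of j] by (simp add: S0_eq)
  thus "size {#b \<in># S0 (Suc j). b \<le> v#} \<le> size {#a \<in># S0 j. a < v#}" unfolding f by auto
qed

lemma W_row: "W x = W y \<Longrightarrow> fst x = fst y"
  by (auto simp: W_def label_def mark_def add_mset_eq_single split: if_splits)

lemma count_W: "count (W x) (fst x) = 1"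
  using marked by (auto simp: W_def label_def mark_def count_replicate_mset)

lemma W_other: "fst x \<noteq> c0 \<Longrightarrow> W x = {#fst x#}"
  by (simp add: W_def label_def mark_def)

lemma sum_W: "(\<Sum>x\<in>cells \<eta>. W x) = image_mset (blk \<nu>) (mset_set {1..r})"
proof (rule multiset_eqI)
  fix b
  have "count (\<Sum>x\<in>cells \<eta>. W x) b = (\<Sum>x\<in>cells \<eta>. (if fst x = b then 1 else 0) + (if mark x then count (replicate_mset w d) b else 0))"
    unfolding count_sum by (rule sum.cong) (auto simp: W_def label_def mark_def)
  also have "\<dots> = \<eta> b + k * count (replicate_mset w d) b"
    by (simp add: sum.distrib sum.If_cases card_row card_marked Int_def)
  also have "\<dots> = (if b < n then \<nu> ! b else 0)"
    using support[of b] marked by (cases "k = 0") (auto simp: nth count_replicate_mset not_less)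
  also have "\<dots> = count (image_mset (blk \<nu>) (mset_set {1..r})) b"
  proof -
    have "{1..r} \<inter> blk \<nu> -` {b} = {t\<in>{1..r}. blk \<nu> t = b}" by auto
    thus ?thesis unfolding card_blk[OF \<nu>, symmetric] by (simp add: count_image_mset Int_commute)
  qed
  finally show "count (\<Sum>x\<in>cells \<eta>. W x) b = count (image_mset (blk \<nu>) (mset_set {1..r})) b" .
qed

lemma embed: "\<exists>h. inj_on h (cells \<eta>) \<and> h ` cells \<eta> \<subseteq> {1..r} \<and> (\<forall>x\<in>cells \<eta>. blk \<nu> (h x) = fst x)"
proof -
  define h where "h = (\<lambda>(c, i). sum_list (take c \<nu>) + Suc i)"
  have h: "h x \<in> {1..r} \<and> blk \<nu> (h x) = fst x" if "x \<in> cells \<eta>" for x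
  proof -
    obtain c i where x: "x = (c, i)" "i < \<eta> c" using \<open>x \<in> cells \<eta>\<close> unfolding cells_def by blast
    have c: "c < n" using support[of c] x(2) by (cases "c < n") auto
    have "h x \<in> block \<nu> c"
      using \<nu> c x nth[OF c] by (simp add: h_def block_def compositions_def take_Suc_conv_app_nth)
    thus ?thesis using block_subset[OF \<nu>, of c] mem_block_iff[OF \<nu> _ c] x by auto
  qed
  have "inj_on h (cells \<eta>)"
  proof (rule inj_onI)
    fix x y assume xy: "x \<in> cells \<eta>" "y \<in> cells \<eta>" "h x = h y"
    have "fst x = fst y" using h[OF xy(1)] h[OF xy(2)] xy(3) by simp
    thus "x = y" using xy(3) by (simp add: h_def prod_eq_iff case_prod_beta)
  qed
  thus ?thesis using h by (intro exI[of _ h]) auto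
qed

text \<open>Row c of \<open>S0\<close> contains only the letter c, so the only admissible labelling
  is f itself.\<close>

lemma wgt_S0:
  assumes Z: "finite Z" and f: "\<And>c. card {x\<in>Z. f x = c} = \<eta> c"
  shows "wgt y Z f S0 = (\<Prod>x\<in>Z. count (vec y x) (f x))"
proof -
  have "{\<beta> \<in> Z \<rightarrow>\<^sub>E UNIV. content f \<beta> Z = S0} = {restrict f Z}" (is "?L = ?R")
  proof
    show "?L \<subseteq> ?R"
    proof
      fix \<beta> assume b: "\<beta> \<in> ?L"
      have "\<beta> x = restrict f Z x" for x
      proof (cases "x \<in> Z")
        case True
        have "\<beta> x \<in># content f \<beta> Z (f x)" unfolding set_content[OF Z] using True by blast
        thus ?thesis using b True by (simp add: S0_eq split: if_splits)
      next
        case False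
        have "\<beta> \<in> Z \<rightarrow>\<^sub>E UNIV" using b by simp
        thus ?thesis using PiE_arb False by fastforce
      qed
      thus "\<beta> \<in> ?R" by blast
    qed
    have "content f (restrict f Z) Z = content f f Z" by (rule content_cong) auto
    hence "content f (restrict f Z) Z = S0" by (simp add: fun_eq_iff content_self[OF Z] S0_eq f)
    thus "?R \<subseteq> ?L" by simp
  qed
  thus ?thesis by (simp add: wgt_def count_vec)
qed

lemma content_label:
  assumes Z: "finite Z" and A: "A \<subseteq> {x\<in>Z. f x = c0}" and u: "\<And>x. x \<in> Z \<Longrightarrow> u x = label (x \<in> A) (f x)"
  shows "content f u Z c = (if c = c0 then replicate_mset (card A) (label True c0) +
    replicate_mset (card {x\<in>Z. f x = c0} - card A) {#c0#} else replicate_mset (card {x\<in>Z. f x = c}) {#c#})"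
proof (cases "c = c0")
  case True
  let ?F = "{x\<in>Z. f x = c0}"
  have fin: "finite A" "finite ?F" using Z finite_subset[OF A] by auto
  have "mset_set ?F = mset_set (A \<union> (?F - A))" using A by (simp add: Un_absorb1)
  also have "\<dots> = mset_set A + mset_set (?F - A)" using fin by (intro mset_set_Union) auto
  finally have "content f u Z c = image_mset u (mset_set A) + image_mset u (mset_set (?F - A))"
    by (simp add: content_def True)
  also have "image_mset u (mset_set A) = replicate_mset (card A) (label True c0)"
    using A u by (intro image_mset_constant fin) (auto simp: label_def)
  also have "image_mset u (mset_set (?F - A)) = replicate_mset (card (?F - A)) {#c0#}"
    using u fin by (intro image_mset_constant) (auto simp: label_def)
  also have "card (?F - A) = card ?F - card A" using A fin by (intro card_Diff_subset) auto
  finally show ?thesis using True by simp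
next
  case False
  have "content f u Z c = replicate_mset (card {x\<in>Z. f x = c}) {#c#}"
    unfolding content_def using Z u A False by (intro image_mset_constant) (auto simp: label_def)
  thus ?thesis using False by simp
qed

text \<open>Given \<open>Z\<close> and f, content \<open>T0\<close> prescribes all fibres except
  which \<open>k\<close> of the points in row \<open>c0\<close> are marked. This is the origin of
  the binomial coefficient.\<close>

lemma card_vectors:
  assumes Z: "Z \<subseteq> {1..r}" and f: "\<And>c. card {x\<in>Z. f x = c} = \<eta> c"
  shows "card {y\<in>confs r \<nu>. supp y = Z \<and> content f (vec y) Z = T0} = \<eta> c0 choose k"
proof -
  have fin: "finite Z" using finite_subset[OF Z] by simp
  let ?F = "{x\<in>Z. f x = c0}"
  let ?P = "{A. A \<subseteq> ?F \<and> card A = k}"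
  define yy where "yy A = of_vec Z (\<lambda>x. label (x \<in> A) (f x))" for A
  have ne: "label b c \<noteq> {#}" for b c by (simp add: label_def)
  have yy: "supp (yy A) = Z" "\<And>x. x \<in> Z \<Longrightarrow> vec (yy A) x = label (x \<in> A) (f x)"
    "image_mset snd (yy A) = (\<Sum>x\<in>Z. label (x \<in> A) (f x))" for A
    unfolding yy_def using of_vec[OF fin, of "\<lambda>x. label (x \<in> A) (f x)"] ne by blast+
  have T0: "T0 c = (if c = c0 then replicate_mset k (label True c0) + replicate_mset (\<eta> c0 - k) {#c0#}
      else replicate_mset (\<eta> c) {#c#})" for c
  proof -
    have "T0 c = (if c = c0 then replicate_mset (card {x\<in>cells \<eta>. mark x}) (label True c0) +
      replicate_mset (card {x\<in>cells \<eta>. fst x = c0} - card {x\<in>cells \<eta>. mark x}) {#c0#} else replicate_mset (card {x\<in>cells \<eta>. fst x = c}) {#c#})"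
      unfolding T0_def by (rule content_label) (auto simp: mark_def W_def)
    thus ?thesis by (simp only: card_row card_marked)
  qed
  have mem: "yy A \<in> confs r \<nu> \<and> content f (vec (yy A)) Z = T0" if A: "A \<in> ?P" for A
  proof -
    have c: "content f (vec (yy A)) Z = T0"
    proof
      fix c
      have "content f (vec (yy A)) Z c = (if c = c0 then replicate_mset (card A) (label True c0) +
        replicate_mset (card ?F - card A) {#c0#} else replicate_mset (card {x\<in>Z. f x = c}) {#c#})"
        using A yy(2) by (intro content_label fin) auto
      thus "content f (vec (yy A)) Z c = T0 c" using A by (simp only: T0 f mem_Collect_eq)
    qed
    have "content fst W (cells \<eta>) = content f (vec (yy A)) Z" using c by (simp add: T0_def)
    then obtain h where h: "bij_betw h (cells \<eta>) Z" "\<forall>x\<in>cells \<eta>. vec (yy A) (h x) = W x"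
      using content_iso[OF finite_cells fin] by blast
    have "image_mset snd (yy A) = (\<Sum>x\<in>Z. vec (yy A) x)" unfolding yy(3) using yy(2) by (intro sum.cong) auto
    also have "\<dots> = (\<Sum>x\<in>cells \<eta>. vec (yy A) (h x))" by (rule sum.reindex_bij_betw[OF h(1), symmetric])
    also have "\<dots> = (\<Sum>x\<in>cells \<eta>. W x)" using h(2) by (intro sum.cong) auto
    finally have "yy A \<in> confs r \<nu>" using sum_W yy(1)[of A] Z by (simp add: confs_def supp_def)
    thus ?thesis using c by blast
  qed
  have "{y\<in>confs r \<nu>. supp y = Z \<and> content f (vec y) Z = T0} = yy ` ?P"
  proof
    show "yy ` ?P \<subseteq> {y\<in>confs r \<nu>. supp y = Z \<and> content f (vec y) Z = T0}" using mem yy(1) by blast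
    show "{y\<in>confs r \<nu>. supp y = Z \<and> content f (vec y) Z = T0} \<subseteq> yy ` ?P"
    proof
      fix y assume y: "y \<in> {y\<in>confs r \<nu>. supp y = Z \<and> content f (vec y) Z = T0}"
      hence "content fst W (cells \<eta>) = content f (vec y) Z" by (simp add: T0_def)
      then obtain h where h: "bij_betw h (cells \<eta>) Z" "\<forall>x\<in>cells \<eta>. f (h x) = fst x \<and> vec y (h x) = W x"
        using content_iso[OF finite_cells fin] by blast
      define A where "A = h ` {x\<in>cells \<eta>. mark x}"
      have inj: "inj_on h (cells \<eta>)" using h(1) by (simp add: bij_betw_def)
      have "card A = k" unfolding A_def using inj card_marked by (subst card_image) (auto simp: inj_on_def)
      moreover have "A \<subseteq> ?F" using h by (auto simp: A_def bij_betw_def mark_def)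
      moreover have "yy A = y"
      proof (rule conf_eqI)
        show "supp (yy A) = supp y" using y yy(1) by simp
        fix z assume "z \<in> supp (yy A)"
        hence z: "z \<in> Z" using yy(1) by simp
        then obtain x where x: "x \<in> cells \<eta>" "z = h x" using h(1) by (auto simp: bij_betw_def)
        have "z \<in> A \<longleftrightarrow> mark x" unfolding A_def x(2) using inj x(1) by (auto simp: inj_on_def)
        thus "vec (yy A) z = vec y z" using yy(2)[OF z, of A] h(2) x by (simp add: W_def)
      qed
      ultimately show "y \<in> yy ` ?P" by blast
    qed
  qed
  moreover have "inj_on yy ?P"
  proof (rule inj_onI)
    fix A B assume AB: "A \<in> ?P" "B \<in> ?P" "yy A = yy B"
    show "A = B"
    proof (cases "k = 0")
      case True
      have "finite A" "finite B" using AB(1,2) fin by (auto intro: finite_subset[OF _ fin])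
      thus ?thesis using AB(1,2) True by simp
    next
      case False
      hence m: "d \<noteq> c0" "0 < w" using marked by auto
      have "x \<in> A \<longleftrightarrow> x \<in> B" if "x \<in> Z" for x
        using yy(2)[OF that, of A] yy(2)[OF that, of B] AB m by (auto simp: label_def split: if_splits)
      thus ?thesis using AB(1,2) by blast
    qed
  qed
  ultimately show ?thesis using n_subsets[of ?F k] fin f[of c0] by (simp add: card_image)
qed

text \<open>Outside row \<open>c0\<close> the fibres in \<open>T0\<close> are single points whose
  block is the row number, so f agrees with g there; equal row sizes then settle row
  \<open>c0\<close>.\<close>

lemma rigid:
  assumes Z: "finite Z" and f: "\<And>c. card {x\<in>Z. f x = c} = \<eta> c" and g: "content g u Z = T0"
    and u: "\<And>x. x \<in> Z \<Longrightarrow> f x \<in># u x" and x: "x \<in> Z"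
  shows "g x = f x"
proof -
  have gc: "card {x\<in>Z. g x = c} = \<eta> c" for c
    using shape_T0 size_content[of g u Z c] unfolding g by (simp add: shape_def fun_eq_iff)
  have other: "f x = g x" if x: "x \<in> Z" and c: "g x \<noteq> c0" for x
  proof -
    have "u x \<in># T0 (g x)" unfolding g[symmetric] set_content[OF Z] using x by blast
    then obtain x' where "fst x' = g x" "u x = W x'" unfolding T0_def set_content[OF finite_cells] by auto
    thus ?thesis using W_other[of x'] u[OF x] c by simp
  qed
  have "{x\<in>Z. f x = c0} = {x\<in>Z. g x = c0}"
  proof (rule card_subset_eq)
    show "{x\<in>Z. f x = c0} \<subseteq> {x\<in>Z. g x = c0}"
    proof
      fix x assume "x \<in> {x\<in>Z. f x = c0}"
      thus "x \<in> {x\<in>Z. g x = c0}" using other[of x] by (cases "g x = c0") auto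
    qed
  qed (use Z f gc in auto)
  hence "g x = c0 \<longleftrightarrow> f x = c0" using x by blast
  thus ?thesis using other[OF x] by (cases "g x = c0") auto
qed

text \<open>In the product only intermediate y with the support of z contribute, each with weight 1,
  and for every row map f they are the configurations counted by
  \<open>card_vectors\<close>.\<close>

lemma ev_square:
  assumes z: "z \<in> confs r \<nu>" and cz: "card (supp z) = tot \<eta>"
  defines "E \<equiv> cod r n \<nu> S0 \<nu> T0"
  shows "ev r (S_mult r n E E) \<nu> \<nu> z = of_nat (\<eta> c0 choose k) * (ev r E \<nu> \<nu> z :: 'k::field)"
proof -
  let ?Z = "supp z"
  let ?b = "\<lambda>f. of_bool (content f (blk \<nu>) ?Z = S0) :: 'k"
  have inner: "(\<Sum>y\<in>confs r \<nu>. ev r E \<nu> \<nu> y * of_nat (wgt y ?Z f S0)) = of_nat (\<eta> c0 choose k) * ?b f"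
    if f: "f \<in> row_maps T0 (vec z) ?Z" for f
  proof -
    have fc: "card {x\<in>?Z. f x = c} = \<eta> c" for c
      using shape_T0 size_content[of f "vec z" ?Z c] row_mapsD(1)[OF f] by (simp add: shape_def fun_eq_iff)
    note wt = wgt_S0[OF finite_supp fc]
    have "ev r E \<nu> \<nu> y * of_nat (wgt y ?Z f S0) = (if supp y = ?Z \<and> content f (vec y) ?Z = T0 then ?b f else 0)"
      if y: "y \<in> confs r \<nu>" for y
    proof -
      have evE: "ev r E \<nu> \<nu> y = (codet S0 T0 (point \<nu> y) :: 'k)" unfolding E_def ev_cod[OF \<nu> \<nu> y] by simp
      show ?thesis
      proof (cases "supp y = ?Z \<and> content f (vec y) ?Z = T0")
        case True
        have c1: "count (vec y x) (f x) = 1" if x: "x \<in> ?Z" for x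
        proof -
          have "vec y x \<in># T0 (f x)" using True set_content[OF finite_supp, of f "vec y" z "f x"] x by auto
          then obtain x' where x': "fst x' = f x" "vec y x = W x'" unfolding T0_def set_content[OF finite_cells] by auto
          show ?thesis unfolding x'(2) x'(1)[symmetric] by (rule count_W)
        qed
        have mem: "f x \<in># vec y x" if "x \<in> ?Z" for x using c1[OF that] by (simp add: count_greater_zero_iff[symmetric])
        \<comment> \<open>By rigidity f is the only placement of content \<open>T0\<close>.\<close>
        have "row_maps S0 (blk \<nu>) ?Z \<inter> row_maps T0 (vec y) ?Z = (if content f (blk \<nu>) ?Z = S0 then {f} else {})"
        proof -
          have "g = f" if g: "g \<in> row_maps T0 (vec y) ?Z" for g
          proof
            fix x show "g x = f x"
            proof (cases "x \<in> ?Z")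
              case True
              show ?thesis by (rule rigid[OF finite_supp fc row_mapsD(1)[OF g] mem True])
            next
              case False
              thus ?thesis using PiE_arb[OF row_mapsD(2)[OF g] False] PiE_arb[OF row_mapsD(2)[OF f] False] by simp
            qed
          qed
          moreover have "f \<in> row_maps T0 (vec y) ?Z" using True row_mapsD(2)[OF f] by (simp add: row_maps_def)
          ultimately have "row_maps T0 (vec y) ?Z = {f}" by blast
          moreover have "f \<in> row_maps S0 (blk \<nu>) ?Z \<longleftrightarrow> content f (blk \<nu>) ?Z = S0"
            using row_mapsD(2)[OF f] by (simp add: row_maps_def)
          ultimately show ?thesis by (simp only: Int_insert_right Int_empty_right split: if_split)
        qed
        hence "codet S0 T0 (point \<nu> y) = ?b f" using True by (simp add: codet_def point_def)
        thus ?thesis using True c1 by (simp add: evE wt)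
      next
        case False
        \<comment> \<open>A nonzero weight puts the letter f x into every fibre over the support of
          z, so the supports agree; a nonzero codeterminant then gives a placement that must be
          f.\<close>
        have "codet S0 T0 (point \<nu> y) = (0::'k) \<or> wgt y ?Z f S0 = 0"
        proof (rule ccontr)
          assume n: "\<not> ?thesis"
          hence cy: "card (supp y) = tot \<eta>" using codet_point_card[of S0 T0 \<nu> y] shape_S0 by auto
          have mem: "f x \<in># vec y x" if "x \<in> ?Z" for x
            using n that unfolding wt by (simp add: count_greater_zero_iff[symmetric] del: count_greater_zero_iff)
          have "?Z \<subseteq> supp y"
          proof
            fix x assume "x \<in> ?Z"
            hence "vec y x \<noteq> {#}" using mem by force
            thus "x \<in> supp y" by (simp add: vec_empty_iff)
          qed
          hence sy: "supp y = ?Z" using card_subset_eq[OF finite_supp] cy cz by metis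
          obtain g where g: "content g (vec y) ?Z = T0"
            using n codet_nonzero_shape(2)[of S0 T0 "supp y" "blk \<nu>" "vec y"] unfolding point_def sy by blast
          have "content f (vec y) ?Z = content g (vec y) ?Z"
            using rigid[OF finite_supp fc g mem] by (intro content_cong) auto
          thus False using False sy g by simp
        qed
        thus ?thesis using False by (auto simp: evE)
      qed
    qed
    hence "(\<Sum>y\<in>confs r \<nu>. ev r E \<nu> \<nu> y * of_nat (wgt y ?Z f S0)) =
        (\<Sum>y\<in>confs r \<nu>. if supp y = ?Z \<and> content f (vec y) ?Z = T0 then ?b f else 0)" by (rule sum.cong[OF refl])
    also have "\<dots> = of_nat (card {y\<in>confs r \<nu>. supp y = ?Z \<and> content f (vec y) ?Z = T0}) * ?b f"
      unfolding sum.inter_filter[OF finite_confs, symmetric] by simp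
    finally show ?thesis unfolding card_vectors[OF supp_subset[OF z] fc] .
  qed
  have "ev r (S_mult r n E E) \<nu> \<nu> z = (\<Sum>f\<in>row_maps T0 (vec z) ?Z. \<Sum>y\<in>confs r \<nu>. ev r E \<nu> \<nu> y * of_nat (wgt y ?Z f S0))"
    using ev_left_action[OF \<nu> \<nu> \<nu> z, of S0 E T0] cz shape_S0 unfolding E_def by simp
  also have "\<dots> = of_nat (\<eta> c0 choose k) * (\<Sum>f\<in>row_maps T0 (vec z) ?Z. ?b f)"
    unfolding sum_distrib_left by (rule sum.cong[OF refl]) (rule inner)
  also have "(\<Sum>f\<in>row_maps T0 (vec z) ?Z. ?b f) = codet S0 T0 (point \<nu> z)"
  proof -
    have "row_maps T0 (vec z) ?Z \<inter> {f. content f (blk \<nu>) ?Z = S0} = row_maps S0 (blk \<nu>) ?Z \<inter> row_maps T0 (vec z) ?Z"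
      by (auto simp: row_maps_def)
    thus ?thesis by (simp add: codet_def point_def of_bool_def sum.If_cases finite_row_maps)
  qed
  finally show ?thesis unfolding E_def ev_cod[OF \<nu> \<nu> z] by simp
qed

text \<open>The probe with labels \<open>fst\<close> and \<open>W\<close> vanishes on the filtration
  but takes the value 1 on the codeterminant, because both labels determine the row; on the square
  it takes the binomial coefficient.\<close>

lemma square_notin_filt:
  assumes K: "\<And>\<eta>'. \<eta>' \<in> K \<Longrightarrow> \<eta>' \<in> shapes r \<and> \<eta>' \<noteq> \<eta> \<and> (tot \<eta>' \<noteq> tot \<eta> \<or> ent \<eta> \<le> ent \<eta>')"
    and nz: "of_nat (\<eta> c0 choose k) \<noteq> (0::'k::field)"
  shows "S_mult r n (cod r n \<nu> S0 \<nu> T0) (cod r n \<nu> S0 \<nu> T0) \<notin> (filt r n K :: (coset_index \<Rightarrow> 'k) set)"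
proof
  let ?E = "cod r n \<nu> S0 \<nu> T0 :: coset_index \<Rightarrow> 'k"
  assume mem: "S_mult r n ?E ?E \<in> filt r n K"
  obtain h where h: "inj_on h (cells \<eta>)" "h ` cells \<eta> \<subseteq> {1..r}" "\<forall>x\<in>cells \<eta>. blk \<nu> (h x) = fst x"
    using embed by blast
  have Wne: "W x \<noteq> {#}" for x by (simp add: W_def label_def)
  interpret probe_data \<eta> r n h \<nu> \<nu> fst W
    by unfold_locales (use h \<nu> Wne sum_W in auto)
  have "probe r \<eta> h \<nu> \<nu> W (S_mult r n ?E ?E) = of_nat (\<eta> c0 choose k) * probe r \<eta> h \<nu> \<nu> W ?E"
  proof -
    have "card (h ` cells \<eta>) = tot \<eta>" using card_image[OF h(1)] card_cells by simp
    hence "ev r (S_mult r n ?E ?E) \<nu> \<nu> (of_vec (h ` cells \<eta>) (W \<circ> \<sigma> \<circ> inv_into (cells \<eta>) h)) = of_nat (\<eta> c0 choose k) *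
        ev r ?E \<nu> \<nu> (of_vec (h ` cells \<eta>) (W \<circ> \<sigma> \<circ> inv_into (cells \<eta>) h))" if s: "\<sigma> \<in> col_perms \<eta>" for \<sigma>
      by (intro ev_square probe_point(1)[OF s]) (simp only: probe_point(2)[OF s])
    thus ?thesis unfolding probe_def sum_distrib_left by (intro sum.cong refl) (simp add: mult.left_commute)
  qed
  also have "probe r \<eta> h \<nu> \<nu> W ?E = col_sum \<eta> fst W S0 T0" using probe_cod[of \<nu> S0 \<nu> T0] by simp
  also have "\<dots> = of_int (col_det \<eta> fst S0 * col_det \<eta> W T0)" by (rule col_sum_factor[OF shape_S0])
  also have "col_det \<eta> fst S0 = 1" unfolding S0_def by (rule col_det_rows)
  also have "col_det \<eta> W T0 = 1" unfolding T0_def by (rule col_det_rows) (rule W_row)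
  finally show False using probe_filt[OF K mem] nz by simp
qed

text \<open>\<open>S0\<close> is standard, but \<open>T0\<close> need not be for the given order on
  multisets. Straightening it replaces the codeterminant by a combination of cells modulo the ideal;
  if all products of cells were in the ideal, so would be the square.\<close>

theorem cell_pairing:
  assumes r: "1 \<le> r" and K: "\<And>\<eta>'. \<eta>' \<in> K \<Longrightarrow> \<eta>' \<in> shapes r \<and> \<eta>' \<noteq> \<eta> \<and> (tot \<eta>' \<noteq> tot \<eta> \<or> ent \<eta> \<le> ent \<eta>')"
    and below: "below r \<eta> \<subseteq> K" and nz: "of_nat (\<eta> c0 choose k) \<noteq> (0::'k::field)"
    and ideal: "vs_algebra.alg_ideal fscale (S_carrier r n) (S_mult r n) (filt r n K :: (coset_index \<Rightarrow> 'k) set)"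
  shows "\<exists>s\<in>left_tabs r n \<eta>. \<exists>t\<in>right_tabs r n \<eta>. \<exists>s'\<in>left_tabs r n \<eta>. \<exists>t'\<in>right_tabs r n \<eta>.
    S_mult r n (cell r n s t) (cell r n s' t') \<notin> (filt r n K :: (coset_index \<Rightarrow> 'k) set)"
proof (rule ccontr)
  assume no: "\<not> ?thesis"
  interpret S: vs_algebra fscale "S_carrier r n :: (coset_index \<Rightarrow> 'k) set" "S_mult r n" "S_one r n" by (rule vs_algebra_S)
  let ?J = "filt r n K :: (coset_index \<Rightarrow> 'k) set"
  note J = S.alg_idealD[OF ideal]
  let ?c = "\<lambda>T. cod r n \<nu> S0 \<nu> T :: coset_index \<Rightarrow> 'k"
  have cV: "?c T \<in> S_carrier r n" for T unfolding cod_def by (rule pull_closed)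
  let ?B = "std_tabs (W ` cells \<eta>) \<eta>"
  have T0: "T0 \<in> tabloids (W ` cells \<eta>) \<eta>"
    unfolding tabloids_def using shape_T0 by (auto simp: T0_def set_content)
  have "\<exists>g. \<forall>S. shape S = \<eta> \<longrightarrow> codet S T0 - (\<Sum>T'\<in>?B. fscale (g T') (codet S T'))
      \<in> fs.span (higher \<eta> :: ((nat, nat, nat multiset) labelled \<Rightarrow> 'k) set)"
    unfolding std_tabs_def by (rule straighten_right[OF finite_imageI[OF finite_cells] finite_support decreasing T0])
  then obtain g where g: "codet S0 T0 - (\<Sum>T'\<in>?B. fscale (g T') (codet S0 T'))
      \<in> fs.span (higher \<eta> :: ((nat, nat, nat multiset) labelled \<Rightarrow> 'k) set)" using shape_S0 by blast
  define x where "x = (\<Sum>T'\<in>?B. fscale (g T') (?c T'))"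
  have xV: "x \<in> S_carrier r n" unfolding x_def by (intro S.V_sum fs.subspace_scale[OF subspace_S] cV)
  have diff: "?c T0 - x \<in> ?J"
    unfolding x_def cod_def pull_straighten[symmetric] by (rule subsetD[OF filt_mono[OF below] higher_in_below[OF r g]])
  have prod: "S_mult r n (?c T1) (?c T2) \<in> ?J" if T: "T1 \<in> ?B" "T2 \<in> ?B" for T1 T2
  proof (cases "?c T1 = 0 \<or> ?c T2 = 0")
    case True
    thus ?thesis using J(3)[OF cV J(8)] J(4)[OF cV J(8)] by (elim disjE) simp_all
  next
    case False
    have s: "standard T1" "standard T2" "shape T1 = shape S0" "shape T2 = shape S0"
      using T shape_S0 by (auto simp: std_tabs_def tabloids_def)
    have "(\<nu>, S0) \<in> left_tabs r n \<eta>" "(\<nu>, T1) \<in> right_tabs r n \<eta>" "(\<nu>, T2) \<in> right_tabs r n \<eta>"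
      using cell_nonzero[OF _ standard_S0 s(1,3), of r n \<nu> \<nu>] cell_nonzero[OF _ standard_S0 s(2,4), of r n \<nu> \<nu>] False
      unfolding shape_S0 by blast+
    hence "S_mult r n (cell r n (\<nu>, S0) (\<nu>, T1)) (cell r n (\<nu>, S0) (\<nu>, T2)) \<in> ?J" using no by blast
    thus ?thesis by (simp only: cell_def fst_conv snd_conv)
  qed
  have "S_mult r n x x = (\<Sum>T1\<in>?B. \<Sum>T2\<in>?B. fscale (g T2) (fscale (g T1) (S_mult r n (?c T1) (?c T2))))"
  proof -
    have "S_mult r n x x = (\<Sum>T1\<in>?B. S_mult r n (fscale (g T1) (?c T1)) x)"
      unfolding x_def by (rule S.mul_sum_left) (intro fs.subspace_scale[OF subspace_S] cV xV[unfolded x_def])+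
    also have "\<dots> = (\<Sum>T1\<in>?B. \<Sum>T2\<in>?B. S_mult r n (fscale (g T1) (?c T1)) (fscale (g T2) (?c T2)))"
      unfolding x_def by (intro sum.cong refl S.mul_sum_right) (intro fs.subspace_scale[OF subspace_S] cV)+
    finally show ?thesis by (simp only: S_mult_bilinear)
  qed
  hence "S_mult r n x x \<in> ?J" using prod by (simp only:) (intro J(9) J(7), blast)
  moreover have "S_mult r n (?c T0 - x) x \<in> ?J" by (rule J(4)[OF xV diff])
  moreover have "S_mult r n (?c T0) (?c T0 - x) \<in> ?J" by (rule J(3)[OF cV diff])
  moreover have "S_mult r n (?c T0) (?c T0) = S_mult r n (?c T0) (?c T0 - x) + (S_mult r n (?c T0 - x) x + S_mult r n x x)"
    by (simp add: S.mul_diff_left S.mul_diff_right cV xV)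
  ultimately have "S_mult r n (?c T0) (?c T0) \<in> ?J" by (simp only:) (intro J(5))
  thus False using square_notin_filt[OF K nz] by contradiction
qed

end

section \<open>The heredity chain\<close>

lemma shapes_support:
  assumes \<eta>: "\<eta> \<in> shapes r" and j: "r \<le> j" shows "\<eta> j = 0"
proof (rule ccontr)
  assume ne: "\<eta> j \<noteq> 0"
  interpret partition_shape \<eta> using \<eta> by (simp add: shapes_def)
  have pos: "1 \<le> \<eta> i" if "i \<le> j" for i using antimono[OF that] ne by simp
  have "Suc j = (\<Sum>i\<le>j. 1)" by simp
  also have "\<dots> \<le> (\<Sum>i\<le>j. \<eta> i)" using pos by (intro sum_mono) simp
  also have "\<dots> \<le> (\<Sum>i | \<eta> i \<noteq> 0. \<eta> i)" using pos finite_support by (intro sum_mono2) force+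
  finally show False using \<eta> j by (simp add: shapes_def tot_def)
qed

lemma shapes_le:
  assumes \<eta>: "\<eta> \<in> shapes r" shows "\<eta> j \<le> r"
proof (cases "\<eta> j = 0")
  case False
  interpret partition_shape \<eta> using \<eta> by (simp add: shapes_def)
  have "\<eta> j \<le> tot \<eta>" unfolding tot_def using False finite_support by (intro member_le_sum) auto
  thus ?thesis using \<eta> by (simp add: shapes_def)
qed simp

lemma finite_shapes: "finite (shapes r)"
proof (rule finite_subset)
  show "shapes r \<subseteq> {\<eta>. \<forall>j. (j \<in> {..<r} \<longrightarrow> \<eta> j \<in> {..r}) \<and> (j \<notin> {..<r} \<longrightarrow> \<eta> j = 0)}"
    using shapes_support shapes_le by auto
  show "finite {\<eta>. \<forall>j. (j \<in> {..<r} \<longrightarrow> \<eta> j \<in> {..r}) \<and> (j \<notin> {..<r} \<longrightarrow> \<eta> j = (0::nat))}"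
    by (rule finite_set_of_finite_funs) auto
qed

text \<open>Orders the shapes by increasing rank and, within a rank, by decreasing \<^const>\<open>ent\<close>.\<close>

definition shape_key :: "nat \<Rightarrow> (nat \<Rightarrow> nat) \<Rightarrow> nat" where
  "shape_key r \<eta> = tot \<eta> * Suc (r * 3 ^ r) + (r * 3 ^ r - ent \<eta>)"

text \<open>Makes the truncated subtraction in \<open>shape_key\<close> exact.\<close>

lemma ent_shapes: assumes \<eta>: "\<eta> \<in> shapes r" shows "ent \<eta> \<le> r * 3 ^ r"
proof -
  have t: "tot \<eta> \<le> r" using \<eta> by (simp add: shapes_def)
  have "ent \<eta> \<le> tot \<eta> * 3 ^ tot \<eta>"
    using \<eta> by (intro ent_le partition_shape.finite_support) (simp add: shapes_def)
  also have "\<dots> \<le> r * 3 ^ r" using t by (intro mult_le_mono power_increasing) auto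
  finally show ?thesis .
qed

lemma shape_key_below:
  assumes \<eta>': "\<eta>' \<in> below r \<eta>" shows "shape_key r \<eta>' < shape_key r \<eta>"
proof (cases "tot \<eta>' < tot \<eta>")
  case True
  have "shape_key r \<eta>' < Suc (tot \<eta>') * Suc (r * 3 ^ r)" by (simp add: shape_key_def)
  also have "\<dots> \<le> tot \<eta> * Suc (r * 3 ^ r)" using True by (intro mult_le_mono1) simp
  finally show ?thesis by (simp add: shape_key_def)
next
  case False
  hence "tot \<eta>' = tot \<eta>" "ent \<eta> < ent \<eta>'" "\<eta>' \<in> shapes r" using \<eta>' by (auto simp: below_def)
  thus ?thesis using ent_shapes[of \<eta>' r] by (simp add: shape_key_def)
qed

lemma shape_key_le:
  assumes "\<eta>' \<in> shapes r" "\<eta> \<in> shapes r" "shape_key r \<eta>' \<le> shape_key r \<eta>"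
  shows "tot \<eta>' \<noteq> tot \<eta> \<or> ent \<eta> \<le> ent \<eta>'"
  using assms(3) ent_shapes[OF assms(1)] ent_shapes[OF assms(2)] by (auto simp: shape_key_def)

text \<open>\<open>k\<close> is the largest power of \<open>p\<close> dividing the row
  \<open>c0\<close>, chosen with least valuation so that \<open>k\<close> divides every row and
  hence the rank; the surplus is then a multiple of \<open>k\<close>.\<close>

lemma ex_marked_shape:
  assumes rn: "r \<le> n" and p: "normalization_semidom_class.prime p" and a: "1 \<le> a" "a < p" "r = a * p ^ l" and \<eta>: "\<eta> \<in> shapes r"
  shows "\<exists>c0 d k w \<nu>. marked_shape \<eta> r n c0 d k w \<nu> \<and> \<not> p dvd (\<eta> c0 choose k)"
proof -
  interpret partition_shape \<eta> using \<eta> by (simp add: shapes_def)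
  have t: "1 \<le> tot \<eta>" "tot \<eta> \<le> r" using \<eta> by (auto simp: shapes_def)
  have support: "\<eta> b = 0" if "n \<le> b" for b using shapes_support[OF \<eta>] rn that by simp
  have sum: "(\<Sum>b<n. \<eta> b) = tot \<eta>"
  proof (rule tot_superset[symmetric])
    show "{b. \<eta> b \<noteq> 0} \<subseteq> {..<n}" using support not_less by auto
  qed simp
  have mk: "marked_shape \<eta> r n c0 d k w (map (\<lambda>b. \<eta> b + (if b = d then k * w else 0)) [0..<n])"
    if "k * w = r - tot \<eta>" "0 < k \<longrightarrow> d < n \<and> d \<noteq> c0 \<and> 0 < w" "k \<le> \<eta> c0" for c0 d k w
  proof unfold_locales
    have "sum_list (map (\<lambda>b. \<eta> b + (if b = d then k * w else 0)) [0..<n]) =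
        (\<Sum>b<n. \<eta> b + (if b = d then k * w else 0))"
      by (simp add: interv_sum_list_conv_sum_set_nat atLeast0LessThan)
    also have "\<dots> = tot \<eta> + (if d < n then k * w else 0)" by (simp add: sum.distrib sum)
    also have "\<dots> = r" using that t by auto
    finally show "map (\<lambda>b. \<eta> b + (if b = d then k * w else 0)) [0..<n] \<in> compositions r n"
      by (simp add: compositions_def)
  qed (use that support in auto)
  show ?thesis
  proof (cases "tot \<eta> = r")
    case True
    \<comment> \<open>In full rank there is no surplus, and with no marked cell the factor is
      1.\<close>
    have "\<not> p dvd (\<eta> 0 choose 0)" using p by (simp add: prime_nat_iff)
    thus ?thesis using mk[of 0 0 0 0] True by fastforce
  next
    case False
    have "{c. \<eta> c \<noteq> 0} \<noteq> {}" using t(1) unfolding tot_def by (metis not_one_le_zero sum.empty)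
    then obtain c1 where c1: "\<eta> c1 \<noteq> 0" by blast
    obtain c0 where c0: "\<eta> c0 \<noteq> 0" "\<And>c. \<eta> c \<noteq> 0 \<Longrightarrow> multiplicity p (\<eta> c0) \<le> multiplicity p (\<eta> c)"
      using ex_has_least_nat[of "\<lambda>c. \<eta> c \<noteq> 0" c1 "\<lambda>c. multiplicity p (\<eta> c)"] c1 by blast
    define j where "j = multiplicity p (\<eta> c0)"
    define k where "k = p ^ j"
    have p1: "1 < p" using prime_gt_1_nat[OF p] .
    have kpos: "0 < k" using p1 by (simp add: k_def)
    have dvd: "k dvd \<eta> c" for c
    proof (cases "\<eta> c = 0")
      case False
      thus ?thesis unfolding k_def using c0(2)[OF False] multiplicity_dvd' j_def by blast
    qed simp
    have "k \<le> \<eta> c0" using dvd c0(1) by (intro dvd_imp_le) auto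
    also have "\<eta> c0 \<le> r" by (rule shapes_le[OF \<eta>])
    \<comment> \<open>The only use of a < p: a power of \<open>p\<close> that is at most r has
      exponent at most l and therefore divides r.\<close>
    also have "r < p ^ Suc l" using a p1 by simp
    finally have "j \<le> l" unfolding k_def power_strict_increasing_iff[OF p1] by simp
    hence "k dvd r" unfolding a(3) k_def by (intro dvd_mult le_imp_power_dvd)
    moreover have "k dvd tot \<eta>" unfolding tot_def using dvd by (intro dvd_sum)
    ultimately have "k dvd r - tot \<eta>" by (rule dvd_diff_nat)
    then obtain w where w: "k * w = r - tot \<eta>" by (metis dvdE)
    have "0 < w" using w False t(2) by (cases w) auto
    \<comment> \<open>The rank is at least 1 and below r, so n is at least 2.\<close>
    moreover have "\<exists>d<n. d \<noteq> c0" using rn t False by (intro exI[of _ "if c0 = 0 then 1 else 0"]) auto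
    ultimately obtain d where "marked_shape \<eta> r n c0 d k w (map (\<lambda>b. \<eta> b + (if b = d then k * w else 0)) [0..<n])"
      using mk[OF w _ \<open>k \<le> \<eta> c0\<close>] by blast
    moreover have "\<not> p dvd (\<eta> c0 choose k)"
    proof -
      have np: "\<not> is_unit p" using p1 by simp
      obtain m where m: "\<eta> c0 = p ^ j * m" "\<not> p dvd m"
        using multiplicity_decompose'[OF c0(1) np] unfolding j_def by blast
      have "0 < m" using m c0(1) by (cases m) auto
      \<comment> \<open>The binomial coefficient of p^j m over p^j has the same
        \<open>p\<close>-adic valuation as m.\<close>
      have "multiplicity p (\<eta> c0 choose k) = multiplicity p m"
        unfolding m(1) k_def by (rule const_p_fac[OF \<open>0 < m\<close> p])
      also have "\<dots> = 0" using m(2) by (rule not_dvd_imp_multiplicity_0)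
      finally show ?thesis using \<open>k \<le> \<eta> c0\<close> np by (subst (asm) multiplicity_eq_zero_iff) auto
    qed
    ultimately show ?thesis by blast
  qed
qed

theorem corollary5p1:
  fixes r n p a l :: nat
  assumes "1 \<le> r" and "r \<le> n"
    and "CHAR('k::field) = p" and "p > 0"
    and "1 \<le> a" and "a < p" and "r = a * p ^ l"
  shows "quasi_hereditary (S_R r n :: ('k, coset_index \<Rightarrow> 'k) module)"
proof -
  have prime: "normalization_semidom_class.prime p" using prime_CHAR_semidom[where 'a='k] assms(3,4) by simp
  obtain xs where xs: "set xs = shapes r" "distinct xs" using finite_distinct_list[OF finite_shapes] by blast
  \<comment> \<open>In this order everything \<open>below\<close> a shape precedes it, and no
    preceding shape of the same rank has smaller \<open>ent\<close>; these are the needs of the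
    actions and of independence.\<close>
  define qs where "qs = sort_key (shape_key r) xs"
  have qs: "set qs = shapes r" "distinct qs" "sorted (map (shape_key r) qs)" using xs by (simp_all add: qs_def)
  define m where "m = length qs"
  define K where "K q = set (take q qs)" for q
  have K_iff: "\<eta> \<in> K q \<longleftrightarrow> (\<exists>q'<q. q' < m \<and> \<eta> = qs ! q')" for \<eta> q
    unfolding K_def m_def by (auto simp: in_set_conv_nth)
  have sh: "qs ! q \<in> shapes r" if "q < m" for q using that qs(1) nth_mem unfolding m_def by blast
  have ps: "partition_shape (qs ! q)" if "q < m" for q using sh[OF that] by (simp add: shapes_def)
  have K: "\<eta>' \<in> shapes r \<and> \<eta>' \<noteq> qs ! q \<and> (tot \<eta>' \<noteq> tot (qs ! q) \<or> ent (qs ! q) \<le> ent \<eta>')"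
    if q: "q < m" and \<eta>': "\<eta>' \<in> K q" for q \<eta>'
  proof -
    obtain q' where q': "q' < q" "\<eta>' = qs ! q'" using \<eta>' K_iff by blast
    hence "shape_key r \<eta>' \<le> shape_key r (qs ! q)"
      using sorted_nth_mono[OF qs(3), of q' q] q by (simp add: m_def)
    moreover have "\<eta>' \<noteq> qs ! q" using nth_eq_iff_index_eq[OF qs(2), of q' q] q q' by (simp add: m_def)
    ultimately show ?thesis using shape_key_le[OF _ sh[OF q]] sh[of q'] q q' by auto
  qed
  have below: "below r (qs ! q) \<subseteq> K q" if q: "q < m" for q
  proof
    fix \<eta>' assume b: "\<eta>' \<in> below r (qs ! q)"
    hence "\<eta>' \<in> set qs" using qs(1) by (simp add: below_def)
    then obtain q' where q': "q' < m" "\<eta>' = qs ! q'" unfolding m_def in_set_conv_nth by blast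
    have "q' < q"
    proof (rule ccontr)
      assume "\<not> q' < q"
      hence "shape_key r (qs ! q) \<le> shape_key r \<eta>'"
        using sorted_nth_mono[OF qs(3), of q q'] q' by (simp add: m_def)
      thus False using shape_key_below[OF b] by simp
    qed
    thus "\<eta>' \<in> K q" using q' K_iff by blast
  qed
  have J: "fs.span {cell r n s t | q' s t. q' < q \<and> s \<in> left_tabs r n (qs ! q') \<and> t \<in> right_tabs r n (qs ! q')} =
      (filt r n (K q) :: (coset_index \<Rightarrow> 'k) set)" if "q \<le> m" for q
  proof -
    have "q' < m" if "q' < q" for q' using that \<open>q \<le> m\<close> by simp
    thus ?thesis unfolding filt_def K_iff by (intro arg_cong[where f = fs.span] Collect_cong) blast
  qed
  interpret pre_cell_basis fscale "S_carrier r n :: (coset_index \<Rightarrow> 'k) set" "S_mult r n" "S_one r n" m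
    "\<lambda>q. left_tabs r n (qs ! q)" "\<lambda>q. right_tabs r n (qs ! q)" "\<lambda>_. cell r n"
    "\<lambda>q. fs.span {cell r n s t | q' s t. q' < q \<and> s \<in> left_tabs r n (qs ! q') \<and> t \<in> right_tabs r n (qs ! q')}"
  proof (intro pre_cell_basis.intro vs_algebra_S pre_cell_basis_axioms.intro)
    show "finite (left_tabs r n (qs ! q))" "finite (right_tabs r n (qs ! q))" if "q < m" for q
      using finite_left_tabs[OF ps[OF that]] finite_right_tabs[OF ps[OF that]] .
  next
    fix q s t
    show "cell r n s t \<in> (S_carrier r n :: (coset_index \<Rightarrow> 'k) set)" unfolding cell_def cod_def by (rule pull_closed)
  next
    \<comment> \<open>No map has rank above r, so the condition is vacuous and
      \<open>low_rank_in_filt\<close> gives spanning.\<close>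
    have "x \<in> low_rank r n (Suc r)" if "x \<in> S_carrier r n" for x :: "coset_index \<Rightarrow> 'k"
    proof -
      have "card (supp y) \<le> r" if "y \<in> confs r \<nu>" for y \<nu> using card_mono[OF _ supp_subset[OF that]] by simp
      thus ?thesis using that unfolding low_rank_def by fastforce
    qed
    hence "x \<in> filt r n {\<eta>\<in>shapes r. tot \<eta> < Suc r}" if "x \<in> S_carrier r n" for x :: "coset_index \<Rightarrow> 'k"
      using low_rank_in_filt[OF assms(1)] that by blast
    moreover have "{\<eta>\<in>shapes r. tot \<eta> < Suc r} \<subseteq> K m" using qs(1) by (auto simp: K_def m_def)
    ultimately show "S_carrier r n \<subseteq> fs.span {cell r n s t :: coset_index \<Rightarrow> 'k | q' s t. q' < m \<and> s \<in> left_tabs r n (qs ! q') \<and> t \<in> right_tabs r n (qs ! q')}"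
      unfolding J[OF le_refl] using filt_mono by (intro subsetI) (rule subsetD)
  next
    fix q a s assume q: "q < m" and s: "s \<in> left_tabs r n (qs ! q)"
    show "\<exists>\<rho>. \<forall>t\<in>right_tabs r n (qs ! q). S_mult r n a (cell r n s t) - (\<Sum>s'\<in>left_tabs r n (qs ! q). fscale (\<rho> s') (cell r n s' t))
      \<in> fs.span {cell r n s t :: coset_index \<Rightarrow> 'k | q' s t. q' < q \<and> s \<in> left_tabs r n (qs ! q') \<and> t \<in> right_tabs r n (qs ! q')}"
      unfolding J[OF less_imp_le[OF q]]
      using cell_left[OF assms(1) ps[OF q] s, of a] subsetD[OF filt_mono[OF below[OF q]]] by meson
  next
    fix q a t assume q: "q < m" and t: "t \<in> right_tabs r n (qs ! q)"
    show "\<exists>\<rho>. \<forall>s\<in>left_tabs r n (qs ! q). S_mult r n (cell r n s t) a - (\<Sum>t'\<in>right_tabs r n (qs ! q). fscale (\<rho> t') (cell r n s t'))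
      \<in> fs.span {cell r n s t :: coset_index \<Rightarrow> 'k | q' s t. q' < q \<and> s \<in> left_tabs r n (qs ! q') \<and> t \<in> right_tabs r n (qs ! q')}"
      unfolding J[OF less_imp_le[OF q]]
      using cell_right[OF assms(1) ps[OF q] t, of a] subsetD[OF filt_mono[OF below[OF q]]] by meson
  next
    fix q and c :: "_ \<Rightarrow> _ \<Rightarrow> 'k" and s t
    assume q: "q < m" and z: "(\<Sum>t\<in>right_tabs r n (qs ! q). \<Sum>s\<in>left_tabs r n (qs ! q). fscale (c s t) (cell r n s t))
        \<in> fs.span {cell r n s t | q' s t. q' < q \<and> s \<in> left_tabs r n (qs ! q') \<and> t \<in> right_tabs r n (qs ! q')}"
      and st: "s \<in> left_tabs r n (qs ! q)" "t \<in> right_tabs r n (qs ! q)"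
    show "c s t = 0" by (rule cell_indep[OF ps[OF q] K[OF q] z[unfolded J[OF less_imp_le[OF q]]] st])
  qed
  interpret cell_basis fscale "S_carrier r n :: (coset_index \<Rightarrow> 'k) set" "S_mult r n" "S_one r n" m
    "\<lambda>q. left_tabs r n (qs ! q)" "\<lambda>q. right_tabs r n (qs ! q)" "\<lambda>_. cell r n"
    "\<lambda>q. fs.span {cell r n s t | q' s t. q' < q \<and> s \<in> left_tabs r n (qs ! q') \<and> t \<in> right_tabs r n (qs ! q')}"
  proof unfold_locales
    fix q assume q: "q < m"
    obtain c0 d k w \<nu> where M: "marked_shape (qs ! q) r n c0 d k w \<nu>" and nd: "\<not> p dvd ((qs ! q) c0 choose k)"
      using ex_marked_shape[OF assms(2) prime assms(5-7) sh[OF q]] by blast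
    have nz: "of_nat ((qs ! q) c0 choose k) \<noteq> (0::'k)" using nd assms(3) by (simp add: of_nat_eq_0_iff_char_dvd)
    \<comment> \<open>\<open>alg_ideal_J\<close> is available from the preceding interpretation, and
      \<open>cell_pairing\<close> needs it.\<close>
    show "\<exists>s\<in>left_tabs r n (qs ! q). \<exists>t\<in>right_tabs r n (qs ! q). \<exists>s'\<in>left_tabs r n (qs ! q). \<exists>t'\<in>right_tabs r n (qs ! q).
      S_mult r n (cell r n s t) (cell r n s' t') \<notin>
        fs.span {cell r n s t :: coset_index \<Rightarrow> 'k | q' s t. q' < q \<and> s \<in> left_tabs r n (qs ! q') \<and> t \<in> right_tabs r n (qs ! q')}"
      unfolding J[OF less_imp_le[OF q]]
      by (rule marked_shape.cell_pairing[OF M assms(1) K[OF q] below[OF q] nz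
          alg_ideal_J[OF less_imp_le[OF q], unfolded J[OF less_imp_le[OF q]]]])
  qed
  show ?thesis using quasi_hereditary_alg unfolding alg_S .
qed

end
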